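(* Fix $\kappa_1\in(0,1)$ and let $\hat\kappa_2>0$ be the threshold defined in the context. Let $\kappa_2^\epsilon\to\hat\kappa_2$ as $\epsilon\to0$ with $\kappa_2^\epsilon<\hat\kappa_2$. Denote by $(u_1^\epsilon,u_2^\epsilon)$ the uniformly subsonic spiral flow corresponding to Problem $(\kappa_1,\kappa_2^\epsilon)$, and put $(q^\epsilon)^2=(u_1^\epsilon)^2+(u_2^\epsilon)^2$. Then there exists a subsequence, still labeled $(u_1^\epsilon,u_2^\epsilon)$, and functions $\hat u_1,\hat u_2$ on $\Omega$ such that, with $\hat q^2=\hat u_1^2+\hat u_2^2$, almost everywhere in $\Omega$, $$u_1^\epsilon\to\hat u_1,\quad u_2^\epsilon\to\hat u_2,\qquad g((q^\epsilon)^2)u_1^\epsilon\to g(\hat q^2)\hat u_1,\quad g((q^\epsilon)^2)u_2^\epsilon\to g(\hat q^2)\hat u_2 .$$ Moreover, this limit yields a subsonic-sonic spiral flow $(\hat\rho,\hat u_1,\hat u_2)$, $\hat\rho=g(\hat q^2)$ (so $\hat q\le1$ a.e.), which is a weak solution of Problem $(\kappa_1,\hat\kappa_2)$: it satisfies in the sense of distributions in $\Omega$, with $\hat p=\hat\rho^\gamma/\gamma$, $$\partial_{x_1}(\hat\rho\hat u_1)+\partial_{x_2}(\hat\rho\hat u_2)=0,\quad \partial_{x_1}(\hat\rho\hat u_1^2)+\partial_{x_2}(\hat\rho\hat u_1\hat u_2)+\partial_{x_1}\hat p=0,$$ $$\partial_{x_1}(\hat\rho\hat u_1\hat u_2)+\partial_{x_2}(\hat\rho\hat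 u_2^2)+\partial_{x_2}\hat p=0,\quad \partial_{x_2}\hat u_1-\partial_{x_1}\hat u_2=0,$$ and it satisfies the boundary condition $\hat\rho\hat{\mathbf u}\cdot\vec n=\rho_bU_1\mathbf e_r\cdot\vec n$ on $\Gamma$ (with $\rho_bU_1$ that of the background flow with parameters $(\kappa_1,\hat\kappa_2)$) as the normal trace of the divergence-measure field $(\hat\rho\hat u_1,\hat\rho\hat u_2)$ on $\Gamma$.
   Context: Domain: $\mathcal D\subset\mathbb R^2$ is a bounded domain containing the unit disc $B_1(0)$ whose boundary $\Gamma$ is a bounded connected $C^\infty$ smooth curve; $\Omega=\mathbb R^2\setminus\mathcal D$ is its exterior, assumed connected; $\vec n$ is the unit normal on $\Gamma$ pointing into $\mathcal D$. $(r,\theta)$ are polar coordinates, $\mathbf e_r=(\cos\theta,\sin\theta)$. Gas: $\gamma>1$ is fixed, $p=\rho^\gamma/\gamma$; Bernoulli's law is $\frac{q^2}{2}+\frac{\rho^{\gamma-1}}{\gamma-1}=\frac{\gamma+1}{2(\gamma-1)}$, equivalently $\rho=g(q^2):=\big(\frac{\gamma+1-(\gamma-1)q^2}{2}\big)^{1/(\gamma-1)}$, $q=|\mathbf u|$; the flow is subsonic iff $q<1$ and sonic iff $q=1$. For $s\in[0,1]$, $H(s)$ is the unique $\rho\ge1$ with $\frac{s}{2\rho^2}+\frac{\rho^{\gamma-1}}{\gamma-1}=\frac{\gamma+1}{2(\gamma-1)}$. Background flow: for $\kappa_1>0$ and $\kappa_2\in\mathbb R$ with $\kappa_1^2+\kappa_2^2<1$,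 let $\rho_0>0$ be defined by $\frac12(\kappa_1^2+\kappa_2^2)+\frac{\rho_0^{\gamma-1}}{\gamma-1}=\frac{\gamma+1}{2(\gamma-1)}$, and let $(\rho_b,U_1,U_2)(r)$, $r>1$, be the smooth radially symmetric solution of $(\rho_bU_1)'+\frac1r\rho_bU_1=0$, $U_1U_1'+\frac1{\rho_b}p_b'-\frac{U_2^2}{r}=0$, $U_1U_2'+\frac{U_1U_2}{r}=0$ ($p_b=\rho_b^\gamma/\gamma$) with $\rho_b(1)=\rho_0$, $U_1(1)=\kappa_1$, $U_2(1)=\kappa_2$. It is uniformly subsonic and $\rho_bU_1=\rho_0\kappa_1/r$, $U_2=\kappa_2/r$; for limiting parameter values, $\rho_bU_1$ is given by the same formula $\rho_0\kappa_1/r$. Put $\psi_{10}=\rho_0\kappa_1\theta$, $\psi_{20}(r)=-\kappa_2\int_1^r\frac{\rho_b(s)}{s}ds$, $\psi_0=\psi_{10}+\psi_{20}$. Problem $(\kappa_1,\kappa_2)$: find $\psi$ (with $\psi-\psi_0$ single-valued on $\Omega$) such that $\operatorname{div}\big(\frac{\nabla\psi}{H(|\nabla\psi|^2)}\big)=0$ in $\Omega$, $\psi=\psi_{10}$ on $\Gamma$, $|\nabla(\psi-\psi_0)|=O(|x|^{-2})$ as $|x|\to\infty$. A uniformly subsonic spiral flow is the flow given by a smooth solution with $\sup_\Omega|\nabla\psi|<1$, via $\rho=H(|\nabla\psi|^2)$, $u_1=\partial_{x_2}\psi/\rho$, $u_2=-\partial_{x_1}\psi/\rho$. Threshold $\hat\kappa_2$: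 for small $\varepsilon>0$ let $\tilde H$ be a smooth decreasing function on $[0,\infty)$ with $\tilde H=H$ on $[0,1-2\varepsilon]$ and $\tilde H=H(1-\varepsilon)$ on $[1-\varepsilon,\infty)$. The truncated problem is Problem $(\kappa_1,\kappa_2)$ with $H$ replaced by $\tilde H$; it has a unique classical solution $\psi$. Let $\varepsilon_i\downarrow0$ strictly, and for the fixed $\kappa_1$ let $[0,\kappa_2^i)$ be the maximal interval such that for $|\kappa_2|\in[0,\kappa_2^i)$ the solution of the truncated problem with $\varepsilon=\varepsilon_i$ satisfies $|\nabla\psi|<\sqrt{1-2\varepsilon_i}$ in $\Omega$. The sequence $\kappa_2^i$ is increasing and $\hat\kappa_2=\lim_{i\to\infty}\kappa_2^i$. For $|\kappa_2|<\hat\kappa_2$, Problem $(\kappa_1,\kappa_2)$ has a unique uniformly subsonic spiral flow. Normal trace: for a bounded field $\mathbf F$ on $\Omega$ with $\operatorname{div}\mathbf F=0$ in distributions, $\mathbf F\cdot\vec n=h$ on $\Gamma$ in the sense of normal trace means $\int_\Omega\mathbf F\cdot\nabla v\,dx=\int_\Gamma h\,v\,ds$ for all $v\in C_c^\infty(\mathbb R^2)$. *)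

theory Defs
  imports "HOL-Analysis.Analysis" "HOL-Library.Landau_Symbols"
begin

section \<open>Smooth functions, gradient, divergence, test functions\<close>

text \<open>\<open>C_k k S f\<close> is meant for open \<open>S\<close>: all iterated directional derivatives along basis
  vectors up to order \<open>k\<close> exist and are continuous.\<close>

primrec C_k :: "nat \<Rightarrow> 'a::euclidean_space set \<Rightarrow> ('a \<Rightarrow> 'b::real_normed_vector) \<Rightarrow> bool" where
  "C_k 0 S f \<longleftrightarrow> continuous_on S f"
| "C_k (Suc k) S f \<longleftrightarrow>
     (\<forall>x\<in>S. f differentiable (at x)) \<and>
     (\<forall>b\<in>Basis. C_k k S (\<lambda>x. frechet_derivative f (at x) b))"

text \<open>For a set that is not open (such as \<open>[0,\<infinity>)\<close>) smoothness means that there is a smooth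
  extension to an open superset; for open \<open>S\<close> this is smoothness on \<open>S\<close> itself.\<close>

definition smooth_on :: "'a::euclidean_space set \<Rightarrow> ('a \<Rightarrow> 'b::real_normed_vector) \<Rightarrow> bool" where
  "smooth_on S f \<longleftrightarrow>
     (\<exists>U F. open U \<and> S \<subseteq> U \<and> (\<forall>k. C_k k U F) \<and> (\<forall>x\<in>S. F x = f x))"

definition grad :: "(real^2 \<Rightarrow> real) \<Rightarrow> real^2 \<Rightarrow> real^2" where
  "grad f x = (THE v. GDERIV f x :> v)"

definition divergence :: "(real^2 \<Rightarrow> real^2) \<Rightarrow> real^2 \<Rightarrow> real" where
  "divergence F x = (\<Sum>i\<in>UNIV. frechet_derivative F (at x) (axis i 1) $ i)"

definition test_function :: "(real^2) set \<Rightarrow> (real^2 \<Rightarrow> real) \<Rightarrow> bool" where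
  "test_function S v \<longleftrightarrow>
     smooth_on UNIV v \<and> compact (closure {x. v x \<noteq> 0}) \<and> closure {x. v x \<noteq> 0} \<subseteq> S"

text \<open>\<open>\<partial>\<^sub>1 F\<^sub>1 + \<partial>\<^sub>2 F\<^sub>2 = 0\<close> in the sense of distributions. Integrability is demanded
  explicitly because the Bochner integral of a non-integrable function is 0.\<close>

definition weakly_div_free :: "(real^2) set \<Rightarrow> (real^2 \<Rightarrow> real^2) \<Rightarrow> bool" where
  "weakly_div_free \<Omega> F \<longleftrightarrow>
     (\<forall>v. test_function \<Omega> v \<longrightarrow>
        set_integrable lborel \<Omega> (\<lambda>x. F x \<bullet> grad v x) \<and>
        (LINT x:\<Omega>|lborel. F x \<bullet> grad v x) = 0)"


section \<open>The domain\<close>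

text \<open>The exterior \<open>\<Omega>\<close> as an open set; \<open>- closure D\<close> is the interior of \<open>- D\<close>.\<close>

definition exterior :: "(real^2) set \<Rightarrow> (real^2) set" where
  "exterior D = - closure D"

text \<open>A parametrisation \<open>c\<close> (1-periodic, regular, injective on a period) of a closed smooth curve.\<close>

definition smooth_closed_curve :: "(real \<Rightarrow> real^2) \<Rightarrow> bool" where
  "smooth_closed_curve c \<longleftrightarrow>
     smooth_on UNIV c \<and> (\<forall>t. c (t + 1) = c t) \<and> inj_on c {0..<1} \<and>
     (\<forall>t. vector_derivative c (at t) \<noteq> 0)"

definition admissible_domain :: "(real^2) set \<Rightarrow> (real \<Rightarrow> real^2) \<Rightarrow> bool" where
  "admissible_domain D c \<longleftrightarrow>
     open D \<and> connected D \<and> bounded D \<and> ball 0 1 \<subseteq> D \<and>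
     smooth_closed_curve c \<and> frontier D = c ` {0..1} \<and> connected (exterior D)"

definition inner_unit_normal ::
    "(real^2) set \<Rightarrow> (real \<Rightarrow> real^2) \<Rightarrow> (real^2 \<Rightarrow> real^2) \<Rightarrow> bool" where
  "inner_unit_normal D c n \<longleftrightarrow>
     (\<forall>t. norm (n (c t)) = 1 \<and> n (c t) \<bullet> vector_derivative c (at t) = 0 \<and>
          (\<forall>\<^sub>F s in at_right 0. c t + s *\<^sub>R n (c t) \<in> D))"

definition arclength_integral :: "(real \<Rightarrow> real^2) \<Rightarrow> (real^2 \<Rightarrow> real) \<Rightarrow> real" where
  "arclength_integral c f = integral {0..1} (\<lambda>t. f (c t) * norm (vector_derivative c (at t)))"

definition normal_trace ::
    "(real^2) set \<Rightarrow> (real \<Rightarrow> real^2) \<Rightarrow> (real^2 \<Rightarrow> real^2) \<Rightarrow> (real^2 \<Rightarrow> real) \<Rightarrow> bool" where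
  "normal_trace \<Omega> c F h \<longleftrightarrow>
     (\<exists>M. AE x in lborel. x \<in> \<Omega> \<longrightarrow> norm (F x) \<le> M) \<and> weakly_div_free \<Omega> F \<and>
     (\<forall>v. test_function UNIV v \<longrightarrow>
        set_integrable lborel \<Omega> (\<lambda>x. F x \<bullet> grad v x) \<and>
        (LINT x:\<Omega>|lborel. F x \<bullet> grad v x) = arclength_integral c (\<lambda>x. h x * v x))"


section \<open>Gas dynamics and the background flow\<close>

definition gas_density :: "real \<Rightarrow> real \<Rightarrow> real" where
  "gas_density \<gamma> s = ((\<gamma> + 1 - (\<gamma> - 1) * s) / 2) powr (1 / (\<gamma> - 1))"

text \<open>The function \<open>H\<close>, to be used on \<open>[0,1]\<close> only.\<close>

definition H_density :: "real \<Rightarrow> real \<Rightarrow> real" where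
  "H_density \<gamma> s = (THE \<rho>. \<rho> \<ge> 1 \<and>
     s / (2 * \<rho>\<^sup>2) + \<rho> powr (\<gamma> - 1) / (\<gamma> - 1) = (\<gamma> + 1) / (2 * (\<gamma> - 1)))"

definition rho0 :: "real \<Rightarrow> real \<Rightarrow> real \<Rightarrow> real" where
  "rho0 \<gamma> \<kappa>1 \<kappa>2 = (THE \<rho>. \<rho> > 0 \<and>
     (\<kappa>1\<^sup>2 + \<kappa>2\<^sup>2) / 2 + \<rho> powr (\<gamma> - 1) / (\<gamma> - 1) = (\<gamma> + 1) / (2 * (\<gamma> - 1)))"

definition background_flow ::
    "real \<Rightarrow> real \<Rightarrow> real \<Rightarrow> (real \<Rightarrow> real) \<times> (real \<Rightarrow> real) \<times> (real \<Rightarrow> real) \<Rightarrow> bool" where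
  "background_flow \<gamma> \<kappa>1 \<kappa>2 = (\<lambda>(\<rho>, U1, U2).
     (\<forall>f\<in>{\<rho>, U1, U2}. smooth_on {1<..} f \<and> continuous_on {1..} f) \<and>
     (\<forall>r\<ge>1. \<rho> r > 0) \<and>
     \<rho> 1 = rho0 \<gamma> \<kappa>1 \<kappa>2 \<and> U1 1 = \<kappa>1 \<and> U2 1 = \<kappa>2 \<and>
     (\<forall>r>1.
        deriv (\<lambda>s. \<rho> s * U1 s) r + 1 / r * (\<rho> r * U1 r) = 0 \<and>
        U1 r * deriv U1 r + 1 / \<rho> r * deriv (\<lambda>s. \<rho> s powr \<gamma> / \<gamma>) r - (U2 r)\<^sup>2 / r = 0 \<and>
        U1 r * deriv U2 r + U1 r * U2 r / r = 0))"

text \<open>For \<open>\<kappa>1 > 0\<close>, \<open>\<kappa>1\<^sup>2 + \<kappa>2\<^sup>2 < 1\<close> the background flow is unique on \<open>[1,\<infinity>)\<close>; the choice below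
  is arbitrary only in the irrelevant values at \<open>r < 1\<close>.\<close>

definition the_background ::
    "real \<Rightarrow> real \<Rightarrow> real \<Rightarrow> (real \<Rightarrow> real) \<times> (real \<Rightarrow> real) \<times> (real \<Rightarrow> real)" where
  "the_background \<gamma> \<kappa>1 \<kappa>2 = (SOME b. background_flow \<gamma> \<kappa>1 \<kappa>2 b)"

definition rho_b :: "real \<Rightarrow> real \<Rightarrow> real \<Rightarrow> real \<Rightarrow> real" where
  "rho_b \<gamma> \<kappa>1 \<kappa>2 = fst (the_background \<gamma> \<kappa>1 \<kappa>2)"

definition U1_b :: "real \<Rightarrow> real \<Rightarrow> real \<Rightarrow> real \<Rightarrow> real" where
  "U1_b \<gamma> \<kappa>1 \<kappa>2 = fst (snd (the_background \<gamma> \<kappa>1 \<kappa>2))"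

text \<open>The radial mass flux \<open>\<rho>\<^sub>b U\<^sub>1\<close>, continued by its explicit formula to the limiting parameters
  \<open>\<kappa>1\<^sup>2 + \<kappa>2\<^sup>2 = 1\<close>, where the background flow itself has not been introduced.\<close>

definition radial_flux :: "real \<Rightarrow> real \<Rightarrow> real \<Rightarrow> real \<Rightarrow> real" where
  "radial_flux \<gamma> \<kappa>1 \<kappa>2 r =
     (if \<kappa>1\<^sup>2 + \<kappa>2\<^sup>2 < 1 then rho_b \<gamma> \<kappa>1 \<kappa>2 r * U1_b \<gamma> \<kappa>1 \<kappa>2 r else rho0 \<gamma> \<kappa>1 \<kappa>2 * \<kappa>1 / r)"


section \<open>Multi-valued stream functions\<close>

text \<open>A stream function takes a point \<open>x\<close> and a choice \<open>\<theta>\<close> of its polar angle. Only the values at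
  pairs with \<open>polar_angle x \<theta>\<close> matter.\<close>

definition polar_angle :: "real^2 \<Rightarrow> real \<Rightarrow> bool" where
  "polar_angle x \<theta> \<longleftrightarrow> x = norm x *\<^sub>R vector [cos \<theta>, sin \<theta>]"

definition angle_branch :: "(real^2) set \<Rightarrow> (real^2 \<Rightarrow> real) \<Rightarrow> bool" where
  "angle_branch U \<Theta> \<longleftrightarrow> open U \<and> continuous_on U \<Theta> \<and> (\<forall>y\<in>U. polar_angle y (\<Theta> y))"

text \<open>Gradient along a continuous branch of the angle near \<open>x\<close>. If \<open>\<psi> - \<psi>\<^sub>0\<close> is single-valued, it
  does not depend on the branch, since two branches differ locally by a constant.\<close>

definition stream_grad :: "(real^2 \<Rightarrow> real \<Rightarrow> real) \<Rightarrow> real^2 \<Rightarrow> real^2" where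
  "stream_grad \<psi> x =
     (SOME v. \<exists>U \<Theta>. x \<in> U \<and> angle_branch U \<Theta> \<and> GDERIV (\<lambda>y. \<psi> y (\<Theta> y)) x :> v)"

definition psi10 :: "real \<Rightarrow> real \<Rightarrow> real \<Rightarrow> real \<Rightarrow> real" where
  "psi10 \<gamma> \<kappa>1 \<kappa>2 \<theta> = rho0 \<gamma> \<kappa>1 \<kappa>2 * \<kappa>1 * \<theta>"

definition psi20 :: "real \<Rightarrow> real \<Rightarrow> real \<Rightarrow> real \<Rightarrow> real" where
  "psi20 \<gamma> \<kappa>1 \<kappa>2 r = - \<kappa>2 * integral {1..r} (\<lambda>s. rho_b \<gamma> \<kappa>1 \<kappa>2 s / s)"

definition psi0 :: "real \<Rightarrow> real \<Rightarrow> real \<Rightarrow> real^2 \<Rightarrow> real \<Rightarrow> real" where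
  "psi0 \<gamma> \<kappa>1 \<kappa>2 x \<theta> = psi10 \<gamma> \<kappa>1 \<kappa>2 \<theta> + psi20 \<gamma> \<kappa>1 \<kappa>2 (norm x)"


section \<open>Problem \<open>(\<kappa>1, \<kappa>2)\<close>, its truncation, and the threshold\<close>

text \<open>\<open>\<phi>\<close> is the single-valued function \<open>\<psi> - \<psi>\<^sub>0\<close>. The density function \<open>G\<close> is \<open>H\<close> for the original
  problem and a truncation of \<open>H\<close> for the truncated one. The solution is classical: \<open>C\<^sup>2\<close> in the
  open exterior and continuous up to the boundary.\<close>

definition solves_problem ::
    "real \<Rightarrow> (real^2) set \<Rightarrow> (real \<Rightarrow> real) \<Rightarrow> real \<Rightarrow> real \<Rightarrow> (real^2 \<Rightarrow> real \<Rightarrow> real) \<Rightarrow> (real^2 \<Rightarrow> real)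
      \<Rightarrow> bool" where
  "solves_problem \<gamma> D G \<kappa>1 \<kappa>2 \<psi> \<phi> \<longleftrightarrow>
     \<kappa>1\<^sup>2 + \<kappa>2\<^sup>2 < 1 \<and>
     (\<forall>x\<in>closure (exterior D). \<forall>\<theta>. polar_angle x \<theta> \<longrightarrow> \<psi> x \<theta> - psi0 \<gamma> \<kappa>1 \<kappa>2 x \<theta> = \<phi> x) \<and>
     C_k 2 (exterior D) \<phi> \<and> continuous_on (closure (exterior D)) \<phi> \<and>
     (\<forall>x\<in>exterior D.
        divergence (\<lambda>y. (1 / G ((norm (stream_grad \<psi> y))\<^sup>2)) *\<^sub>R stream_grad \<psi> y) x = 0) \<and>
     (\<forall>x\<in>frontier D. \<forall>\<theta>. polar_angle x \<theta> \<longrightarrow> \<psi> x \<theta> = psi10 \<gamma> \<kappa>1 \<kappa>2 \<theta>) \<and>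
     (\<lambda>x. norm (grad \<phi> x)) \<in> O[at_infinity](\<lambda>x. 1 / (norm x)\<^sup>2)"

text \<open>The velocity field \<open>u\<close> of a smooth solution with \<open>sup |\<nabla>\<psi>| < 1\<close>.\<close>

definition uniformly_subsonic_flow ::
    "real \<Rightarrow> (real^2) set \<Rightarrow> real \<Rightarrow> real \<Rightarrow> (real^2 \<Rightarrow> real^2) \<Rightarrow> bool" where
  "uniformly_subsonic_flow \<gamma> D \<kappa>1 \<kappa>2 u \<longleftrightarrow>
     (\<exists>\<psi> \<phi>. solves_problem \<gamma> D (H_density \<gamma>) \<kappa>1 \<kappa>2 \<psi> \<phi> \<and> smooth_on (exterior D) \<phi> \<and>
        (\<exists>M<1. \<forall>x\<in>exterior D. norm (stream_grad \<psi> x) \<le> M) \<and>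
        (\<forall>x\<in>exterior D.
           u x = (1 / H_density \<gamma> ((norm (stream_grad \<psi> x))\<^sup>2)) *\<^sub>R
                   vector [stream_grad \<psi> x $ 2, - (stream_grad \<psi> x $ 1)]))"

definition truncated_density :: "real \<Rightarrow> real \<Rightarrow> (real \<Rightarrow> real) \<Rightarrow> bool" where
  "truncated_density \<gamma> \<epsilon> G \<longleftrightarrow>
     smooth_on {0..} G \<and> antimono_on {0..} G \<and>
     (\<forall>s\<in>{0..1 - 2 * \<epsilon>}. G s = H_density \<gamma> s) \<and>
     (\<forall>s\<ge>1 - \<epsilon>. G s = H_density \<gamma> (1 - \<epsilon>))"

text \<open>\<open>[0, truncated_bound)\<close> is the maximal interval of values of \<open>|\<kappa>2|\<close> for which the solution of
  the truncated problem satisfies the gradient bound. The set below contains 0 and is bounded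
  since \<open>solves_problem\<close> forces \<open>\<kappa>1\<^sup>2 + \<kappa>2\<^sup>2 < 1\<close>.\<close>

definition truncated_bound :: "real \<Rightarrow> (real^2) set \<Rightarrow> real \<Rightarrow> real \<Rightarrow> (real \<Rightarrow> real) \<Rightarrow> real" where
  "truncated_bound \<gamma> D \<kappa>1 \<epsilon> G =
     Sup {k. 0 \<le> k \<and> (\<forall>\<kappa>2. \<bar>\<kappa>2\<bar> < k \<longrightarrow>
        (\<exists>\<psi> \<phi>. solves_problem \<gamma> D G \<kappa>1 \<kappa>2 \<psi> \<phi> \<and>
           (\<forall>x\<in>exterior D. norm (stream_grad \<psi> x) < sqrt (1 - 2 * \<epsilon>))))}"

definition is_threshold ::
    "real \<Rightarrow> (real^2) set \<Rightarrow> real \<Rightarrow> (nat \<Rightarrow> real) \<Rightarrow> (nat \<Rightarrow> real \<Rightarrow> real) \<Rightarrow> real \<Rightarrow> bool" where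
  "is_threshold \<gamma> D \<kappa>1 \<epsilon> G K \<longleftrightarrow>
     (\<forall>i. 0 < \<epsilon> i \<and> \<epsilon> i < 1 / 2 \<and> \<epsilon> (Suc i) < \<epsilon> i) \<and> \<epsilon> \<longlonglongrightarrow> 0 \<and>
     (\<forall>i. truncated_density \<gamma> (\<epsilon> i) (G i)) \<and>
     (\<lambda>i. truncated_bound \<gamma> D \<kappa>1 (\<epsilon> i) (G i)) \<longlonglongrightarrow> K"


section \<open>Weak subsonic-sonic flows\<close>

text \<open>Each conservation law is written as the vanishing distributional divergence of its flux.\<close>

definition weak_euler :: "real \<Rightarrow> (real^2) set \<Rightarrow> (real^2 \<Rightarrow> real) \<Rightarrow> (real^2 \<Rightarrow> real^2) \<Rightarrow> bool" where
  "weak_euler \<gamma> \<Omega> \<rho> u \<longleftrightarrow>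
     (let p = (\<lambda>x. \<rho> x powr \<gamma> / \<gamma>) in
      weakly_div_free \<Omega> (\<lambda>x. vector [\<rho> x * u x $ 1, \<rho> x * u x $ 2]) \<and>
      weakly_div_free \<Omega> (\<lambda>x. vector [\<rho> x * (u x $ 1)\<^sup>2 + p x, \<rho> x * u x $ 1 * u x $ 2]) \<and>
      weakly_div_free \<Omega> (\<lambda>x. vector [\<rho> x * u x $ 1 * u x $ 2, \<rho> x * (u x $ 2)\<^sup>2 + p x]) \<and>
      weakly_div_free \<Omega> (\<lambda>x. vector [- (u x $ 2), u x $ 1]))"

end

theory Submission
  imports Defs "HOL-Complex_Analysis.Great_Picard" "HOL-Real_Asymp.Real_Asymp"
begin

text \<open>The limit exists because the velocity of a subsonic flow is controlled by its stream function alone.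
The stream function is \<open>w + k \<theta>\<close>, where \<open>w\<close> is single-valued, vanishes on the boundary curve, and
\<open>k = \<rho>\<^sub>0 \<kappa>\<^sub>1\<close>, so that \<open>\<rho> u = (\<partial>\<^sub>2 w, - \<partial>\<^sub>1 w) + k x / |x|\<^sup>2\<close>, while the equation for the stream function says
that \<open>u\<close> is irrotational (\<open>uniformly_subsonic_stream_flow\<close>). As \<open>\<nabla>(w + k \<theta>)\<close> has length less than 1
and \<open>\<nabla>\<theta>\<close> has length at most 1 outside the unit disc, the extension of \<open>w\<close> by zero is Lipschitz on
the whole plane with constant \<open>1 + k\<close>. The parameters \<open>k\<close> converge because \<open>\<kappa>\<^sub>2\<close> does, so a subsequence
of the functions \<open>w\<close> converges at every point.

To pass from the stream functions to the velocities, take two flows with mass fluxes \<open>m, m'\<close> and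
velocities \<open>u, u'\<close> and test the equation \<open>curl (u - u') = 0\<close> with \<open>\<phi> (w - w')\<close> for a cutoff \<open>\<phi>\<close>. Up to
terms that are small with \<open>w - w'\<close> and \<open>k - k'\<close>, this gives \<open>\<integral> \<phi> (m - m') \<bullet> (u - u') = 0\<close>
(\<open>local_energy_estimate\<close>). The map \<open>u \<mapsto> g(|u|\<^sup>2) u\<close> is monotone on the closed unit ball; its radial
derivative vanishes on the sonic circle, but only to first order, and this leaves the bound
\<open>|u - u'|\<^sup>4 \<le> 8 (m - m') \<bullet> (u - u')\<close> (\<open>momentum_monotonicity\<close>). Hence the velocities form a Cauchy
sequence in \<open>L\<^sup>4\<close> on small balls, and a subsequence converges almost everywhere. All fluxes in the
Euler equations are continuous functions of a velocity in the closed unit ball, so dominated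
convergence carries the equations to the limit.

The boundary condition has to be obtained without any regularity of the velocity at the boundary.
For each subsonic flow \<open>\<integral> \<rho> u \<bullet> \<nabla>v\<close> over the exterior splits into two parts. The rotated gradient of
\<open>w\<close> contributes nothing, because the zero extension of \<open>w\<close> is Lipschitz and can be integrated by parts
over the whole plane. The explicit field \<open>k x / |x|\<^sup>2\<close> is smooth near the curve and contributes
\<open>k \<integral> v e\<^sub>r \<bullet> n / |x|\<close> along the curve by the divergence theorem. The result depends on the flow
only through \<open>k\<close>, so it survives the limit, and \<open>k / r\<close> is the radial mass flux of the background flow.

The divergence theorem for the interior of a smooth Jordan curve is obtained from the
Cauchy-Pompeiu formula: integrating that formula along the curve and exchanging the integrals turns
its kernel into the winding number of the curve, which is \<open>\<plusminus> 1\<close> inside and 0 outside. The sign is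
matched with the inner normal by computing how the winding number jumps across the curve.

The background flow is a choice among the solutions of an ordinary differential system, so an
existence proof is needed before anything can be said about it. Bernoulli's law expresses \<open>1 / r\<^sup>2\<close>
explicitly as a decreasing function of the density, and the density is the inverse of that function.\<close>

section \<open>Calculus of \<open>C\<^sup>k\<close> functions\<close>

lemma C_k_cong:
  assumes "open S" "\<And>x. x \<in> S \<Longrightarrow> f x = g x" "C_k k S f"
  shows "C_k k S g"
  using assms(2,3)
proof (induction k arbitrary: f g)
  case 0
  then show ?case by (metis C_k.simps(1) continuous_on_cong)
next
  case (Suc k)
  have d: "g differentiable (at x)" "frechet_derivative f (at x) = frechet_derivative g (at x)" if "x \<in> S" for x
  proof -
    have "(f has_derivative frechet_derivative f (at x)) (at x)"
      using Suc.prems(2) that frechet_derivative_works by auto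
    then have *: "(g has_derivative frechet_derivative f (at x)) (at x)"
      by (rule has_derivative_transform_within_open[OF _ assms(1) that]) (use Suc.prems in auto)
    then show "g differentiable (at x)" by (auto simp: differentiable_def)
    show "frechet_derivative f (at x) = frechet_derivative g (at x)"
      using frechet_derivative_at[OF *] by simp
  qed
  have "C_k k S (\<lambda>x. frechet_derivative g (at x) b)" if "b \<in> Basis" for b
    by (rule Suc.IH[of "\<lambda>x. frechet_derivative f (at x) b"]) (use d Suc.prems that in auto)
  with d show ?case by simp
qed

lemma C_k_SucI:
  assumes "open S" "\<And>x. x \<in> S \<Longrightarrow> (f has_derivative f' x) (at x)"
    "\<And>b. b \<in> Basis \<Longrightarrow> C_k k S (\<lambda>x. f' x b)"
  shows "C_k (Suc k) S f"
proof -
  have "C_k k S (\<lambda>x. frechet_derivative f (at x) b)" if "b \<in> Basis" for b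
    by (rule C_k_cong[OF assms(1) _ assms(3)[OF that]])
      (use assms(2) frechet_derivative_at in metis)
  then show ?thesis using assms(2) by (auto simp: differentiable_def)
qed

lemma C_k_has_derivative:
  "C_k (Suc k) S f \<Longrightarrow> x \<in> S \<Longrightarrow> (f has_derivative frechet_derivative f (at x)) (at x)"
  using frechet_derivative_works by auto

lemma C_k_SucD: "C_k (Suc k) S f \<Longrightarrow> C_k k S f"
proof (induction k arbitrary: f)
  case 0
  then show ?case
    by (auto intro!: continuous_at_imp_continuous_on differentiable_imp_continuous_within)
next
  case (Suc k)
  then show ?case
    by (metis C_k.simps(2))
qed

lemma C_k_le: "C_k m S f \<Longrightarrow> k \<le> m \<Longrightarrow> C_k k S f"
  by (induction m) (auto simp del: C_k.simps dest: C_k_SucD simp: le_Suc_eq)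

lemma C_k_imp_continuous_on: "C_k k S f \<Longrightarrow> continuous_on S f"
  using C_k_le[of k S f 0] by simp

lemma C_k_subset: "C_k k S f \<Longrightarrow> T \<subseteq> S \<Longrightarrow> C_k k T f"
  by (induction k arbitrary: f) (auto intro: continuous_on_subset)

lemma C_k_const: "open S \<Longrightarrow> C_k k S (\<lambda>x. c)"
proof (induction k arbitrary: c)
  case (Suc k)
  show ?case by (rule C_k_SucI[where f'="\<lambda>x h. 0"]) (use Suc in auto)
qed simp

lemma C_k_bounded_linear: "open S \<Longrightarrow> bounded_linear f \<Longrightarrow> C_k k S f"
proof (cases k)
  case (Suc m)
  assume "open S" "bounded_linear f"
  then show ?thesis unfolding Suc
    by (intro C_k_SucI[where f'="\<lambda>x. f"] C_k_const bounded_linear_imp_has_derivative)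
qed (simp add: linear_continuous_on)

lemma frechet_derivative_worksI:
  "f differentiable (at x) \<Longrightarrow> (f has_derivative frechet_derivative f (at x)) (at x)"
  using frechet_derivative_works by blast

lemma C_k_add:
  assumes S: "open S" shows "C_k k S f \<Longrightarrow> C_k k S g \<Longrightarrow> C_k k S (\<lambda>x. f x + g x)"
proof (induction k arbitrary: f g)
  case (Suc k)
  show ?case
    by (rule C_k_SucI[where f'="\<lambda>x h. frechet_derivative f (at x) h + frechet_derivative g (at x) h", OF S])
      (use Suc in \<open>auto intro!: has_derivative_add frechet_derivative_worksI simp del: C_k.simps(1)\<close>)
qed (auto intro: continuous_intros)

lemma C_k_mult:
  fixes f g :: "'a::euclidean_space \<Rightarrow> real"
  assumes S: "open S" shows "C_k k S f \<Longrightarrow> C_k k S g \<Longrightarrow> C_k k S (\<lambda>x. f x * g x)"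
proof (induction k arbitrary: f g)
  case (Suc k)
  show ?case
  proof (rule C_k_SucI[where f'="\<lambda>x h. f x * frechet_derivative g (at x) h + frechet_derivative f (at x) h * g x", OF S])
    show "((\<lambda>x. f x * g x) has_derivative (\<lambda>h. f x * frechet_derivative g (at x) h + frechet_derivative f (at x) h * g x)) (at x)"
      if "x \<in> S" for x
      by (rule has_derivative_mult) (use Suc.prems that C_k_has_derivative in blast)+
    show "C_k k S (\<lambda>x. f x * frechet_derivative g (at x) b + frechet_derivative f (at x) b * g x)"
      if "b \<in> Basis" for b
      using Suc.prems that by (intro C_k_add[OF S] Suc.IH) (auto dest!: C_k_SucD simp del: C_k.simps(1) simp: C_k_SucD)
  qed
qed (auto intro: continuous_intros)

lemma C_k_minus:
  fixes f :: "'a::euclidean_space \<Rightarrow> real"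
  assumes S: "open S" and "C_k k S f" shows "C_k k S (\<lambda>x. - f x)"
  using C_k_mult[OF S C_k_const[OF S, of k "-1"] assms(2)] by simp

lemma C_k_diff:
  fixes f g :: "'a::euclidean_space \<Rightarrow> real"
  assumes S: "open S" and "C_k k S f" "C_k k S g" shows "C_k k S (\<lambda>x. f x - g x)"
  using C_k_add[OF S assms(2) C_k_minus[OF S assms(3)]] by simp

lemma C_k_real_SucI:
  fixes f :: "real \<Rightarrow> real"
  assumes "open S" "\<And>x. x \<in> S \<Longrightarrow> (f has_real_derivative f' x) (at x)" "C_k k S f'"
  shows "C_k (Suc k) S f"
  by (rule C_k_SucI[where f'="\<lambda>x h. f' x * h"]) (use assms in \<open>auto simp: has_field_derivative_def\<close>)

text \<open>On the line the derivative is a number, and this number is the value of the Frechet derivative at 1,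
the only basis vector.\<close>

lemma C_k_real_SucD:
  fixes f :: "real \<Rightarrow> real"
  assumes "C_k (Suc k) S f"
  shows "\<And>x. x \<in> S \<Longrightarrow> (f has_real_derivative frechet_derivative f (at x) 1) (at x)"
    and "C_k k S (\<lambda>x. frechet_derivative f (at x) 1)"
proof -
  show "C_k k S (\<lambda>x. frechet_derivative f (at x) 1)" using assms by simp
  fix x assume "x \<in> S"
  then have d: "(f has_derivative frechet_derivative f (at x)) (at x)"
    using assms C_k_has_derivative by blast
  have "frechet_derivative f (at x) = (*) (frechet_derivative f (at x) 1)"
  proof
    fix h
    have "linear (frechet_derivative f (at x))" using d has_derivative_linear by blast
    then have "frechet_derivative f (at x) (h *\<^sub>R 1) = h *\<^sub>R frechet_derivative f (at x) 1"
      by (rule linear_cmul)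
    then show "frechet_derivative f (at x) h = frechet_derivative f (at x) 1 * h" by (simp add: mult.commute)
  qed
  with d show "(f has_real_derivative frechet_derivative f (at x) 1) (at x)"
    by (simp add: has_field_derivative_def)
qed

lemma C_k_compose:
  fixes h :: "real \<Rightarrow> real" and f :: "'a::euclidean_space \<Rightarrow> real"
  assumes S: "open S" and T: "open T" and im: "\<And>x. x \<in> S \<Longrightarrow> f x \<in> T"
  shows "C_k k T h \<Longrightarrow> C_k k S f \<Longrightarrow> C_k k S (\<lambda>x. h (f x))"
proof (induction k arbitrary: h)
  case 0
  then show ?case using continuous_on_compose2[of T h S f] im by auto
next
  case (Suc k)
  show ?case
  proof (rule C_k_SucI[where f'="\<lambda>x v. frechet_derivative h (at (f x)) 1 * frechet_derivative f (at x) v", OF S])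
    show "((\<lambda>x. h (f x)) has_derivative (\<lambda>v. frechet_derivative h (at (f x)) 1 * frechet_derivative f (at x) v)) (at x)"
      if "x \<in> S" for x
      using has_derivative_compose[OF C_k_has_derivative[OF Suc.prems(2) that],
          of h "\<lambda>v. frechet_derivative h (at (f x)) 1 * v"]
        C_k_real_SucD(1)[OF Suc.prems(1) im[OF that]] by (simp add: has_field_derivative_def)
    show "C_k k S (\<lambda>x. frechet_derivative h (at (f x)) 1 * frechet_derivative f (at x) b)" if "b \<in> Basis" for b
      using Suc.prems(2) that
      by (intro C_k_mult[OF S] Suc.IH[OF C_k_real_SucD(2)[OF Suc.prems(1)]] C_k_SucD[OF Suc.prems(2)]) auto
  qed
qed

lemma C_k_powr_real: "C_k k {0<..} (\<lambda>x::real. x powr a)"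
proof (induction k arbitrary: a)
  case 0
  then show ?case by (auto intro!: continuous_intros)
next
  case (Suc k)
  have "C_k k {0<..} (\<lambda>x::real. a * x powr (a - 1))"
    by (intro C_k_mult C_k_const Suc) auto
  then show ?case
    by (rule C_k_real_SucI[rotated 2]) (auto intro!: derivative_eq_intros)
qed

lemma C_k_powr:
  fixes f :: "'a::euclidean_space \<Rightarrow> real"
  assumes "open S" "C_k k S f" "\<And>x. x \<in> S \<Longrightarrow> f x > 0"
  shows "C_k k S (\<lambda>x. f x powr a)"
  by (rule C_k_compose[where T="{0<..}" and h="\<lambda>x. x powr a", OF _ _ _ C_k_powr_real]) (use assms in auto)

lemma C_k_divide:
  fixes f g :: "'a::euclidean_space \<Rightarrow> real"
  assumes "open S" "C_k k S f" "C_k k S g" "\<And>x. x \<in> S \<Longrightarrow> g x > 0"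
  shows "C_k k S (\<lambda>x. f x / g x)"
  by (rule C_k_cong[OF assms(1) _ C_k_mult[OF assms(1,2) C_k_powr[OF assms(1,3,4), of "-1"]]])
    (use assms(4) in \<open>auto simp: powr_minus divide_inverse abs_of_pos less_imp_le\<close>)

lemma smooth_onI:
  "open S \<Longrightarrow> (\<And>k. C_k k S f) \<Longrightarrow> smooth_on S f"
  unfolding smooth_on_def by blast

lemma smooth_on_C_k:
  assumes "smooth_on S f" "open S" shows "C_k k S f"
proof -
  obtain U F where "open U" "S \<subseteq> U" "C_k k U F" "\<forall>x\<in>S. F x = f x"
    using assms unfolding smooth_on_def by blast
  then show ?thesis using C_k_cong[OF assms(2), of F f] C_k_subset by blast
qed

section \<open>Integrals of directional derivatives\<close>

lemma integral_lborel_shift: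
  fixes f :: "'a::euclidean_space \<Rightarrow> real"
  assumes "integrable lborel f"
  shows "integrable lborel (\<lambda>x. f (x + c))" "(\<integral>x. f (x + c) \<partial>lborel) = (\<integral>x. f x \<partial>lborel)"
proof -
  have m: "f \<in> borel_measurable borel" using assms by simp
  have i: "integrable (distr lborel borel ((+) c)) f" using assms by (simp add: lborel_distr_plus)
  show "integrable lborel (\<lambda>x. f (x + c))"
    using integrable_distr[OF _ i] by (simp add: add.commute)
  have "(\<integral>x. f x \<partial>distr lborel borel ((+) c)) = (\<integral>x. f (c + x) \<partial>lborel)"
    by (rule integral_distr) (use m in auto)
  then show "(\<integral>x. f (x + c) \<partial>lborel) = (\<integral>x. f x \<partial>lborel)"
    by (simp add: lborel_distr_plus add.commute)
qed

lemma integrable_bounded_support: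
  fixes f :: "'a::euclidean_space \<Rightarrow> real"
  assumes "f \<in> borel_measurable borel" "\<And>x. \<bar>f x\<bar> \<le> B" "\<And>x. norm x > R \<Longrightarrow> f x = 0"
  shows "integrable lborel f"
proof (rule Bochner_Integration.integrable_bound[where f="\<lambda>x. B * indicator (cball 0 R) x"])
  show "integrable lborel (\<lambda>x. B * indicator (cball (0::'a) R) x)"
    using emeasure_lborel_cball_finite[of "0::'a" R] by (intro integrable_mult_right) (auto simp: integrable_indicator_iff)
  show "AE x in lborel. norm (f x) \<le> norm (B * indicator (cball 0 R) x :: real)"
  proof (rule AE_I2)
    fix x :: 'a
    show "norm (f x) \<le> norm (B * indicator (cball 0 R) x :: real)"
      using assms(2)[of x] assms(3)[of x] by (cases "norm x > R") (auto simp: indicator_def)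
  qed
qed (use assms in auto)

text \<open>Difference quotients integrate to zero because Lebesgue measure is invariant under translations. The
Lipschitz bound and the bounded support dominate them, so the integral of the pointwise limit is zero
as well. The derivative is
required almost everywhere only, which admits functions that are differentiable off a null set, such
as extensions by zero.\<close>

lemma integral_directional_derivative_Lipschitz:
  fixes f :: "'a::euclidean_space \<Rightarrow> real"
  assumes lip: "\<And>x y. \<bar>f x - f y\<bar> \<le> L * norm (x - y)"
    and supp: "\<And>x. norm x > R \<Longrightarrow> f x = 0"
    and der: "AE x in lborel. ((\<lambda>t. f (x + t *\<^sub>R e)) has_real_derivative g x) (at 0)"
    and meas: "g \<in> borel_measurable borel"
  shows "integrable lborel g" "(\<integral>x. g x \<partial>lborel) = 0"
proof -
  define h where "h n = 1 / real (Suc n)" for n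
  have h: "0 < h n" "h n \<le> 1" "h n \<noteq> 0" for n by (auto simp: h_def)
  have hlim: "h \<longlonglongrightarrow> 0" unfolding h_def by (rule LIMSEQ_Suc[OF lim_const_over_n])
  define s where "s n x = (f (x + h n *\<^sub>R e) - f x) / h n" for n x
  have "continuous_on UNIV f"
  proof (rule lipschitz_on_continuous_on[of "max L 0"], rule lipschitz_onI)
    fix x y show "dist (f x) (f y) \<le> max L 0 * dist x y"
      using lip[of x y] mult_right_mono[of L "max L 0" "norm (x - y)"] by (simp add: dist_norm dist_real_def)
  qed auto
  then have fm: "f \<in> borel_measurable borel" by (rule borel_measurable_continuous_onI)
  \<comment> \<open>A point outside the support: comparing with it bounds \<open>f\<close>.\<close>
  define z :: 'a where "z = (\<bar>R\<bar> + 1) *\<^sub>R (SOME i. i \<in> Basis)"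
  have "norm z = \<bar>R\<bar> + 1" unfolding z_def by (simp add: SOME_Basis)
  then have fz: "f z = 0" using supp by simp
  have fb: "\<bar>f x\<bar> \<le> \<bar>L\<bar> * (\<bar>R\<bar> + norm z)" for x
  proof (cases "norm x > R")
    case True then show ?thesis using supp by simp
  next
    case False
    have "\<bar>f x\<bar> \<le> L * norm (x - z)" using lip[of x z] fz by simp
    also have "\<dots> \<le> \<bar>L\<bar> * (\<bar>R\<bar> + norm z)"
      using False norm_triangle_ineq4[of x z] by (intro mult_mono) auto
    finally show ?thesis .
  qed
  have fi: "integrable lborel f" by (rule integrable_bounded_support[OF fm fb supp])
  have s0: "(\<integral>x. s n x \<partial>lborel) = 0" for n
    unfolding s_def using integral_lborel_shift[OF fi] fi by simp
  have sb: "norm (s n x) \<le> \<bar>L\<bar> * norm e * indicator (cball 0 (R + norm e)) x" for n x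
  proof (cases "norm x > R + norm e")
    case True
    have "norm (h n *\<^sub>R e) \<le> norm e" using h[of n] by (simp add: mult_left_le_one_le)
    then have "norm (x + h n *\<^sub>R e) > R" using True norm_triangle_ineq2[of x "- (h n *\<^sub>R e)"] by simp
    moreover have "norm x > R" using True norm_ge_zero[of e] by linarith
    ultimately show ?thesis by (simp add: s_def supp)
  next
    case False
    have "\<bar>f (x + h n *\<^sub>R e) - f x\<bar> \<le> \<bar>L\<bar> * (h n * norm e)"
    proof -
      have "L * (h n * norm e) \<le> \<bar>L\<bar> * (h n * norm e)" using h(1)[of n] by (intro mult_right_mono) auto
      moreover have "\<bar>f (x + h n *\<^sub>R e) - f x\<bar> \<le> L * (h n * norm e)"
        using lip[of "x + h n *\<^sub>R e" x] h(1)[of n] by simp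
      ultimately show ?thesis by linarith
    qed
    then have "norm (s n x) \<le> \<bar>L\<bar> * norm e"
      using h(1)[of n] unfolding s_def by (simp add: pos_divide_le_eq) (simp add: mult_ac)
    with False show ?thesis by (simp add: indicator_def)
  qed
  have conv: "AE x in lborel. (\<lambda>n. s n x) \<longlonglongrightarrow> g x"
    using der
  proof eventually_elim
    case (elim x)
    then have "((\<lambda>t. (f (x + t *\<^sub>R e) - f x) / t) \<longlongrightarrow> g x) (at 0)"
      by (simp add: has_field_derivative_iff)
    moreover have "filterlim h (at 0) sequentially"
      using hlim h by (simp add: filterlim_at)
    ultimately show ?case unfolding s_def using filterlim_compose by blast
  qed
  have wi: "integrable lborel (\<lambda>x::'a. \<bar>L\<bar> * norm e * indicator (cball 0 (R + norm e)) x)"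
    using emeasure_lborel_cball_finite[of "0::'a" "R + norm e"] by (intro integrable_mult_right) (auto simp: integrable_indicator_iff)
  have sm: "s n \<in> borel_measurable lborel" for n unfolding s_def using fm by measurable
  show "integrable lborel g"
    by (rule integrable_dominated_convergence[OF _ sm wi conv]) (use meas sb in auto)
  have "(\<lambda>n. \<integral>x. s n x \<partial>lborel) \<longlonglongrightarrow> (\<integral>x. g x \<partial>lborel)"
    by (rule integral_dominated_convergence[OF _ sm wi conv]) (use meas sb in auto)
  then show "(\<integral>x. g x \<partial>lborel) = 0" by (simp add: s0 LIMSEQ_const_iff)
qed

lemma C1_bounded_support_derivative:
  fixes f :: "'a::euclidean_space \<Rightarrow> real"
  assumes der: "\<And>x. (f has_derivative f' x) (at x)"
    and cont: "\<And>b. b \<in> Basis \<Longrightarrow> continuous_on UNIV (\<lambda>x. f' x b)"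
    and supp: "\<And>x. norm x > R \<Longrightarrow> f x = 0"
  obtains B where "\<And>x b. b \<in> Basis \<Longrightarrow> \<bar>f' x b\<bar> \<le> B" "\<And>x. norm x > R \<Longrightarrow> f' x = (\<lambda>h. 0)"
proof -
  have 0: "f' x = (\<lambda>h. 0)" if "norm x > R" for x
  proof -
    have "open {x::'a. norm x > R}" by (intro open_Collect_less continuous_intros)
    then have "((\<lambda>x. 0) has_derivative f' x) (at x)"
      using has_derivative_transform_within_open[OF der[of x], of "{x. norm x > R}" "\<lambda>x. 0"] that supp by auto
    then show ?thesis using has_derivative_unique has_derivative_const by blast
  qed
  have "\<exists>B. \<forall>x. \<bar>f' x b\<bar> \<le> B" if b: "b \<in> Basis" for b
  proof -
    have "compact ((\<lambda>x. f' x b) ` cball 0 R)"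
      using cont[OF b] by (intro compact_continuous_image) (auto intro: continuous_on_subset)
    then have "bounded ((\<lambda>x. f' x b) ` cball 0 R)" by (rule compact_imp_bounded)
    then obtain B where "\<forall>y\<in>(\<lambda>x. f' x b) ` cball 0 R. norm y \<le> B"
      unfolding bounded_iff by blast
    then have "\<bar>f' x b\<bar> \<le> max B 0" for x using 0[of x] by (cases "norm x > R") (auto simp: le_max_iff_disj)
    then show ?thesis by blast
  qed
  then obtain B where B: "\<And>b x. b \<in> Basis \<Longrightarrow> \<bar>f' x b\<bar> \<le> B b" by metis
  have "\<bar>f' x b\<bar> \<le> (\<Sum>b\<in>Basis. \<bar>B b\<bar>)" if "b \<in> Basis" for b x
    using B[OF that, of x] member_le_sum[OF that, of "\<lambda>b. \<bar>B b\<bar>"] by force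
  then show thesis using that 0 by blast
qed

lemma Lipschitz_of_C1_bounded_support:
  fixes f :: "'a::euclidean_space \<Rightarrow> real"
  assumes der: "\<And>x. (f has_derivative f' x) (at x)"
    and cont: "\<And>b. b \<in> Basis \<Longrightarrow> continuous_on UNIV (\<lambda>x. f' x b)"
    and supp: "\<And>x. norm x > R \<Longrightarrow> f x = 0"
  obtains L where "\<And>x y. \<bar>f x - f y\<bar> \<le> L * norm (x - y)"
proof -
  obtain B where B: "\<And>x b. b \<in> Basis \<Longrightarrow> \<bar>f' x b\<bar> \<le> B"
  proof (rule C1_bounded_support_derivative[of f f' R])
    show "(f has_derivative f' x) (at x)" for x by (rule der)
    show "continuous_on UNIV (\<lambda>x. f' x b)" if "b \<in> Basis" for b by (rule cont[OF that])
    show "f x = 0" if "norm x > R" for x by (rule supp[OF that])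
  qed (rule that)
  define L where "L = (\<Sum>b\<in>(Basis::'a set). B)"
  have on: "onorm (f' x) \<le> L" for x
  proof (rule onorm_le)
    fix h
    have lin: "linear (f' x)" using der has_derivative_linear by blast
    have "f' x h = f' x (\<Sum>b\<in>Basis. (h \<bullet> b) *\<^sub>R b)" by (simp add: euclidean_representation)
    also have "\<dots> = (\<Sum>b\<in>Basis. (h \<bullet> b) * f' x b)"
      using lin by (simp add: linear_sum linear_cmul)
    finally have "norm (f' x h) \<le> (\<Sum>b\<in>Basis. \<bar>(h \<bullet> b) * f' x b\<bar>)" by (simp add: sum_abs)
    also have "\<dots> \<le> (\<Sum>b\<in>(Basis::'a set). B * norm h)"
    proof (rule sum_mono)
      fix b :: 'a assume b: "b \<in> Basis"
      have "\<bar>h \<bullet> b\<bar> * \<bar>f' x b\<bar> \<le> norm h * B" using Basis_le_norm[OF b, of h] B[OF b, of x] by (intro mult_mono) auto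
      then show "\<bar>(h \<bullet> b) * f' x b\<bar> \<le> B * norm h" by (simp add: abs_mult mult.commute)
    qed
    finally show "norm (f' x h) \<le> L * norm h" unfolding L_def by (simp only: sum_distrib_right)
  qed
  have "norm (f x - f y) \<le> L * norm (x - y)" for x y
    by (rule differentiable_bound[of UNIV f f']) (use der on in auto)
  then show thesis by (intro that[of L]) simp
qed

lemma has_derivative_directional:
  assumes "(f has_derivative f') (at (x::'a::real_normed_vector))"
  shows "((\<lambda>t. f (x + t *\<^sub>R e)) has_real_derivative f' e) (at 0)"
proof -
  have "((\<lambda>t. x + t *\<^sub>R e) has_derivative (\<lambda>t. t *\<^sub>R e)) (at 0)"
    by (auto intro!: derivative_eq_intros)
  then have "((\<lambda>t. f (x + t *\<^sub>R e)) has_derivative (\<lambda>t. f' (t *\<^sub>R e))) (at 0)"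
    by (rule has_derivative_compose) (use assms in simp)
  moreover have "f' (t *\<^sub>R e) = f' e * t" for t
    using linear_cmul[OF has_derivative_linear[OF assms], of t e] by simp
  ultimately show ?thesis unfolding has_field_derivative_def by simp
qed

lemma integral_directional_derivative_C1:
  fixes f :: "'a::euclidean_space \<Rightarrow> real"
  assumes der: "\<And>x. (f has_derivative f' x) (at x)"
    and cont: "\<And>b. b \<in> Basis \<Longrightarrow> continuous_on UNIV (\<lambda>x. f' x b)"
    and supp: "\<And>x. norm x > R \<Longrightarrow> f x = 0"
    and e: "e \<in> Basis"
  shows "integrable lborel (\<lambda>x. f' x e)" "(\<integral>x. f' x e \<partial>lborel) = 0"
proof -
  obtain L where L: "\<And>x y. \<bar>f x - f y\<bar> \<le> L * norm (x - y)"
    using Lipschitz_of_C1_bounded_support[OF der cont supp] by blast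
  have m: "(\<lambda>x. f' x e) \<in> borel_measurable borel"
    using cont[OF e] borel_measurable_continuous_onI by blast
  have a: "AE x in lborel. ((\<lambda>t. f (x + t *\<^sub>R e)) has_real_derivative f' x e) (at 0)"
    using has_derivative_directional[OF der] by simp
  show "integrable lborel (\<lambda>x. f' x e)" "(\<integral>x. f' x e \<partial>lborel) = 0"
    using integral_directional_derivative_Lipschitz[OF L supp a m] by auto
qed

section \<open>The Cauchy-Pompeiu formula in real form\<close>

lemma Basis_real2: "(Basis :: (real^2) set) = {axis 1 1, axis 2 1}"
proof -
  have "(Basis :: (real^2) set) = (\<Union>i. {axis i 1})" unfolding Basis_vec_def by simp
  also have "\<dots> = {axis 1 1, axis 2 1}" unfolding UNIV_2 by auto
  finally show ?thesis .
qed

lemma norm_real2_sq: "(norm (x::real^2))\<^sup>2 = (x $ 1)\<^sup>2 + (x $ 2)\<^sup>2"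
  unfolding power2_norm_eq_inner inner_vec_def by (simp add: sum_2 power2_eq_square)

lemma inner_real2: "x \<bullet> (y::real^2) = x $ 1 * y $ 1 + x $ 2 * y $ 2"
  unfolding inner_vec_def by (simp add: sum_2)

text \<open>Layer-cake integration of a radial function that decreases to 0 at infinity: \<open>- F(|y|)\<close> is the
integral of \<open>\<psi> = F'\<close> over \<open>[|y|, \<infinity>)\<close>, and after exchanging the integrals \<open>\<psi> r\<close> is weighted by the area \<open>\<pi> r\<^sup>2\<close>
of the disc. This replaces polar coordinates; \<open>G\<close> is an antiderivative of the resulting density. The
value \<open>\<xi> 0\<close> is left open because \<open>\<psi>\<close> may be singular at 0.\<close>

lemma nn_integral_radial_real2:
  fixes F \<psi> :: "real \<Rightarrow> real"
  assumes F: "\<And>r. r > 0 \<Longrightarrow> (F has_real_derivative \<psi> r) (at r)"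
    and nonneg: "\<And>r. r > 0 \<Longrightarrow> 0 \<le> \<psi> r"
    and Flim: "(F \<longlongrightarrow> 0) at_top"
    and G: "\<And>r. r \<ge> 0 \<Longrightarrow> (G has_real_derivative \<xi> r) (at r)"
    and \<xi>: "\<And>r. r > 0 \<Longrightarrow> \<xi> r = pi * r\<^sup>2 * \<psi> r" "\<xi> 0 \<ge> 0"
    and Glim: "(G \<longlongrightarrow> T) at_top"
    and meas[measurable]: "\<psi> \<in> borel_measurable borel" "\<xi> \<in> borel_measurable borel"
  shows "(\<integral>\<^sup>+ y. ennreal (- F (norm (y::real^2))) \<partial>lborel) = ennreal (T - G 0)"
proof -
  have "(\<integral>\<^sup>+ y. ennreal (- F (norm (y::real^2))) \<partial>lborel) =
    (\<integral>\<^sup>+ y. (\<integral>\<^sup>+ r. ennreal (\<psi> r) * indicator {p. norm (fst p) \<le> snd p} (y::real^2, r) \<partial>lborel) \<partial>lborel)"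
  proof (rule nn_integral_cong_AE)
    have "AE y in lborel. y \<noteq> (0::real^2)" by (rule AE_lborel_singleton)
    then show "AE y in lborel. ennreal (- F (norm (y::real^2))) =
      (\<integral>\<^sup>+ r. ennreal (\<psi> r) * indicator {p. norm (fst p) \<le> snd p} (y::real^2, r) \<partial>lborel)"
    proof eventually_elim
      case (elim y)
      then have y: "norm y > 0" by simp
      have "(\<integral>\<^sup>+ r. ennreal (\<psi> r) * indicator {norm y..} r \<partial>lborel) = ennreal (0 - F (norm y))"
        by (rule nn_integral_FTC_atLeast[OF _ _ _ Flim]) (use less_le_trans[OF y] F nonneg in auto)
      then show ?case by (simp add: indicator_def)
    qed
  qed
  also have "\<dots> = (\<integral>\<^sup>+ r. (\<integral>\<^sup>+ y. ennreal (\<psi> r) * indicator {p. norm (fst p) \<le> snd p} (y::real^2, r) \<partial>lborel) \<partial>lborel)"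
  proof (rule lborel_pair.Fubini'[symmetric])
    have [measurable]: "{p::(real^2)\<times>real. norm (fst p) \<le> snd p} \<in> sets (borel \<Otimes>\<^sub>M borel)"
      unfolding borel_prod by (intro borel_closed closed_Collect_le continuous_intros)
    show "(\<lambda>(y::real^2, r). ennreal (\<psi> r) * indicator {p. norm (fst p) \<le> snd p} (y::real^2, r)) \<in> borel_measurable (lborel \<Otimes>\<^sub>M lborel)"
      by measurable
  qed
  also have "\<dots> = (\<integral>\<^sup>+ r. ennreal (\<xi> r) * indicator {0..} r \<partial>lborel)"
  proof (rule nn_integral_cong_AE)
    have "AE r in lborel. r \<noteq> (0::real)" by (rule AE_lborel_singleton)
    then show "AE r in lborel. (\<integral>\<^sup>+ y. ennreal (\<psi> r) * indicator {p. norm (fst p) \<le> snd p} (y::real^2, r) \<partial>lborel)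
      = ennreal (\<xi> r) * indicator {0..} r"
    proof eventually_elim
      case (elim r)
      have "(\<integral>\<^sup>+ y. ennreal (\<psi> r) * indicator {p. norm (fst p) \<le> snd p} (y::real^2, r) \<partial>lborel)
        = (\<integral>\<^sup>+ y. ennreal (\<psi> r) * indicator (cball 0 r) (y::real^2) \<partial>lborel)"
        by (intro nn_integral_cong) (auto simp: indicator_def)
      also have "\<dots> = ennreal (\<psi> r) * emeasure lborel (cball (0::real^2) r)"
        by (subst nn_integral_cmult_indicator) auto
      also have "\<dots> = ennreal (\<xi> r) * indicator {0..} r"
      proof (cases "r > 0")
        case True
        then have "emeasure lborel (cball (0::real^2) r) = ennreal (pi * r\<^sup>2)"
          using emeasure_cball[of r "0::real^2"] by (simp add: unit_ball_vol_2)
        then show ?thesis using True \<xi> nonneg[OF True] by (simp add: ennreal_mult[symmetric] mult.commute)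
      next
        case False
        then show ?thesis using elim by (simp add: cball_empty)
      qed
      finally show ?case .
    qed
  qed
  also have "\<dots> = ennreal (T - G 0)"
  proof (rule nn_integral_FTC_atLeast[OF _ _ _ Glim])
    show "0 \<le> \<xi> r" if "0 \<le> r" for r using \<xi> nonneg that by (cases "r = 0") auto
  qed (use G in auto)
  finally show ?thesis .
qed

text \<open>The kernel \<open>d\<^sup>2 / (|y|\<^sup>2 + d\<^sup>2)\<^sup>2\<close> is what remains of the divergence of the regularised Cauchy kernel. Its
mass is \<open>\<pi>\<close> for every \<open>d\<close>, so it approximates \<open>\<pi>\<close> times the point mass at 0.\<close>

lemma nn_integral_mollifier:
  assumes "d > 0"
  shows "(\<integral>\<^sup>+ y. ennreal (d\<^sup>2 / ((norm (y::real^2))\<^sup>2 + d\<^sup>2)\<^sup>2) \<partial>lborel) = ennreal pi"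
proof -
  define i where "i r = inverse (r\<^sup>2 + d\<^sup>2)" for r
  have p: "r\<^sup>2 + d\<^sup>2 > 0" for r using assms by (simp add: add_nonneg_pos)
  then have ip: "i r > 0" for r by (simp add: i_def)
  have i1: "(r\<^sup>2 + d\<^sup>2) * i r = 1" for r by (metis p right_inverse less_irrefl i_def)
  have di: "(i has_real_derivative - (2 * r) * (i r)\<^sup>2) (at r)" for r
    unfolding i_def using p[of r] by (auto intro!: derivative_eq_intros simp: power2_eq_square)
  have [measurable]: "i \<in> borel_measurable borel" unfolding i_def by measurable
  have "(\<integral>\<^sup>+ y. ennreal (- (- d\<^sup>2 * (i (norm (y::real^2)))\<^sup>2)) \<partial>lborel)
    = ennreal (pi - pi * 0^4 * (i 0)\<^sup>2)"
  proof (rule nn_integral_radial_real2[where F="\<lambda>r. - d\<^sup>2 * (i r)\<^sup>2" and \<psi>="\<lambda>r. 4 * r * d\<^sup>2 * (i r)^3"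
        and \<xi>="\<lambda>r. pi * (4 * r^3 * d\<^sup>2 * (i r)^3)" and G="\<lambda>r. pi * r^4 * (i r)\<^sup>2"])
    show "((\<lambda>r. - d\<^sup>2 * (i r)\<^sup>2) has_real_derivative 4 * r * d\<^sup>2 * (i r)^3) (at r)" for r
      by (rule derivative_eq_intros di refl)+ (simp, algebra)
    have e: "4 * pi * r^3 * (i r)\<^sup>2 - pi * r^4 * (4 * r * (i r)^3) = pi * (4 * r^3 * d\<^sup>2 * (i r)^3)" for r
      using i1[of r] by algebra
    show "((\<lambda>r. pi * r^4 * (i r)\<^sup>2) has_real_derivative pi * (4 * r^3 * d\<^sup>2 * (i r)^3)) (at r)" for r
      unfolding e[symmetric]
      by (rule derivative_eq_intros di refl)+ (simp, algebra)
    show "((\<lambda>r. - d\<^sup>2 * (i r)\<^sup>2) \<longlongrightarrow> 0) at_top" using assms unfolding i_def by real_asymp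
    show "((\<lambda>r. pi * r^4 * (i r)\<^sup>2) \<longlongrightarrow> pi) at_top" using assms unfolding i_def by real_asymp
    show "0 \<le> 4 * r * d\<^sup>2 * i r ^ 3" if "r > 0" for r using that ip[of r] by simp
  qed (auto simp: power_numeral_reduce)
  then show ?thesis by (simp add: i_def divide_inverse power_inverse)
qed

text \<open>An upper bound of order \<open>d\<close> for the first moment of the mollifier: \<open>|y|\<close> is replaced by
\<open>sqrt (|y|\<^sup>2 + d\<^sup>2)\<close>, which makes the integral elementary.\<close>

lemma nn_integral_mollifier_moment:
  assumes "d > 0"
  shows "(\<integral>\<^sup>+ y. ennreal (d\<^sup>2 / (sqrt ((norm (y::real^2))\<^sup>2 + d\<^sup>2))^3) \<partial>lborel) = ennreal (2 * pi * d)"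
proof -
  define s where "s r = inverse (sqrt (r\<^sup>2 + d\<^sup>2))" for r
  have p: "r\<^sup>2 + d\<^sup>2 > 0" for r using assms by (simp add: add_nonneg_pos)
  have sp: "s r > 0" for r using p by (simp add: s_def)
  have sq: "(r\<^sup>2 + d\<^sup>2) * (s r)\<^sup>2 = 1" for r
  proof -
    have "(s r)\<^sup>2 = inverse (r\<^sup>2 + d\<^sup>2)" using p[of r] by (simp add: s_def power_inverse)
    then show ?thesis by (metis p right_inverse less_irrefl)
  qed
  have ds: "(s has_real_derivative - r * (s r)^3) (at r)" for r
  proof -
    have "((\<lambda>r. r\<^sup>2 + d\<^sup>2) has_real_derivative 2 * r) (at r)"
      by (auto intro!: derivative_eq_intros)
    from DERIV_chain2[OF DERIV_real_sqrt[OF p[of r]] this]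
    have "((\<lambda>r. sqrt (r\<^sup>2 + d\<^sup>2)) has_real_derivative r * s r) (at r)"
      by (simp add: s_def mult.commute)
    moreover have "sqrt (r\<^sup>2 + d\<^sup>2) \<noteq> 0" using real_sqrt_gt_zero[OF p[of r]] by linarith
    ultimately have "(s has_real_derivative - (s r * (r * s r) * s r)) (at r)"
      unfolding s_def by (rule DERIV_inverse')
    then show ?thesis by (simp add: power_numeral_reduce mult_ac)
  qed
  have [measurable]: "s \<in> borel_measurable borel" unfolding s_def by measurable
  have "(\<integral>\<^sup>+ y. ennreal (- (- d\<^sup>2 * (s (norm (y::real^2)))^3)) \<partial>lborel)
    = ennreal (0 - pi * d\<^sup>2 * (d\<^sup>2 * (s 0)^3 - 3 * s 0))"
  proof (rule nn_integral_radial_real2[where F="\<lambda>r. - d\<^sup>2 * (s r)^3" and \<psi>="\<lambda>r. 3 * r * d\<^sup>2 * (s r)^5"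
        and \<xi>="\<lambda>r. pi * (3 * r^3 * d\<^sup>2 * (s r)^5)" and G="\<lambda>r. pi * d\<^sup>2 * (d\<^sup>2 * (s r)^3 - 3 * s r)"])
    show "((\<lambda>r. - d\<^sup>2 * (s r)^3) has_real_derivative 3 * r * d\<^sup>2 * (s r)^5) (at r)" for r
      by (rule derivative_eq_intros ds refl)+ (simp add: power_numeral_reduce)
    have e: "pi * d\<^sup>2 * (3 * r * (s r)^3 - 3 * r * d\<^sup>2 * (s r)^5) = pi * (3 * r^3 * d\<^sup>2 * (s r)^5)" for r
      using sq[of r] by algebra
    show "((\<lambda>r. pi * d\<^sup>2 * (d\<^sup>2 * (s r)^3 - 3 * s r)) has_real_derivative pi * (3 * r^3 * d\<^sup>2 * (s r)^5)) (at r)" for r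
      unfolding e[symmetric]
      by (rule derivative_eq_intros ds refl)+ (simp add: power_numeral_reduce algebra_simps)
    show "((\<lambda>r. - d\<^sup>2 * (s r)^3) \<longlongrightarrow> 0) at_top" unfolding s_def using assms by real_asymp
    show "((\<lambda>r. pi * d\<^sup>2 * (d\<^sup>2 * (s r)^3 - 3 * s r)) \<longlongrightarrow> 0) at_top" unfolding s_def using assms by real_asymp
    show "3 * r * d\<^sup>2 * s r ^ 5 \<ge> 0" if "r > 0" for r using that sp[of r] by simp
  qed (auto simp: power_numeral_reduce)
  moreover have "s 0 = inverse d" using assms by (simp add: s_def)
  moreover have "0 - pi * d\<^sup>2 * (d\<^sup>2 * (inverse d)^3 - 3 * inverse d) = 2 * pi * d"
    using assms by (simp add: power_numeral_reduce field_simps)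
  ultimately show ?thesis by (simp add: s_def divide_inverse power_inverse)
qed

text \<open>The factor \<open>1 / (1 + |y|\<^sup>2)\<close> makes \<open>1 / |y|\<close> integrable over the whole plane without changing its
singularity. This gives a bound for the integral of \<open>1 / |z - w|\<close> over a disc that is uniform in \<open>z\<close>.\<close>

lemma nn_integral_singular_kernel:
  "(\<integral>\<^sup>+ y. ennreal (1 / (norm (y::real^2) * (1 + (norm y)\<^sup>2))) \<partial>lborel) = ennreal (pi\<^sup>2)"
proof -
  define i where "i r = inverse (1 + r\<^sup>2)" for r :: real
  have p: "1 + r\<^sup>2 > 0" for r :: real by (simp add: add_pos_nonneg)
  have i1: "(1 + r\<^sup>2) * i r = 1" for r by (metis p right_inverse less_irrefl i_def)
  have di: "(i has_real_derivative - (2 * r) * (i r)\<^sup>2) (at r)" for r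
    unfolding i_def using p[of r] by (auto intro!: derivative_eq_intros simp: power2_eq_square)
  have [measurable]: "i \<in> borel_measurable borel" unfolding i_def by measurable
  have "(\<integral>\<^sup>+ y. ennreal (- (- (inverse (norm (y::real^2)) * i (norm y)))) \<partial>lborel)
    = ennreal (pi\<^sup>2 - pi * (2 * arctan 0 - 0 * i 0))"
  proof (rule nn_integral_radial_real2[where F="\<lambda>r. - (inverse r * i r)" and \<psi>="\<lambda>r. (1 + 3 * r\<^sup>2) * (inverse r)\<^sup>2 * (i r)\<^sup>2"
        and \<xi>="\<lambda>r. pi * ((1 + 3 * r\<^sup>2) * (i r)\<^sup>2)" and G="\<lambda>r. pi * (2 * arctan r - r * i r)"])
    show "((\<lambda>r. - (inverse r * i r)) has_real_derivative (1 + 3 * r\<^sup>2) * (inverse r)\<^sup>2 * (i r)\<^sup>2) (at r)" if "r > 0" for r :: real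
    proof -
      have r1: "r * inverse r = 1" using that by simp
      have e: "(inverse r)\<^sup>2 * i r + inverse r * (2 * r * (i r)\<^sup>2) = (1 + 3 * r\<^sup>2) * (inverse r)\<^sup>2 * (i r)\<^sup>2"
        using i1[of r] r1 by algebra
      show ?thesis unfolding e[symmetric]
        using that by (auto intro!: derivative_eq_intros di simp: power2_eq_square)
    qed
    show "((\<lambda>r. pi * (2 * arctan r - r * i r)) has_real_derivative pi * ((1 + 3 * r\<^sup>2) * (i r)\<^sup>2)) (at r)" for r :: real
    proof -
      have e: "pi * (2 * i r - (i r - r * (2 * r * (i r)\<^sup>2))) = pi * ((1 + 3 * r\<^sup>2) * (i r)\<^sup>2)"
        using i1[of r] by algebra
      show ?thesis unfolding e[symmetric]
        by (rule derivative_eq_intros di refl)+ (simp add: i_def algebra_simps)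
    qed
    show "((\<lambda>r::real. - (inverse r * i r)) \<longlongrightarrow> 0) at_top" unfolding i_def by real_asymp
    have "((\<lambda>r::real. r * i r) \<longlongrightarrow> 0) at_top" unfolding i_def by real_asymp
    then have "((\<lambda>r::real. pi * (2 * arctan r - r * i r)) \<longlongrightarrow> pi * (2 * (pi/2) - 0)) at_top"
      by (intro tendsto_intros tendsto_arctan_at_top)
    then show "((\<lambda>r::real. pi * (2 * arctan r - r * i r)) \<longlongrightarrow> pi\<^sup>2) at_top" by (simp add: power2_eq_square)
    show "pi * ((1 + 3 * r\<^sup>2) * (i r)\<^sup>2) = pi * r\<^sup>2 * ((1 + 3 * r\<^sup>2) * (inverse r)\<^sup>2 * (i r)\<^sup>2)" if "r > 0" for r
    proof -
      have "r * inverse r = 1" using that by simp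
      then show ?thesis by algebra
    qed
  qed auto
  then show ?thesis by (simp add: i_def divide_inverse)
qed

lemma axis_real2_nth [simp]:
  "axis 1 1 $ (1::2) = (1::real)" "axis 1 1 $ (2::2) = (0::real)"
  "axis 2 1 $ (1::2) = (0::real)" "axis 2 1 $ (2::2) = (1::real)"
  by (auto simp: axis_def)

lemma has_derivative_vec_nth:
  "((\<lambda>x. x $ i) has_derivative (\<lambda>h. h $ i)) (at (x::real^'n))"
  by (rule bounded_linear_imp_has_derivative) (rule bounded_linear_vec_nth)

text \<open>Let \<open>a + i b = z - w\<close> and \<open>k = 1 / (|z - w|\<^sup>2 + d\<^sup>2)\<close>. The real and imaginary parts \<open>f, g\<close> of
\<open>(P + i Q) (a + i b) k\<close> are \<open>C\<^sup>1\<close> with bounded support, so \<open>\<partial>\<^sub>1 f + \<partial>\<^sub>2 g\<close> has integral 0. Written out, this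
divergence is the integrand on the left minus \<open>2 P d\<^sup>2 k\<^sup>2\<close>.\<close>

lemma integral_regularised_Cauchy_kernel:
  fixes P Q :: "real^2 \<Rightarrow> real" and z :: "real^2"
  assumes d: "d > 0"
    and P: "\<And>x. (P has_derivative P' x) (at x)" "\<And>b. b \<in> Basis \<Longrightarrow> continuous_on UNIV (\<lambda>x. P' x b)"
    and Q: "\<And>x. (Q has_derivative Q' x) (at x)" "\<And>b. b \<in> Basis \<Longrightarrow> continuous_on UNIV (\<lambda>x. Q' x b)"
    and supp: "\<And>x. norm x > R \<Longrightarrow> P x = 0" "\<And>x. norm x > R \<Longrightarrow> Q x = 0"
  shows "(\<integral>w. ((P' w (axis 1 1) + Q' w (axis 2 1)) * (z $ 1 - w $ 1)
            + (P' w (axis 2 1) - Q' w (axis 1 1)) * (z $ 2 - w $ 2)) / ((norm (z - w))\<^sup>2 + d\<^sup>2) \<partial>lborel)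
       = 2 * (\<integral>w. P w * (d\<^sup>2 / ((norm (w - z))\<^sup>2 + d\<^sup>2)\<^sup>2) \<partial>lborel)" (is "?lhs = 2 * ?rhs")
proof -
  define k where "k w = inverse ((z $ 1 - w $ 1)\<^sup>2 + (z $ 2 - w $ 2)\<^sup>2 + d\<^sup>2)" for w :: "real^2"
  have nz: "(z $ 1 - w $ 1)\<^sup>2 + (z $ 2 - w $ 2)\<^sup>2 + d\<^sup>2 \<noteq> 0" for w
    using d by (smt (verit) zero_le_power2 zero_less_power)
  have k1: "((z $ 1 - w $ 1)\<^sup>2 + (z $ 2 - w $ 2)\<^sup>2 + d\<^sup>2) * k w = 1" for w
    unfolding k_def by (rule right_inverse[OF nz])
  have dk: "(k has_derivative (\<lambda>h. 2 * ((z $ 1 - w $ 1) * h $ 1 + (z $ 2 - w $ 2) * h $ 2) * (k w)\<^sup>2)) (at w)" for w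
    unfolding k_def
    by (rule derivative_eq_intros has_derivative_vec_nth refl nz)+
      (auto simp: fun_eq_iff power2_eq_square algebra_simps)
  have ck: "continuous_on UNIV k" using dk
    by (intro continuous_at_imp_continuous_on ballI) (rule has_derivative_continuous)
  have kk: "k w = 1 / ((norm (z - w))\<^sup>2 + d\<^sup>2)" for w
    unfolding k_def norm_real2_sq by (simp add: divide_inverse)
  have kk': "d\<^sup>2 / ((norm (w - z))\<^sup>2 + d\<^sup>2)\<^sup>2 = d\<^sup>2 * (k w)\<^sup>2" for w
    unfolding kk norm_minus_commute[of w z] by (simp add: power_divide)
  define f where "f w = (P w * (z $ 1 - w $ 1) - Q w * (z $ 2 - w $ 2)) * k w" for w
  define f' where "f' w h = (P' w h * (z $ 1 - w $ 1) - P w * h $ 1 - Q' w h * (z $ 2 - w $ 2) + Q w * h $ 2) * k w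
      + (P w * (z $ 1 - w $ 1) - Q w * (z $ 2 - w $ 2)) *
        (2 * ((z $ 1 - w $ 1) * h $ 1 + (z $ 2 - w $ 2) * h $ 2) * (k w)\<^sup>2)" for w h
  define g where "g w = (Q w * (z $ 1 - w $ 1) + P w * (z $ 2 - w $ 2)) * k w" for w
  define g' where "g' w h = (Q' w h * (z $ 1 - w $ 1) - Q w * h $ 1 + P' w h * (z $ 2 - w $ 2) - P w * h $ 2) * k w
      + (Q w * (z $ 1 - w $ 1) + P w * (z $ 2 - w $ 2)) *
        (2 * ((z $ 1 - w $ 1) * h $ 1 + (z $ 2 - w $ 2) * h $ 2) * (k w)\<^sup>2)" for w h
  have df: "(f has_derivative f' w) (at w)" for w
    unfolding f_def
    by (rule has_derivative_eq_rhs, (rule derivative_intros has_derivative_vec_nth P(1) Q(1) dk)+)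
      (auto simp: f'_def fun_eq_iff algebra_simps)
  have dg: "(g has_derivative g' w) (at w)" for w
    unfolding g_def
    by (rule has_derivative_eq_rhs, (rule derivative_intros has_derivative_vec_nth P(1) Q(1) dk)+)
      (auto simp: g'_def fun_eq_iff algebra_simps)
  have cP: "continuous_on UNIV P" "continuous_on UNIV Q" using P(1) Q(1)
    by (intro continuous_at_imp_continuous_on ballI, metis has_derivative_continuous)+
  have cf: "continuous_on UNIV (\<lambda>w. f' w b)" "continuous_on UNIV (\<lambda>w. g' w b)" if "b \<in> Basis" for b
    unfolding f'_def g'_def using P(2)[OF that] Q(2)[OF that] ck cP by (auto intro!: continuous_intros)
  have sf: "f w = 0" "g w = 0" if "norm w > R" for w using supp that by (auto simp: f_def g_def)
  have e: "axis 1 1 \<in> (Basis::(real^2) set)" "axis 2 1 \<in> (Basis::(real^2) set)" by (auto simp: Basis_real2)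
  note f = integral_directional_derivative_C1[where R=R, OF df cf(1) sf(1) e(1)]
  note g = integral_directional_derivative_C1[where R=R, OF dg cf(2) sf(2) e(2)]
  have alg: "((P' w (axis 1 1) + Q' w (axis 2 1)) * (z $ 1 - w $ 1)
      + (P' w (axis 2 1) - Q' w (axis 1 1)) * (z $ 2 - w $ 2)) / ((norm (z - w))\<^sup>2 + d\<^sup>2)
    = f' w (axis 1 1) + g' w (axis 2 1) + 2 * (P w * (d\<^sup>2 / ((norm (w - z))\<^sup>2 + d\<^sup>2)\<^sup>2))" for w
  proof -
    have "((P' w (axis 1 1) + Q' w (axis 2 1)) * (z $ 1 - w $ 1)
      + (P' w (axis 2 1) - Q' w (axis 1 1)) * (z $ 2 - w $ 2)) * k w
      = f' w (axis 1 1) + g' w (axis 2 1) + 2 * (P w * (d\<^sup>2 * (k w)\<^sup>2))"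
      unfolding f'_def g'_def axis_real2_nth using k1[of w] by algebra
    then show ?thesis unfolding kk' by (simp add: kk)
  qed
  have ip: "integrable lborel (\<lambda>w. P w * (d\<^sup>2 / ((norm (w - z))\<^sup>2 + d\<^sup>2)\<^sup>2))"
  proof -
    obtain B where B: "\<And>x. \<bar>P x\<bar> \<le> B"
    proof -
      have "compact (P ` cball 0 R)" using cP by (intro compact_continuous_image) (auto intro: continuous_on_subset)
      then obtain B where "\<forall>y\<in>P ` cball 0 R. norm y \<le> B"
        using compact_imp_bounded[of "P ` cball 0 R"] unfolding bounded_iff by blast
      then have B: "\<And>x. norm x \<le> R \<Longrightarrow> \<bar>P x\<bar> \<le> B" by simp
      then have "\<bar>P x\<bar> \<le> \<bar>B\<bar>" for x using supp(1)[of x] by (cases "norm x > R") (auto intro: order_trans[OF B])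
      then show thesis using that by blast
    qed
    have kb: "0 \<le> k w" "k w \<le> inverse (d\<^sup>2)" for w
      unfolding k_def using d by (auto intro!: le_imp_inverse_le)
    show ?thesis unfolding kk'
    proof (rule integrable_bounded_support[where R=R and B="B * (d\<^sup>2 * (inverse (d\<^sup>2))\<^sup>2)"])
      show "(\<lambda>w. P w * (d\<^sup>2 * (k w)\<^sup>2)) \<in> borel_measurable borel"
        using cP ck by (intro borel_measurable_continuous_onI continuous_intros)
      show "\<bar>P w * (d\<^sup>2 * (k w)\<^sup>2)\<bar> \<le> B * (d\<^sup>2 * (inverse (d\<^sup>2))\<^sup>2)" for w
        unfolding abs_mult using B[of w] kb[of w] by (intro mult_mono) (auto intro!: mult_left_mono power_mono)
    qed (use supp in auto)
  qed
  define q where "q w = P w * (d\<^sup>2 / ((norm (w - z))\<^sup>2 + d\<^sup>2)\<^sup>2)" for w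
  show ?thesis unfolding alg using f g ip unfolding q_def[symmetric] by simp
qed

text \<open>For a Lipschitz function the error of mollification is at most the Lipschitz constant times the
first moment of the mollifier.\<close>

lemma mollified_approximation:
  fixes P :: "real^2 \<Rightarrow> real" and z :: "real^2"
  assumes d: "d > 0" and lip: "\<And>x y. \<bar>P x - P y\<bar> \<le> L * norm (x - y)"
    and supp: "\<And>x. norm x > R \<Longrightarrow> P x = 0"
  shows "\<bar>(\<integral>w. P w * (d\<^sup>2 / ((norm (w - z))\<^sup>2 + d\<^sup>2)\<^sup>2) \<partial>lborel) - pi * P z\<bar> \<le> L * (2 * pi * d)"
proof -
  define m where "m y = d\<^sup>2 / ((norm y)\<^sup>2 + d\<^sup>2)\<^sup>2" for y :: "real^2"
  define m1 where "m1 y = d\<^sup>2 / (sqrt ((norm y)\<^sup>2 + d\<^sup>2))^3" for y :: "real^2"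
  have pos: "(norm y)\<^sup>2 + d\<^sup>2 > 0" for y :: "real^2" using d by (simp add: add_nonneg_pos)
  have [measurable]: "m \<in> borel_measurable borel" "m1 \<in> borel_measurable borel" unfolding m_def m1_def by measurable
  have mpos: "0 \<le> m y" "0 \<le> m1 y" for y unfolding m_def m1_def using pos[of y] by auto
  have im: "has_bochner_integral lborel m pi"
    by (rule has_bochner_integral_nn_integral) (use mpos nn_integral_mollifier[OF d] in \<open>auto simp: m_def\<close>)
  have im1: "has_bochner_integral lborel m1 (2 * pi * d)"
    by (rule has_bochner_integral_nn_integral) (use d mpos nn_integral_mollifier_moment[OF d] in \<open>auto simp: m1_def\<close>)
  have sh: "integrable lborel (\<lambda>w. m (w - z))" "(\<integral>w. m (w - z) \<partial>lborel) = pi"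
    "integrable lborel (\<lambda>w. m1 (w - z))" "(\<integral>w. m1 (w - z) \<partial>lborel) = 2 * pi * d"
    using integral_lborel_shift[of m "-z"] integral_lborel_shift[of m1 "-z"] im im1
    by (auto simp: has_bochner_integral_iff)
  have L: "0 \<le> L"
  proof -
    have "norm (axis 1 1 :: real^2) = 1" by (rule norm_Basis) (simp add: Basis_real2)
    then have "\<bar>P (axis 1 1) - P 0\<bar> \<le> L" using lip[of "axis 1 1" 0] by simp
    then show ?thesis using abs_ge_zero[of "P (axis 1 1) - P 0"] by linarith
  qed
  have key: "\<bar>(P w - P z) * m (w - z)\<bar> \<le> L * m1 (w - z)" for w
  proof -
    define s where "s = sqrt ((norm (w - z))\<^sup>2 + d\<^sup>2)"
    have s: "s > 0" "s\<^sup>2 = (norm (w - z))\<^sup>2 + d\<^sup>2" "norm (w - z) \<le> s"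
      using pos[of "w - z"] by (auto simp: s_def real_le_rsqrt)
    have "norm (w - z) * m (w - z) \<le> s * m (w - z)" using s mpos by (intro mult_right_mono) auto
    also have "\<dots> = m1 (w - z)" using s(1)
      unfolding m_def m1_def s_def[symmetric] s(2)[symmetric] by (simp add: power_numeral_reduce)
    finally have "L * (norm (w - z) * m (w - z)) \<le> L * m1 (w - z)" using L by (intro mult_left_mono)
    moreover have "\<bar>(P w - P z) * m (w - z)\<bar> \<le> L * norm (w - z) * m (w - z)"
      unfolding abs_mult using lip[of w z] mpos[of "w - z"] by (simp add: mult_right_mono)
    ultimately show ?thesis by (simp add: mult.assoc)
  qed
  have Pm: "P \<in> borel_measurable borel"
    by (intro borel_measurable_continuous_onI lipschitz_on_continuous_on[of L] lipschitz_onI)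
      (use lip L in \<open>auto simp: dist_norm\<close>)
  have iPz: "integrable lborel (\<lambda>w. (P w - P z) * m (w - z))"
    by (rule Bochner_Integration.integrable_bound[of _ "\<lambda>w. L * m1 (w - z)"])
      (use key sh Pm L mpos in \<open>auto intro: order_trans[OF key abs_ge_self]\<close>)
  have iP: "integrable lborel (\<lambda>w. P w * m (w - z))"
    using Bochner_Integration.integrable_add[OF iPz integrable_mult_right[OF sh(1), of "P z"]] by (simp add: algebra_simps)
  have "(\<integral>w. P w * m (w - z) \<partial>lborel) - pi * P z = (\<integral>w. (P w - P z) * m (w - z) \<partial>lborel)"
    using iP sh(1,2) by (simp add: left_diff_distrib)
  also have "\<bar>\<dots>\<bar> \<le> (\<integral>w. \<bar>(P w - P z) * m (w - z)\<bar> \<partial>lborel)" by (rule integral_abs_bound)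
  also have "\<dots> \<le> (\<integral>w. L * m1 (w - z) \<partial>lborel)"
    by (rule integral_mono) (use iPz sh key in auto)
  also have "\<dots> = L * (2 * pi * d)" using sh by simp
  finally show ?thesis unfolding m_def .
qed

text \<open>The common majorant of all kernels below. The cutoff to a disc that contains the supports makes it
integrable.\<close>

definition singular_kernel :: "real \<Rightarrow> real^2 \<Rightarrow> real^2 \<Rightarrow> real" where
  "singular_kernel R z w = indicator (cball 0 R) w / norm (z - w)"

lemma singular_kernel_measurable: "singular_kernel R z \<in> borel_measurable borel"
  unfolding singular_kernel_def[abs_def]
  by (intro borel_measurable_divide borel_measurable_indicator borel_measurable_continuous_onI continuous_intros) auto

lemma singular_kernel_nonneg: "0 \<le> singular_kernel R z w"
  by (simp add: singular_kernel_def)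

lemma nn_integral_singular_kernel_on_ball_le:
  assumes "norm z \<le> S" "0 \<le> R"
  shows "(\<integral>\<^sup>+ w. ennreal (singular_kernel R z w) \<partial>lborel) \<le> ennreal ((1 + (S + R)\<^sup>2) * pi\<^sup>2)"
proof -
  have S: "0 \<le> S" using assms norm_ge_zero order_trans by blast
  define f where "f y = 1 / (norm y * (1 + (norm y)\<^sup>2))" for y :: "real^2"
  have [measurable]: "f \<in> borel_measurable borel" unfolding f_def by measurable
  have "(\<integral>\<^sup>+ w. ennreal (singular_kernel R z w) \<partial>lborel) \<le> (\<integral>\<^sup>+ w. ennreal (1 + (S + R)\<^sup>2) * ennreal (f (- z + w)) \<partial>lborel)"
  proof (rule nn_integral_mono)
    fix w :: "real^2"
    have n: "norm (- z + w) = norm (z - w)" by (simp add: norm_minus_commute)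
    have "singular_kernel R z w \<le> (1 + (S + R)\<^sup>2) * f (- z + w)"
    proof (cases "norm w \<le> R \<and> z \<noteq> w")
      case True
      have "norm (z - w) \<le> S + R" using norm_triangle_ineq4[of z w] True assms by linarith
      then have "1 + (norm (z - w))\<^sup>2 \<le> 1 + (S + R)\<^sup>2" by (simp add: power_mono)
      then have "1 \<le> (1 + (S + R)\<^sup>2) / (1 + (norm (z - w))\<^sup>2)"
        by (subst le_divide_eq_1_pos) (auto simp: add_pos_nonneg)
      then have "1 / norm (z - w) \<le> (1 + (S + R)\<^sup>2) / (1 + (norm (z - w))\<^sup>2) / norm (z - w)"
        by (rule divide_right_mono) simp
      then show ?thesis using True unfolding singular_kernel_def f_def n by (simp add: mult.commute)
    qed (auto simp: singular_kernel_def f_def)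
    then have "ennreal (singular_kernel R z w) \<le> ennreal ((1 + (S + R)\<^sup>2) * f (- z + w))" by (rule ennreal_leI)
    then show "ennreal (singular_kernel R z w) \<le> ennreal (1 + (S + R)\<^sup>2) * ennreal (f (- z + w))"
      by (subst ennreal_mult[symmetric]) (auto simp: f_def)
  qed
  also have "\<dots> = ennreal (1 + (S + R)\<^sup>2) * (\<integral>\<^sup>+ w. ennreal (f (- z + w)) \<partial>lborel)"
    by (rule nn_integral_cmult) measurable
  also have "(\<integral>\<^sup>+ w. ennreal (f (- z + w)) \<partial>lborel) = (\<integral>\<^sup>+ w. ennreal (f w) \<partial>distr lborel borel ((+) (- z)))"
    by (rule nn_integral_distr[symmetric]) auto
  also have "\<dots> = ennreal (pi\<^sup>2)"
    unfolding lborel_distr_plus f_def by (rule nn_integral_singular_kernel)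
  also have "ennreal (1 + (S + R)\<^sup>2) * ennreal (pi\<^sup>2) = ennreal ((1 + (S + R)\<^sup>2) * pi\<^sup>2)"
    by (rule ennreal_mult[symmetric]) auto
  finally show ?thesis .
qed

lemma integrable_singular_kernel_on_ball:
  assumes "0 \<le> R"
  shows "integrable lborel (singular_kernel R z)"
proof (rule integrableI_nonneg)
  show "singular_kernel R z \<in> borel_measurable lborel" using singular_kernel_measurable by simp
  show "(\<integral>\<^sup>+ w. ennreal (singular_kernel R z w) \<partial>lborel) < \<infinity>"
    using nn_integral_singular_kernel_on_ball_le[OF order_refl assms, of z] by (rule le_less_trans) simp
qed (auto simp: singular_kernel_nonneg)

lemma kernel_combination_le:
  fixes a b k1 k2 r B :: real
  assumes "\<bar>a\<bar> \<le> B" "\<bar>b\<bar> \<le> B" "\<bar>k1\<bar> \<le> r" "\<bar>k2\<bar> \<le> r" "r > 0" "X \<ge> r\<^sup>2"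
  shows "\<bar>(a * k1 + b * k2) / X\<bar> \<le> 2 * B / r"
proof -
  have B: "0 \<le> B" using assms by linarith
  have X: "X > 0" using assms by (meson less_le_trans zero_less_power)
  have "\<bar>a * k1 + b * k2\<bar> \<le> B * r + B * r"
  proof -
    have "\<bar>a\<bar> * \<bar>k1\<bar> \<le> B * r" "\<bar>b\<bar> * \<bar>k2\<bar> \<le> B * r" using assms B by (intro mult_mono; simp)+
    then show ?thesis using abs_triangle_ineq[of "a * k1" "b * k2"] unfolding abs_mult by linarith
  qed
  then have "\<bar>(a * k1 + b * k2) / X\<bar> \<le> (2 * B * r) / X"
    using X unfolding abs_divide by (simp add: divide_right_mono)
  also have "\<dots> \<le> (2 * B * r) / r\<^sup>2"
    using assms B X by (intro divide_left_mono) auto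
  also have "\<dots> = 2 * B / r" using assms by (simp add: power2_eq_square)
  finally show ?thesis .
qed

text \<open>The real part of the Cauchy-Pompeiu formula for \<open>f = P - i Q\<close>. It is the limit
\<open>d \<rightarrow> 0\<close> of the regularised identity: the kernels are dominated by the integrable kernel \<open>1 / |z - w|\<close>, and
the mollified values of \<open>P\<close> converge.\<close>

lemma Cauchy_Pompeiu_real:
  fixes P Q :: "real^2 \<Rightarrow> real" and z :: "real^2"
  assumes R: "0 \<le> R"
    and P: "\<And>x. (P has_derivative P' x) (at x)" "\<And>b. b \<in> Basis \<Longrightarrow> continuous_on UNIV (\<lambda>x. P' x b)"
    and Q: "\<And>x. (Q has_derivative Q' x) (at x)" "\<And>b. b \<in> Basis \<Longrightarrow> continuous_on UNIV (\<lambda>x. Q' x b)"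
    and supp: "\<And>x. norm x > R \<Longrightarrow> P x = 0" "\<And>x. norm x > R \<Longrightarrow> Q x = 0"
  defines "F \<equiv> \<lambda>w. ((P' w (axis 1 1) + Q' w (axis 2 1)) * (z $ 1 - w $ 1)
            + (P' w (axis 2 1) - Q' w (axis 1 1)) * (z $ 2 - w $ 2)) / (norm (z - w))\<^sup>2"
  shows "integrable lborel F" "(\<integral>w. F w \<partial>lborel) = 2 * pi * P z"
proof -
  obtain BP where BP: "\<And>x b. b \<in> Basis \<Longrightarrow> \<bar>P' x b\<bar> \<le> BP" "\<And>x. norm x > R \<Longrightarrow> P' x = (\<lambda>h. 0)"
    using C1_bounded_support_derivative[OF P supp(1)] by blast
  obtain BQ where BQ: "\<And>x b. b \<in> Basis \<Longrightarrow> \<bar>Q' x b\<bar> \<le> BQ" "\<And>x. norm x > R \<Longrightarrow> Q' x = (\<lambda>h. 0)"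
    using C1_bounded_support_derivative[OF Q supp(2)] by blast
  obtain L where L: "\<And>x y. \<bar>P x - P y\<bar> \<le> L * norm (x - y)"
    using Lipschitz_of_C1_bounded_support[OF P supp(1)] by blast
  have e: "axis 1 1 \<in> (Basis::(real^2) set)" "axis 2 1 \<in> (Basis::(real^2) set)" by (auto simp: Basis_real2)
  define B where "B = BP + BQ"
  define a where "a w = P' w (axis 1 1) + Q' w (axis 2 1)" for w
  define b where "b w = P' w (axis 2 1) - Q' w (axis 1 1)" for w
  have ab: "\<bar>a w\<bar> \<le> B" "\<bar>b w\<bar> \<le> B" "norm w > R \<Longrightarrow> a w = 0" "norm w > R \<Longrightarrow> b w = 0" for w
    unfolding a_def b_def B_def using BP(1)[OF e(1), of w] BP(1)[OF e(2), of w] BQ(1)[OF e(1), of w] BQ(1)[OF e(2), of w]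
      BP(2)[of w] BQ(2)[of w] by auto
  have [measurable]: "a \<in> borel_measurable borel" "b \<in> borel_measurable borel"
    unfolding a_def b_def using P(2)[OF e(1)] P(2)[OF e(2)] Q(2)[OF e(1)] Q(2)[OF e(2)]
    by (auto intro!: borel_measurable_continuous_onI continuous_intros)
  define d where "d n = 1 / real (Suc n)" for n
  have d: "d n > 0" for n by (simp add: d_def)
  have dlim: "d \<longlonglongrightarrow> 0" unfolding d_def by (rule LIMSEQ_Suc[OF lim_const_over_n])
  define Fn where "Fn n w = (a w * (z $ 1 - w $ 1) + b w * (z $ 2 - w $ 2)) / ((norm (z - w))\<^sup>2 + (d n)\<^sup>2)" for n w
  have Fdef: "F w = (a w * (z $ 1 - w $ 1) + b w * (z $ 2 - w $ 2)) / (norm (z - w))\<^sup>2" for w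
    unfolding F_def a_def b_def ..
  have nth: "\<bar>z $ i - w $ i\<bar> \<le> norm (z - w)" for w i
    using component_le_norm_cart[of "z - w" i] by simp
  have Fm: "F \<in> borel_measurable lborel" "Fn n \<in> borel_measurable lborel" for n
    unfolding Fdef[abs_def] Fn_def by measurable
  have "AE w in lborel. w \<noteq> z" by (rule AE_lborel_singleton)
  then have conv: "AE w in lborel. (\<lambda>n. Fn n w) \<longlonglongrightarrow> F w"
  proof eventually_elim
    case (elim w)
    then have "norm (z - w) \<noteq> 0" by simp
    then have "(\<lambda>n. Fn n w) \<longlonglongrightarrow> (a w * (z $ 1 - w $ 1) + b w * (z $ 2 - w $ 2)) / ((norm (z - w))\<^sup>2 + 0\<^sup>2)"
      unfolding Fn_def by (intro tendsto_intros dlim) auto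
    then show ?case by (simp add: Fdef)
  qed
  have bound: "AE w in lborel. norm (Fn n w) \<le> 2 * B * singular_kernel R z w" for n
    using AE_lborel_singleton[of z]
  proof eventually_elim
    case (elim w)
    show ?case
    proof (cases "norm w > R")
      case True then show ?thesis by (simp add: Fn_def ab singular_kernel_def)
    next
      case False
      have "\<bar>Fn n w\<bar> \<le> 2 * B / norm (z - w)"
        unfolding Fn_def by (rule kernel_combination_le) (use ab nth elim in auto)
      then show ?thesis using False by (simp add: singular_kernel_def)
    qed
  qed
  have i: "integrable lborel (\<lambda>w. 2 * B * singular_kernel R z w)" using integrable_singular_kernel_on_ball[OF R] by simp
  show "integrable lborel F"
    by (rule integrable_dominated_convergence[OF Fm i conv bound])
  have lim: "(\<lambda>n. \<integral>w. Fn n w \<partial>lborel) \<longlonglongrightarrow> (\<integral>w. F w \<partial>lborel)"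
    by (rule integral_dominated_convergence[OF Fm i conv bound])
  define I where "I n = (\<integral>w. P w * ((d n)\<^sup>2 / ((norm (w - z))\<^sup>2 + (d n)\<^sup>2)\<^sup>2) \<partial>lborel)" for n
  have "(\<integral>w. Fn n w \<partial>lborel) = 2 * I n" for n
    using integral_regularised_Cauchy_kernel[OF d P Q supp] unfolding Fn_def a_def b_def I_def by simp
  moreover have "I \<longlonglongrightarrow> pi * P z"
  proof (rule LIM_zero_cancel, rule Lim_null_comparison)
    have "\<bar>I n - pi * P z\<bar> \<le> L * (2 * pi * d n)" for n
      unfolding I_def by (rule mollified_approximation[OF d L supp(1)])
    then show "\<forall>\<^sub>F n in sequentially. norm (I n - pi * P z) \<le> L * (2 * pi * d n)" by simp
    have "(\<lambda>n. L * (2 * pi * d n)) \<longlonglongrightarrow> L * (2 * pi * 0)" by (intro tendsto_intros dlim)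
    then show "(\<lambda>n. L * (2 * pi * d n)) \<longlonglongrightarrow> 0" by simp
  qed
  ultimately have "(\<lambda>n. \<integral>w. Fn n w \<partial>lborel) \<longlonglongrightarrow> 2 * (pi * P z)" by (simp add: tendsto_mult_left)
  then show "(\<integral>w. F w \<partial>lborel) = 2 * pi * P z" using LIMSEQ_unique[OF lim] by simp
qed

section \<open>Green's formula with winding numbers\<close>

text \<open>Insert the Cauchy-Pompeiu formulas for \<open>P\<close> and \<open>- Q\<close> at the point \<open>c t\<close> into the line integral and
exchange the integrals. For fixed \<open>w\<close> the inner integral over \<open>t\<close> then contains the imaginary and the
real part of \<open>c' / (c - w)\<close>. The imaginary part integrates to \<open>2 \<pi>\<close> times the winding number \<open>s w\<close>, and
the real part, the derivative of \<open>ln |c - w|\<close>, integrates to 0 along a closed curve.\<close>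

lemma green_winding_form:
  fixes P Q :: "real^2 \<Rightarrow> real" and c c' :: "real \<Rightarrow> real^2" and s :: "real^2 \<Rightarrow> real"
  assumes c: "\<And>t. (c has_vector_derivative c' t) (at t)" and c': "continuous_on UNIV c'"
    and P: "\<And>x. (P has_derivative P' x) (at x)" "\<And>b. b \<in> Basis \<Longrightarrow> continuous_on UNIV (\<lambda>x. P' x b)"
    and Q: "\<And>x. (Q has_derivative Q' x) (at x)" "\<And>b. b \<in> Basis \<Longrightarrow> continuous_on UNIV (\<lambda>x. Q' x b)"
    and supp: "\<And>x. norm x > R \<Longrightarrow> P x = 0" "\<And>x. norm x > R \<Longrightarrow> Q x = 0"
    and wind: "\<And>w. w \<notin> c ` {0..1} \<Longrightarrow>
      ((\<lambda>t. (c' t $ 2 * (c t $ 1 - w $ 1) - c' t $ 1 * (c t $ 2 - w $ 2)) / (norm (c t - w))\<^sup>2) has_integral 2 * pi * s w) {0..1}"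
    and wind0: "\<And>w. w \<notin> c ` {0..1} \<Longrightarrow>
      ((\<lambda>t. (c' t $ 1 * (c t $ 1 - w $ 1) + c' t $ 2 * (c t $ 2 - w $ 2)) / (norm (c t - w))\<^sup>2) has_integral 0) {0..1}"
    and null: "c ` {0..1} \<in> null_sets lborel"
    and s: "s \<in> borel_measurable borel"
  shows "integral {0..1} (\<lambda>t. P (c t) * c' t $ 2 - Q (c t) * c' t $ 1)
    = (\<integral>w. (P' w (axis 1 1) + Q' w (axis 2 1)) * s w \<partial>lborel)"
proof -
  define R' where "R' = \<bar>R\<bar>"
  have R: "0 \<le> R'" by (simp add: R'_def)
  have supp: "\<And>x. norm x > R' \<Longrightarrow> P x = 0" "\<And>x. norm x > R' \<Longrightarrow> Q x = 0" using supp by (auto simp: R'_def)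
  obtain BP where BP: "\<And>x b. b \<in> Basis \<Longrightarrow> \<bar>P' x b\<bar> \<le> BP" "\<And>x. norm x > R' \<Longrightarrow> P' x = (\<lambda>h. 0)"
    using C1_bounded_support_derivative[OF P supp(1)] by blast
  obtain BQ where BQ: "\<And>x b. b \<in> Basis \<Longrightarrow> \<bar>Q' x b\<bar> \<le> BQ" "\<And>x. norm x > R' \<Longrightarrow> Q' x = (\<lambda>h. 0)"
    using C1_bounded_support_derivative[OF Q supp(2)] by blast
  have e: "axis 1 1 \<in> (Basis::(real^2) set)" "axis 2 1 \<in> (Basis::(real^2) set)" by (auto simp: Basis_real2)
  define B where "B = BP + BQ"
  define a where "a w = P' w (axis 1 1) + Q' w (axis 2 1)" for w
  define b where "b w = P' w (axis 2 1) - Q' w (axis 1 1)" for w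
  have ab: "\<bar>a w\<bar> \<le> B" "\<bar>b w\<bar> \<le> B" "norm w > R' \<Longrightarrow> a w = 0" "norm w > R' \<Longrightarrow> b w = 0" for w
    unfolding a_def b_def B_def using BP(1)[OF e(1), of w] BP(1)[OF e(2), of w] BQ(1)[OF e(1), of w] BQ(1)[OF e(2), of w]
      BP(2)[of w] BQ(2)[of w] by auto
  have B0: "0 \<le> B" using ab(1)[of 0] by linarith
  have [measurable]: "a \<in> borel_measurable borel" "b \<in> borel_measurable borel"
    unfolding a_def b_def using P(2)[OF e(1)] P(2)[OF e(2)] Q(2)[OF e(1)] Q(2)[OF e(2)]
    by (auto intro!: borel_measurable_continuous_onI continuous_intros)
  have cc: "continuous_on UNIV c" using c
    by (intro continuous_at_imp_continuous_on ballI) (metis has_vector_derivative_continuous)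
  have [measurable]: "c \<in> borel_measurable borel" "c' \<in> borel_measurable borel"
    using cc c' by (auto intro: borel_measurable_continuous_onI)
  obtain S where S: "\<And>t. t \<in> {0..1} \<Longrightarrow> norm (c t) \<le> S"
  proof -
    have "compact (c ` {0..1})" using cc by (intro compact_continuous_image) (auto intro: continuous_on_subset)
    then have "bounded (c ` {0..1})" by (rule compact_imp_bounded)
    then obtain S where "\<forall>y\<in>c ` {0..1}. norm y \<le> S" unfolding bounded_iff by blast
    then show thesis by (intro that[of S]) auto
  qed
  obtain C where C: "\<And>t. t \<in> {0..1} \<Longrightarrow> norm (c' t) \<le> C"
  proof -
    have "compact (c' ` {0..1})" using c' by (intro compact_continuous_image) (auto intro: continuous_on_subset)
    then have "bounded (c' ` {0..1})" by (rule compact_imp_bounded)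
    then obtain S where "\<forall>y\<in>c' ` {0..1}. norm y \<le> S" unfolding bounded_iff by blast
    then show thesis by (intro that[of S]) auto
  qed
  have C0: "0 \<le> C" using order_trans[OF norm_ge_zero C[of 0]] by simp
  \<comment> \<open>The imaginary and the real part of \<open>c' / (c - w)\<close>.\<close>
  define X where "X t w = (c' t $ 2 * (c t $ 1 - w $ 1) - c' t $ 1 * (c t $ 2 - w $ 2)) / (norm (c t - w))\<^sup>2" for t w
  define Y where "Y t w = (c' t $ 1 * (c t $ 1 - w $ 1) + c' t $ 2 * (c t $ 2 - w $ 2)) / (norm (c t - w))\<^sup>2" for t w
  define \<Phi> where "\<Phi> t w = indicator {0..1} t * (a w * X t w + b w * Y t w)" for t :: real and w
  have [measurable]: "(\<lambda>x::real^2. x $ i) \<in> borel_measurable borel" for i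
    by (intro borel_measurable_continuous_onI continuous_intros)
  have \<Phi>m: "case_prod \<Phi> \<in> borel_measurable (lborel \<Otimes>\<^sub>M lborel)"
    unfolding \<Phi>_def X_def Y_def by measurable
  have \<Phi>b: "\<bar>\<Phi> t w\<bar> \<le> 4 * B * C * (indicator {0..1} t * singular_kernel R' (c t) w)" for t w
  proof (cases "t \<in> {0..1} \<and> norm w \<le> R' \<and> c t \<noteq> w")
    case True
    have nth: "\<bar>c t $ i - w $ i\<bar> \<le> norm (c t - w)" for i
      using component_le_norm_cart[of "c t - w" i] by simp
    have nth': "\<bar>c' t $ i\<bar> \<le> C" for i
      using component_le_norm_cart[of "c' t" i] C True by (meson order_trans)
    have "\<bar>X t w\<bar> \<le> 2 * C / norm (c t - w)"
      using kernel_combination_le[of "c' t $ 2" C "- c' t $ 1" "c t $ 1 - w $ 1" "norm (c t - w)" "c t $ 2 - w $ 2" "(norm (c t - w))\<^sup>2"] nth nth' True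
      by (auto simp: X_def)
    moreover have "\<bar>Y t w\<bar> \<le> 2 * C / norm (c t - w)"
      unfolding Y_def by (rule kernel_combination_le) (use nth nth' True in auto)
    ultimately have "\<bar>a w\<bar> * \<bar>X t w\<bar> + \<bar>b w\<bar> * \<bar>Y t w\<bar> \<le> B * (2 * C / norm (c t - w)) + B * (2 * C / norm (c t - w))"
      using ab(1,2)[of w] B0 by (intro add_mono mult_mono) auto
    then have "\<bar>a w * X t w + b w * Y t w\<bar> \<le> 4 * B * C / norm (c t - w)"
      using abs_triangle_ineq[of "a w * X t w" "b w * Y t w"] by (simp add: abs_mult)
    then show ?thesis using True by (simp add: \<Phi>_def singular_kernel_def)
  next
    case False
    then consider "t \<notin> {0..1}" | "norm w > R'" | "c t = w" by fastforce
    then show ?thesis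
      using B0 C0 by cases (auto simp: \<Phi>_def singular_kernel_def ab X_def Y_def)
  qed
  have \<Phi>i: "integrable (lborel \<Otimes>\<^sub>M lborel) (case_prod \<Phi>)"
  proof (rule integrableI_bounded[OF \<Phi>m])
    have "(\<integral>\<^sup>+ p. ennreal (norm (case_prod \<Phi> p)) \<partial>(lborel \<Otimes>\<^sub>M lborel))
       = (\<integral>\<^sup>+ t. (\<integral>\<^sup>+ w. ennreal (norm (case_prod \<Phi> (t, w))) \<partial>lborel) \<partial>lborel)"
      by (rule lborel.nn_integral_fst[symmetric]) (use \<Phi>m in measurable)
    also have "\<dots> \<le> (\<integral>\<^sup>+ t. ennreal (4 * B * C) * (ennreal ((1 + (S + R')\<^sup>2) * pi\<^sup>2)) * indicator {0..1} (t::real) \<partial>lborel)"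
    proof (rule nn_integral_mono)
      fix t :: real
      show "(\<integral>\<^sup>+ w. ennreal (norm (case_prod \<Phi> (t, w))) \<partial>lborel)
        \<le> ennreal (4 * B * C) * (ennreal ((1 + (S + R')\<^sup>2) * pi\<^sup>2)) * indicator {0..1} t"
      proof (cases "t \<in> {0..1}")
        case True
        have "(\<integral>\<^sup>+ w. ennreal (norm (case_prod \<Phi> (t, w))) \<partial>lborel)
          \<le> (\<integral>\<^sup>+ w. ennreal (4 * B * C) * ennreal (singular_kernel R' (c t) w) \<partial>lborel)"
        proof (rule nn_integral_mono)
          fix w
          have "ennreal (norm (case_prod \<Phi> (t, w))) \<le> ennreal (4 * B * C * singular_kernel R' (c t) w)"
            using \<Phi>b[of t w] True by (intro ennreal_leI) simp
          then show "ennreal (norm (case_prod \<Phi> (t, w))) \<le> ennreal (4 * B * C) * ennreal (singular_kernel R' (c t) w)"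
            using B0 C0 singular_kernel_nonneg by (simp add: ennreal_mult)
        qed
        also have "\<dots> = ennreal (4 * B * C) * (\<integral>\<^sup>+ w. ennreal (singular_kernel R' (c t) w) \<partial>lborel)"
          by (rule nn_integral_cmult) (use singular_kernel_measurable in measurable)
        also have "\<dots> \<le> ennreal (4 * B * C) * ennreal ((1 + (S + R')\<^sup>2) * pi\<^sup>2)"
          by (intro mult_left_mono nn_integral_singular_kernel_on_ball_le S True R) auto
        finally show ?thesis using True by simp
      next
        case False then show ?thesis by (simp add: \<Phi>_def)
      qed
    qed
    also have "\<dots> < \<infinity>"
      by (subst nn_integral_cmult_indicator) (auto simp: ennreal_mult_less_top)
    finally show "(\<integral>\<^sup>+ p. ennreal (norm (case_prod \<Phi> p)) \<partial>(lborel \<Otimes>\<^sub>M lborel)) < \<infinity>" .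
  qed
  have inner1: "(\<integral>w. \<Phi> t w \<partial>lborel) = 2 * pi * (indicator {0..1} t * (P (c t) * c' t $ 2 - Q (c t) * c' t $ 1))" for t
  proof -
    define F1 where "F1 w = (a w * (c t $ 1 - w $ 1) + b w * (c t $ 2 - w $ 2)) / (norm (c t - w))\<^sup>2" for w
    define F2 where "F2 w = (b w * (c t $ 1 - w $ 1) - a w * (c t $ 2 - w $ 2)) / (norm (c t - w))\<^sup>2" for w
    have 1: "integrable lborel F1" "(\<integral>w. F1 w \<partial>lborel) = 2 * pi * P (c t)"
      using Cauchy_Pompeiu_real[OF R P Q supp, of "c t"] unfolding F1_def a_def b_def by auto
    have nQ: "((\<lambda>x. - Q x) has_derivative (\<lambda>h. - Q' x h)) (at x)" for x
      by (rule has_derivative_minus[OF Q(1)])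
    have "integrable lborel F2 \<and> (\<integral>w. F2 w \<partial>lborel) = 2 * pi * - Q (c t)"
      using Cauchy_Pompeiu_real[OF R nQ _ P, of "c t"] Q(2) supp unfolding F2_def a_def b_def
      by (simp add: continuous_on_minus algebra_simps)
    then have 2: "integrable lborel F2" "(\<integral>w. F2 w \<partial>lborel) = - (2 * pi * Q (c t))" by auto
    have "\<Phi> t w = indicator {0..1} t * (c' t $ 2 * F1 w + c' t $ 1 * F2 w)" for w
      unfolding \<Phi>_def X_def Y_def F1_def F2_def
      by (simp add: add_divide_distrib[symmetric] diff_divide_distrib[symmetric]) (simp add: algebra_simps)
    then show ?thesis using 1 2 by (simp add: algebra_simps)
  qed
  have inner2: "AE w in lborel. (\<integral>t. \<Phi> t w \<partial>lborel) = 2 * pi * (a w * s w)"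
    using AE_not_in[OF null]
  proof eventually_elim
    case (elim w)
    have nz: "norm (c t - w) \<noteq> 0" if "t \<in> {0..1}" for t using elim that by auto
    have cX: "continuous_on {0..1} (\<lambda>t. X t w)" "continuous_on {0..1} (\<lambda>t. Y t w)"
      unfolding X_def Y_def using nz
      by (intro continuous_intros continuous_on_subset[OF cc] continuous_on_subset[OF c'] ballI; simp)+
    have X: "integrable lborel (\<lambda>t. indicator {0..1} t * X t w)" "(\<integral>t. indicator {0..1} t * X t w \<partial>lborel) = 2 * pi * s w"
      using borel_integrable_atLeastAtMost'[OF cX(1)] set_borel_integral_eq_integral(2)[OF borel_integrable_atLeastAtMost'[OF cX(1)]]
        wind[OF elim, folded X_def] by (auto simp: set_integrable_def set_lebesgue_integral_def integral_unique)
    have Y: "integrable lborel (\<lambda>t. indicator {0..1} t * Y t w)" "(\<integral>t. indicator {0..1} t * Y t w \<partial>lborel) = 0"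
      using borel_integrable_atLeastAtMost'[OF cX(2)] set_borel_integral_eq_integral(2)[OF borel_integrable_atLeastAtMost'[OF cX(2)]]
        wind0[OF elim, folded Y_def] by (auto simp: set_integrable_def set_lebesgue_integral_def integral_unique)
    have "\<Phi> t w = a w * (indicator {0..1} t * X t w) + b w * (indicator {0..1} t * Y t w)" for t
      unfolding \<Phi>_def by (simp add: algebra_simps)
    then show ?case using X Y by simp
  qed
  have cont: "continuous_on {0..1} (\<lambda>t. P (c t) * c' t $ 2 - Q (c t) * c' t $ 1)"
  proof -
    have "continuous_on UNIV P" "continuous_on UNIV Q" using P(1) Q(1)
      by (intro continuous_at_imp_continuous_on ballI, metis has_derivative_continuous)+
    then have "continuous_on {0..1} (\<lambda>t. P (c t))" "continuous_on {0..1} (\<lambda>t. Q (c t))"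
      by (auto intro!: continuous_on_compose2[of UNIV P] continuous_on_compose2[of UNIV Q] continuous_on_subset[OF cc])
    then show ?thesis by (intro continuous_intros continuous_on_subset[OF c']) auto
  qed
  have "2 * pi * integral {0..1} (\<lambda>t. P (c t) * c' t $ 2 - Q (c t) * c' t $ 1)
    = (\<integral>t. (\<integral>w. \<Phi> t w \<partial>lborel) \<partial>lborel)"
    unfolding inner1 using set_borel_integral_eq_integral(2)[OF borel_integrable_atLeastAtMost'[OF cont]]
    by (simp add: set_lebesgue_integral_def)
  also have "\<dots> = (\<integral>w. (\<integral>t. \<Phi> t w \<partial>lborel) \<partial>lborel)"
    by (rule lborel_pair.Fubini_integral[symmetric]) (use \<Phi>i in simp)
  also have "\<dots> = (\<integral>w. 2 * pi * (a w * s w) \<partial>lborel)"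
  proof (rule integral_cong_AE[OF _ _ inner2])
    show "(\<lambda>w. \<integral>t. \<Phi> t w \<partial>lborel) \<in> borel_measurable lborel"
      by (rule lborel.borel_measurable_lebesgue_integral) (use \<Phi>m in measurable)
  qed (use s in measurable)
  also have "\<dots> = 2 * pi * (\<integral>w. a w * s w \<partial>lborel)" by simp
  finally show ?thesis unfolding a_def by simp
qed

section \<open>The jump of the winding number across a curve\<close>

text \<open>For \<open>W = 1\<close> and \<open>Z = \<tau>\<close> the quotient is the Poisson kernel \<open>s / (\<tau>\<^sup>2 + s\<^sup>2)\<close>. The constant 1/12 is small enough
for half of the kernel to survive the perturbation: with \<open>X = \<tau>\<^sup>2 + s\<^sup>2\<close> the denominator changes by at
most \<open>X / 4\<close>, so \<open>W / E\<close> differs from \<open>1 / X\<close> by at most \<open>(1/12 + 1/4) / (3/4) = 4/9\<close> of \<open>1 / X\<close>.\<close>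

lemma perturbed_Poisson_kernel_bound:
  fixes W Z :: complex and \<tau> s :: real
  assumes W: "norm (W - 1) \<le> 1/12" and Z: "norm (Z - of_real \<tau>) \<le> \<bar>\<tau>\<bar> / 12" and s: "s > 0"
  shows "Z\<^sup>2 + of_real (s\<^sup>2) \<noteq> 0" and "Re (of_real s * W / (Z\<^sup>2 + of_real (s\<^sup>2))) \<ge> (1/2) * (s / (\<tau>\<^sup>2 + s\<^sup>2))"
proof -
  define X where "X = \<tau>\<^sup>2 + s\<^sup>2"
  define E where "E = Z\<^sup>2 + of_real (s\<^sup>2)"
  have X: "X > 0" using s by (simp add: X_def add_nonneg_pos)
  have "Z + of_real \<tau> = (Z - of_real \<tau>) + of_real (2 * \<tau>)" by simp
  then have "norm (Z + of_real \<tau>) \<le> norm (Z - of_real \<tau>) + norm (of_real (2 * \<tau>) :: complex)"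
    by (metis norm_triangle_ineq)
  then have "norm (Z + of_real \<tau>) \<le> norm (Z - of_real \<tau>) + 2 * \<bar>\<tau>\<bar>" unfolding norm_of_real abs_mult by simp
  then have "norm (Z + of_real \<tau>) \<le> 3 * \<bar>\<tau>\<bar>" using Z by linarith
  then have "norm (Z - of_real \<tau>) * norm (Z + of_real \<tau>) \<le> (\<bar>\<tau>\<bar> / 12) * (3 * \<bar>\<tau>\<bar>)"
    using Z by (intro mult_mono) auto
  moreover have "(Z - of_real \<tau>) * (Z + of_real \<tau>) = E - of_real X"
    unfolding E_def X_def by (simp add: power2_eq_square algebra_simps)
  moreover have "(\<bar>\<tau>\<bar> / 12) * (3 * \<bar>\<tau>\<bar>) = \<tau>\<^sup>2 / 4" by (simp add: power2_eq_square)
  ultimately have "norm (E - of_real X) \<le> \<tau>\<^sup>2 / 4" by (metis norm_mult)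
  then have E1: "norm (E - of_real X) \<le> X / 4" unfolding X_def by (smt (verit) zero_le_power2 divide_right_mono)
  have nE: "norm E \<ge> 3/4 * X"
    using norm_triangle_ineq2[of "of_real X" "of_real X - E"] E1 X by (simp add: norm_minus_commute)
  then show E0: "Z\<^sup>2 + of_real (s\<^sup>2) \<noteq> 0" using X unfolding E_def[symmetric] by auto
  then have E0: "E \<noteq> 0" by (simp add: E_def)
  have "W / E - 1 / of_real X = ((W - 1) * of_real X - (E - of_real X)) / (E * of_real X)"
    using E0 X by (simp add: field_simps)
  then have "norm (W / E - 1 / of_real X) = norm ((W - 1) * of_real X - (E - of_real X)) / (norm E * X)"
    using X by (simp add: norm_divide norm_mult)
  also have "\<dots> \<le> (X / 12 + X / 4) / (norm E * X)"
  proof (rule divide_right_mono)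
    have "norm ((W - 1) * of_real X) \<le> X / 12" using W X by (simp add: norm_mult)
    then show "norm ((W - 1) * of_real X - (E - of_real X)) \<le> X / 12 + X / 4"
      using norm_triangle_ineq4[of "(W - 1) * of_real X" "E - of_real X"] E1 by linarith
  qed (use X in auto)
  also have "\<dots> \<le> (X / 12 + X / 4) / (3/4 * X * X)"
  proof -
    have "norm E > 0" using E0 by simp
    then show ?thesis using nE X by (intro divide_left_mono mult_right_mono) auto
  qed
  also have "\<dots> \<le> (1/2) / X" using X by (simp add: field_simps)
  finally have "\<bar>Re (W / E - 1 / of_real X)\<bar> \<le> (1/2) / X"
    using abs_Re_le_cmod order_trans by blast
  moreover have "Re (1 / of_real X :: complex) = 1 / X" by (metis Re_complex_of_real of_real_1 of_real_divide)
  moreover have "1 / X = (1/2) / X + (1/2) / X" by (simp add: add_divide_distrib[symmetric])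
  ultimately have "Re (W / E) \<ge> (1/2) / X" unfolding minus_complex.simps by linarith
  then have "s * Re (W / E) \<ge> s * ((1/2) / X)" using s by (intro mult_left_mono) auto
  moreover have "Re (of_real s * W / E) = s * Re (W / E)"
  proof -
    have "of_real s * W / E = s *\<^sub>R (W / E)" by (simp add: scaleR_conv_of_real)
    then show ?thesis by simp
  qed
  ultimately show "Re (of_real s * W / (Z\<^sup>2 + of_real (s\<^sup>2))) \<ge> (1/2) * (s / (\<tau>\<^sup>2 + s\<^sup>2))"
    unfolding E_def X_def by simp
qed

text \<open>The winding number is larger on the left of the curve than on its right. With \<open>Z = (\<gamma> - \<gamma> t\<^sub>0) / \<gamma>' t\<^sub>0\<close> and
\<open>W = \<gamma>' / \<gamma>' t\<^sub>0\<close>, the difference of the winding numbers around \<open>\<gamma> t\<^sub>0 \<plusminus> s i \<gamma>' t\<^sub>0\<close> is \<open>1 / \<pi>\<close> times the integral of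
\<open>Re (s W / (Z\<^sup>2 + s\<^sup>2))\<close>. Near \<open>t\<^sub>0\<close> the integrand is at least half of the Poisson kernel, whose integral
does not vanish as \<open>s \<rightarrow> 0\<close>; elsewhere it is \<open>O(s)\<close> because the curve does not return to \<open>\<gamma> t\<^sub>0\<close>.\<close>

lemma winding_number_jump:
  fixes \<gamma> \<gamma>' :: "real \<Rightarrow> complex"
  assumes vp: "valid_path \<gamma>"
    and der: "\<And>t. t \<in> {0..1} \<Longrightarrow> (\<gamma> has_vector_derivative \<gamma>' t) (at t)"
    and cont: "continuous_on {0..1} \<gamma>'"
    and t0: "0 < t0" "t0 < 1" and nz: "\<gamma>' t0 \<noteq> 0"
    and inj: "\<And>t. t \<in> {0..1} \<Longrightarrow> t \<noteq> t0 \<Longrightarrow> \<gamma> t \<noteq> \<gamma> t0"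
  shows "\<forall>\<^sub>F s in at_right 0. \<gamma> t0 + of_real s * (\<i> * \<gamma>' t0) \<notin> path_image \<gamma> \<and>
      \<gamma> t0 - of_real s * (\<i> * \<gamma>' t0) \<notin> path_image \<gamma> \<and>
      Re (winding_number \<gamma> (\<gamma> t0 + of_real s * (\<i> * \<gamma>' t0)))
        > Re (winding_number \<gamma> (\<gamma> t0 - of_real s * (\<i> * \<gamma>' t0)))"
proof -
  define v where "v = \<gamma>' t0"
  define z0 where "z0 = \<gamma> t0"
  define Z where "Z t = (\<gamma> t - z0) / v" for t
  define W where "W t = \<gamma>' t / v" for t
  have v: "v \<noteq> 0" using nz by (simp add: v_def)
  have c\<gamma>: "continuous_on {0..1} \<gamma>"
    using der by (intro continuous_at_imp_continuous_on ballI) (metis has_vector_derivative_continuous)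
  have cZ: "continuous_on {0..1} Z" and cW: "continuous_on {0..1} W"
    unfolding Z_def[abs_def] W_def[abs_def] using v by (intro continuous_intros c\<gamma> cont; simp)+
  obtain \<delta>1 where \<delta>1: "\<delta>1 > 0" "\<And>t. \<bar>t - t0\<bar> < \<delta>1 \<Longrightarrow> norm (Z t - of_real (t - t0)) \<le> \<bar>t - t0\<bar> / 12"
  proof -
    have "(\<gamma> has_derivative (\<lambda>x. x *\<^sub>R v)) (at t0)"
      using der[of t0] t0 unfolding has_vector_derivative_def v_def by simp
    then obtain d where d: "d > 0" "\<And>y. norm (y - t0) < d \<Longrightarrow> norm (\<gamma> y - \<gamma> t0 - (y - t0) *\<^sub>R v) \<le> (norm v / 12) * norm (y - t0)"
      unfolding has_derivative_at_alt using v by (metis divide_pos_pos zero_less_norm_iff zero_less_numeral)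
    show thesis
    proof (rule that[OF d(1)])
      fix t assume "\<bar>t - t0\<bar> < d"
      then have *: "norm (\<gamma> t - \<gamma> t0 - (t - t0) *\<^sub>R v) \<le> (norm v / 12) * \<bar>t - t0\<bar>" using d(2)[of t] by simp
      have "Z t - of_real (t - t0) = (\<gamma> t - \<gamma> t0 - (t - t0) *\<^sub>R v) / v"
        using v by (simp add: Z_def z0_def scaleR_conv_of_real diff_divide_distrib)
      then have "norm (Z t - of_real (t - t0)) = norm (\<gamma> t - \<gamma> t0 - (t - t0) *\<^sub>R v) / norm v"
        by (simp add: norm_divide)
      also have "\<dots> \<le> (norm v / 12) * \<bar>t - t0\<bar> / norm v" using * by (rule divide_right_mono) simp
      also have "\<dots> = \<bar>t - t0\<bar> / 12" using v by simp
      finally show "norm (Z t - of_real (t - t0)) \<le> \<bar>t - t0\<bar> / 12" .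
    qed
  qed
  obtain \<delta>2 where \<delta>2: "\<delta>2 > 0" "\<And>t. t \<in> {0..1} \<Longrightarrow> \<bar>t - t0\<bar> < \<delta>2 \<Longrightarrow> norm (W t - 1) \<le> 1/12"
  proof -
    have "\<exists>d>0. \<forall>t\<in>{0..1}. dist t t0 < d \<longrightarrow> dist (W t) (W t0) < 1/12"
      using cW[unfolded continuous_on_iff, rule_format, of t0 "1/12"] t0 by simp
    moreover have "W t0 = 1" using v by (simp add: W_def v_def)
    ultimately obtain d where "d > 0" "\<forall>t\<in>{0..1}. dist t t0 < d \<longrightarrow> dist (W t) 1 < 1/12" by auto
    then show thesis by (intro that[of d]) (auto simp: dist_norm less_imp_le)
  qed
  define \<delta> where "\<delta> = min (min \<delta>1 \<delta>2) (min t0 (1 - t0))"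
  have \<delta>: "\<delta> > 0" "\<delta> \<le> \<delta>1" "\<delta> \<le> \<delta>2" "\<delta> \<le> t0" "\<delta> \<le> 1 - t0" using \<delta>1 \<delta>2 t0 by (auto simp: \<delta>_def)
  define F where "F = {t \<in> {0..1}. \<delta> \<le> \<bar>t - t0\<bar>}"
  have F: "compact F" "0 \<in> F"
  proof -
    have "closed {t. \<delta> \<le> \<bar>t - t0\<bar>}" by (intro closed_Collect_le continuous_intros)
    then have "compact ({0..1} \<inter> {t. \<delta> \<le> \<bar>t - t0\<bar>})" by (rule compact_Int_closed[OF compact_Icc])
    moreover have "F = {0..1} \<inter> {t. \<delta> \<le> \<bar>t - t0\<bar>}" by (auto simp: F_def)
    ultimately show "compact F" by simp
    show "0 \<in> F" using \<delta> t0 by (auto simp: F_def)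
  qed
  obtain m where m: "m > 0" "\<And>t. t \<in> F \<Longrightarrow> m \<le> norm (Z t)"
  proof -
    have "continuous_on F (\<lambda>t. norm (Z t))"
      by (intro continuous_intros continuous_on_subset[OF cZ]) (auto simp: F_def)
    then obtain t1 where t1: "t1 \<in> F" "\<forall>t\<in>F. norm (Z t1) \<le> norm (Z t)"
      using continuous_attains_inf[OF F(1), of "\<lambda>t. norm (Z t)"] F(2) by blast
    have "t1 \<noteq> t0" "t1 \<in> {0..1}" using t1(1) \<delta> by (auto simp: F_def)
    then have "norm (Z t1) > 0" using inj[of t1] v by (auto simp: Z_def z0_def)
    then show thesis using that t1 by blast
  qed
  obtain C where C: "\<And>t. t \<in> {0..1} \<Longrightarrow> norm (W t) \<le> C"
  proof -
    have "compact (W ` {0..1})" using cW by (intro compact_continuous_image) auto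
    then have "bounded (W ` {0..1})" by (rule compact_imp_bounded)
    then obtain S where "\<forall>y\<in>W ` {0..1}. norm y \<le> S" unfolding bounded_iff by blast
    then show thesis by (intro that[of S]) auto
  qed
  have C0: "0 \<le> C" using order_trans[OF norm_ge_zero C[of 0]] by simp
  \<comment> \<open>On \<open>F\<close> the first term bounds \<open>|h| / s\<close> and the second one half of the Poisson kernel divided by \<open>s\<close>, so that \<open>Re h \<ge> (1/2) s / ((t - t0)\<^sup>2 + s\<^sup>2) - K s\<close> holds on all of \<open>[0,1]\<close>.\<close>
  define K where "K = 2 * C / m\<^sup>2 + 1 / (2 * \<delta>\<^sup>2)"
  have K: "K > 0" using C0 m \<delta> by (simp add: K_def add_nonneg_pos)
  \<comment> \<open>\<open>s \<le> \<delta>\<close> makes both arctangents below at least \<open>\<pi> / 4\<close>, \<open>s \<le> m / 2\<close> keeps the denominator away from 0 on \<open>F\<close>, and the last bound gives \<open>K s < \<pi> / 4\<close>.\<close>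
  define s0 where "s0 = min (min \<delta> (m / 2)) (pi / (8 * K))"
  have s0: "s0 > 0" using \<delta> m K by (simp add: s0_def)
  have main: "z0 + of_real s * (\<i> * v) \<notin> path_image \<gamma> \<and> z0 - of_real s * (\<i> * v) \<notin> path_image \<gamma> \<and>
      Re (winding_number \<gamma> (z0 + of_real s * (\<i> * v))) > Re (winding_number \<gamma> (z0 - of_real s * (\<i> * v)))"
    if s: "0 < s" "s < s0" for s
  proof -
    have sd: "s \<le> \<delta>" "s \<le> m / 2" "K * s < pi / 4"
    proof -
      have "s * (8 * K) < pi" using s K by (simp add: s0_def pos_less_divide_eq)
      then show "K * s < pi / 4" using mult_pos_pos[OF K s(1)] by (simp add: mult_ac)
    qed (use s in \<open>auto simp: s0_def\<close>)
    define h where "h t = of_real s * W t / ((Z t)\<^sup>2 + of_real (s\<^sup>2))" for t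
    have near: "(Z t)\<^sup>2 + of_real (s\<^sup>2) \<noteq> 0" "Re (h t) \<ge> (1/2) * (s / ((t - t0)\<^sup>2 + s\<^sup>2))"
      if "t \<in> {0..1}" "\<bar>t - t0\<bar> < \<delta>" for t
      using perturbed_Poisson_kernel_bound[OF \<delta>2(2)[of t] \<delta>1(2)[of t] s(1)] that \<delta> unfolding h_def by auto
    have far: "norm ((Z t)\<^sup>2 + of_real (s\<^sup>2)) \<ge> m\<^sup>2 / 2" if "t \<in> F" for t
    proof -
      have "s\<^sup>2 \<le> (m/2)\<^sup>2" using sd s by (intro power_mono) auto
      then have "4 * s\<^sup>2 \<le> m\<^sup>2" by (simp add: power_divide)
      then have "s\<^sup>2 \<le> m\<^sup>2 / 2" using zero_le_power2[of s] by linarith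
      moreover have "m\<^sup>2 \<le> (norm (Z t))\<^sup>2" using m(2)[OF that] m(1) by (intro power_mono) auto
      moreover have "norm ((Z t)\<^sup>2) - norm (of_real (s\<^sup>2) :: complex) \<le> norm ((Z t)\<^sup>2 + of_real (s\<^sup>2))"
        using norm_diff_ineq by blast
      moreover have "norm (of_real (s\<^sup>2) :: complex) = s\<^sup>2" by (simp only: norm_of_real) simp
      ultimately show ?thesis by (simp add: norm_power)
    qed
    have nz: "(Z t)\<^sup>2 + of_real (s\<^sup>2) \<noteq> 0" if "t \<in> {0..1}" for t
    proof (cases "\<bar>t - t0\<bar> < \<delta>")
      case True then show ?thesis using near that by blast
    next
      case False
      then have "norm ((Z t)\<^sup>2 + of_real (s\<^sup>2)) \<ge> m\<^sup>2 / 2" using far that by (auto simp: F_def)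
      moreover have "m\<^sup>2 / 2 > 0" using m by simp
      ultimately show ?thesis by (metis norm_zero not_less)
    qed
    have fac: "(Z t)\<^sup>2 + of_real (s\<^sup>2) = (Z t - \<i> * of_real s) * (Z t + \<i> * of_real s)" for t
      by (simp add: algebra_simps power2_eq_square)
    have \<gamma>Z: "\<gamma> t - (z0 + of_real s * (\<i> * v)) = v * (Z t - \<i> * of_real s)"
      "\<gamma> t - (z0 - of_real s * (\<i> * v)) = v * (Z t + \<i> * of_real s)" for t
    proof -
      have "v * Z t = \<gamma> t - z0" using v by (simp add: Z_def)
      then show "\<gamma> t - (z0 + of_real s * (\<i> * v)) = v * (Z t - \<i> * of_real s)"
        "\<gamma> t - (z0 - of_real s * (\<i> * v)) = v * (Z t + \<i> * of_real s)" by (auto simp: algebra_simps)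
    qed
    have nzz: "Z t - \<i> * of_real s \<noteq> 0" "Z t + \<i> * of_real s \<noteq> 0" if "t \<in> {0..1}" for t
      using nz[OF that] unfolding fac by auto
    have notin: "z0 + of_real s * (\<i> * v) \<notin> path_image \<gamma>" "z0 - of_real s * (\<i> * v) \<notin> path_image \<gamma>"
      using nzz \<gamma>Z v unfolding path_image_def by (auto simp: image_iff) (metis eq_iff_diff_eq_0 mult_eq_0_iff atLeastAtMost_iff)+
    have wn: "(\<lambda>t. 1 / (\<gamma> t - z) * \<gamma>' t) integrable_on {0..1} \<and>
        2 * of_real pi * \<i> * winding_number \<gamma> z = integral {0..1} (\<lambda>t. 1 / (\<gamma> t - z) * \<gamma>' t)"
      if z: "z \<notin> path_image \<gamma>" for z
    proof -
      have n: "\<gamma> t - z \<noteq> 0" if "t \<in> {0..1}" for t using z that unfolding path_image_def by auto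
      have "continuous_on {0..1} (\<lambda>t. 1 / (\<gamma> t - z) * \<gamma>' t)"
        using n by (intro continuous_intros c\<gamma> cont) auto
      then have "(\<lambda>t. 1 / (\<gamma> t - z) * \<gamma>' t) integrable_on {0..1}" by (rule integrable_continuous_real)
      moreover have "contour_integral \<gamma> (\<lambda>w. 1 / (w - z)) = integral {0..1} (\<lambda>t. 1 / (\<gamma> t - z) * \<gamma>' t)"
        unfolding contour_integral_integral
        by (rule integral_cong) (use der vector_derivative_at in force)
      ultimately show ?thesis using winding_number_valid_path[OF vp z] by simp
    qed
    define z1 where "z1 = z0 + of_real s * (\<i> * v)"
    define z2 where "z2 = z0 - of_real s * (\<i> * v)"
    have eq: "1 / (\<gamma> t - z1) * \<gamma>' t - 1 / (\<gamma> t - z2) * \<gamma>' t = 2 * \<i> * h t" if "t \<in> {0..1}" for t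
    proof -
      have "\<gamma>' t = v * W t" using v by (simp add: W_def)
      moreover have "1 / (v * (Z t - \<i> * of_real s)) * (v * W t) - 1 / (v * (Z t + \<i> * of_real s)) * (v * W t)
          = W t / (Z t - \<i> * of_real s) - W t / (Z t + \<i> * of_real s)" using v by simp
      moreover have "\<dots> = (W t * (Z t + \<i> * of_real s) - W t * (Z t - \<i> * of_real s)) / ((Z t - \<i> * of_real s) * (Z t + \<i> * of_real s))"
        by (rule diff_frac_eq[OF nzz[OF that]])
      moreover have "W t * (Z t + \<i> * of_real s) - W t * (Z t - \<i> * of_real s) = 2 * \<i> * (of_real s * W t)"
        by (simp add: algebra_simps)
      ultimately show ?thesis unfolding z1_def z2_def \<gamma>Z h_def fac by simp
    qed
    have ch: "continuous_on {0..1} h" unfolding h_def[abs_def] using nz by (intro continuous_intros cW cZ) auto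
    have "2 * of_real pi * \<i> * (winding_number \<gamma> z1 - winding_number \<gamma> z2) = integral {0..1} (\<lambda>t. 2 * \<i> * h t)"
    proof -
      have "integral {0..1} (\<lambda>t. 1 / (\<gamma> t - z1) * \<gamma>' t) - integral {0..1} (\<lambda>t. 1 / (\<gamma> t - z2) * \<gamma>' t)
        = integral {0..1} (\<lambda>t. 1 / (\<gamma> t - z1) * \<gamma>' t - 1 / (\<gamma> t - z2) * \<gamma>' t)"
        using wn[OF notin(1)] wn[OF notin(2)] unfolding z1_def z2_def by (intro Henstock_Kurzweil_Integration.integral_diff[symmetric]) auto
      also have "\<dots> = integral {0..1} (\<lambda>t. 2 * \<i> * h t)" by (rule integral_cong) (rule eq)
      finally show ?thesis using wn[OF notin(1)] wn[OF notin(2)] unfolding z1_def z2_def by (simp add: algebra_simps)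
    qed
    moreover have "integral {0..1} (\<lambda>t. 2 * \<i> * h t) = 2 * \<i> * integral {0..1} h" by (rule integral_mult_right)
    ultimately have "(2 * \<i>) * (of_real pi * (winding_number \<gamma> z1 - winding_number \<gamma> z2)) = (2 * \<i>) * integral {0..1} h"
      by (simp only: mult_ac)
    then have ii: "of_real pi * (winding_number \<gamma> z1 - winding_number \<gamma> z2) = integral {0..1} h" by simp
    have hi: "h integrable_on {0..1}" using ch by (rule integrable_continuous_real)
    have "Re (of_real pi * (winding_number \<gamma> z1 - winding_number \<gamma> z2)) = Re (integral {0..1} h)" using ii by simp
    then have re: "pi * (Re (winding_number \<gamma> z1) - Re (winding_number \<gamma> z2)) = integral {0..1} (\<lambda>t. Re (h t))"
      using integral_linear[OF hi bounded_linear_Re] by (simp add: o_def)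
    \<comment> \<open>An antiderivative of the lower bound for \<open>Re h\<close>.\<close>
    define G where "G t = (1/2) * arctan ((t - t0) / s) - K * s * t" for t
    have G: "(G has_real_derivative (1/2) * (s / ((t - t0)\<^sup>2 + s\<^sup>2)) - K * s) (at t)" for t
    proof -
      have "1 + ((t - t0) / s)\<^sup>2 = ((t - t0)\<^sup>2 + s\<^sup>2) / s\<^sup>2" using s by (simp add: power_divide field_simps)
      then have e: "inverse (1 + ((t - t0) / s)\<^sup>2) * (1 / s) = s / ((t - t0)\<^sup>2 + s\<^sup>2)"
        using s by (simp add: power2_eq_square)
      have "((\<lambda>t. (t - t0) / s) has_real_derivative 1 / s) (at t)" using s by (auto intro!: derivative_eq_intros)
      from DERIV_chain2[OF DERIV_arctan this]
      have "((\<lambda>t. arctan ((t - t0) / s)) has_real_derivative s / ((t - t0)\<^sup>2 + s\<^sup>2)) (at t)" unfolding e .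
      from DERIV_diff[OF DERIV_cmult[OF this, of "1/2"] DERIV_cmult[OF DERIV_ident, of "K * s"]]
      show ?thesis unfolding G_def[abs_def] by simp
    qed
    have Gi: "((\<lambda>t. (1/2) * (s / ((t - t0)\<^sup>2 + s\<^sup>2)) - K * s) has_integral G 1 - G 0) {0..1}"
      by (rule fundamental_theorem_of_calculus)
        (use G in \<open>auto simp: has_real_derivative_iff_has_vector_derivative intro: has_vector_derivative_at_within\<close>)
    have "G 1 - G 0 \<le> integral {0..1} (\<lambda>t. Re (h t))"
    proof (rule has_integral_le[OF Gi integrable_integral])
      show "(\<lambda>t. Re (h t)) integrable_on {0..1}" using ch by (intro integrable_continuous_real continuous_intros)
      fix t :: real assume t: "t \<in> {0..1}"
      show "(1/2) * (s / ((t - t0)\<^sup>2 + s\<^sup>2)) - K * s \<le> Re (h t)"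
      proof (cases "\<bar>t - t0\<bar> < \<delta>")
        case True
        then show ?thesis using near(2)[OF t] K s by (smt (verit) mult_pos_pos)
      next
        case False
        then have tF: "t \<in> F" using t by (auto simp: F_def)
        have "norm (h t) = s * norm (W t) / norm ((Z t)\<^sup>2 + of_real (s\<^sup>2))" using s by (simp add: h_def norm_divide norm_mult)
        also have "\<dots> \<le> s * C / (m\<^sup>2 / 2)"
          using far[OF tF] C[OF t] s m C0 by (intro frac_le mult_left_mono mult_nonneg_nonneg) auto
        finally have 1: "Re (h t) \<ge> - (s * C / (m\<^sup>2 / 2))" using abs_Re_le_cmod[of "h t"] by linarith
        have "\<delta>\<^sup>2 \<le> (t - t0)\<^sup>2" using False \<delta>(1) by (metis less_imp_le not_less power2_abs power_mono)
        then have "\<delta>\<^sup>2 \<le> (t - t0)\<^sup>2 + s\<^sup>2" by (simp add: add_increasing2)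
        then have "(1/2) * (s / ((t - t0)\<^sup>2 + s\<^sup>2)) \<le> (1/2) * (s / \<delta>\<^sup>2)"
          using s \<delta> by (intro mult_left_mono divide_left_mono) (auto intro!: mult_pos_pos add_nonneg_pos)
        moreover have "K * s = s * C / (m\<^sup>2 / 2) + (1/2) * (s / \<delta>\<^sup>2)" unfolding K_def by (simp add: algebra_simps)
        ultimately show ?thesis using 1 by linarith
      qed
    qed
    moreover have "G 1 - G 0 > 0"
    proof -
      have "arctan 1 \<le> arctan ((1 - t0) / s)" "arctan 1 \<le> arctan (t0 / s)"
        unfolding arctan_le_iff using sd \<delta> s by (auto simp: pos_le_divide_eq)
      moreover have "G 1 - G 0 = (1/2) * (arctan ((1 - t0) / s) + arctan (t0 / s)) - K * s"
        by (simp add: G_def arctan_minus algebra_simps minus_divide_left[symmetric])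
      ultimately show ?thesis using sd by (simp add: arctan_one)
    qed
    ultimately have "pi * (Re (winding_number \<gamma> z1) - Re (winding_number \<gamma> z2)) > 0" using re by linarith
    then have "Re (winding_number \<gamma> z1) > Re (winding_number \<gamma> z2)" by (simp add: zero_less_mult_iff)
    then show ?thesis using notin unfolding z1_def z2_def by blast
  qed
  show ?thesis
    unfolding eventually_at_right_field using s0 main by (auto simp: v_def z0_def)
qed

section \<open>The divergence theorem inside a smooth closed curve\<close>

definition to_complex :: "real^2 \<Rightarrow> complex" where
  "to_complex x = Complex (x $ 1) (x $ 2)"

lemma to_complex_simps [simp]: "Re (to_complex x) = x $ 1" "Im (to_complex x) = x $ 2"
  by (simp_all add: to_complex_def)

lemma linear_to_complex: "linear to_complex"
  by (rule linearI) (auto simp: complex_eq_iff)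

lemma bounded_linear_to_complex: "bounded_linear to_complex"
  by (rule linear_conv_bounded_linear[THEN iffD1, OF linear_to_complex])

lemma to_complex_minus: "to_complex (x - y) = to_complex x - to_complex y"
  by (simp add: complex_eq_iff)

lemma norm_to_complex: "norm (to_complex x) = norm x"
proof -
  have "(norm (to_complex x))\<^sup>2 = (norm x)\<^sup>2" by (simp add: cmod_power2 norm_real2_sq)
  then show ?thesis by simp
qed

lemma bij_to_complex: "bij to_complex"
proof (rule bijI)
  show "inj to_complex" by (rule injI) (metis norm_to_complex to_complex_minus eq_iff_diff_eq_0 norm_eq_zero)
  have "to_complex (vector [Re z, Im z]) = z" for z by (simp add: complex_eq_iff)
  then show "surj to_complex" by (rule surjI)
qed

lemma inj_to_complex: "to_complex x = to_complex y \<longleftrightarrow> x = y"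
  using bij_to_complex by (simp add: bij_def inj_eq)

lemma smooth_closed_curve_derivative:
  assumes "smooth_closed_curve c"
  shows "(c has_vector_derivative vector_derivative c (at t)) (at t)"
    and "continuous_on UNIV (\<lambda>t. vector_derivative c (at t))"
proof -
  have C: "C_k 1 UNIV c" using assms smooth_on_C_k unfolding smooth_closed_curve_def by blast
  have d: "c differentiable (at t)" for t using C by simp
  show 1: "(c has_vector_derivative vector_derivative c (at t)) (at t)" for t
    using d vector_derivative_works by blast
  have "frechet_derivative c (at t) 1 = vector_derivative c (at t)" for t
  proof -
    have "(\<lambda>x. x *\<^sub>R vector_derivative c (at t)) = frechet_derivative c (at t)"
      by (rule frechet_derivative_at) (use 1[of t] in \<open>simp add: has_vector_derivative_def\<close>)
    from fun_cong[OF this, of 1] show ?thesis by simp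
  qed
  then show "continuous_on UNIV (\<lambda>t. vector_derivative c (at t))" using C by simp
qed

text \<open>The image of an interval under a differentiable map into the plane is negligible.\<close>

lemma curve_null_set:
  assumes "smooth_closed_curve c"
  shows "c ` {0..1} \<in> null_sets lborel"
proof -
  have "c differentiable_on {0..1}"
    using smooth_closed_curve_derivative(1)[OF assms]
    by (meson differentiable_at_imp_differentiable_on has_vector_derivative_def differentiableI)
  then have "negligible (c ` {0..1})"
    by (rule negligible_differentiable_image_lowdim[rotated]) simp
  moreover have "compact (c ` {0..1})"
    using smooth_closed_curve_derivative(1)[OF assms]
    by (intro compact_continuous_image continuous_at_imp_continuous_on ballI) (auto intro: has_vector_derivative_continuous)
  then have "c ` {0..1} \<in> sets borel" using borel_closed compact_imp_closed by blast
  ultimately show ?thesis by (simp add: negligible_iff_null_sets null_sets_completion_iff)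
qed

context
  fixes D :: "(real^2) set" and c :: "real \<Rightarrow> real^2" and \<gamma> :: "real \<Rightarrow> complex"
  assumes adm: "admissible_domain D c"
  defines "\<gamma> \<equiv> to_complex \<circ> c"
begin

lemma curve_facts:
  "smooth_closed_curve c" "open D" "connected D" "bounded D" "frontier D = c ` {0..1}" "ball 0 1 \<subseteq> D"
  using adm unfolding admissible_domain_def by auto

lemma c_der: "(c has_vector_derivative vector_derivative c (at t)) (at t)"
  by (rule smooth_closed_curve_derivative[OF curve_facts(1)])

lemma c'_nonzero: "vector_derivative c (at t) \<noteq> 0"
  using curve_facts(1) unfolding smooth_closed_curve_def by blast

lemma \<gamma>_der: "(\<gamma> has_vector_derivative to_complex (vector_derivative c (at t))) (at t)"
  unfolding \<gamma>_def o_def by (rule bounded_linear.has_vector_derivative[OF bounded_linear_to_complex c_der])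

lemma \<gamma>'_cont: "continuous_on UNIV (\<lambda>t. to_complex (vector_derivative c (at t)))"
  using continuous_on_compose2[OF linear_continuous_on[OF bounded_linear_to_complex] smooth_closed_curve_derivative(2)[OF curve_facts(1)]]
  by auto

lemma \<gamma>_valid: "valid_path \<gamma>"
proof -
  have "\<gamma> C1_differentiable_on {0..1}"
    unfolding C1_differentiable_on_def
    by (rule exI, intro conjI ballI, rule \<gamma>_der, rule continuous_on_subset[OF \<gamma>'_cont]) simp
  then show ?thesis unfolding valid_path_def by (rule C1_differentiable_imp_piecewise)
qed

lemma c_inj: "s \<in> {0..1} \<Longrightarrow> t \<in> {0..1} \<Longrightarrow> c s = c t \<Longrightarrow> s = t \<or> s = 0 \<and> t = 1 \<or> s = 1 \<and> t = 0"
proof -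
  assume *: "s \<in> {0..1}" "t \<in> {0..1}" "c s = c t"
  have i: "inj_on c {0..<1}" and p: "c 1 = c 0"
    using curve_facts(1) unfolding smooth_closed_curve_def by (blast, metis add_0)
  define r where "r x = (if x = 1 then 0 else x)" for x :: real
  have "c (r x) = c x" for x using p by (simp add: r_def)
  moreover have "r s \<in> {0..<1}" "r t \<in> {0..<1}" using * by (auto simp: r_def)
  ultimately have "r s = r t" using i *(3) by (metis inj_onD)
  then show ?thesis unfolding r_def by (auto split: if_splits)
qed

lemma \<gamma>_simple: "simple_path \<gamma>" "pathfinish \<gamma> = pathstart \<gamma>" "path_image \<gamma> = to_complex ` c ` {0..1}"
proof -
  have p: "c 1 = c 0" using curve_facts(1) unfolding smooth_closed_curve_def by (metis add_0)
  show "pathfinish \<gamma> = pathstart \<gamma>" using p by (simp add: \<gamma>_def pathfinish_def pathstart_def)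
  show "path_image \<gamma> = to_complex ` c ` {0..1}" by (simp add: \<gamma>_def path_image_def image_comp)
  have "loop_free \<gamma>" unfolding loop_free_def \<gamma>_def using c_inj inj_to_complex by simp
  then show "simple_path \<gamma>" using valid_path_imp_path[OF \<gamma>_valid] by (simp add: simple_path_def)
qed

text \<open>\<open>D\<close> is bounded and its frontier is the curve, so each of the two Jordan components of the complement,
being connected, lies in \<open>D\<close> or is disjoint from it. The unbounded component cannot lie in \<open>D\<close>.\<close>

lemma image_D_inside: "to_complex ` D = inside (path_image \<gamma>)"
proof -
  note J = Jordan_inside_outside[OF \<gamma>_simple(1,2)]
  define I where "I = inside (path_image \<gamma>)"
  define E where "E = outside (path_image \<gamma>)"
  define D' where "D' = to_complex ` D"
  have J: "connected I" "open I" "connected E" "open E" "\<not> bounded E" "I \<inter> E = {}" "I \<union> E = - path_image \<gamma>"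
    using J unfolding I_def E_def by auto
  have oD: "open D'" unfolding D'_def
    using open_bijective_linear_image_eq[OF linear_to_complex bij_to_complex] curve_facts(2) by simp
  have cD: "connected D'" unfolding D'_def
    by (intro connected_continuous_image linear_continuous_on bounded_linear_to_complex curve_facts)
  have bD: "bounded D'" unfolding D'_def
    by (intro bounded_linear_image curve_facts bounded_linear_to_complex)
  have fD: "frontier D' = path_image \<gamma>"
  proof -
    have "closure D' = to_complex ` closure D"
      unfolding D'_def using closure_injective_linear_image[OF linear_to_complex] bij_to_complex by (simp add: bij_def)
    moreover have "interior D' = D'" "interior D = D" using oD curve_facts(2) by (simp_all add: interior_open)
    ultimately have "frontier D' = to_complex ` closure D - to_complex ` D" unfolding frontier_def by (simp add: D'_def)
    also have "\<dots> = to_complex ` (closure D - D)"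
      using bij_to_complex by (simp add: bij_def image_set_diff)
    also have "closure D - D = frontier D" using \<open>interior D = D\<close> by (simp add: frontier_def)
    finally show ?thesis using \<gamma>_simple(3) curve_facts(5) by simp
  qed
  have "0 \<in> D" using curve_facts(6) by auto
  then have ne: "D' \<noteq> {}" by (auto simp: D'_def)
  have disj: "D' \<inter> path_image \<gamma> = {}" using fD oD by (metis Int_commute frontier_disjoint_eq)
  have sub: "X \<subseteq> D'" if "connected X" "X \<inter> D' \<noteq> {}" "X \<inter> path_image \<gamma> = {}" for X
    using connected_Int_frontier[of X D'] that fD by blast
  have "E \<inter> D' = {}"
  proof (rule ccontr)
    assume "E \<inter> D' \<noteq> {}"
    then have "E \<subseteq> D'" by (intro sub J) (use J in auto)
    then show False using bD J(5) bounded_subset by blast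
  qed
  then have "D' \<subseteq> I" using disj J(7) by blast
  moreover have "I \<subseteq> D'" by (rule sub) (use J ne calculation in auto)
  ultimately show ?thesis unfolding I_def D'_def by blast
qed

lemma winding_sign:
  obtains \<sigma> :: real where "\<sigma> = 1 \<or> \<sigma> = -1"
    "\<And>w. w \<notin> c ` {0..1} \<Longrightarrow> winding_number \<gamma> (to_complex w) = of_real (\<sigma> * indicator D w)"
proof -
  have out: "winding_number \<gamma> (to_complex w) = 0" if "w \<notin> c ` {0..1}" "w \<notin> D" for w
  proof -
    have "to_complex w \<notin> path_image \<gamma>" unfolding \<gamma>_simple(3) using that(1) inj_to_complex by auto
    moreover have "to_complex w \<notin> inside (path_image \<gamma>)"
      unfolding image_D_inside[symmetric] using that(2) inj_to_complex by auto
    ultimately have "to_complex w \<in> outside (path_image \<gamma>)" by (metis ComplI UnE inside_Un_outside)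
    then show ?thesis by (intro winding_number_zero_in_outside valid_path_imp_path \<gamma>_valid \<gamma>_simple)
  qed
  have ins: "w \<in> D \<Longrightarrow> to_complex w \<in> inside (path_image \<gamma>)" for w
    unfolding image_D_inside[symmetric] by auto
  show thesis
  proof (rule simple_closed_path_winding_number_inside[OF \<gamma>_simple(1)])
    assume *: "\<And>z. z \<in> inside (path_image \<gamma>) \<Longrightarrow> winding_number \<gamma> z = 1"
    show thesis
      by (rule that[of 1]) (use *[OF ins] out in \<open>auto simp: indicator_def\<close>)
  next
    assume *: "\<And>z. z \<in> inside (path_image \<gamma>) \<Longrightarrow> winding_number \<gamma> z = -1"
    show thesis
      by (rule that[of "-1"]) (use *[OF ins] out in \<open>auto simp: indicator_def\<close>)
  qed
qed

text \<open>The inner normal is a unit vector orthogonal to the tangent \<open>v\<close>, hence \<open>\<plusminus> i v / |v|\<close>. The winding number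
is \<open>\<sigma>\<close> in \<open>D\<close> and 0 outside, and it increases from the side of \<open>- i v\<close> to the side of \<open>i v\<close>, so the inner side is
that of \<open>\<sigma> i v\<close>.\<close>

lemma normal_orientation:
  assumes n: "inner_unit_normal D c n" and \<sigma>: "\<sigma> = 1 \<or> \<sigma> = (-1::real)"
    and wn: "\<And>w. w \<notin> c ` {0..1} \<Longrightarrow> winding_number \<gamma> (to_complex w) = of_real (\<sigma> * indicator D w)"
    and t: "0 < t" "t < 1"
  shows "norm (vector_derivative c (at t)) *\<^sub>R n (c t) =
    \<sigma> *\<^sub>R vector [- (vector_derivative c (at t) $ 2), vector_derivative c (at t) $ 1]"
proof -
  define v where "v = vector_derivative c (at t)"
  define J :: "real^2" where "J = vector [- (v $ 2), v $ 1]"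
  define m where "m = n (c t)"
  have v: "v \<noteq> 0" using c'_nonzero by (simp add: v_def)
  have m: "norm m = 1" "m \<bullet> v = 0" "\<forall>\<^sub>F s in at_right 0. c t + s *\<^sub>R m \<in> D"
    using n unfolding inner_unit_normal_def v_def m_def by auto
  have Jv: "to_complex J = \<i> * to_complex v" by (simp add: complex_eq_iff J_def)
  obtain \<tau> where \<tau>: "norm v *\<^sub>R m = \<tau> *\<^sub>R J" "\<tau> = 1 \<or> \<tau> = -1"
  proof -
    have o: "m $ 1 * v $ 1 + m $ 2 * v $ 2 = 0" using m(2) by (simp add: inner_real2)
    have nm: "(m $ 1)\<^sup>2 + (m $ 2)\<^sup>2 = 1" using m(1) norm_real2_sq[of m] by simp
    have nv: "(norm v)\<^sup>2 = (v $ 1)\<^sup>2 + (v $ 2)\<^sup>2" by (rule norm_real2_sq)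
    \<comment> \<open>\<open>k\<close> is \<open>m \<bullet> J\<close>, and \<open>m\<close> is a multiple of \<open>J\<close>.\<close>
    define k where "k = - m $ 1 * v $ 2 + m $ 2 * v $ 1"
    have "k\<^sup>2 = (norm v)\<^sup>2" using o nm nv unfolding k_def by algebra
    then have "k = norm v \<or> k = - norm v" by (simp add: power2_eq_iff)
    then obtain \<tau> :: real where t: "\<tau> = 1 \<or> \<tau> = -1" "k = \<tau> * norm v" by (metis mult_1 mult_minus1)
    have nz: "norm v \<noteq> 0" using v by simp
    have "(norm v)\<^sup>2 * m $ 1 = k * - v $ 2" "(norm v)\<^sup>2 * m $ 2 = k * v $ 1"
      using o nv unfolding k_def by algebra+
    then have "norm v * (norm v * m $ 1) = norm v * (\<tau> * - v $ 2)" "norm v * (norm v * m $ 2) = norm v * (\<tau> * v $ 1)"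
      unfolding t(2) by (simp_all add: power2_eq_square mult_ac)
    then have "norm v * m $ 1 = \<tau> * - v $ 2" "norm v * m $ 2 = \<tau> * v $ 1"
      using nz mult_left_cancel by blast+
    then have "norm v *\<^sub>R m = \<tau> *\<^sub>R J" by (simp add: vec_eq_iff forall_2 J_def)
    then show thesis using that t(1) by blast
  qed
  have "\<tau> = \<sigma>"
  proof (rule ccontr)
    assume "\<tau> \<noteq> \<sigma>"
    then have op: "\<tau> = - \<sigma>" using \<tau>(2) \<sigma> by auto
    have "\<forall>\<^sub>F s in at_right 0. \<gamma> t + of_real s * (\<i> * to_complex v) \<notin> path_image \<gamma> \<and>
      \<gamma> t - of_real s * (\<i> * to_complex v) \<notin> path_image \<gamma> \<and>
      Re (winding_number \<gamma> (\<gamma> t + of_real s * (\<i> * to_complex v)))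
        > Re (winding_number \<gamma> (\<gamma> t - of_real s * (\<i> * to_complex v)))"
      unfolding v_def
    proof (rule winding_number_jump[OF \<gamma>_valid, where \<gamma>'="\<lambda>t. to_complex (vector_derivative c (at t))"])
      show "to_complex (vector_derivative c (at t)) \<noteq> 0"
        using c'_nonzero[of t] norm_to_complex by (metis norm_eq_zero)
      show "\<gamma> s \<noteq> \<gamma> t" if "s \<in> {0..1}" "s \<noteq> t" for s
        using c_inj[of s t] that t inj_to_complex by (auto simp: \<gamma>_def)
      show "continuous_on {0..1} (\<lambda>t. to_complex (vector_derivative c (at t)))"
        by (rule continuous_on_subset[OF \<gamma>'_cont]) simp
    qed (use \<gamma>_der t in auto)
    moreover have "\<forall>\<^sub>F s in at_right 0. c t + (s * norm v) *\<^sub>R m \<in> D"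
    proof -
      have "filterlim (\<lambda>s. s * norm v) (at_right 0) (at_right 0)"
      proof (rule filterlim_at_withinI)
        have "((\<lambda>s. s * norm v) \<longlongrightarrow> 0 * norm v) (at_right 0)" by (intro tendsto_intros)
        then show "filterlim (\<lambda>s. s * norm v) (nhds 0) (at_right 0)" by simp
        show "\<forall>\<^sub>F s in at_right 0. s * norm v \<in> {0<..} - {0}"
          by (rule eventually_mono[OF eventually_at_right_less[of "0::real"]]) (use v in simp)
      qed
      then show ?thesis using m(3) unfolding filterlim_iff by blast
    qed
    ultimately have "\<forall>\<^sub>F s in at_right (0::real). False"
    proof eventually_elim
      case (elim s)
      have e1: "\<gamma> t + of_real s * (\<i> * to_complex v) = to_complex (c t + s *\<^sub>R J)"
        "\<gamma> t - of_real s * (\<i> * to_complex v) = to_complex (c t - s *\<^sub>R J)"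
        unfolding Jv[symmetric] by (auto simp: \<gamma>_def complex_eq_iff)
      have nin: "c t + s *\<^sub>R J \<notin> c ` {0..1}" "c t - s *\<^sub>R J \<notin> c ` {0..1}"
        using elim unfolding e1 \<gamma>_simple(3) by blast+
      have gt: "\<sigma> * indicator D (c t + s *\<^sub>R J) > \<sigma> * (indicator D (c t - s *\<^sub>R J) :: real)"
        using elim unfolding e1 wn[OF nin(1)] wn[OF nin(2)] by simp
      have "(s * norm v) *\<^sub>R m = s *\<^sub>R (norm v *\<^sub>R m)" by simp
      also have "\<dots> = (s * \<tau>) *\<^sub>R J" unfolding \<tau>(1) by simp
      finally have "c t + (s * \<tau>) *\<^sub>R J \<in> D" using elim by simp
      then show False using gt \<sigma> op by (auto simp: indicator_def of_bool_def split: if_splits)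
    qed
    then show False by simp
  qed
  then show ?thesis using \<tau>(1) unfolding v_def m_def J_def by simp
qed

text \<open>Green's formula with the winding number \<open>\<sigma>\<close> on \<open>D\<close>, in which the tangent is replaced by \<open>\<sigma>\<close> times the
rotated inner normal. The sign \<open>\<sigma>\<close> enters twice and cancels.\<close>

lemma divergence_theorem_domain:
  fixes P Q :: "real^2 \<Rightarrow> real"
  assumes n: "inner_unit_normal D c n"
    and P: "\<And>x. (P has_derivative P' x) (at x)" "\<And>b. b \<in> Basis \<Longrightarrow> continuous_on UNIV (\<lambda>x. P' x b)"
    and Q: "\<And>x. (Q has_derivative Q' x) (at x)" "\<And>b. b \<in> Basis \<Longrightarrow> continuous_on UNIV (\<lambda>x. Q' x b)"
    and supp: "\<And>x. norm x > R \<Longrightarrow> P x = 0" "\<And>x. norm x > R \<Longrightarrow> Q x = 0"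
  shows "(\<integral>w. (P' w (axis 1 1) + Q' w (axis 2 1)) * indicator D w \<partial>lborel)
    = - integral {0..1} (\<lambda>t. (P (c t) * n (c t) $ 1 + Q (c t) * n (c t) $ 2) * norm (vector_derivative c (at t)))"
proof -
  obtain \<sigma> :: real where \<sigma>: "\<sigma> = 1 \<or> \<sigma> = -1"
    and wn: "\<And>w. w \<notin> c ` {0..1} \<Longrightarrow> winding_number \<gamma> (to_complex w) = of_real (\<sigma> * indicator D w)"
    using winding_sign by blast
  define c' where "c' t = vector_derivative c (at t)" for t
  define j where "j w t = 1 / (\<gamma> t - to_complex w) * to_complex (c' t)" for w t
  have j: "(j w has_integral of_real (2 * pi * (\<sigma> * indicator D w)) * \<i>) {0..1}" if w: "w \<notin> c ` {0..1}" for w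
  proof -
    have n: "\<gamma> t - to_complex w \<noteq> 0" if "t \<in> {0..1}" for t
      using w that inj_to_complex by (auto simp: \<gamma>_def)
    have cg: "continuous_on {0..1} \<gamma>"
      using \<gamma>_valid valid_path_imp_path path_def by blast
    have "continuous_on {0..1} (j w)" unfolding j_def[abs_def] c'_def
      using n by (intro continuous_intros cg continuous_on_subset[OF \<gamma>'_cont]) auto
    then have "(j w has_integral integral {0..1} (j w)) {0..1}"
      by (intro integrable_integral integrable_continuous_real)
    moreover have "contour_integral \<gamma> (\<lambda>z. 1 / (z - to_complex w)) = integral {0..1} (j w)"
      unfolding contour_integral_integral j_def
      by (rule integral_cong) (use \<gamma>_der vector_derivative_at c'_def in force)
    moreover have "to_complex w \<notin> path_image \<gamma>" using w inj_to_complex unfolding \<gamma>_simple(3) by auto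
    then have "of_real (\<sigma> * indicator D w) = 1/(2*pi*\<i>) * contour_integral \<gamma> (\<lambda>z. 1/(z - to_complex w))"
      using winding_number_valid_path[OF \<gamma>_valid] wn[OF w] by metis
    ultimately show ?thesis by (simp add: field_simps)
  qed
  have jd: "j w t = Complex ((c' t $ 1 * (c t $ 1 - w $ 1) + c' t $ 2 * (c t $ 2 - w $ 2)) / (norm (c t - w))\<^sup>2)
     ((c' t $ 2 * (c t $ 1 - w $ 1) - c' t $ 1 * (c t $ 2 - w $ 2)) / (norm (c t - w))\<^sup>2)" for w t
    unfolding j_def \<gamma>_def o_def to_complex_minus[symmetric] norm_real2_sq
    by (simp add: complex_eq_iff Re_divide Im_divide cmod_power2 divide_simps algebra_simps)
  have Im: "((\<lambda>t. (c' t $ 2 * (c t $ 1 - w $ 1) - c' t $ 1 * (c t $ 2 - w $ 2)) / (norm (c t - w))\<^sup>2) has_integral 2 * pi * (\<sigma> * indicator D w)) {0..1}"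
    and Re: "((\<lambda>t. (c' t $ 1 * (c t $ 1 - w $ 1) + c' t $ 2 * (c t $ 2 - w $ 2)) / (norm (c t - w))\<^sup>2) has_integral 0) {0..1}"
    if w: "w \<notin> c ` {0..1}" for w
    using has_integral_linear[OF j[OF w] bounded_linear_Im] has_integral_linear[OF j[OF w] bounded_linear_Re]
    by (simp_all add: o_def jd)
  have "integral {0..1} (\<lambda>t. P (c t) * c' t $ 2 - Q (c t) * c' t $ 1)
    = (\<integral>w. (P' w (axis 1 1) + Q' w (axis 2 1)) * (\<sigma> * indicator D w) \<partial>lborel)"
    by (rule green_winding_form[OF _ _ P Q supp Im Re curve_null_set[OF curve_facts(1)]])
      (use c_der smooth_closed_curve_derivative(2)[OF curve_facts(1)] curve_facts(2) in \<open>auto simp: c'_def\<close>)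
  also have "\<dots> = \<sigma> * (\<integral>w. (P' w (axis 1 1) + Q' w (axis 2 1)) * indicator D w \<partial>lborel)"
    by (subst integral_mult_right_zero[symmetric]) (simp add: mult_ac)
  finally have 1: "\<sigma> * integral {0..1} (\<lambda>t. P (c t) * c' t $ 2 - Q (c t) * c' t $ 1)
    = (\<integral>w. (P' w (axis 1 1) + Q' w (axis 2 1)) * indicator D w \<partial>lborel)" using \<sigma> by auto
  have "integral {0..1} (\<lambda>t. (P (c t) * n (c t) $ 1 + Q (c t) * n (c t) $ 2) * norm (c' t))
    = integral {0..1} (\<lambda>t. - \<sigma> * (P (c t) * c' t $ 2 - Q (c t) * c' t $ 1))"
  \<comment> \<open>The jump formula is available at interior parameters only.\<close>
  proof (rule integral_spike[of "{0,1}"])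
    fix t :: real assume "t \<in> {0..1} - {0, 1}"
    then have t: "0 < t" "t < 1" by auto
    have *: "norm (c' t) *\<^sub>R n (c t) = \<sigma> *\<^sub>R vector [- (c' t $ 2), c' t $ 1]"
      unfolding c'_def by (rule normal_orientation[OF n \<sigma> wn t])
    have "norm (c' t) * n (c t) $ 1 = \<sigma> * - (c' t $ 2)" "norm (c' t) * n (c t) $ 2 = \<sigma> * c' t $ 1"
      using arg_cong[OF *, of "\<lambda>x. x $ 1"] arg_cong[OF *, of "\<lambda>x. x $ 2"] by simp_all
    then show "- \<sigma> * (P (c t) * c' t $ 2 - Q (c t) * c' t $ 1)
      = (P (c t) * n (c t) $ 1 + Q (c t) * n (c t) $ 2) * norm (c' t)" by algebra
  qed simp
  then show ?thesis using 1 unfolding c'_def by simp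
qed

end

section \<open>Density as a function of speed and of momentum\<close>

lemma C_k_inverse_function:
  fixes f g :: "real \<Rightarrow> real"
  assumes S: "open S" and T: "open T" and gT: "\<And>s. s \<in> S \<Longrightarrow> g s \<in> T"
    and f: "\<And>k. C_k k T f" and neg: "\<And>y. y \<in> T \<Longrightarrow> deriv f y < 0"
    and inv: "\<And>s. s \<in> S \<Longrightarrow> f (g s) = s" and cont: "continuous_on S g"
  shows "C_k k S g"
proof -
  define df where "df y = frechet_derivative f (at y) 1" for y
  have df: "(f has_real_derivative df y) (at y)" if "y \<in> T" for y
    unfolding df_def by (rule C_k_real_SucD(1)[OF f that])
  have dneg: "df y < 0" if "y \<in> T" for y
    using neg[OF that] DERIV_imp_deriv[OF df[OF that]] by simp
  have Cdf: "C_k k T df" for k unfolding df_def[abs_def] by (rule C_k_real_SucD(2)[OF f])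
  have dg: "(g has_real_derivative inverse (df (g s))) (at s)" if s: "s \<in> S" for s
  proof -
    obtain e where e: "e > 0" "ball s e \<subseteq> S" using S s openE by blast
    show ?thesis
    proof (rule DERIV_inverse_function[where f=f and a="s - e" and b="s + e"])
      show "(f has_real_derivative df (g s)) (at (g s))" by (rule df[OF gT[OF s]])
      show "df (g s) \<noteq> 0" using dneg[OF gT[OF s]] by simp
      show "isCont g s" using cont S s continuous_on_eq_continuous_at by blast
      show "f (g y) = y" if "s - e < y" "y < s + e" for y
        by (rule inv) (use e that in \<open>auto simp: dist_real_def subset_iff\<close>)
    qed (use e in auto)
  qed
  show ?thesis
  proof (induction k)
    case 0 then show ?case using cont by simp
  next
    case (Suc k)
    have "C_k k S (\<lambda>s. df (g s))" by (rule C_k_compose[OF S T gT Cdf Suc])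
    then have "C_k k S (\<lambda>s. - (1 / - df (g s)))"
      using dneg[OF gT] by (intro C_k_minus[OF S] C_k_divide[OF S C_k_const[OF S]]) auto
    then have "C_k k S (\<lambda>s. inverse (df (g s)))"
      by (rule C_k_cong[OF S, rotated]) (simp add: divide_inverse)
    then show ?case by (rule C_k_real_SucI[OF S, rotated]) (rule dg)
  qed
qed

lemma C_k_id: "open S \<Longrightarrow> C_k k S (\<lambda>x::real. x)"
  by (rule C_k_bounded_linear) auto

definition bernoulli_const :: "real \<Rightarrow> real" where
  "bernoulli_const \<gamma> = (\<gamma> + 1) / (2 * (\<gamma> - 1))"

lemma gas_density_base:
  assumes "\<gamma> > (1::real)" "s \<le> 1"
  shows "1 \<le> (\<gamma> + 1 - (\<gamma> - 1) * s) / 2"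
proof -
  have "(\<gamma> - 1) * s \<le> (\<gamma> - 1) * 1" using assms by (intro mult_left_mono) auto
  then show ?thesis by simp
qed

lemma gas_density_ge_1:
  assumes "\<gamma> > 1" "s \<le> 1" shows "1 \<le> gas_density \<gamma> s"
  unfolding gas_density_def using gas_density_base[OF assms] assms by (intro ge_one_powr_ge_zero) auto

lemma bernoulli_iff_gas_density:
  assumes "\<gamma> > 1" "s \<le> 1" "\<rho> > 0"
  shows "s / 2 + \<rho> powr (\<gamma> - 1) / (\<gamma> - 1) = (\<gamma> + 1) / (2 * (\<gamma> - 1)) \<longleftrightarrow> \<rho> = gas_density \<gamma> s"
proof -
  define b where "b = (\<gamma> + 1 - (\<gamma> - 1) * s) / 2"
  have b: "b \<ge> 1" unfolding b_def by (rule gas_density_base[OF assms(1,2)])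
  have "s / 2 + \<rho> powr (\<gamma> - 1) / (\<gamma> - 1) = (\<gamma> + 1) / (2 * (\<gamma> - 1)) \<longleftrightarrow> \<rho> powr (\<gamma> - 1) = b"
    using assms(1) unfolding b_def by (auto simp: field_simps)
  also have "\<dots> \<longleftrightarrow> \<rho> = b powr (1 / (\<gamma> - 1))"
  proof
    assume "\<rho> powr (\<gamma> - 1) = b"
    then have "b powr (1 / (\<gamma> - 1)) = \<rho> powr ((\<gamma> - 1) * (1 / (\<gamma> - 1)))" by (metis powr_powr)
    then show "\<rho> = b powr (1 / (\<gamma> - 1))" using assms by simp
  next
    assume "\<rho> = b powr (1 / (\<gamma> - 1))"
    then have "\<rho> powr (\<gamma> - 1) = b powr ((1 / (\<gamma> - 1)) * (\<gamma> - 1))" by (metis powr_powr)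
    then show "\<rho> powr (\<gamma> - 1) = b" using assms b by simp
  qed
  finally show ?thesis unfolding b_def gas_density_def .
qed

lemma rho0_eq_gas_density:
  assumes "\<gamma> > 1" "\<kappa>1\<^sup>2 + \<kappa>2\<^sup>2 \<le> 1"
  shows "rho0 \<gamma> \<kappa>1 \<kappa>2 = gas_density \<gamma> (\<kappa>1\<^sup>2 + \<kappa>2\<^sup>2)"
proof -
  have pos: "gas_density \<gamma> (\<kappa>1\<^sup>2 + \<kappa>2\<^sup>2) > 0" using gas_density_ge_1[OF assms] by linarith
  show ?thesis unfolding rho0_def
    by (rule the_equality) (use bernoulli_iff_gas_density[OF assms] pos in blast)+
qed

lemma gas_density_C_k:
  assumes "\<gamma> > 1"
  shows "C_k k {..< (\<gamma> + 1) / (\<gamma> - 1)} (gas_density \<gamma>)"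
proof -
  have "C_k k {..< (\<gamma> + 1) / (\<gamma> - 1)} (\<lambda>s. (\<gamma> + 1 - (\<gamma> - 1) * s) * (1/2))"
    by (intro C_k_diff C_k_mult C_k_const C_k_id) auto
  then have "C_k k {..< (\<gamma> + 1) / (\<gamma> - 1)} (\<lambda>s. ((\<gamma> + 1 - (\<gamma> - 1) * s) * (1/2)) powr (1 / (\<gamma> - 1)))"
    by (rule C_k_powr[rotated]) (use assms in \<open>auto simp: pos_less_divide_eq mult.commute\<close>)
  then show ?thesis unfolding gas_density_def[abs_def] by simp
qed

lemma sonic_less_max_speed: "\<gamma> > 1 \<Longrightarrow> s \<le> 1 \<Longrightarrow> s < (\<gamma> + 1) / (\<gamma> - (1::real))"
  by (rule le_less_trans[of _ 1]) (auto simp: pos_less_divide_eq)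

lemma isCont_gas_density:
  assumes "\<gamma> > 1" "s \<le> 1" shows "isCont (gas_density \<gamma>) s"
proof -
  have "continuous_on {..< (\<gamma> + 1) / (\<gamma> - 1)} (gas_density \<gamma>)"
    by (rule C_k_imp_continuous_on[OF gas_density_C_k[OF assms(1)]])
  then show ?thesis using sonic_less_max_speed[OF assms] by (simp add: continuous_on_eq_continuous_at)
qed

text \<open>Bernoulli's law in differential form, \<open>dp = - \<rho> d(q\<^sup>2) / 2\<close>.\<close>

lemma pressure_has_derivative:
  assumes "\<gamma> > 1" "s \<le> 1"
  shows "((\<lambda>s. gas_density \<gamma> s powr \<gamma> / \<gamma>) has_real_derivative - gas_density \<gamma> s / 2) (at s)"
proof -
  define b where "b s = (\<gamma> + 1 - (\<gamma> - 1) * s) / 2" for s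
  have b: "b s > 0" using gas_density_base[OF assms] unfolding b_def by linarith
  have db: "(b has_real_derivative - (\<gamma> - 1) / 2) (at s)"
    unfolding b_def[abs_def] by (auto intro!: derivative_eq_intros)
  have e: "gas_density \<gamma> s powr \<gamma> / \<gamma> = b s powr (\<gamma> / (\<gamma> - 1)) / \<gamma>" for s
    unfolding gas_density_def b_def by (simp add: powr_powr)
  have "((\<lambda>s. b s powr (\<gamma> / (\<gamma> - 1))) has_real_derivative
     (\<gamma> / (\<gamma> - 1)) * b s powr (\<gamma> / (\<gamma> - 1) - 1) * (- (\<gamma> - 1) / 2)) (at s)"
    by (rule DERIV_chain2[OF _ db, of "\<lambda>x. x powr (\<gamma> / (\<gamma> - 1))"]) (auto intro!: derivative_eq_intros simp: b)
  from DERIV_cdivide[OF this, of \<gamma>]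
  have "((\<lambda>s. b s powr (\<gamma> / (\<gamma> - 1)) / \<gamma>) has_real_derivative
     (\<gamma> / (\<gamma> - 1)) * b s powr (\<gamma> / (\<gamma> - 1) - 1) * (- (\<gamma> - 1) / 2) / \<gamma>) (at s)" .
  moreover have "(\<gamma> / (\<gamma> - 1)) * b s powr (\<gamma> / (\<gamma> - 1) - 1) * (- (\<gamma> - 1) / 2) / \<gamma> = - (b s powr (1 / (\<gamma> - 1))) / 2"
  proof -
    have "\<gamma> / (\<gamma> - 1) - 1 = 1 / (\<gamma> - 1)" using assms by (simp add: field_simps)
    then have *: "b s powr (\<gamma> / (\<gamma> - 1) - 1) = b s powr (1 / (\<gamma> - 1))" by simp
    have "(\<gamma> / (\<gamma> - 1)) * x * (- (\<gamma> - 1) / 2) / \<gamma> = - x / 2" for x using assms by (simp add: field_simps)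
    then show ?thesis unfolding * .
  qed
  ultimately show ?thesis unfolding e unfolding gas_density_def b_def[symmetric] by simp
qed

text \<open>The squared momentum \<open>\<rho>\<^sup>2 q\<^sup>2\<close> as a function of the density, by Bernoulli's law. On \<open>[1, \<infinity>)\<close>, the subsonic
and sonic densities, it is strictly decreasing, and its inverse is \<open>H_density\<close>.\<close>

definition H_inv :: "real \<Rightarrow> real \<Rightarrow> real" where
  "H_inv \<gamma> \<rho> = 2 * \<rho>\<^sup>2 * (bernoulli_const \<gamma> - \<rho> powr (\<gamma> - 1) / (\<gamma> - 1))"

lemma H_inv_iff:
  assumes "\<rho> \<ge> 1"
  shows "s / (2 * \<rho>\<^sup>2) + \<rho> powr (\<gamma> - 1) / (\<gamma> - 1) = (\<gamma> + 1) / (2 * (\<gamma> - 1)) \<longleftrightarrow> H_inv \<gamma> \<rho> = s"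
proof -
  define x where "x = \<rho> powr (\<gamma> - 1) / (\<gamma> - 1)"
  have "2 * \<rho>\<^sup>2 > 0" using assms by simp
  then have "s / (2 * \<rho>\<^sup>2) = bernoulli_const \<gamma> - x \<longleftrightarrow> s = 2 * \<rho>\<^sup>2 * (bernoulli_const \<gamma> - x)"
    by (simp add: divide_eq_eq mult.commute)
  then show ?thesis unfolding H_inv_def bernoulli_const_def x_def[symmetric] by (auto simp: algebra_simps)
qed

lemma H_inv_1:
  assumes "\<gamma> > 1" shows "H_inv \<gamma> 1 = 1"
proof -
  define a where "a = \<gamma> - 1"
  have "a > 0" "\<gamma> = a + 1" using assms by (auto simp: a_def)
  then show ?thesis unfolding H_inv_def bernoulli_const_def by (simp add: field_simps)
qed

lemma H_inv_derivative:
  assumes "\<gamma> > 1" "\<rho> > 0"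
  shows "(H_inv \<gamma> has_real_derivative 2 * (\<gamma> + 1) / (\<gamma> - 1) * (\<rho> - \<rho> powr \<gamma>)) (at \<rho>)"
proof -
  have p: "\<rho> powr (\<gamma> - 1) * \<rho> = \<rho> powr \<gamma>" "\<rho>\<^sup>2 * \<rho> powr (\<gamma> - 2) = \<rho> powr \<gamma>"
  proof -
    show "\<rho> powr (\<gamma> - 1) * \<rho> = \<rho> powr \<gamma>" using assms powr_add[of \<rho> "\<gamma> - 1" 1] by simp
    show "\<rho>\<^sup>2 * \<rho> powr (\<gamma> - 2) = \<rho> powr \<gamma>" using assms powr_add[of \<rho> "\<gamma> - 2" 2] by (simp add: mult.commute)
  qed
  have d: "((\<lambda>\<rho>. \<rho> powr (\<gamma> - 1)) has_real_derivative (\<gamma> - 1) * \<rho> powr (\<gamma> - 2)) (at \<rho>)"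
    using has_real_derivative_powr[OF assms(2), of "\<gamma> - 1"] by simp
  have "(H_inv \<gamma> has_real_derivative
     2 * \<rho>\<^sup>2 * (0 - (\<gamma> - 1) * \<rho> powr (\<gamma> - 2) / (\<gamma> - 1)) + 2 * (2 * \<rho>) * (bernoulli_const \<gamma> - \<rho> powr (\<gamma> - 1) / (\<gamma> - 1))) (at \<rho>)"
    unfolding H_inv_def[abs_def]
    by (rule DERIV_mult' DERIV_diff DERIV_const DERIV_cdivide d DERIV_cmult)+
      (auto intro!: derivative_eq_intros simp: assms)
  moreover have "2 * \<rho>\<^sup>2 * (0 - (\<gamma> - 1) * \<rho> powr (\<gamma> - 2) / (\<gamma> - 1)) + 2 * (2 * \<rho>) * (bernoulli_const \<gamma> - \<rho> powr (\<gamma> - 1) / (\<gamma> - 1))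
    = 2 * (\<gamma> + 1) / (\<gamma> - 1) * (\<rho> - \<rho> powr \<gamma>)"
  proof -
    have "2 * \<rho>\<^sup>2 * (0 - (\<gamma> - 1) * \<rho> powr (\<gamma> - 2) / (\<gamma> - 1)) = - 2 * \<rho> powr \<gamma>"
      using assms p(2) by simp
    moreover have "2 * (2 * \<rho>) * (bernoulli_const \<gamma> - \<rho> powr (\<gamma> - 1) / (\<gamma> - 1)) = 4 * \<rho> * bernoulli_const \<gamma> - 4 * \<rho> powr \<gamma> / (\<gamma> - 1)"
      unfolding p(1)[symmetric] by (simp add: algebra_simps)
    moreover have "- 2 * A + (4 * \<rho> * ((a + 2) / (2 * a)) - 4 * A / a) = 2 * (a + 2) / a * (\<rho> - A)" if "a > 0" for a A :: real
      using that by (simp add: field_simps)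
    from this[of "\<gamma> - 1" "\<rho> powr \<gamma>"]
    have "- 2 * \<rho> powr \<gamma> + (4 * \<rho> * bernoulli_const \<gamma> - 4 * \<rho> powr \<gamma> / (\<gamma> - 1)) = 2 * (\<gamma> + 1) / (\<gamma> - 1) * (\<rho> - \<rho> powr \<gamma>)"
      using assms(1) unfolding bernoulli_const_def by (simp add: add.commute)
    ultimately show ?thesis by simp
  qed
  ultimately show ?thesis by simp
qed

lemma H_inv_derivative_neg:
  fixes \<gamma> \<rho> :: real
  assumes "\<gamma> > 1" "\<rho> > 1"
  shows "2 * (\<gamma> + 1) / (\<gamma> - 1) * (\<rho> - \<rho> powr \<gamma>) < 0"
proof -
  have "\<rho> powr 1 < \<rho> powr \<gamma>" using assms powr_less_cancel_iff[of \<rho> 1 \<gamma>] by blast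
  then show ?thesis using assms by (intro mult_pos_neg) auto
qed

lemma H_inv_strict_antimono:
  assumes "\<gamma> > 1" "1 \<le> x" "x < y"
  shows "H_inv \<gamma> y < H_inv \<gamma> x"
proof (rule DERIV_neg_imp_decreasing_open[OF assms(3)])
  show "\<exists>d. (H_inv \<gamma> has_real_derivative d) (at z) \<and> d < 0" if "x < z" "z < y" for z
    using H_inv_derivative[OF assms(1), of z] H_inv_derivative_neg[OF assms(1), of z] that assms by force
  show "continuous_on {x..y} (H_inv \<gamma>)"
    by (intro continuous_at_imp_continuous_on ballI DERIV_isCont[OF H_inv_derivative[OF assms(1)]]) (use assms in simp)
qed

lemma H_inv_surj:
  assumes "\<gamma> > 1" "s \<le> 1"
  obtains \<rho> where "1 \<le> \<rho>" "H_inv \<gamma> \<rho> = s"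
proof -
  \<comment> \<open>Chosen to make the bracket in \<open>H_inv\<close> at most \<open>- |s|\<close> at \<open>b\<close>.\<close>
  define M where "M = max 1 ((\<gamma> - 1) * (bernoulli_const \<gamma> + \<bar>s\<bar>))"
  define b where "b = M powr (1 / (\<gamma> - 1))"
  have M: "M \<ge> 1" "M \<ge> (\<gamma> - 1) * (bernoulli_const \<gamma> + \<bar>s\<bar>)" by (auto simp: M_def)
  have b1: "b \<ge> 1" unfolding b_def using M assms by (intro ge_one_powr_ge_zero) auto
  have "b powr (\<gamma> - 1) = M" unfolding b_def using M assms by (simp add: powr_powr)
  moreover have "M / (\<gamma> - 1) \<ge> bernoulli_const \<gamma> + \<bar>s\<bar>" using M(2) assms by (simp add: pos_le_divide_eq mult.commute)
  ultimately have "bernoulli_const \<gamma> - b powr (\<gamma> - 1) / (\<gamma> - 1) \<le> - \<bar>s\<bar>" by simp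
  then have "2 * b\<^sup>2 * (bernoulli_const \<gamma> - b powr (\<gamma> - 1) / (\<gamma> - 1)) \<le> 2 * b\<^sup>2 * (- \<bar>s\<bar>)"
    by (intro mult_left_mono) auto
  moreover have "1 * \<bar>s\<bar> \<le> 2 * b\<^sup>2 * \<bar>s\<bar>" using b1 by (intro mult_right_mono) (auto intro: order_trans[of _ "b\<^sup>2"])
  ultimately have fb: "H_inv \<gamma> b \<le> s" unfolding H_inv_def by linarith
  have f1: "H_inv \<gamma> 1 = 1" by (rule H_inv_1) (use assms in simp)
  have "\<exists>x\<ge>1. x \<le> b \<and> H_inv \<gamma> x = s"
  proof (rule IVT2'[where f="H_inv \<gamma>" and a=1 and b=b and y=s, OF fb _ b1])
    show "s \<le> H_inv \<gamma> 1" using f1 assms by simp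
    show "continuous_on {1..b} (H_inv \<gamma>)"
      by (intro continuous_at_imp_continuous_on ballI DERIV_isCont[OF H_inv_derivative[OF assms(1)]]) simp
  qed
  then show thesis using that by blast
qed

lemma H_density_inv:
  assumes "\<gamma> > 1" "1 \<le> \<rho>"
  shows "H_density \<gamma> (H_inv \<gamma> \<rho>) = \<rho>"
  unfolding H_density_def
proof (rule the_equality)
  show "\<rho> \<ge> 1 \<and> H_inv \<gamma> \<rho> / (2 * \<rho>\<^sup>2) + \<rho> powr (\<gamma> - 1) / (\<gamma> - 1) = (\<gamma> + 1) / (2 * (\<gamma> - 1))"
    using H_inv_iff[OF assms(2)] assms by blast
  fix x assume "x \<ge> 1 \<and> H_inv \<gamma> \<rho> / (2 * x\<^sup>2) + x powr (\<gamma> - 1) / (\<gamma> - 1) = (\<gamma> + 1) / (2 * (\<gamma> - 1))"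
  then have "x \<ge> 1" "H_inv \<gamma> x = H_inv \<gamma> \<rho>" using H_inv_iff by blast+
  then show "x = \<rho>" using H_inv_strict_antimono[OF assms(1)] assms(2) by (metis less_irrefl linorder_neqE_linordered_idom)
qed

lemma H_density_spec:
  assumes "\<gamma> > 1" "s \<le> 1"
  shows "1 \<le> H_density \<gamma> s" "H_inv \<gamma> (H_density \<gamma> s) = s"
  using H_inv_surj[OF assms] H_density_inv[OF assms(1)] by metis+

lemma H_density_gt_1:
  assumes "\<gamma> > 1" "s < 1"
  shows "1 < H_density \<gamma> s"
proof -
  have f1: "H_inv \<gamma> 1 = 1" by (rule H_inv_1) (use assms in simp)
  have "H_density \<gamma> s \<noteq> 1" using H_density_spec(2)[of \<gamma> s] assms f1 by force
  then show ?thesis using H_density_spec(1)[of \<gamma> s] assms by simp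
qed

text \<open>The two descriptions of the density agree: if \<open>s\<close> is the squared momentum, then \<open>s / H(s)\<^sup>2\<close> is the squared
speed.\<close>

lemma H_density_bernoulli:
  assumes "\<gamma> > 1" "s \<le> 1"
  shows "H_density \<gamma> s = gas_density \<gamma> (s / (H_density \<gamma> s)\<^sup>2)"
proof -
  define \<rho> where "\<rho> = H_density \<gamma> s"
  have \<rho>: "1 \<le> \<rho>" "H_inv \<gamma> \<rho> = s" using H_density_spec[OF assms] by (simp_all add: \<rho>_def)
  have "(s / \<rho>\<^sup>2) / 2 + \<rho> powr (\<gamma> - 1) / (\<gamma> - 1) = (\<gamma> + 1) / (2 * (\<gamma> - 1))"
    using H_inv_iff[OF \<rho>(1), of s \<gamma>] \<rho>(2) by (simp add: mult.commute)
  moreover have "s / \<rho>\<^sup>2 \<le> 1" using \<rho>(1) assms(2) by (simp add: divide_le_eq) (smt (verit) one_le_power)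
  ultimately show ?thesis using bernoulli_iff_gas_density[OF assms(1), of "s / \<rho>\<^sup>2" \<rho>] \<rho>(1) by (simp add: \<rho>_def)
qed

text \<open>The derivative of \<open>H_inv\<close> vanishes at the sonic density 1, so smoothness is claimed below the sonic
momentum only.\<close>

lemma H_density_C_k:
  assumes \<gamma>: "\<gamma> > 1"
  shows "C_k k {..<1} (H_density \<gamma>)"
proof (rule C_k_inverse_function[where T="{1<..}" and f="H_inv \<gamma>"])
  show "C_k k {1<..} (H_inv \<gamma>)" for k
    unfolding H_inv_def[abs_def] power2_eq_square
    by (intro C_k_mult C_k_diff C_k_const C_k_id C_k_divide C_k_powr) (use \<gamma> in auto)
  show "deriv (H_inv \<gamma>) y < 0" if "y \<in> {1<..}" for y
    using DERIV_imp_deriv[OF H_inv_derivative[OF \<gamma>, of y]] H_inv_derivative_neg[OF \<gamma>, of y] that by simp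
  show "continuous_on {..<1} (H_density \<gamma>)"
  proof (intro continuous_at_imp_continuous_on ballI)
    fix s :: real assume "s \<in> {..<1}"
    then have s: "s < 1" by simp
    define \<rho> where "\<rho> = H_density \<gamma> s"
    have \<rho>: "1 < \<rho>" "H_inv \<gamma> \<rho> = s" using H_density_gt_1[OF \<gamma> s] H_density_spec(2)[OF \<gamma>, of s] s by (auto simp: \<rho>_def)
    have "isCont (H_density \<gamma>) (H_inv \<gamma> \<rho>)"
    proof (rule isCont_inverse_function2[where f="H_inv \<gamma>" and g="H_density \<gamma>" and x=\<rho> and a="(1 + \<rho>) / 2" and b="\<rho> + 1"])
      show "H_density \<gamma> (H_inv \<gamma> z) = z" if "(1 + \<rho>) / 2 \<le> z" for z
        by (rule H_density_inv[OF \<gamma>]) (use that \<rho> in auto)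
      show "isCont (H_inv \<gamma>) z" if "(1 + \<rho>) / 2 \<le> z" for z
        by (rule DERIV_isCont[OF H_inv_derivative[OF \<gamma>]]) (use that \<rho> in auto)
    qed (use \<rho> in auto)
    then show "isCont (H_density \<gamma>) s" using \<rho> by simp
  qed
qed (use H_density_gt_1[OF \<gamma>] H_density_spec(2)[OF \<gamma>] in auto)

section \<open>Existence of the background flow\<close>

context
  fixes \<gamma> \<kappa>1 \<kappa>2 :: real
  assumes \<gamma>: "\<gamma> > 1" and \<kappa>1: "0 < \<kappa>1" and sub: "\<kappa>1\<^sup>2 + \<kappa>2\<^sup>2 < 1"
begin

definition mass_flux :: real where "mass_flux = rho0 \<gamma> \<kappa>1 \<kappa>2 * \<kappa>1"

text \<open>The mass equation gives \<open>U\<^sub>1 = mass_flux / (r \<rho>)\<close> and the angular equation gives \<open>U\<^sub>2 = \<kappa>\<^sub>2 / r\<close>, so the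
squared speed at density \<open>\<rho>\<close> and radius \<open>r\<close> is \<open>speed_weight \<rho> / r\<^sup>2\<close>.\<close>

definition speed_weight :: "real \<Rightarrow> real" where "speed_weight \<rho> = mass_flux\<^sup>2 / \<rho>\<^sup>2 + \<kappa>2\<^sup>2"

text \<open>The value of \<open>1 / r\<^sup>2\<close> at which Bernoulli's law yields the density \<open>\<rho>\<close>.\<close>

definition inverse_square_radius :: "real \<Rightarrow> real" where
  "inverse_square_radius \<rho> = 2 * (bernoulli_const \<gamma> - \<rho> powr (\<gamma> - 1) / (\<gamma> - 1)) / speed_weight \<rho>"

text \<open>The density at rest, which is approached at infinity.\<close>

definition rho_max :: real where "rho_max = ((\<gamma> - 1) * bernoulli_const \<gamma>) powr (1 / (\<gamma> - 1))"

lemma rho0_facts: "rho0 \<gamma> \<kappa>1 \<kappa>2 \<ge> 1"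
    "(\<kappa>1\<^sup>2 + \<kappa>2\<^sup>2) / 2 + rho0 \<gamma> \<kappa>1 \<kappa>2 powr (\<gamma> - 1) / (\<gamma> - 1) = bernoulli_const \<gamma>"
proof -
  have e: "rho0 \<gamma> \<kappa>1 \<kappa>2 = gas_density \<gamma> (\<kappa>1\<^sup>2 + \<kappa>2\<^sup>2)" using rho0_eq_gas_density[OF \<gamma>] sub by simp
  show 1: "rho0 \<gamma> \<kappa>1 \<kappa>2 \<ge> 1" unfolding e by (rule gas_density_ge_1[OF \<gamma>]) (use sub in simp)
  show "(\<kappa>1\<^sup>2 + \<kappa>2\<^sup>2) / 2 + rho0 \<gamma> \<kappa>1 \<kappa>2 powr (\<gamma> - 1) / (\<gamma> - 1) = bernoulli_const \<gamma>"
    unfolding bernoulli_const_def using bernoulli_iff_gas_density[OF \<gamma>, of "\<kappa>1\<^sup>2 + \<kappa>2\<^sup>2"] sub 1 e by simp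
qed

lemma mass_flux_bounds: "mass_flux > 0" "mass_flux\<^sup>2 < (rho0 \<gamma> \<kappa>1 \<kappa>2)\<^sup>2"
proof -
  show "mass_flux > 0" unfolding mass_flux_def using rho0_facts(1) \<kappa>1 by simp
  have "\<kappa>1\<^sup>2 < 1" using sub zero_le_power2[of \<kappa>2] by linarith
  then have "(rho0 \<gamma> \<kappa>1 \<kappa>2)\<^sup>2 * \<kappa>1\<^sup>2 < (rho0 \<gamma> \<kappa>1 \<kappa>2)\<^sup>2 * 1" using rho0_facts(1) by (intro mult_strict_left_mono) auto
  then show "mass_flux\<^sup>2 < (rho0 \<gamma> \<kappa>1 \<kappa>2)\<^sup>2" unfolding mass_flux_def by (simp add: power_mult_distrib)
qed

lemma speed_weight_pos: "\<rho> > 0 \<Longrightarrow> speed_weight \<rho> > 0"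
  unfolding speed_weight_def using mass_flux_bounds(1) by (intro add_pos_nonneg) auto

lemma inverse_square_radius_iff:
  assumes "\<rho> > 0"
  shows "inverse_square_radius \<rho> = s \<longleftrightarrow> speed_weight \<rho> * s / 2 + \<rho> powr (\<gamma> - 1) / (\<gamma> - 1) = bernoulli_const \<gamma>"
    and "inverse_square_radius \<rho> \<le> s \<longleftrightarrow> bernoulli_const \<gamma> \<le> speed_weight \<rho> * s / 2 + \<rho> powr (\<gamma> - 1) / (\<gamma> - 1)"
  using speed_weight_pos[OF assms] unfolding inverse_square_radius_def
  by (auto simp: divide_eq_eq divide_le_eq algebra_simps)

text \<open>The radial speed is less than the sound speed for densities above \<open>\<rho>\<^sub>0\<close>. This sign makes Bernoulli's
law solvable for the density.\<close>

lemma subsonic_inequality: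
  assumes "rho0 \<gamma> \<kappa>1 \<kappa>2 \<le> \<rho>" "0 \<le> s" "s \<le> 1"
  shows "s * mass_flux\<^sup>2 / \<rho>^3 < \<rho> powr (\<gamma> - 2)"
proof -
  have \<rho>: "\<rho> \<ge> 1" using assms rho0_facts(1) by linarith
  have "s * mass_flux\<^sup>2 \<le> 1 * mass_flux\<^sup>2" using assms by (intro mult_right_mono) auto
  also have "\<dots> < (rho0 \<gamma> \<kappa>1 \<kappa>2)\<^sup>2" using mass_flux_bounds by simp
  also have "\<dots> \<le> \<rho>\<^sup>2" using assms rho0_facts(1) by (intro power_mono) auto
  also have "\<dots> = \<rho> powr 2" using \<rho> by simp
  also have "\<dots> \<le> \<rho> powr (\<gamma> + 1)" using \<rho> \<gamma> by (intro powr_mono) auto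
  also have "\<dots> = \<rho> powr (\<gamma> - 2) * \<rho>^3" using \<rho> powr_add[of \<rho> "\<gamma> - 2" 3] by (simp add: add.commute)
  finally show ?thesis using \<rho> by (simp add: pos_divide_less_eq)
qed

lemma powr_derivative:
  "\<rho> > 0 \<Longrightarrow> ((\<lambda>\<rho>. \<rho> powr (\<gamma> - 1) / (\<gamma> - 1)) has_real_derivative \<rho> powr (\<gamma> - 2)) (at \<rho>)"
  using DERIV_cdivide[OF has_real_derivative_powr[of \<rho> "\<gamma> - 1"], of "\<gamma> - 1"] \<gamma> by simp

lemma speed_weight_derivative:
  "\<rho> > 0 \<Longrightarrow> (speed_weight has_real_derivative - 2 * mass_flux\<^sup>2 / \<rho>^3) (at \<rho>)"
  unfolding speed_weight_def[abs_def]
  by (auto intro!: derivative_eq_intros simp: power2_eq_square power3_eq_cube mult_ac)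

lemma bernoulli_strict_mono:
  assumes "rho0 \<gamma> \<kappa>1 \<kappa>2 \<le> x" "x < y" "0 \<le> s" "s \<le> 1"
  shows "speed_weight x * s / 2 + x powr (\<gamma> - 1) / (\<gamma> - 1) < speed_weight y * s / 2 + y powr (\<gamma> - 1) / (\<gamma> - 1)"
proof (rule DERIV_pos_imp_increasing[OF assms(2), of "\<lambda>\<rho>. speed_weight \<rho> * s / 2 + \<rho> powr (\<gamma> - 1) / (\<gamma> - 1)"])
  fix z assume z: "x \<le> z" "z \<le> y"
  have z0: "z > 0" using z assms rho0_facts(1) by linarith
  have "((\<lambda>\<rho>. speed_weight \<rho> * s / 2 + \<rho> powr (\<gamma> - 1) / (\<gamma> - 1)) has_real_derivative
      (- 2 * mass_flux\<^sup>2 / z^3) * s / 2 + z powr (\<gamma> - 2)) (at z)"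
    by (intro DERIV_add DERIV_cdivide DERIV_cmult_right speed_weight_derivative powr_derivative z0)
  moreover have "(- 2 * mass_flux\<^sup>2 / z^3) * s / 2 + z powr (\<gamma> - 2) > 0"
    using subsonic_inequality[of z s] z assms by (simp add: mult.commute)
  ultimately show "\<exists>d. ((\<lambda>\<rho>. speed_weight \<rho> * s / 2 + \<rho> powr (\<gamma> - 1) / (\<gamma> - 1)) has_real_derivative d) (at z) \<and> d > 0"
    by blast
qed

lemma inverse_square_radius_derivative:
  assumes "\<rho> > 0"
  shows "(inverse_square_radius has_real_derivative 2 / speed_weight \<rho> * (inverse_square_radius \<rho> * mass_flux\<^sup>2 / \<rho>^3 - \<rho> powr (\<gamma> - 2))) (at \<rho>)"
proof -
  define N where "N \<rho> = 2 * (bernoulli_const \<gamma> - \<rho> powr (\<gamma> - 1) / (\<gamma> - 1))" for \<rho>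
  have N: "(N has_real_derivative 2 * (0 - \<rho> powr (\<gamma> - 2))) (at \<rho>)"
    unfolding N_def[abs_def] by (intro DERIV_cmult DERIV_diff DERIV_const powr_derivative assms)
  have k: "speed_weight \<rho> \<noteq> 0" using speed_weight_pos[OF assms] by simp
  have "((\<lambda>\<rho>. N \<rho> / speed_weight \<rho>) has_real_derivative
     (2 * (0 - \<rho> powr (\<gamma> - 2)) * speed_weight \<rho> - N \<rho> * (- 2 * mass_flux\<^sup>2 / \<rho>^3)) / (speed_weight \<rho> * speed_weight \<rho>)) (at \<rho>)"
    by (rule DERIV_divide[OF N speed_weight_derivative[OF assms] k])
  moreover have "(2 * (0 - x) * w - n * (- 2 * y)) / (w * w) = 2 / w * (n / w * y - x)" if "w \<noteq> 0" for x y n w :: real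
    using that by (simp add: field_simps)
  from this[OF k, of "\<rho> powr (\<gamma> - 2)" "N \<rho>" "mass_flux\<^sup>2 / \<rho>^3"]
  have "(2 * (0 - \<rho> powr (\<gamma> - 2)) * speed_weight \<rho> - N \<rho> * (- 2 * mass_flux\<^sup>2 / \<rho>^3)) / (speed_weight \<rho> * speed_weight \<rho>)
    = 2 / speed_weight \<rho> * (inverse_square_radius \<rho> * mass_flux\<^sup>2 / \<rho>^3 - \<rho> powr (\<gamma> - 2))"
    unfolding inverse_square_radius_def N_def by simp
  ultimately show ?thesis unfolding inverse_square_radius_def[abs_def] N_def by simp
qed

lemma rho_max: "rho_max powr (\<gamma> - 1) / (\<gamma> - 1) = bernoulli_const \<gamma>" "rho0 \<gamma> \<kappa>1 \<kappa>2 < rho_max"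
proof -
  have B: "bernoulli_const \<gamma> > 0" using \<gamma> by (simp add: bernoulli_const_def)
  then show 1: "rho_max powr (\<gamma> - 1) / (\<gamma> - 1) = bernoulli_const \<gamma>"
    using \<gamma> by (simp add: rho_max_def powr_powr)
  have "\<kappa>1\<^sup>2 > 0" using \<kappa>1 by simp
  then have "rho0 \<gamma> \<kappa>1 \<kappa>2 powr (\<gamma> - 1) / (\<gamma> - 1) < rho_max powr (\<gamma> - 1) / (\<gamma> - 1)"
  proof -
    have *: "x < y" if "(a + b) / 2 + x = B" "y = B" "a > 0" "b \<ge> 0" for x y a b B :: real
    proof -
      have "y - x = (a + b) / 2" using that by (simp add: eq_diff_eq[symmetric])
      moreover have "(a + b) / 2 > 0" using that by simp
      ultimately show "x < y" by (metis diff_gt_0_iff_gt)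
    qed
    show ?thesis by (rule *[OF rho0_facts(2) 1 \<open>\<kappa>1\<^sup>2 > 0\<close>]) simp
  qed
  then have "rho0 \<gamma> \<kappa>1 \<kappa>2 powr (\<gamma> - 1) < rho_max powr (\<gamma> - 1)" using \<gamma> by (simp add: divide_less_cancel)
  moreover have "rho_max powr (\<gamma> - 1) \<le> rho0 \<gamma> \<kappa>1 \<kappa>2 powr (\<gamma> - 1)" if "rho_max \<le> rho0 \<gamma> \<kappa>1 \<kappa>2"
    using that \<gamma> by (intro powr_mono2) (auto simp: rho_max_def)
  ultimately show "rho0 \<gamma> \<kappa>1 \<kappa>2 < rho_max" by linarith
qed

lemma inverse_square_radius_range:
  assumes "rho0 \<gamma> \<kappa>1 \<kappa>2 \<le> \<rho>" "\<rho> \<le> rho_max"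
  shows "0 \<le> inverse_square_radius \<rho>" "inverse_square_radius \<rho> \<le> 1"
proof -
  have \<rho>: "\<rho> > 0" using assms rho0_facts(1) by linarith
  have "\<rho> powr (\<gamma> - 1) \<le> rho_max powr (\<gamma> - 1)" using assms \<rho> \<gamma> by (intro powr_mono2) auto
  then have "\<rho> powr (\<gamma> - 1) / (\<gamma> - 1) \<le> bernoulli_const \<gamma>" using \<gamma> rho_max(1) by (metis divide_right_mono diff_ge_0_iff_ge less_imp_le)
  then show "0 \<le> inverse_square_radius \<rho>" unfolding inverse_square_radius_def using speed_weight_pos[OF \<rho>] by simp
  have "speed_weight (rho0 \<gamma> \<kappa>1 \<kappa>2) = \<kappa>1\<^sup>2 + \<kappa>2\<^sup>2"
    using rho0_facts(1) by (simp add: speed_weight_def mass_flux_def power_mult_distrib)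
  then have "bernoulli_const \<gamma> = speed_weight (rho0 \<gamma> \<kappa>1 \<kappa>2) * 1 / 2 + rho0 \<gamma> \<kappa>1 \<kappa>2 powr (\<gamma> - 1) / (\<gamma> - 1)"
    using rho0_facts(2) by simp
  also have "\<dots> \<le> speed_weight \<rho> * 1 / 2 + \<rho> powr (\<gamma> - 1) / (\<gamma> - 1)"
    using bernoulli_strict_mono[of "rho0 \<gamma> \<kappa>1 \<kappa>2" \<rho> 1] assms by (cases "\<rho> = rho0 \<gamma> \<kappa>1 \<kappa>2") auto
  finally show "inverse_square_radius \<rho> \<le> 1" using inverse_square_radius_iff(2)[OF \<rho>] by blast
qed

lemma inverse_square_radius_ends: "inverse_square_radius (rho0 \<gamma> \<kappa>1 \<kappa>2) = 1" "inverse_square_radius rho_max = 0"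
proof -
  have r: "rho0 \<gamma> \<kappa>1 \<kappa>2 > 0" using rho0_facts(1) by linarith
  have "speed_weight (rho0 \<gamma> \<kappa>1 \<kappa>2) = \<kappa>1\<^sup>2 + \<kappa>2\<^sup>2"
    using rho0_facts(1) by (simp add: speed_weight_def mass_flux_def power_mult_distrib)
  then show "inverse_square_radius (rho0 \<gamma> \<kappa>1 \<kappa>2) = 1" using inverse_square_radius_iff(1)[OF r, of 1] rho0_facts(2) by simp
  show "inverse_square_radius rho_max = 0" unfolding inverse_square_radius_def rho_max(1) by simp
qed

lemma inverse_square_radius_inj: "inj_on inverse_square_radius {rho0 \<gamma> \<kappa>1 \<kappa>2..rho_max}"
proof (rule linorder_inj_onI')
  fix x y assume xy: "x \<in> {rho0 \<gamma> \<kappa>1 \<kappa>2..rho_max}" "y \<in> {rho0 \<gamma> \<kappa>1 \<kappa>2..rho_max}" "x < y"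
  then have p: "x > 0" "y > 0" using rho0_facts(1) by auto
  show "inverse_square_radius x \<noteq> inverse_square_radius y"
  proof
    assume e: "inverse_square_radius x = inverse_square_radius y"
    have "speed_weight x * inverse_square_radius x / 2 + x powr (\<gamma> - 1) / (\<gamma> - 1)
       < speed_weight y * inverse_square_radius x / 2 + y powr (\<gamma> - 1) / (\<gamma> - 1)"
      using xy inverse_square_radius_range[of x] by (intro bernoulli_strict_mono) auto
    then show False using inverse_square_radius_iff(1)[OF p(1), of "inverse_square_radius x"] inverse_square_radius_iff(1)[OF p(2), of "inverse_square_radius x"] e by simp
  qed
qed

definition density_at_inverse_square :: "real \<Rightarrow> real" where
  "density_at_inverse_square = inv_into {rho0 \<gamma> \<kappa>1 \<kappa>2..rho_max} inverse_square_radius"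

lemma inverse_square_radius_cont: "continuous_on {rho0 \<gamma> \<kappa>1 \<kappa>2..rho_max} inverse_square_radius"
  by (intro continuous_at_imp_continuous_on ballI DERIV_isCont[OF inverse_square_radius_derivative]) (use rho0_facts(1) in simp)

lemma inverse_square_radius_image: "{0..1} \<subseteq> inverse_square_radius ` {rho0 \<gamma> \<kappa>1 \<kappa>2..rho_max}"
proof
  fix s :: real assume s: "s \<in> {0..1}"
  have "\<exists>x\<ge>rho0 \<gamma> \<kappa>1 \<kappa>2. x \<le> rho_max \<and> inverse_square_radius x = s"
    by (rule IVT2'[where f=inverse_square_radius]) (use s inverse_square_radius_ends rho_max(2) inverse_square_radius_cont in auto)
  then show "s \<in> inverse_square_radius ` {rho0 \<gamma> \<kappa>1 \<kappa>2..rho_max}" by auto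
qed

lemma density_at_inverse_square:
  assumes "s \<in> {0..1}"
  shows "density_at_inverse_square s \<in> {rho0 \<gamma> \<kappa>1 \<kappa>2..rho_max}" "inverse_square_radius (density_at_inverse_square s) = s"
proof -
  have s: "s \<in> inverse_square_radius ` {rho0 \<gamma> \<kappa>1 \<kappa>2..rho_max}" using assms inverse_square_radius_image by blast
  show "density_at_inverse_square s \<in> {rho0 \<gamma> \<kappa>1 \<kappa>2..rho_max}" "inverse_square_radius (density_at_inverse_square s) = s"
    unfolding density_at_inverse_square_def by (rule inv_into_into[OF s], rule f_inv_into_f[OF s])
qed

lemma density_at_inverse_square_cont: "continuous_on {0..1} density_at_inverse_square"
proof -
  have "continuous_on (inverse_square_radius ` {rho0 \<gamma> \<kappa>1 \<kappa>2..rho_max}) density_at_inverse_square"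
    unfolding density_at_inverse_square_def
    by (rule continuous_on_inv[OF inverse_square_radius_cont compact_Icc]) (use inverse_square_radius_inj in simp)
  then show ?thesis using inverse_square_radius_image continuous_on_subset by blast
qed

lemma density_at_inverse_square_C_k: "C_k k {0<..<1} density_at_inverse_square"
proof (rule C_k_inverse_function[where T="{rho0 \<gamma> \<kappa>1 \<kappa>2<..<rho_max}" and f=inverse_square_radius])
  show "C_k k {rho0 \<gamma> \<kappa>1 \<kappa>2<..<rho_max} inverse_square_radius" for k
    unfolding inverse_square_radius_def[abs_def] speed_weight_def[abs_def] power2_eq_square
  proof (intro C_k_divide C_k_mult C_k_diff C_k_const C_k_id C_k_powr C_k_add; (simp only: open_greaterThanLessThan)?)
    fix x assume x: "x \<in> {rho0 \<gamma> \<kappa>1 \<kappa>2<..<rho_max}"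
    then have x0: "x > 0" using rho0_facts(1) by auto
    then show "0 < x" "0 < x * x" by auto
    show "0 < mass_flux * mass_flux / (x * x) + \<kappa>2 * \<kappa>2"
      using speed_weight_pos[OF x0] by (simp add: speed_weight_def power2_eq_square)
  qed (use \<gamma> in auto)
  show "deriv inverse_square_radius y < 0" if y: "y \<in> {rho0 \<gamma> \<kappa>1 \<kappa>2<..<rho_max}" for y
  proof -
    have y0: "y > 0" using y rho0_facts(1) by auto
    have "inverse_square_radius y * mass_flux\<^sup>2 / y^3 - y powr (\<gamma> - 2) < 0"
      using subsonic_inequality[of y "inverse_square_radius y"] inverse_square_radius_range[of y] y by auto
    then have "2 / speed_weight y * (inverse_square_radius y * mass_flux\<^sup>2 / y^3 - y powr (\<gamma> - 2)) < 0"
      using speed_weight_pos[OF y0] by (intro mult_pos_neg) auto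
    then show ?thesis using DERIV_imp_deriv[OF inverse_square_radius_derivative[OF y0]] by simp
  qed
  show "density_at_inverse_square s \<in> {rho0 \<gamma> \<kappa>1 \<kappa>2<..<rho_max}" if "s \<in> {0<..<1}" for s
  proof -
    have "density_at_inverse_square s \<noteq> rho0 \<gamma> \<kappa>1 \<kappa>2" "density_at_inverse_square s \<noteq> rho_max"
      using density_at_inverse_square(2)[of s] inverse_square_radius_ends that by auto
    then show ?thesis using density_at_inverse_square(1)[of s] that by auto
  qed
  show "continuous_on {0<..<1} density_at_inverse_square" by (rule continuous_on_subset[OF density_at_inverse_square_cont]) auto
qed (use density_at_inverse_square in auto)

definition background_density :: "real \<Rightarrow> real" where "background_density r = density_at_inverse_square (1 / r\<^sup>2)"

lemma inverse_square_range: "r \<ge> 1 \<Longrightarrow> 1 / r\<^sup>2 \<in> {0..1::real}" "r > 1 \<Longrightarrow> 1 / r\<^sup>2 \<in> {0<..<1::real}"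
  using one_le_power[of r 2] one_less_power[of r 2] by auto

lemma background_density_facts:
  assumes "r \<ge> 1"
  shows "background_density r \<ge> 1" "speed_weight (background_density r) * (1 / r\<^sup>2) / 2 + background_density r powr (\<gamma> - 1) / (\<gamma> - 1) = bernoulli_const \<gamma>"
proof -
  show 1: "background_density r \<ge> 1" using density_at_inverse_square(1)[OF inverse_square_range(1)[OF assms]] rho0_facts(1) by (simp add: background_density_def)
  show "speed_weight (background_density r) * (1 / r\<^sup>2) / 2 + background_density r powr (\<gamma> - 1) / (\<gamma> - 1) = bernoulli_const \<gamma>"
    using inverse_square_radius_iff(1)[of "background_density r" "1 / r\<^sup>2"] density_at_inverse_square(2)[OF inverse_square_range(1)[OF assms]] 1 by (simp add: background_density_def)
qed

lemma background_density_1: "background_density 1 = rho0 \<gamma> \<kappa>1 \<kappa>2"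
proof -
  have "inverse_square_radius (rho0 \<gamma> \<kappa>1 \<kappa>2) = inverse_square_radius (background_density 1)" "background_density 1 \<in> {rho0 \<gamma> \<kappa>1 \<kappa>2..rho_max}"
    using density_at_inverse_square[of 1] inverse_square_radius_ends by (simp_all add: background_density_def)
  then show ?thesis using inverse_square_radius_inj rho_max(2) by (metis atLeastAtMost_iff inj_onD less_imp_le order_refl)
qed

lemma background_density_cont: "continuous_on {1..} background_density"
  unfolding background_density_def[abs_def]
  by (rule continuous_on_compose2[OF density_at_inverse_square_cont])
    (use inverse_square_range in \<open>auto intro!: continuous_intros\<close>)

lemma C_k_inverse_square: "C_k k {1<..} (\<lambda>r::real. 1 / r\<^sup>2)"
  unfolding power2_eq_square by (intro C_k_divide C_k_const C_k_mult C_k_id) auto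

lemma background_density_C_k: "C_k k {1<..} background_density"
  unfolding background_density_def[abs_def]
  by (rule C_k_compose[where T="{0<..<1}", OF _ _ _ density_at_inverse_square_C_k C_k_inverse_square])
    (use inverse_square_range in auto)

text \<open>The mass and angular momentum equations hold by the choice of \<open>U\<^sub>1\<close> and \<open>U\<^sub>2\<close>. The radial momentum
equation is the derivative of Bernoulli's law, which holds by the choice of the density.\<close>

lemma background_flow_exists:
  "background_flow \<gamma> \<kappa>1 \<kappa>2 (background_density, \<lambda>r. mass_flux / (r * background_density r), \<lambda>r. \<kappa>2 / r)"
proof -
  define U1 where "U1 r = mass_flux / (r * background_density r)" for r
  define U2 where "U2 r = \<kappa>2 / r" for r
  have U1C: "C_k k {1<..} U1" for k
  proof -
    have "0 < r * background_density r" if "r \<in> {1<..}" for r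
      using background_density_facts(1)[of r] that by (intro mult_pos_pos) auto
    then show ?thesis unfolding U1_def[abs_def]
      by (intro C_k_divide C_k_const C_k_mult C_k_id background_density_C_k) auto
  qed
  have U2C: "C_k k {1<..} U2" for k unfolding U2_def[abs_def] by (intro C_k_divide C_k_const C_k_id) auto
  have pos: "r \<ge> 1 \<Longrightarrow> background_density r > 0" for r using background_density_facts(1)[of r] by simp
  have c1: "continuous_on {1..} U1" unfolding U1_def[abs_def]
    by (intro continuous_intros background_density_cont) (use pos in force)
  have c2: "continuous_on {1..} U2" unfolding U2_def[abs_def] by (intro continuous_intros) auto
  have ode: "deriv (\<lambda>s. background_density s * U1 s) r + 1 / r * (background_density r * U1 r) = 0 \<and>
        U1 r * deriv U1 r + 1 / background_density r * deriv (\<lambda>s. background_density s powr \<gamma> / \<gamma>) r - (U2 r)\<^sup>2 / r = 0 \<and>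
        U1 r * deriv U2 r + U1 r * U2 r / r = 0" if r: "r > 1" for r
  proof -
    obtain d\<rho> where d\<rho>: "(background_density has_real_derivative d\<rho>) (at r)"
      using C_k_real_SucD(1)[OF background_density_C_k[of "Suc 0"], of r] r by auto
    obtain d1 where d1: "(U1 has_real_derivative d1) (at r)"
      using C_k_real_SucD(1)[OF U1C[of "Suc 0"], of r] r by auto
    have d2: "(U2 has_real_derivative - \<kappa>2 / r\<^sup>2) (at r)"
      unfolding U2_def[abs_def] using r by (auto intro!: derivative_eq_intros simp: power2_eq_square)
    have \<rho>: "background_density r > 0" using pos r by simp
    have o: "open ({1<..} :: real set)" "r \<in> {1<..}" using r by auto
    have "((\<lambda>s. mass_flux / s) has_real_derivative - mass_flux / r\<^sup>2) (at r)"
      using r by (auto intro!: derivative_eq_intros simp: power2_eq_square)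
    then have "((\<lambda>s. background_density s * U1 s) has_real_derivative - mass_flux / r\<^sup>2) (at r)"
    proof (rule has_field_derivative_transform_within_open[OF _ o])
      fix x :: real assume "x \<in> {1<..}"
      then have "background_density x \<noteq> 0" using pos[of x] by simp
      then show "mass_flux / x = background_density x * U1 x" by (simp add: U1_def)
    qed
    then have "deriv (\<lambda>s. background_density s * U1 s) r = - mass_flux / r\<^sup>2" by (rule DERIV_imp_deriv)
    moreover have "background_density r * U1 r = mass_flux / r" using \<rho> r by (simp add: U1_def)
    ultimately have 1: "deriv (\<lambda>s. background_density s * U1 s) r + 1 / r * (background_density r * U1 r) = 0"
      by (simp add: power2_eq_square)
    have dp: "((\<lambda>s. background_density s powr \<gamma> / \<gamma>) has_real_derivative background_density r powr (\<gamma> - 1) * d\<rho>) (at r)"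
      using DERIV_cdivide[OF DERIV_chain2[OF has_real_derivative_powr[OF \<rho>, of \<gamma>] d\<rho>], of \<gamma>] \<gamma> by simp
    have "((\<lambda>s. ((U1 s)\<^sup>2 + (U2 s)\<^sup>2) / 2 + background_density s powr (\<gamma> - 1) / (\<gamma> - 1)) has_real_derivative
       (2 * U1 r * d1 + 2 * U2 r * (- \<kappa>2 / r\<^sup>2)) / 2 + background_density r powr (\<gamma> - 2) * d\<rho>) (at r)"
    proof (rule DERIV_add[OF _ DERIV_chain2[OF powr_derivative[OF \<rho>] d\<rho>]])
      show "((\<lambda>s. ((U1 s)\<^sup>2 + (U2 s)\<^sup>2) / 2) has_real_derivative (2 * U1 r * d1 + 2 * U2 r * (- \<kappa>2 / r\<^sup>2)) / 2) (at r)"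
        by (auto intro!: derivative_eq_intros d1 d2)
    qed
    moreover have "((\<lambda>s. ((U1 s)\<^sup>2 + (U2 s)\<^sup>2) / 2 + background_density s powr (\<gamma> - 1) / (\<gamma> - 1)) has_real_derivative 0) (at r)"
    proof (rule has_field_derivative_transform_within_open[OF DERIV_const[of "bernoulli_const \<gamma>"] o])
      fix s :: real assume "s \<in> {1<..}"
      then have s: "s \<ge> 1" by simp
      have "((U1 s)\<^sup>2 + (U2 s)\<^sup>2) / 2 = speed_weight (background_density s) * (1 / s\<^sup>2) / 2"
        using s pos[OF s] by (simp add: U1_def U2_def speed_weight_def power_divide power_mult_distrib distrib_right add_divide_distrib)
      then show "bernoulli_const \<gamma> = ((U1 s)\<^sup>2 + (U2 s)\<^sup>2) / 2 + background_density s powr (\<gamma> - 1) / (\<gamma> - 1)"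
        using background_density_facts(2)[OF s] by simp
    qed
    ultimately have "(2 * U1 r * d1 + 2 * U2 r * (- \<kappa>2 / r\<^sup>2)) / 2 + background_density r powr (\<gamma> - 2) * d\<rho> = 0"
      by (rule DERIV_unique)
    moreover have "U2 r * (- \<kappa>2 / r\<^sup>2) = - (U2 r)\<^sup>2 / r" using r by (simp add: U2_def power2_eq_square)
    moreover have "1 / background_density r * (background_density r powr (\<gamma> - 1) * d\<rho>) = background_density r powr (\<gamma> - 2) * d\<rho>"
      using powr_diff[of "background_density r" "\<gamma> - 1" 1] \<rho> by simp
    ultimately have 2: "U1 r * deriv U1 r + 1 / background_density r * deriv (\<lambda>s. background_density s powr \<gamma> / \<gamma>) r - (U2 r)\<^sup>2 / r = 0"
      unfolding DERIV_imp_deriv[OF d1] DERIV_imp_deriv[OF dp] by (simp add: algebra_simps diff_divide_distrib)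
    have 3: "U1 r * deriv U2 r + U1 r * U2 r / r = 0"
      unfolding DERIV_imp_deriv[OF d2] using r by (simp add: U2_def power2_eq_square)
    show ?thesis using 1 2 3 by blast
  qed
  have "background_flow \<gamma> \<kappa>1 \<kappa>2 (background_density, U1, U2)"
    unfolding background_flow_def prod.case
    using ode background_density_1 pos rho0_facts(1) c1 c2 background_density_cont smooth_onI[OF _ background_density_C_k] smooth_onI[OF _ U1C] smooth_onI[OF _ U2C]
    by (auto simp: U1_def U2_def mass_flux_def)
  then show ?thesis unfolding U1_def[abs_def] U2_def[abs_def] .
qed

lemma the_background_flow: "background_flow \<gamma> \<kappa>1 \<kappa>2 (the_background \<gamma> \<kappa>1 \<kappa>2)"
  unfolding the_background_def by (rule someI, rule background_flow_exists)

lemma rho_b_facts: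
  "C_k k {1<..} (rho_b \<gamma> \<kappa>1 \<kappa>2)" "continuous_on {1..} (rho_b \<gamma> \<kappa>1 \<kappa>2)"
  using the_background_flow unfolding background_flow_def rho_b_def
  by (auto simp: case_prod_beta intro: smooth_on_C_k)

text \<open>The mass equation says that \<open>r \<rho>\<^sub>b U\<^sub>1\<close> has derivative 0. The argument uses only the defining properties of
a background flow, because \<open>the_background\<close> is an arbitrary one.\<close>

lemma radial_flux_subsonic:
  assumes "r \<ge> 1"
  shows "rho_b \<gamma> \<kappa>1 \<kappa>2 r * U1_b \<gamma> \<kappa>1 \<kappa>2 r = rho0 \<gamma> \<kappa>1 \<kappa>2 * \<kappa>1 / r"
proof -
  define \<rho> where "\<rho> = rho_b \<gamma> \<kappa>1 \<kappa>2"
  define U where "U = U1_b \<gamma> \<kappa>1 \<kappa>2"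
  have f: "smooth_on {1<..} \<rho>" "smooth_on {1<..} U" "continuous_on {1..} \<rho>" "continuous_on {1..} U"
    "\<rho> 1 = rho0 \<gamma> \<kappa>1 \<kappa>2" "U 1 = \<kappa>1"
    "\<And>r. r > 1 \<Longrightarrow> deriv (\<lambda>s. \<rho> s * U s) r + 1 / r * (\<rho> r * U r) = 0"
    using the_background_flow unfolding background_flow_def \<rho>_def U_def rho_b_def U1_b_def by (auto simp: case_prod_beta)
  have "(\<lambda>r. r * (\<rho> r * U r)) r = (\<lambda>r. r * (\<rho> r * U r)) 1"
  proof (cases "r = 1")
    case False
    show ?thesis
    proof (rule DERIV_isconst_end[where f="\<lambda>r. r * (\<rho> r * U r)"])
      show "1 < r" using False assms by simp
      show "continuous_on {1..r} (\<lambda>r. r * (\<rho> r * U r))"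
        by (intro continuous_intros continuous_on_subset[OF f(3)] continuous_on_subset[OF f(4)]) auto
      fix x :: real assume "1 < x"
      then have x: "x \<in> {1<..}" by simp
      have C: "C_k (Suc 0) {1<..} (\<lambda>s. \<rho> s * U s)"
        by (intro C_k_mult smooth_on_C_k f) auto
      have d: "((\<lambda>s. \<rho> s * U s) has_real_derivative deriv (\<lambda>s. \<rho> s * U s) x) (at x)"
        using C_k_real_SucD(1)[OF C x] DERIV_imp_deriv by metis
      have "((\<lambda>r. r * (\<rho> r * U r)) has_real_derivative x * deriv (\<lambda>s. \<rho> s * U s) x + 1 * (\<rho> x * U x)) (at x)"
        by (rule DERIV_mult'[OF DERIV_ident d])
      moreover have "x * deriv (\<lambda>s. \<rho> s * U s) x + 1 * (\<rho> x * U x) = x * (deriv (\<lambda>s. \<rho> s * U s) x + 1 / x * (\<rho> x * U x))"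
        using x by (simp add: algebra_simps)
      ultimately show "((\<lambda>r. r * (\<rho> r * U r)) has_real_derivative 0) (at x)" using f(7)[of x] x by simp
    qed
  qed simp
  then have "r * (\<rho> r * U r) = rho0 \<gamma> \<kappa>1 \<kappa>2 * \<kappa>1" using f by simp
  then show ?thesis unfolding \<rho>_def U_def using assms by (simp add: field_simps)
qed

lemma psi20_facts:
  "continuous_on {1..} (psi20 \<gamma> \<kappa>1 \<kappa>2)" "C_k k {1<..} (psi20 \<gamma> \<kappa>1 \<kappa>2)"
proof -
  define h where "h s = rho_b \<gamma> \<kappa>1 \<kappa>2 s / s" for s
  have ch: "continuous_on {1..b} h" for b unfolding h_def[abs_def]
    by (intro continuous_intros continuous_on_subset[OF rho_b_facts(2)]) auto
  have Ch: "C_k k {1<..} (\<lambda>r. - \<kappa>2 * h r)" for k unfolding h_def[abs_def]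
    by (intro C_k_mult C_k_const C_k_divide rho_b_facts C_k_id) auto
  have within: "((\<lambda>r. integral {1..r} h) has_real_derivative h r) (at r within {1..b})" if "r \<in> {1..b}" for r b
    by (rule integral_has_real_derivative[OF ch that])
  have d: "(psi20 \<gamma> \<kappa>1 \<kappa>2 has_real_derivative - \<kappa>2 * h r) (at r)" if "r \<in> {1<..}" for r
  proof -
    have "((\<lambda>r. integral {1..r} h) has_real_derivative h r) (at r within {1..r + 1})" using that by (intro within) auto
    then have "((\<lambda>r. integral {1..r} h) has_real_derivative h r) (at r)"
      using that at_within_Icc_at[of 1 r "r + 1"] by simp
    then show ?thesis unfolding psi20_def[abs_def] h_def[abs_def, symmetric] by (rule DERIV_cmult)
  qed
  show "C_k k {1<..} (psi20 \<gamma> \<kappa>1 \<kappa>2)"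
  proof (cases k)
    case 0 then show ?thesis using d by (auto intro!: continuous_at_imp_continuous_on DERIV_isCont)
  next
    case (Suc m) show ?thesis unfolding Suc by (rule C_k_real_SucI[OF _ d Ch]) auto
  qed
  show "continuous_on {1..} (psi20 \<gamma> \<kappa>1 \<kappa>2)"
  proof (rule continuous_on_eq_continuous_within[THEN iffD2], intro ballI)
    fix r :: real assume r: "r \<in> {1..}"
    have "continuous (at r within {1..r + 1}) (\<lambda>r. integral {1..r} h)"
      using within[of r "r + 1"] r by (auto intro: DERIV_continuous)
    moreover have "at r within {1..r + 1} = at r within {1..}"
    proof (rule at_within_nhd[where S="{r - 1<..<r + 1}"])
      show "{1..r + 1} \<inter> {r - 1<..<r + 1} - {r} = {1..} \<inter> {r - 1<..<r + 1} - {r}" by auto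
    qed auto
    ultimately have "continuous (at r within {1..}) (\<lambda>r. integral {1..r} h)" by simp
    then show "continuous (at r within {1..}) (psi20 \<gamma> \<kappa>1 \<kappa>2)"
      unfolding psi20_def[abs_def] h_def[abs_def, symmetric] by (intro continuous_intros)
  qed
qed

end

section \<open>Partial derivatives and integration by parts in the plane\<close>

lemma C_k_Un:
  assumes "open S" "open T"
  shows "C_k k S f \<Longrightarrow> C_k k T f \<Longrightarrow> C_k k (S \<union> T) f"
proof (induction k arbitrary: f)
  case 0
  then show ?case using continuous_on_open_Un[OF assms] by simp
qed auto

lemma axis_in_Basis_real2: "axis i 1 \<in> (Basis :: (real^2) set)"
  by (rule axis_in_Basis_iff[THEN iffD2]) simp

text \<open>Partial derivatives as real functions; they turn the vector-valued statements about gradients and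
divergences into scalar ones.\<close>

definition pd :: "2 \<Rightarrow> (real^2 \<Rightarrow> real) \<Rightarrow> real^2 \<Rightarrow> real" where
  "pd i f x = frechet_derivative f (at x) (axis i 1)"

lemma real2_expand: "(h::real^2) = h $ 1 *\<^sub>R axis 1 1 + h $ 2 *\<^sub>R axis 2 1"
  by (simp add: vec_eq_iff forall_2)

lemma linear_real2:
  assumes "linear (f :: real^2 \<Rightarrow> real)"
  shows "f h = f (axis 1 1) * h $ 1 + f (axis 2 1) * h $ 2"
proof -
  have "f h = f (h $ 1 *\<^sub>R axis 1 1 + h $ 2 *\<^sub>R axis 2 1)" using real2_expand[of h] by simp
  then show ?thesis using assms by (simp add: linear_add linear_cmul)
qed

lemma pd_eqI: "(f has_derivative f') (at x) \<Longrightarrow> pd i f x = f' (axis i 1)"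
  unfolding pd_def using frechet_derivative_at by metis

lemma has_derivative_pd:
  assumes "f differentiable (at x)"
  shows "(f has_derivative (\<lambda>h. pd 1 f x * h $ 1 + pd 2 f x * h $ 2)) (at x)"
proof -
  have d: "(f has_derivative frechet_derivative f (at x)) (at x)" using assms frechet_derivative_works by blast
  then have "frechet_derivative f (at x) = (\<lambda>h. pd 1 f x * h $ 1 + pd 2 f x * h $ 2)"
    unfolding pd_def by (intro ext) (rule linear_real2[OF has_derivative_linear[OF d]])
  with d show ?thesis by metis
qed

lemma C_k_pd: "C_k (Suc k) S f \<Longrightarrow> C_k k S (pd i f)"
  unfolding pd_def[abs_def] using axis_in_Basis_real2 by simp

lemma pd_cong:
  assumes "open S" "x \<in> S" "\<And>y. y \<in> S \<Longrightarrow> f y = g y" "f differentiable (at x)"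
  shows "pd i f x = pd i g x" "g differentiable (at x)"
proof -
  have d: "(f has_derivative frechet_derivative f (at x)) (at x)" using assms frechet_derivative_works by blast
  have "(g has_derivative frechet_derivative f (at x)) (at x)"
    by (rule has_derivative_transform_within_open[OF d assms(1,2)]) (use assms in auto)
  then show "pd i f x = pd i g x" "g differentiable (at x)"
    using pd_eqI unfolding pd_def by (metis, auto simp: differentiable_def)
qed

lemma pd_add: "f differentiable (at x) \<Longrightarrow> g differentiable (at x) \<Longrightarrow> pd i (\<lambda>x. f x + g x) x = pd i f x + pd i g x"
  by (subst pd_eqI[OF has_derivative_add[OF frechet_derivative_worksI frechet_derivative_worksI]]) (auto simp: pd_def)

lemma pd_diff: "f differentiable (at x) \<Longrightarrow> g differentiable (at x) \<Longrightarrow> pd i (\<lambda>x. f x - g x) x = pd i f x - pd i g x"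
  by (subst pd_eqI[OF has_derivative_diff[OF frechet_derivative_worksI frechet_derivative_worksI]]) (auto simp: pd_def)

lemma pd_mult: "f differentiable (at x) \<Longrightarrow> g differentiable (at x) \<Longrightarrow>
  pd i (\<lambda>x. f x * g x) x = f x * pd i g x + pd i f x * g x"
  by (subst pd_eqI[OF has_derivative_mult[OF frechet_derivative_worksI frechet_derivative_worksI]]) (auto simp: pd_def)

lemma pd_minus: "f differentiable (at x) \<Longrightarrow> pd i (\<lambda>x. - f x) x = - pd i f x"
  by (subst pd_eqI[OF has_derivative_minus[OF frechet_derivative_worksI]]) (auto simp: pd_def)

lemma pd_compose:
  assumes "f differentiable (at x)" "(h has_real_derivative h') (at (f x))"
  shows "pd i (\<lambda>x. h (f x)) x = h' * pd i f x"
  by (subst pd_eqI[OF has_derivative_compose[OF frechet_derivative_worksI[OF assms(1)] assms(2)[unfolded has_field_derivative_def]]])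
    (auto simp: pd_def)

lemma GDERIV_pd:
  assumes "f differentiable (at x)"
  shows "GDERIV f x :> vector [pd 1 f x, pd 2 f x]"
  unfolding gderiv_def by (rule has_derivative_eq_rhs[OF has_derivative_pd[OF assms]]) (auto simp: inner_real2 mult.commute)

lemma GDERIV_unique:
  assumes "GDERIV f x :> a" "GDERIV f x :> b" shows "a = (b :: real^2)"
proof -
  have "(\<lambda>h. h \<bullet> a) = (\<lambda>h. h \<bullet> b)" using assms has_derivative_unique unfolding gderiv_def by blast
  then have "(a - b) \<bullet> a = (a - b) \<bullet> b" by metis
  then have "(a - b) \<bullet> (a - b) = 0" by (simp add: inner_diff_right)
  then show ?thesis by simp
qed

lemma grad_eq: "GDERIV f x :> v \<Longrightarrow> grad f x = v"
  unfolding grad_def using GDERIV_unique by blast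

lemma grad_pd: "f differentiable (at x) \<Longrightarrow> grad f x = vector [pd 1 f x, pd 2 f x]"
  by (rule grad_eq[OF GDERIV_pd])

text \<open>The second difference of \<open>f\<close> over a small square equals \<open>h\<^sup>2\<close> times a mixed derivative at some point of
the square, by applying the mean value theorem in each direction.\<close>

lemma mixed_difference:
  fixes f :: "real^2 \<Rightarrow> real"
  assumes h: "h > 0" and sq: "\<And>s t. \<bar>s\<bar> \<le> h \<Longrightarrow> \<bar>t\<bar> \<le> h \<Longrightarrow> x + s *\<^sub>R axis i 1 + t *\<^sub>R axis j 1 \<in> S"
    and C: "C_k 2 S f"
  obtains s t where "0 < s" "s < h" "0 < t" "t < h"
    "f (x + h *\<^sub>R axis i 1 + h *\<^sub>R axis j 1) - f (x + h *\<^sub>R axis i 1) - f (x + h *\<^sub>R axis j 1) + f x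
      = h\<^sup>2 * pd j (pd i f) (x + s *\<^sub>R axis i 1 + t *\<^sub>R axis j 1)"
proof -
  define y where "y s t = x + s *\<^sub>R axis i 1 + t *\<^sub>R axis j 1" for s t
  have yS: "y s t \<in> S" if "\<bar>s\<bar> \<le> h" "\<bar>t\<bar> \<le> h" for s t using sq[OF that] by (simp add: y_def)
  have C2: "C_k (Suc 1) S f" using C by (simp add: numeral_2_eq_2)
  have d1: "((\<lambda>s. f (y s t)) has_real_derivative pd i f (y s t)) (at s)" if "\<bar>s\<bar> \<le> h" "\<bar>t\<bar> \<le> h" for s t
  proof -
    have "((\<lambda>s. y s t) has_derivative (\<lambda>r. r *\<^sub>R axis i 1)) (at s)"
      unfolding y_def by (auto intro!: derivative_eq_intros)
    from has_derivative_compose[OF this C_k_has_derivative[OF C2 yS[OF that]]]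
    show ?thesis unfolding pd_def has_field_derivative_def
      by (rule has_derivative_eq_rhs)
        (auto simp: fun_eq_iff linear_cmul[OF has_derivative_linear[OF C_k_has_derivative[OF C2 yS[OF that]]]])
  qed
  have d2: "((\<lambda>t. pd i f (y s t)) has_real_derivative pd j (pd i f) (y s t)) (at t)" if "\<bar>s\<bar> \<le> h" "\<bar>t\<bar> \<le> h" for s t
  proof -
    have Cp: "C_k (Suc 0) S (pd i f)" using C_k_pd[OF C2] by simp
    have "((\<lambda>t. y s t) has_derivative (\<lambda>r. r *\<^sub>R axis j 1)) (at t)"
      unfolding y_def by (auto intro!: derivative_eq_intros)
    from has_derivative_compose[OF this C_k_has_derivative[OF Cp yS[OF that]]]
    show ?thesis unfolding pd_def[of j] has_field_derivative_def
      by (rule has_derivative_eq_rhs)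
        (auto simp: fun_eq_iff linear_cmul[OF has_derivative_linear[OF C_k_has_derivative[OF Cp yS[OF that]]]])
  qed
  have "\<exists>s>0. s < h \<and> (f (y h h) - f (y h 0)) - (f (y 0 h) - f (y 0 0)) = (h - 0) * (pd i f (y s h) - pd i f (y s 0))"
    by (rule MVT2[OF h, where f="\<lambda>s. f (y s h) - f (y s 0)"]) (use h in \<open>auto intro!: DERIV_diff d1\<close>)
  then obtain s where s: "0 < s" "s < h" "f (y h h) - f (y h 0) - (f (y 0 h) - f (y 0 0)) = h * (pd i f (y s h) - pd i f (y s 0))"
    by auto
  have "\<exists>t>0. t < h \<and> pd i f (y s h) - pd i f (y s 0) = (h - 0) * pd j (pd i f) (y s t)"
    by (rule MVT2[OF h, where f="\<lambda>t. pd i f (y s t)"]) (use s in \<open>auto intro!: d2\<close>)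
  then obtain t where t: "0 < t" "t < h" "pd i f (y s h) - pd i f (y s 0) = h * pd j (pd i f) (y s t)" by auto
  show thesis
    by (rule that[OF s(1,2) t(1,2)]) (use s(3) t(3) in \<open>simp add: y_def power2_eq_square\<close>)
qed

text \<open>The second difference is symmetric in the two directions, and divided by \<open>h\<^sup>2\<close> it converges to either
mixed derivative.\<close>

lemma mixed_partials_commute:
  fixes f :: "real^2 \<Rightarrow> real"
  assumes S: "open S" and C: "C_k 2 S f" and x: "x \<in> S"
  shows "pd j (pd i f) x = pd i (pd j f) x"
proof -
  obtain e where e: "e > 0" "ball x e \<subseteq> S" using S x openE by blast
  \<comment> \<open>Squares of this size stay inside the ball of radius \<open>e\<close>.\<close>
  define h where "h n = e / (3 * real (Suc n))" for n
  have h: "h n > 0" "h n \<le> e / 3" for n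
    using e unfolding h_def by (simp, intro divide_left_mono) auto
  have hlim: "h \<longlonglongrightarrow> 0"
  proof -
    have "(\<lambda>n. (e/3) * (1 / real (Suc n))) \<longlonglongrightarrow> (e/3) * 0"
      by (intro tendsto_mult_left LIMSEQ_Suc[OF lim_const_over_n])
    then show ?thesis unfolding h_def by simp
  qed
  have near: "norm ((s *\<^sub>R axis i 1 + t *\<^sub>R axis j 1) :: real^2) \<le> \<bar>s\<bar> + \<bar>t\<bar>" for s t i j
    by (rule order_trans[OF norm_triangle_ineq]) (simp add: norm_axis_1)
  have sq: "x + s *\<^sub>R axis i 1 + t *\<^sub>R axis j 1 \<in> S" if "\<bar>s\<bar> \<le> h n" "\<bar>t\<bar> \<le> h n" for s t n i j
  proof -
    have "\<bar>s\<bar> + \<bar>t\<bar> < e" using that h[of n] e(1) by linarith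
    then have "norm ((s *\<^sub>R axis i 1 + t *\<^sub>R axis j 1) :: real^2) < e" using near[of s i t j] by linarith
    then have "x + (s *\<^sub>R axis i 1 + t *\<^sub>R axis j 1) \<in> ball x e"
    proof -
      have "dist x (x + y) = norm y" for y by (simp add: dist_norm)
      with \<open>norm (s *\<^sub>R axis i 1 + t *\<^sub>R axis j 1) < e\<close> show ?thesis by (simp only: mem_ball)
    qed
    then have "x + s *\<^sub>R axis i 1 + t *\<^sub>R axis j 1 \<in> ball x e" by (simp only: add.assoc)
    then show ?thesis using e by blast
  qed
  have main: "(\<lambda>n. (f (x + h n *\<^sub>R axis i 1 + h n *\<^sub>R axis j 1) - f (x + h n *\<^sub>R axis i 1) - f (x + h n *\<^sub>R axis j 1) + f x) / (h n)\<^sup>2)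
     \<longlonglongrightarrow> pd j (pd i f) x" for i j
  proof -
    have "\<forall>n. \<exists>s t. 0 < s \<and> s < h n \<and> 0 < t \<and> t < h n \<and>
      f (x + h n *\<^sub>R axis i 1 + h n *\<^sub>R axis j 1) - f (x + h n *\<^sub>R axis i 1) - f (x + h n *\<^sub>R axis j 1) + f x
      = (h n)\<^sup>2 * pd j (pd i f) (x + s *\<^sub>R axis i 1 + t *\<^sub>R axis j 1)"
    proof
      fix n
      show "\<exists>s t. 0 < s \<and> s < h n \<and> 0 < t \<and> t < h n \<and>
        f (x + h n *\<^sub>R axis i 1 + h n *\<^sub>R axis j 1) - f (x + h n *\<^sub>R axis i 1) - f (x + h n *\<^sub>R axis j 1) + f x
        = (h n)\<^sup>2 * pd j (pd i f) (x + s *\<^sub>R axis i 1 + t *\<^sub>R axis j 1)"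
        by (rule mixed_difference[OF h(1)[of n] sq C]) blast+
    qed
    then obtain s t where st: "\<And>n. 0 < s n \<and> s n < h n \<and> 0 < t n \<and> t n < h n \<and>
      f (x + h n *\<^sub>R axis i 1 + h n *\<^sub>R axis j 1) - f (x + h n *\<^sub>R axis i 1) - f (x + h n *\<^sub>R axis j 1) + f x
      = (h n)\<^sup>2 * pd j (pd i f) (x + s n *\<^sub>R axis i 1 + t n *\<^sub>R axis j 1)" by metis
    have s0: "s \<longlonglongrightarrow> 0" "t \<longlonglongrightarrow> 0"
      by (rule tendsto_sandwich[OF _ _ tendsto_const hlim]; use st in \<open>auto intro!: always_eventually less_imp_le\<close>)+
    have "(\<lambda>n. x + s n *\<^sub>R axis i 1 + t n *\<^sub>R axis j 1) \<longlonglongrightarrow> x + 0 *\<^sub>R axis i 1 + 0 *\<^sub>R axis j 1"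
      by (intro tendsto_intros s0)
    moreover have "isCont (pd j (pd i f)) x"
    proof -
      have "C_k 0 S (pd j (pd i f))" using C by (intro C_k_pd) (simp add: numeral_2_eq_2 C_k_pd[of 1, simplified])
      then show ?thesis using S x by (simp add: continuous_on_eq_continuous_at)
    qed
    ultimately have "(\<lambda>n. pd j (pd i f) (x + s n *\<^sub>R axis i 1 + t n *\<^sub>R axis j 1)) \<longlonglongrightarrow> pd j (pd i f) x"
      using isCont_tendsto_compose by fastforce
    moreover have "(f (x + h n *\<^sub>R axis i 1 + h n *\<^sub>R axis j 1) - f (x + h n *\<^sub>R axis i 1) - f (x + h n *\<^sub>R axis j 1) + f x) / (h n)\<^sup>2
      = pd j (pd i f) (x + s n *\<^sub>R axis i 1 + t n *\<^sub>R axis j 1)" for n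
      using st[of n] h(1)[of n] by simp
    ultimately show ?thesis by simp
  qed
  have "(\<lambda>n. (f (x + h n *\<^sub>R axis j 1 + h n *\<^sub>R axis i 1) - f (x + h n *\<^sub>R axis j 1) - f (x + h n *\<^sub>R axis i 1) + f x) / (h n)\<^sup>2)
     \<longlonglongrightarrow> pd j (pd i f) x" using main[of i j] by (simp add: algebra_simps)
  then show ?thesis using main[of j i] LIMSEQ_unique by blast
qed

lemma C1_vanishing_off_compact:
  fixes f :: "real^2 \<Rightarrow> real"
  assumes "open S" "C_k 1 S f" "compact K" "K \<subseteq> S" "\<And>x. x \<in> S - K \<Longrightarrow> f x = 0"
  shows "C_k 1 UNIV (\<lambda>x. if x \<in> S then f x else 0)"
proof -
  have o: "open (- K)" by (rule open_Compl[OF compact_imp_closed[OF assms(3)]])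
  have "C_k 1 S (\<lambda>x. if x \<in> S then f x else 0)" by (rule C_k_cong[OF assms(1) _ assms(2)]) simp
  moreover have "C_k 1 (- K) (\<lambda>x. if x \<in> S then f x else 0)"
    by (rule C_k_cong[OF o _ C_k_const[OF o, of _ 0]]) (use assms(5) in auto)
  moreover have "S \<union> - K = UNIV" using assms(4) by blast
  ultimately show ?thesis using C_k_Un[OF assms(1) o] by metis
qed

lemma integral_pd_C1:
  fixes f :: "real^2 \<Rightarrow> real"
  assumes C: "C_k 1 UNIV f" and supp: "\<And>x. norm x > R \<Longrightarrow> f x = 0"
  shows "integrable lborel (pd i f)" "(\<integral>x. pd i f x \<partial>lborel) = 0"
proof -
  have d: "(f has_derivative frechet_derivative f (at x)) (at x)" for x
    by (rule C_k_has_derivative[of 0 UNIV]) (use C in auto)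
  have c: "continuous_on UNIV (\<lambda>x. frechet_derivative f (at x) b)" if "b \<in> Basis" for b using C that by simp
  show "integrable lborel (pd i f)" "(\<integral>x. pd i f x \<partial>lborel) = 0"
    using integral_directional_derivative_C1[where R=R, OF d c supp axis_in_Basis_real2[of i]] unfolding pd_def[abs_def] by auto
qed

text \<open>The products \<open>v F\<^sub>1\<close> and \<open>v F\<^sub>2\<close>, extended by zero, are \<open>C\<^sup>1\<close> on the plane with bounded support, and the
divergence of this field is the integrand. The test function need only be \<open>C\<^sup>1\<close>, so that stream
functions can serve as test functions.\<close>

lemma weak_divergence_C1:
  fixes F1 F2 v :: "real^2 \<Rightarrow> real"
  assumes S: "open S" and F: "C_k 1 S F1" "C_k 1 S F2" and v: "C_k 1 S v"
    and K: "compact K" "K \<subseteq> S" "\<And>x. x \<in> S - K \<Longrightarrow> v x = 0"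
    and div: "\<And>x. x \<in> S \<Longrightarrow> pd 1 F1 x + pd 2 F2 x = 0"
  shows "integrable lborel (\<lambda>x. indicator S x * (F1 x * pd 1 v x + F2 x * pd 2 v x))"
    "(\<integral>x. indicator S x * (F1 x * pd 1 v x + F2 x * pd 2 v x) \<partial>lborel) = 0"
proof -
  obtain R where R: "\<And>x. x \<in> K \<Longrightarrow> norm x \<le> R" using compact_imp_bounded[OF K(1)] bounded_iff by blast
  define G where "G F x = (if x \<in> S then v x * F x else 0)" for F :: "real^2 \<Rightarrow> real" and x
  have C: "C_k 1 UNIV (G F)" if "C_k 1 S F" for F unfolding G_def[abs_def]
    by (rule C1_vanishing_off_compact[OF S C_k_mult[OF S v that] K(1,2)]) (use K(3) in simp)
  have z: "G F x = 0" if "norm x > R" for F x using K(3) R that by (force simp: G_def)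
  note I1 = integral_pd_C1[where R=R, OF C[OF F(1)] z, of 1]
  note I2 = integral_pd_C1[where R=R, OF C[OF F(2)] z, of 2]
  have on: "pd i (G F) x = v x * pd i F x + pd i v x * F x" if "x \<in> S" "C_k 1 S F" for i F x
  proof -
    have d: "v differentiable (at x)" "F differentiable (at x)" using v that by auto
    then have dm: "(\<lambda>x. v x * F x) differentiable (at x)" by (rule differentiable_mult)
    have "pd i (G F) x = pd i (\<lambda>x. v x * F x) x"
      by (rule pd_cong(1)[OF S that(1), symmetric]) (use dm in \<open>auto simp: G_def\<close>)
    then show ?thesis using pd_mult[OF d] by simp
  qed
  have off: "pd i (G F) x = 0" if "x \<notin> S" for i F x
  proof -
    have o: "open (- K)" by (rule open_Compl[OF compact_imp_closed[OF K(1)]])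
    have "pd i (\<lambda>x. 0) x = pd i (G F) x"
      by (rule pd_cong(1)[OF o]) (use that K in \<open>auto simp: G_def\<close>)
    moreover have "pd i (\<lambda>x. 0) x = 0" using pd_eqI[OF has_derivative_const] by simp
    ultimately show ?thesis by simp
  qed
  have eq: "pd 1 (G F1) x + pd 2 (G F2) x = indicator S x * (F1 x * pd 1 v x + F2 x * pd 2 v x)" for x
  proof (cases "x \<in> S")
    case True
    have "v x * pd 1 F1 x + v x * pd 2 F2 x = v x * (pd 1 F1 x + pd 2 F2 x)" by (simp add: distrib_left)
    then show ?thesis using on[OF True] F div[OF True] True by simp
  qed (simp add: off)
  show "integrable lborel (\<lambda>x. indicator S x * (F1 x * pd 1 v x + F2 x * pd 2 v x))"
    "(\<integral>x. indicator S x * (F1 x * pd 1 v x + F2 x * pd 2 v x) \<partial>lborel) = 0"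
    unfolding eq[symmetric] using I1 I2 by simp_all
qed

lemma test_function_facts:
  assumes "test_function S v"
  obtains R B K where "\<And>k. C_k k UNIV v" "0 \<le> R" "\<And>x. norm x > R \<Longrightarrow> v x = 0" "\<And>x i. norm x > R \<Longrightarrow> pd i v x = 0"
    "\<And>i x. \<bar>pd i v x\<bar> \<le> B" "compact K" "K \<subseteq> S" "\<And>x. x \<notin> K \<Longrightarrow> v x = 0" "\<And>x. grad v x = vector [pd 1 v x, pd 2 v x]"
proof -
  have C: "C_k k UNIV v" for k using assms smooth_on_C_k unfolding test_function_def by blast
  define K where "K = closure {x. v x \<noteq> 0}"
  have K: "compact K" "K \<subseteq> S" using assms unfolding test_function_def K_def by auto
  have Kv: "v x = 0" if "x \<notin> K" for x
    using that closure_subset[of "{x. v x \<noteq> 0}"] unfolding K_def by blast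
  obtain R where R: "\<And>x. x \<in> K \<Longrightarrow> norm x \<le> R" using compact_imp_bounded[OF K(1)] bounded_iff by blast
  have vR: "v x = 0" if "norm x > \<bar>R\<bar>" for x using Kv R that by force
  have d: "(v has_derivative frechet_derivative v (at x)) (at x)" for x
    using C_k_has_derivative[OF C[of "Suc 0"]] by auto
  have c: "continuous_on UNIV (\<lambda>x. frechet_derivative v (at x) b)" if "b \<in> Basis" for b using C[of 1] that by simp
  obtain B where B: "\<And>x b. b \<in> Basis \<Longrightarrow> \<bar>frechet_derivative v (at x) b\<bar> \<le> B" "\<And>x. norm x > \<bar>R\<bar> \<Longrightarrow> frechet_derivative v (at x) = (\<lambda>h. 0)"
    using C1_bounded_support_derivative[OF d c vR] by blast
  show thesis
  proof (rule that[of "\<bar>R\<bar>" B K, OF C _ vR _ _ K Kv])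
    show "grad v x = vector [pd 1 v x, pd 2 v x]" for x
      by (rule grad_pd) (use C[of 1] in simp)
  qed (use B axis_in_Basis_real2 in \<open>auto simp: pd_def\<close>)
qed

section \<open>Branches of the polar angle\<close>

lemma polar_angle_components:
  assumes "polar_angle y \<theta>"
  shows "y $ 1 = norm y * cos \<theta>" "y $ 2 = norm y * sin \<theta>"
  using arg_cong[OF assms[unfolded polar_angle_def], of "\<lambda>v. v $ 1"]
    arg_cong[OF assms[unfolded polar_angle_def], of "\<lambda>v. v $ 2"] by auto

text \<open>Near \<open>x\<close> a continuous branch satisfies \<open>\<Theta> y = \<Theta> x + arcsin (sin (\<Theta> y - \<Theta> x))\<close>, and this sine is an
explicit differentiable function of \<open>y\<close>.\<close>

lemma angle_branch_derivative:
  assumes br: "angle_branch U \<Theta>" and x: "x \<in> U" "x \<noteq> 0"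
  shows "GDERIV \<Theta> x :> (1 / (norm x)\<^sup>2) *\<^sub>R vector [- (x $ 2), x $ 1]"
proof -
  have U: "open U" "continuous_on U \<Theta>" "\<And>y. y \<in> U \<Longrightarrow> polar_angle y (\<Theta> y)"
    using br unfolding angle_branch_def by auto
  define S where "S y = (y $ 2 * cos (\<Theta> x) - y $ 1 * sin (\<Theta> x)) / norm y" for y :: "real^2"
  note px = polar_angle_components[OF U(3)[OF x(1)]]
  have nx: "norm x > 0" using x by simp
  have Sx: "S x = 0" using px by (simp add: S_def mult_ac)
  have dN: "((\<lambda>y. y $ 2 * cos (\<Theta> x) - y $ 1 * sin (\<Theta> x)) has_derivative
      (\<lambda>h. h $ 2 * cos (\<Theta> x) - h $ 1 * sin (\<Theta> x))) (at x)"
    by (rule has_derivative_eq_rhs, (rule derivative_intros has_derivative_vec_nth)+) auto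
  have dn: "(norm has_derivative (\<lambda>h. h \<bullet> sgn x)) (at x)"
    using GDERIV_norm[OF x(2)] unfolding gderiv_def .
  have Nx: "x $ 2 * cos (\<Theta> x) - x $ 1 * sin (\<Theta> x) = 0" using Sx nx by (simp add: S_def)
  have dS: "(S has_derivative (\<lambda>h. (h $ 2 * cos (\<Theta> x) - h $ 1 * sin (\<Theta> x)) / norm x)) (at x)"
    unfolding S_def[abs_def]
    by (rule has_derivative_eq_rhs[OF has_derivative_divide'[OF dN dn]])
      (use nx Nx in \<open>auto simp: fun_eq_iff\<close>)
  have dA: "(arcsin has_derivative (\<lambda>r. r)) (at (S x))"
  proof -
    have "(*) (1::real) = (\<lambda>r. r)" by auto
    then show ?thesis using DERIV_arcsin[of 0] unfolding Sx has_field_derivative_def by simp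
  qed
  have dAS: "((\<lambda>y. \<Theta> x + arcsin (S y)) has_derivative
     (\<lambda>h. (h $ 2 * cos (\<Theta> x) - h $ 1 * sin (\<Theta> x)) / norm x)) (at x)"
    by (rule has_derivative_eq_rhs[OF has_derivative_add[OF has_derivative_const has_derivative_compose[OF dS dA]]]) auto
  have "isCont \<Theta> x" using U(1,2) x by (simp add: continuous_on_eq_continuous_at)
  then have "\<forall>\<^sub>F y in nhds x. dist (\<Theta> y) (\<Theta> x) < pi / 2"
    unfolding isCont_def tendsto_at_iff_tendsto_nhds by (rule tendstoD) simp
  moreover have "\<forall>\<^sub>F y in nhds x. y \<in> U" using U(1) x eventually_nhds_in_open by blast
  moreover have "\<forall>\<^sub>F y in nhds x. y \<in> - {0}" using x by (intro eventually_nhds_in_open) auto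
  ultimately have "\<forall>\<^sub>F y in nhds x. \<Theta> x + arcsin (S y) = \<Theta> y"
  proof eventually_elim
    case (elim y)
    note py = polar_angle_components[OF U(3)[OF elim(2)]]
    have "S y = sin (\<Theta> y - \<Theta> x)" unfolding S_def using elim(3) py
      by (simp add: sin_diff divide_simps) (simp add: algebra_simps)
    moreover have "arcsin (sin (\<Theta> y - \<Theta> x)) = \<Theta> y - \<Theta> x"
      by (rule arcsin_sin) (use elim(1) in \<open>unfold dist_real_def, linarith+\<close>)
    ultimately show ?case by simp
  qed
  then have "(\<Theta> has_derivative (\<lambda>h. (h $ 2 * cos (\<Theta> x) - h $ 1 * sin (\<Theta> x)) / norm x)) (at x)"
  proof -
    obtain V where V: "open V" "x \<in> V" "\<And>y. y \<in> V \<Longrightarrow> \<Theta> x + arcsin (S y) = \<Theta> y"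
      using \<open>\<forall>\<^sub>F y in nhds x. \<Theta> x + arcsin (S y) = \<Theta> y\<close> unfolding eventually_nhds by blast
    show ?thesis by (rule has_derivative_transform_within_open[OF dAS V])
  qed
  then show ?thesis unfolding gderiv_def
  proof (rule has_derivative_eq_rhs, intro ext)
    fix h :: "real^2"
    have "cos (\<Theta> x) = x $ 1 / norm x" "sin (\<Theta> x) = x $ 2 / norm x" using px nx by auto
    then show "(h $ 2 * cos (\<Theta> x) - h $ 1 * sin (\<Theta> x)) / norm x = h \<bullet> ((1 / (norm x)\<^sup>2) *\<^sub>R vector [- (x $ 2), x $ 1])"
      by (simp add: inner_real2 power2_eq_square diff_divide_distrib)
  qed
qed

lemma polar_angle_exists:
  obtains \<theta> where "polar_angle x \<theta>"
proof (cases "x = 0")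
  case True
  then show thesis using that[of 0] by (simp add: polar_angle_def)
next
  case False
  then have "(x $ 1 / norm x)\<^sup>2 + (x $ 2 / norm x)\<^sup>2 = 1"
    by (simp add: power_divide add_divide_distrib[symmetric] norm_real2_sq[symmetric])
  then obtain t where t: "x $ 1 / norm x = cos t" "x $ 2 / norm x = sin t" by (rule sincos_total_2pi)
  have "norm x * (x $ 1 / norm x) = x $ 1" "norm x * (x $ 2 / norm x) = x $ 2" using False by auto
  then have "polar_angle x t" unfolding polar_angle_def t by (simp add: vec_eq_iff forall_2)
  then show thesis by (rule that)
qed

text \<open>In the half-plane of points that make an acute angle with \<open>x\<close>, the angle relative to \<open>x\<close> is an
arcsine.\<close>

lemma angle_branch_exists:
  assumes x: "x \<noteq> 0"
  obtains U \<Theta> where "x \<in> U" "angle_branch U \<Theta>"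
proof -
  obtain \<theta> where \<theta>: "polar_angle x \<theta>" using polar_angle_exists by blast
  note p = polar_angle_components[OF \<theta>]
  define C where "C y = y $ 1 * cos \<theta> + y $ 2 * sin \<theta>" for y :: "real^2"
  define S where "S y = y $ 2 * cos \<theta> - y $ 1 * sin \<theta>" for y :: "real^2"
  define U where "U = {y. C y > 0}"
  define \<Theta> where "\<Theta> y = \<theta> + arcsin (S y / norm y)" for y
  have sq: "(C y)\<^sup>2 + (S y)\<^sup>2 = (norm y)\<^sup>2" for y
    unfolding C_def S_def norm_real2_sq using sin_cos_squared_add[of \<theta>] by algebra
  have sc: "(cos \<theta>)\<^sup>2 + (sin \<theta>)\<^sup>2 = 1" by simp
  have "C x = norm x * ((cos \<theta>)\<^sup>2 + (sin \<theta>)\<^sup>2)" unfolding C_def p power2_eq_square by (simp only: distrib_left mult_ac)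
  then have xU: "x \<in> U" using x by (simp add: U_def)
  have oU: "open U" unfolding U_def C_def by (intro open_Collect_less continuous_intros)
  have facts: "norm y > 0" "(S y / norm y)\<^sup>2 \<le> 1" "\<bar>S y / norm y\<bar> \<le> 1" "sqrt (1 - (S y / norm y)\<^sup>2) = C y / norm y" if "y \<in> U" for y
  proof -
    have C: "C y > 0" using that by (simp add: U_def)
    show n: "norm y > 0" using C by (auto simp: C_def)
    have e: "1 - (S y / norm y)\<^sup>2 = (C y / norm y)\<^sup>2" using sq[of y] n by (simp add: power_divide field_simps)
    then show "(S y / norm y)\<^sup>2 \<le> 1" using zero_le_power2[of "C y / norm y"] by linarith
    then show "\<bar>S y / norm y\<bar> \<le> 1" by (simp only: abs_square_le_1)
    show "sqrt (1 - (S y / norm y)\<^sup>2) = C y / norm y" unfolding e using C n by simp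
  qed
  have "angle_branch U \<Theta>"
    unfolding angle_branch_def
  proof (intro conjI oU ballI)
    have "continuous_on U (\<lambda>y. S y / norm y)" unfolding S_def using facts(1) by (intro continuous_intros) force
    then have "continuous_on U (\<lambda>y. arcsin (S y / norm y))"
    proof (rule continuous_on_compose2[OF continuous_on_arcsin'], intro image_subsetI)
      fix y assume "y \<in> U"
      from facts(3)[OF this] show "S y / norm y \<in> {- 1..1}"
        unfolding atLeastAtMost_iff by linarith
    qed
    then show "continuous_on U \<Theta>" unfolding \<Theta>_def[abs_def] by (rule continuous_on_add[OF continuous_on_const])
    fix y assume y: "y \<in> U"
    have b: "- 1 \<le> S y / norm y" "S y / norm y \<le> 1" using facts(3)[OF y] by linarith+
    have s: "sin (arcsin (S y / norm y)) = S y / norm y" by (rule sin_arcsin[OF b])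
    have c: "cos (arcsin (S y / norm y)) = C y / norm y" unfolding cos_arcsin[OF b] by (rule facts(4)[OF y])
    have "norm y * cos (\<Theta> y) = C y * cos \<theta> - S y * sin \<theta>" "norm y * sin (\<Theta> y) = C y * sin \<theta> + S y * cos \<theta>"
      unfolding \<Theta>_def cos_add sin_add s c using facts(1)[OF y] by (auto simp: field_simps)
    moreover have "C y * cos \<theta> - S y * sin \<theta> = y $ 1" "C y * sin \<theta> + S y * cos \<theta> = y $ 2"
      unfolding C_def S_def using sc by algebra+
    ultimately show "polar_angle y (\<Theta> y)" unfolding polar_angle_def by (simp add: vec_eq_iff forall_2)
  qed
  then show thesis using xU that by blast
qed

text \<open>All branches of the angle have the same gradient \<open>\<nabla>\<theta> = (- x\<^sub>2, x\<^sub>1) / |x|\<^sup>2\<close>, so the choice in the definition of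
\<open>stream_grad\<close> is determined.\<close>

lemma stream_grad_eq:
  assumes x: "x \<noteq> 0" and W: "open W" "x \<in> W"
    and \<psi>: "\<And>y \<theta>. y \<in> W \<Longrightarrow> polar_angle y \<theta> \<Longrightarrow> \<psi> y \<theta> = f y + k * \<theta>"
    and f: "GDERIV f x :> a"
  shows "stream_grad \<psi> x = a + (k / (norm x)\<^sup>2) *\<^sub>R vector [- (x $ 2), x $ 1]"
proof -
  define v where "v = a + (k / (norm x)\<^sup>2) *\<^sub>R vector [- (x $ 2), x $ 1]"
  have key: "GDERIV (\<lambda>y. \<psi> y (\<Theta> y)) x :> v" if "x \<in> U" "angle_branch U \<Theta>" for U \<Theta>
  proof -
    have "GDERIV (\<lambda>y. f y + k * \<Theta> y) x :> a + (k *\<^sub>R ((1 / (norm x)\<^sup>2) *\<^sub>R vector [- (x $ 2), x $ 1]) + \<Theta> x *\<^sub>R 0)"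
      by (intro GDERIV_add f GDERIV_mult GDERIV_const angle_branch_derivative[OF that(2,1) x])
    then have d: "GDERIV (\<lambda>y. f y + k * \<Theta> y) x :> v" by (simp add: v_def)
    have "open (U \<inter> W)" "x \<in> U \<inter> W" using that W unfolding angle_branch_def by auto
    show ?thesis unfolding gderiv_def
    proof (rule has_derivative_transform_within_open[OF d[unfolded gderiv_def] \<open>open (U \<inter> W)\<close> \<open>x \<in> U \<inter> W\<close>])
      fix y assume "y \<in> U \<inter> W"
      then show "f y + k * \<Theta> y = \<psi> y (\<Theta> y)" using \<psi> that by (auto simp: angle_branch_def)
    qed
  qed
  obtain U \<Theta> where U: "x \<in> U" "angle_branch U \<Theta>" using angle_branch_exists[OF x] by blast
  have "\<exists>U \<Theta>. x \<in> U \<and> angle_branch U \<Theta> \<and> GDERIV (\<lambda>y. \<psi> y (\<Theta> y)) x :> v" using key[OF U] U by blast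
  then have "\<exists>U \<Theta>. x \<in> U \<and> angle_branch U \<Theta> \<and> GDERIV (\<lambda>y. \<psi> y (\<Theta> y)) x :> stream_grad \<psi> x"
    unfolding stream_grad_def by (rule someI)
  then show ?thesis using key GDERIV_unique unfolding v_def by blast
qed

section \<open>The single-valued part of the stream function\<close>

text \<open>If \<open>h\<close> has zeros, only the part before the first one and the part after the last one contribute to
\<open>h 1 - h 0\<close>, and on these parts \<open>h\<close> is differentiable.\<close>

lemma Lipschitz_off_zero_set_interval:
  fixes h :: "real \<Rightarrow> real"
  assumes cont: "continuous_on {0..1} h" and Z: "closed Z" "\<And>t. t \<in> Z \<Longrightarrow> h t = 0"
    and der: "\<And>t. t \<in> {0..1} - Z \<Longrightarrow> \<exists>d. (h has_real_derivative d) (at t) \<and> \<bar>d\<bar> \<le> L"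
    and L: "0 \<le> L"
  shows "\<bar>h 1 - h 0\<bar> \<le> L"
proof -
  have mv: "\<bar>h b - h a\<bar> \<le> L * (b - a)" if ab: "0 \<le> a" "a \<le> b" "b \<le> 1" "\<And>t. a < t \<Longrightarrow> t < b \<Longrightarrow> t \<notin> Z" for a b
  proof (cases "a = b")
    case False
    then have "a < b" using ab by simp
    then obtain l z where lz: "a < z" "z < b" "(h has_real_derivative l) (at z)" "h b - h a = (b - a) * l"
      using MVT[of a b h] continuous_on_subset[OF cont, of "{a..b}"] der ab
      by (metis (no_types, lifting) Diff_iff atLeastAtMost_iff atLeastatMost_subset_iff less_imp_le order_trans real_differentiable_def)
    obtain d where d: "(h has_real_derivative d) (at z)" "\<bar>d\<bar> \<le> L" using der[of z] lz ab by fastforce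
    then have "l = d" using lz DERIV_unique by blast
    then show ?thesis using lz d \<open>a < b\<close> by (simp add: abs_mult mult.commute mult_left_mono)
  qed (use L in simp)
  define T where "T = Z \<inter> {0..1}"
  show ?thesis
  proof (cases "T = {}")
    case True
    then have "t \<notin> Z" if "0 < t" "t < 1" for t using that by (auto simp: T_def)
    then show ?thesis using mv[of 0 1] by simp
  next
    case False
    have cT: "compact T" unfolding T_def using Z(1) by (simp add: closed_Int_compact)
    obtain a where a: "a \<in> T" "\<And>t. t \<in> T \<Longrightarrow> a \<le> t" using compact_attains_inf[OF cT False] by blast
    obtain b where b: "b \<in> T" "\<And>t. t \<in> T \<Longrightarrow> t \<le> b" using compact_attains_sup[OF cT False] by blast
    have ab: "0 \<le> a" "a \<le> 1" "0 \<le> b" "b \<le> 1" "a \<le> b" "h a = 0" "h b = 0" using a b Z(2) by (auto simp: T_def)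
    have "\<bar>h a - h 0\<bar> \<le> L * (a - 0)" by (rule mv) (use a ab in \<open>force simp: T_def\<close>)+
    moreover have "\<bar>h 1 - h b\<bar> \<le> L * (1 - b)" by (rule mv) (use b ab in \<open>force simp: T_def\<close>)+
    moreover have "L * a + L * (1 - b) \<le> L * 1" using mult_left_mono[OF ab(5) L] by (simp add: algebra_simps)
    ultimately show ?thesis using ab(6,7) by (simp add: algebra_simps)
  qed
qed

text \<open>A segment may cross the boundary infinitely often, but the extended function vanishes outside \<open>S\<close> and on its frontier, so the one-dimensional lemma applies along the segment.\<close>

lemma Lipschitz_zero_extension:
  fixes w :: "real^2 \<Rightarrow> real"
  assumes S: "open S" and cont: "continuous_on (closure S) w" and bd: "\<And>x. x \<in> frontier S \<Longrightarrow> w x = 0"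
    and der: "\<And>x. x \<in> S \<Longrightarrow> GDERIV w x :> g x" and g: "\<And>x. x \<in> S \<Longrightarrow> norm (g x) \<le> L" and L: "0 \<le> L"
  shows "\<bar>(if x \<in> S then w x else 0) - (if y \<in> S then w y else 0)\<bar> \<le> L * norm (x - y)"
proof -
  define W where "W x = (if x \<in> S then w x else 0)" for x
  have "continuous_on (closure S \<union> - S) (\<lambda>x. if x \<in> closure S then w x else 0)"
  proof (rule continuous_on_cases)
    show "\<forall>x. x \<in> closure S \<and> x \<notin> closure S \<or> x \<in> - S \<and> x \<in> closure S \<longrightarrow> w x = 0"
      using bd S by (auto simp: frontier_def interior_open)
  qed (use S cont in auto)
  moreover have "closure S \<union> - S = UNIV" using closure_subset by blast
  moreover have "(\<lambda>x. if x \<in> closure S then w x else 0) = W"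
    using bd S closure_subset by (fastforce simp: W_def frontier_def interior_open)
  ultimately have cW: "continuous_on UNIV W" by metis
  have dW: "GDERIV W z :> g z" if "z \<in> S" for z
    using der[OF that] unfolding gderiv_def
    by (rule has_derivative_transform_within_open[OF _ S that]) (auto simp: W_def)
  define p where "p t = y + t *\<^sub>R (x - y)" for t
  have cp: "continuous_on A p" for A unfolding p_def by (intro continuous_intros)
  have "\<bar>W (p 1) - W (p 0)\<bar> \<le> L * norm (x - y)"
  proof (rule Lipschitz_off_zero_set_interval[where Z="p -` (- S)"])
    show "continuous_on {0..1} (\<lambda>t. W (p t))" by (rule continuous_on_compose2[OF cW cp]) simp
    show "closed (p -` (- S))" by (rule closed_vimage[OF _ cp]) (use S in auto)
    show "W (p t) = 0" if "t \<in> p -` (- S)" for t using that by (auto simp: W_def)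
    fix t assume "t \<in> {0..1} - p -` (- S)"
    then have pt: "p t \<in> S" by auto
    have "(p has_derivative (\<lambda>r. r *\<^sub>R (x - y))) (at t)" unfolding p_def by (auto intro!: derivative_eq_intros)
    from has_derivative_compose[OF this dW[OF pt, unfolded gderiv_def]]
    have "((\<lambda>t. W (p t)) has_real_derivative (x - y) \<bullet> g (p t)) (at t)"
      unfolding has_field_derivative_def by (rule has_derivative_eq_rhs) (auto simp: mult.commute)
    moreover have "\<bar>(x - y) \<bullet> g (p t)\<bar> \<le> L * norm (x - y)"
      using Cauchy_Schwarz_ineq2[of "x - y" "g (p t)"] mult_left_mono[OF g[OF pt], of "norm (x - y)"] by (simp add: mult.commute)
    ultimately show "\<exists>d. ((\<lambda>t. W (p t)) has_real_derivative d) (at t) \<and> \<bar>d\<bar> \<le> L * norm (x - y)" by blast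
  qed (use L in simp)
  moreover have p: "p 1 = x" "p 0 = y" by (simp_all add: p_def)
  ultimately show ?thesis unfolding p W_def by metis
qed

lemma C_k_nth: "open S \<Longrightarrow> C_k k S (\<lambda>x::real^2. x $ i)"
  by (rule C_k_bounded_linear) (auto intro: bounded_linear_vec_nth)

lemma C_k_norm_sq: "open S \<Longrightarrow> C_k k S (\<lambda>x::real^2. (norm x)\<^sup>2)"
  unfolding norm_real2_sq unfolding power2_eq_square by (intro C_k_add C_k_mult C_k_nth)

lemma C_k_norm:
  assumes "open S" "0 \<notin> S" shows "C_k k S (norm :: real^2 \<Rightarrow> real)"
proof -
  have p: "x \<in> S \<Longrightarrow> 0 < (norm x)\<^sup>2" for x using assms by auto
  have "C_k k S (\<lambda>x::real^2. ((norm x)\<^sup>2) powr (1/2))"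
    by (rule C_k_powr[OF assms(1) C_k_norm_sq[OF assms(1)] p])
  then show ?thesis
    by (rule C_k_cong[OF assms(1), rotated]) (simp add: powr_half_sqrt)
qed

text \<open>The field \<open>x / |x|\<^sup>2\<close> of a point source, which carries the multi-valued part of the stream function, is
divergence-free away from the origin.\<close>

lemma radial_field_pd:
  assumes "x \<noteq> (0::real^2)"
  shows "pd 1 (\<lambda>x. x $ 1 / (norm x)\<^sup>2) x + pd 2 (\<lambda>x. x $ 2 / (norm x)\<^sup>2) x = 0"
    "(\<lambda>x. x $ i / (norm x)\<^sup>2) differentiable (at x)"
proof -
  have n: "(norm x)\<^sup>2 \<noteq> 0" using assms by simp
  have dn: "((\<lambda>x::real^2. (norm x)\<^sup>2) has_derivative (\<lambda>h. 2 * (x \<bullet> h))) (at x)"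
    unfolding power2_norm_eq_inner
    by (rule has_derivative_eq_rhs, (rule derivative_intros)+) (auto simp: inner_commute)
  have d: "((\<lambda>x. x $ i / (norm x)\<^sup>2) has_derivative (\<lambda>h. (h $ i * (norm x)\<^sup>2 - x $ i * (2 * (x \<bullet> h))) / ((norm x)\<^sup>2 * (norm x)\<^sup>2))) (at x)" for i
    by (rule has_derivative_divide'[OF has_derivative_vec_nth dn n])
  show "(\<lambda>x. x $ i / (norm x)\<^sup>2) differentiable (at x)" using d differentiable_def by blast
  have "pd 1 (\<lambda>x. x $ 1 / (norm x)\<^sup>2) x + pd 2 (\<lambda>x. x $ 2 / (norm x)\<^sup>2) x
     = (((norm x)\<^sup>2 - x $ 1 * (2 * x $ 1)) + ((norm x)\<^sup>2 - x $ 2 * (2 * x $ 2))) / ((norm x)\<^sup>2 * (norm x)\<^sup>2)"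
    unfolding pd_eqI[OF d] by (subst add_divide_distrib[symmetric]) (simp add: inner_real2)
  also have "((norm x)\<^sup>2 - x $ 1 * (2 * x $ 1)) + ((norm x)\<^sup>2 - x $ 2 * (2 * x $ 2)) = 0"
    unfolding norm_real2_sq by (simp add: power2_eq_square)
  finally show "pd 1 (\<lambda>x. x $ 1 / (norm x)\<^sup>2) x + pd 2 (\<lambda>x. x $ 2 / (norm x)\<^sup>2) x = 0" by simp
qed

lemma divergence_pd:
  assumes S: "open S" "x \<in> S" and F: "\<And>y. y \<in> S \<Longrightarrow> F y = vector [f1 y, f2 y]"
    and d: "f1 differentiable (at x)" "f2 differentiable (at x)"
  shows "divergence F x = pd 1 f1 x + pd 2 f2 x"
proof -
  have "((\<lambda>y. f1 y *\<^sub>R axis 1 1 + f2 y *\<^sub>R axis 2 1) has_derivative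
     (\<lambda>h. frechet_derivative f1 (at x) h *\<^sub>R axis 1 1 + frechet_derivative f2 (at x) h *\<^sub>R (axis 2 1 :: real^2))) (at x)"
    by (intro has_derivative_add has_derivative_scaleR_left frechet_derivative_worksI d)
  then have "(F has_derivative
     (\<lambda>h. frechet_derivative f1 (at x) h *\<^sub>R axis 1 1 + frechet_derivative f2 (at x) h *\<^sub>R (axis 2 1 :: real^2))) (at x)"
    by (rule has_derivative_transform_within_open[OF _ S]) (simp add: F vec_eq_iff forall_2)
  from frechet_derivative_at[OF this, symmetric] show ?thesis
    unfolding divergence_def sum_2 pd_def by simp
qed

text \<open>The closed unit disc lies in the closure of \<open>D\<close>, so the exterior keeps away from the origin, where
the polar angle and \<open>x / |x|\<^sup>2\<close> are singular.\<close>

lemma exterior_facts: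
  assumes "admissible_domain D c"
  shows "open (exterior D)" "x \<in> exterior D \<Longrightarrow> norm x > 1" "x \<in> closure (exterior D) \<Longrightarrow> norm x \<ge> 1"
    "frontier (exterior D) \<subseteq> frontier D" "x \<in> frontier D \<Longrightarrow> norm x \<ge> 1"
proof -
  show "open (exterior D)" by (simp add: exterior_def open_Compl)
  have b: "ball 0 1 \<subseteq> D" "open D" using assms by (auto simp: admissible_domain_def)
  have "cball (0::real^2) 1 = closure (ball 0 1)" by (simp add: closure_ball)
  then have cb: "cball 0 1 \<subseteq> closure D" using closure_mono[OF b(1)] by simp
  show 1: "norm x > 1" if "x \<in> exterior D" for x using cb that by (force simp: exterior_def)
  have "exterior D \<subseteq> {x. 1 \<le> norm x}" using 1 by force
  moreover have "closed {x::real^2. 1 \<le> norm x}" by (intro closed_Collect_le continuous_intros)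
  ultimately have "closure (exterior D) \<subseteq> {x. 1 \<le> norm x}" by (rule closure_minimal)
  then show "x \<in> closure (exterior D) \<Longrightarrow> norm x \<ge> 1" by blast
  show "frontier (exterior D) \<subseteq> frontier D"
  proof -
    have "frontier (closure D) \<subseteq> frontier D"
      unfolding frontier_def using interior_mono[OF closure_subset[of D]] by auto
    then show ?thesis unfolding exterior_def frontier_complement .
  qed
  show "norm x \<ge> 1" if "x \<in> frontier D"
  proof (rule ccontr)
    assume "\<not> norm x \<ge> 1"
    then have "x \<in> D" using b(1) by auto
    then show False using that b(2) by (simp add: frontier_def interior_open)
  qed
qed

definition zero_extension :: "(real^2) set \<Rightarrow> (real^2 \<Rightarrow> real) \<Rightarrow> real^2 \<Rightarrow> real" where
  "zero_extension S w x = (if x \<in> S then w x else 0)"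

text \<open>What the limit process needs to know about a subsonic flow: \<open>w\<close> is the single-valued part of the stream
function, \<open>k\<close> the coefficient of the polar angle, the second clause encodes that \<open>w\<close> vanishes on the boundary and has a bounded gradient, and
the last one is irrotationality, which is the equation for the stream function.\<close>

definition stream_flow ::
    "real \<Rightarrow> (real^2) set \<Rightarrow> real \<Rightarrow> (real^2 \<Rightarrow> real) \<Rightarrow> (real^2 \<Rightarrow> real^2) \<Rightarrow> bool" where
  "stream_flow \<gamma> S k w u \<longleftrightarrow>
     C_k 2 S w \<and>
     (\<forall>x y. \<bar>zero_extension S w x - zero_extension S w y\<bar> \<le> (1 + k) * norm (x - y)) \<and>
     (\<forall>x\<in>S. norm (u x) < 1 \<and>
        gas_density \<gamma> ((norm (u x))\<^sup>2) * u x $ 1 = pd 2 w x + k * (x $ 1 / (norm x)\<^sup>2) \<and>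
        gas_density \<gamma> ((norm (u x))\<^sup>2) * u x $ 2 = - pd 1 w x + k * (x $ 2 / (norm x)\<^sup>2)) \<and>
     C_k 1 S (\<lambda>x. u x $ 1) \<and> C_k 1 S (\<lambda>x. u x $ 2) \<and>
     (\<forall>x\<in>S. pd 2 (\<lambda>x. u x $ 1) x = pd 1 (\<lambda>x. u x $ 2) x)"

text \<open>Since \<open>\<psi> = \<phi> + \<psi>\<^sub>2\<^sub>0 + k \<theta>\<close>, the single-valued part is \<open>w = \<phi> + \<psi>\<^sub>2\<^sub>0\<close>, and the boundary condition says that it
vanishes there. Its gradient is bounded by \<open>|\<nabla>\<psi>| + k |\<nabla>\<theta>| \<le> 1 + k\<close>.\<close>

lemma uniformly_subsonic_stream_flow:
  assumes adm: "admissible_domain D c" and \<gamma>: "\<gamma> > 1" and \<kappa>1: "0 < \<kappa>1"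
    and flow: "uniformly_subsonic_flow \<gamma> D \<kappa>1 \<kappa>2 u"
  shows "\<kappa>1\<^sup>2 + \<kappa>2\<^sup>2 < 1" "\<exists>w. stream_flow \<gamma> (exterior D) (rho0 \<gamma> \<kappa>1 \<kappa>2 * \<kappa>1) w u"
proof -
  define \<Omega> where "\<Omega> = exterior D"
  define k where "k = rho0 \<gamma> \<kappa>1 \<kappa>2 * \<kappa>1"
  note E = exterior_facts[OF adm, folded \<Omega>_def]
  obtain \<psi> \<phi> M where sol: "solves_problem \<gamma> D (H_density \<gamma>) \<kappa>1 \<kappa>2 \<psi> \<phi>"
    and M: "M < 1" "\<forall>x\<in>\<Omega>. norm (stream_grad \<psi> x) \<le> M"
    and u: "\<forall>x\<in>\<Omega>. u x = (1 / H_density \<gamma> ((norm (stream_grad \<psi> x))\<^sup>2)) *\<^sub>R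
                   vector [stream_grad \<psi> x $ 2, - (stream_grad \<psi> x $ 1)]"
    using flow unfolding uniformly_subsonic_flow_def \<Omega>_def by blast
  show sub: "\<kappa>1\<^sup>2 + \<kappa>2\<^sup>2 < 1" using sol unfolding solves_problem_def by blast
  note P = psi20_facts[OF \<gamma> \<kappa>1 sub]
  have \<psi>: "\<psi> x \<theta> - psi0 \<gamma> \<kappa>1 \<kappa>2 x \<theta> = \<phi> x" if "x \<in> closure \<Omega>" "polar_angle x \<theta>" for x \<theta>
    using sol that unfolding solves_problem_def \<Omega>_def by blast
  have \<phi>: "C_k 2 \<Omega> \<phi>" "continuous_on (closure \<Omega>) \<phi>" using sol unfolding solves_problem_def \<Omega>_def by blast+
  have pde: "divergence (\<lambda>y. (1 / H_density \<gamma> ((norm (stream_grad \<psi> y))\<^sup>2)) *\<^sub>R stream_grad \<psi> y) x = 0" if "x \<in> \<Omega>" for x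
    using sol that unfolding solves_problem_def \<Omega>_def by blast
  have bc: "\<psi> x \<theta> = psi10 \<gamma> \<kappa>1 \<kappa>2 \<theta>" if "x \<in> frontier D" "polar_angle x \<theta>" for x \<theta>
    using sol that unfolding solves_problem_def by blast
  have oO: "open \<Omega>" by (rule E(1))
  have O0: "0 \<notin> \<Omega>" using E(2) by force
  have k0: "k \<ge> 0" using rho0_facts(1)[OF \<gamma> \<kappa>1 sub] \<kappa>1 by (simp add: k_def)
  define w where "w x = \<phi> x + psi20 \<gamma> \<kappa>1 \<kappa>2 (norm x)" for x
  have Cw: "C_k 2 \<Omega> w" unfolding w_def[abs_def]
    by (intro C_k_add[OF oO] \<phi>(1) C_k_compose[OF oO _ _ P(2) C_k_norm[OF oO O0]]) (use E(2) in auto)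
  have dw: "w differentiable (at x)" if "x \<in> \<Omega>" for x using Cw that by (simp add: numeral_2_eq_2)
  define p :: "real^2 \<Rightarrow> real^2" where "p x = vector [pd 1 w x, pd 2 w x] + (k / (norm x)\<^sup>2) *\<^sub>R vector [- (x $ 2), x $ 1]" for x :: "real^2"
  have sg: "stream_grad \<psi> x = p x" if x: "x \<in> \<Omega>" for x
    unfolding p_def
  proof (rule stream_grad_eq[OF _ oO x, where f=w])
    show "x \<noteq> 0" using O0 x by blast
    show "\<psi> y \<theta> = w y + k * \<theta>" if "y \<in> \<Omega>" "polar_angle y \<theta>" for y \<theta>
      using \<psi>[of y \<theta>] that closure_subset[of \<Omega>] by (auto simp: psi0_def psi10_def w_def k_def)
    show "GDERIV w x :> vector [pd 1 w x, pd 2 w x]" by (rule GDERIV_pd[OF dw[OF x]])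
  qed
  have pM: "norm (p x) \<le> M" if "x \<in> \<Omega>" for x using M(2) sg that by auto
  have p1: "p x $ 1 = pd 1 w x - k * (x $ 2 / (norm x)\<^sup>2)" "p x $ 2 = pd 2 w x + k * (x $ 1 / (norm x)\<^sup>2)" for x
    by (simp_all add: p_def)
  have Cp: "C_k 1 \<Omega> (\<lambda>x. p x $ i)" for i
  proof -
    have 2: "C_k (Suc 1) \<Omega> w" using Cw by (simp add: numeral_2_eq_2)
    have q: "C_k 1 \<Omega> (\<lambda>x. k * (x $ j / (norm x)\<^sup>2))" for j
      by (intro C_k_mult C_k_const C_k_divide C_k_nth C_k_norm_sq oO) (use O0 in auto)
    have "C_k 1 \<Omega> (\<lambda>x. p x $ 1)" "C_k 1 \<Omega> (\<lambda>x. p x $ 2)" unfolding p1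
      by (intro C_k_diff C_k_add C_k_pd[OF 2] q oO)+
    then show ?thesis using exhaust_2[of i] by auto
  qed
  define h where "h x = H_density \<gamma> ((norm (p x))\<^sup>2)" for x
  have s1: "(norm (p x))\<^sup>2 < 1" if "x \<in> \<Omega>" for x
    using pM[OF that] M(1) by (simp add: abs_square_less_1)
  have h1: "h x \<ge> 1" if "x \<in> \<Omega>" for x unfolding h_def using H_density_spec(1)[OF \<gamma>] s1[OF that] by simp
  have Ch: "C_k 1 \<Omega> h" unfolding h_def[abs_def]
  proof (rule C_k_compose[OF oO _ _ H_density_C_k[OF \<gamma>]])
    show "C_k 1 \<Omega> (\<lambda>x. (norm (p x))\<^sup>2)" unfolding norm_real2_sq unfolding power2_eq_square
      by (intro C_k_add C_k_mult oO Cp)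
  qed (use s1 in auto)
  have u12: "u x $ 1 = p x $ 2 / h x" "u x $ 2 = - (p x $ 1 / h x)" if "x \<in> \<Omega>" for x
    using u that sg[OF that] by (simp_all add: h_def)
  have nu: "(norm (u x))\<^sup>2 = (norm (p x))\<^sup>2 / (h x)\<^sup>2" if "x \<in> \<Omega>" for x
    unfolding norm_real2_sq u12[OF that] by (simp add: power_divide add_divide_distrib)
  have Cu: "C_k 1 \<Omega> (\<lambda>x. u x $ 1)" "C_k 1 \<Omega> (\<lambda>x. u x $ 2)"
  proof -
    have d: "C_k 1 \<Omega> (\<lambda>x. p x $ i / h x)" for i by (rule C_k_divide[OF oO Cp Ch]) (use h1 in force)
    show "C_k 1 \<Omega> (\<lambda>x. u x $ 1)" by (rule C_k_cong[OF oO _ d[of 2]]) (simp add: u12)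
    show "C_k 1 \<Omega> (\<lambda>x. u x $ 2)" by (rule C_k_cong[OF oO _ C_k_minus[OF oO d[of 1]]]) (simp add: u12)
  qed
  have curl: "pd 2 (\<lambda>x. u x $ 1) x = pd 1 (\<lambda>x. u x $ 2) x" if x: "x \<in> \<Omega>" for x
  proof -
    have du: "(\<lambda>x. u x $ 1) differentiable (at x)" "(\<lambda>x. u x $ 2) differentiable (at x)" using Cu x by auto
    have "divergence (\<lambda>y. (1 / H_density \<gamma> ((norm (stream_grad \<psi> y))\<^sup>2)) *\<^sub>R stream_grad \<psi> y) x
      = pd 1 (\<lambda>x. - u x $ 2) x + pd 2 (\<lambda>x. u x $ 1) x"
    proof (rule divergence_pd[OF oO x _ _ du(1)])
      show "(\<lambda>x. - u x $ 2) differentiable (at x)" by (rule differentiable_minus[OF du(2)])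
      show "(1 / H_density \<gamma> ((norm (stream_grad \<psi> y))\<^sup>2)) *\<^sub>R stream_grad \<psi> y = vector [- u y $ 2, u y $ 1]" if "y \<in> \<Omega>" for y
        unfolding sg[OF that] using u12[OF that] by (simp add: vec_eq_iff forall_2 h_def)
    qed
    then show ?thesis using pde[OF x] pd_minus[OF du(2)] by simp
  qed
  have lip: "\<bar>zero_extension \<Omega> w x - zero_extension \<Omega> w y\<bar> \<le> (1 + k) * norm (x - y)" for x y
    unfolding zero_extension_def
  proof (rule Lipschitz_zero_extension[OF oO])
    show "continuous_on (closure \<Omega>) w" unfolding w_def[abs_def]
      by (intro continuous_on_add \<phi>(2) continuous_on_compose2[OF P(1)] continuous_on_norm_id) (use E(3) in auto)
    show "w x = 0" if x: "x \<in> frontier \<Omega>" for x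
    proof -
      obtain \<theta> where \<theta>: "polar_angle x \<theta>" using polar_angle_exists by blast
      have "x \<in> frontier D" "x \<in> closure \<Omega>" using x E(4) by (auto simp: frontier_def)
      then show ?thesis using \<psi>[OF _ \<theta>] bc[OF _ \<theta>] by (simp add: psi0_def w_def)
    qed
    show "GDERIV w x :> vector [pd 1 w x, pd 2 w x]" if "x \<in> \<Omega>" for x by (rule GDERIV_pd[OF dw[OF that]])
    show "norm (vector [pd 1 w x, pd 2 w x] :: real^2) \<le> 1 + k" if x: "x \<in> \<Omega>" for x
    proof -
      define z :: "real^2" where "z = vector [- (x $ 2), x $ 1]"
      have nx: "norm x > 1" by (rule E(2)[OF x])
      have "(norm z)\<^sup>2 = (norm x)\<^sup>2" unfolding norm_real2_sq z_def by simp
      then have nz: "norm z = norm x" by simp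
      have "norm ((k / (norm x)\<^sup>2) *\<^sub>R z) = k / norm x" using k0 nx nz by (simp add: power2_eq_square)
      also have "\<dots> \<le> k" using k0 nx by (simp add: divide_le_eq mult_le_cancel_left1)
      finally have "norm ((k / (norm x)\<^sup>2) *\<^sub>R z) \<le> k" .
      moreover have "vector [pd 1 w x, pd 2 w x] = p x - (k / (norm x)\<^sup>2) *\<^sub>R z" unfolding p_def z_def by simp
      ultimately show ?thesis using pM[OF x] M(1) norm_triangle_ineq4[of "p x" "(k / (norm x)\<^sup>2) *\<^sub>R z"] by simp
    qed
    show "0 \<le> 1 + k" using k0 by simp
  qed
  have main: "norm (u x) < 1 \<and>
        gas_density \<gamma> ((norm (u x))\<^sup>2) * u x $ 1 = pd 2 w x + k * (x $ 1 / (norm x)\<^sup>2) \<and>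
        gas_density \<gamma> ((norm (u x))\<^sup>2) * u x $ 2 = - pd 1 w x + k * (x $ 2 / (norm x)\<^sup>2)" if x: "x \<in> \<Omega>" for x
  proof -
    have g: "gas_density \<gamma> ((norm (u x))\<^sup>2) = h x"
      unfolding nu[OF x] h_def using H_density_bernoulli[OF \<gamma>, of "(norm (p x))\<^sup>2"] s1[OF x] by simp
    have hp: "(h x)\<^sup>2 \<ge> 1" using h1[OF x] by (simp add: one_le_power)
    have "(norm (p x))\<^sup>2 / (h x)\<^sup>2 \<le> (norm (p x))\<^sup>2 / 1" using hp by (intro divide_left_mono) auto
    then have "(norm (u x))\<^sup>2 < 1" unfolding nu[OF x] using s1[OF x] by simp
    then have "norm (u x) < 1" by (simp add: abs_square_less_1)
    moreover have "h x * u x $ 1 = p x $ 2" "h x * u x $ 2 = - p x $ 1" using u12[OF x] h1[OF x] by auto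
    ultimately show ?thesis unfolding g p1 by simp
  qed
  show "\<exists>w. stream_flow \<gamma> (exterior D) (rho0 \<gamma> \<kappa>1 \<kappa>2 * \<kappa>1) w u"
    unfolding stream_flow_def \<Omega>_def[symmetric] k_def[symmetric]
    by (intro exI[of _ w] conjI Cw allI lip ballI main Cu curl)
qed

section \<open>Euler equations of a smooth potential flow\<close>

lemma borel_measurable_indicator_times:
  fixes f :: "real^2 \<Rightarrow> real"
  assumes "open S" "continuous_on S f"
  shows "(\<lambda>x. indicator S x * f x) \<in> borel_measurable borel"
  using borel_measurable_continuous_on_indicator[OF _ assms(2)] assms(1) by simp

lemma weakly_div_freeI:
  assumes S: "open S" and F: "C_k 1 S F1" "C_k 1 S F2"
    and div: "\<And>x. x \<in> S \<Longrightarrow> pd 1 F1 x + pd 2 F2 x = 0"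
  shows "weakly_div_free S (\<lambda>x. vector [F1 x, F2 x])"
  unfolding weakly_div_free_def
proof (intro allI impI)
  fix v assume v: "test_function S v"
  obtain R B K where T: "\<And>k. C_k k UNIV v" "0 \<le> R" "\<And>x. norm x > R \<Longrightarrow> v x = 0" "\<And>x i. norm x > R \<Longrightarrow> pd i v x = 0"
    "\<And>i x. \<bar>pd i v x\<bar> \<le> B" "compact K" "K \<subseteq> S" "\<And>x. x \<notin> K \<Longrightarrow> v x = 0" "\<And>x. grad v x = vector [pd 1 v x, pd 2 v x]"
    by (rule test_function_facts[OF v], rule that)
  have e: "vector [F1 x, F2 x] \<bullet> grad v x = F1 x * pd 1 v x + F2 x * pd 2 v x" for x
    unfolding T(9) inner_real2 by simp
  have Cv: "C_k 1 S v" by (rule C_k_subset[OF T(1)]) simp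
  show "set_integrable lborel S (\<lambda>x. vector [F1 x, F2 x] \<bullet> grad v x) \<and> (LINT x:S|lborel. vector [F1 x, F2 x] \<bullet> grad v x) = 0"
    using weak_divergence_C1[OF S F Cv T(6,7) _ div] T(8)
    unfolding e set_integrable_def set_lebesgue_integral_def by simp
qed

text \<open>Dominated convergence: the gradient of a test function is bounded and has bounded support.\<close>

lemma weak_pairing_limit:
  fixes F :: "nat \<Rightarrow> real^2 \<Rightarrow> real^2"
  assumes meas: "\<And>n. (\<lambda>x. indicator S x *\<^sub>R F n x) \<in> borel_measurable borel" "(\<lambda>x. indicator S x *\<^sub>R G x) \<in> borel_measurable borel"
    and bound: "\<And>n x. x \<in> S \<Longrightarrow> norm (F n x) \<le> M"
    and conv: "AE x in lborel. x \<in> S \<longrightarrow> (\<lambda>n. F n x) \<longlonglongrightarrow> G x"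
    and v: "test_function T v"
  shows "set_integrable lborel S (\<lambda>x. G x \<bullet> grad v x)"
    "(\<lambda>n. LINT x:S|lborel. F n x \<bullet> grad v x) \<longlonglongrightarrow> (LINT x:S|lborel. G x \<bullet> grad v x)"
proof -
  obtain R B K where T: "\<And>k. C_k k UNIV v" "0 \<le> R" "\<And>x. norm x > R \<Longrightarrow> v x = 0" "\<And>x i. norm x > R \<Longrightarrow> pd i v x = 0"
    "\<And>i x. \<bar>pd i v x\<bar> \<le> B" "compact K" "K \<subseteq> T" "\<And>x. x \<notin> K \<Longrightarrow> v x = 0" "\<And>x. grad v x = vector [pd 1 v x, pd 2 v x]"
    by (rule test_function_facts[OF v], rule that)
  have gi: "grad v x = pd 1 v x *\<^sub>R axis 1 1 + pd 2 v x *\<^sub>R axis 2 1" for x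
    unfolding T(9) by (simp add: vec_eq_iff forall_2)
  have cg: "continuous_on UNIV (grad v)"
  proof -
    have "C_k 0 UNIV (pd i v)" for i by (rule C_k_pd[OF T(1)])
    then have "continuous_on UNIV (pd i v)" for i by simp
    then show ?thesis unfolding gi[abs_def] by (intro continuous_intros) auto
  qed
  have gm: "grad v \<in> borel_measurable borel" by (rule borel_measurable_continuous_onI[OF cg])
  have B0: "0 \<le> B" using T(5)[of 1 0] by linarith
  have gb: "norm (grad v x) \<le> 2 * B" for x
  proof -
    have "norm (grad v x) \<le> \<bar>pd 1 v x\<bar> + \<bar>pd 2 v x\<bar>"
      unfolding gi by (rule order_trans[OF norm_triangle_ineq]) (simp add: norm_axis_1)
    then show ?thesis using T(5)[of 1 x] T(5)[of 2 x] by linarith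
  qed
  have g0: "grad v x = 0" if "norm x > R" for x unfolding gi using T(4)[OF that] by simp
  define M' where "M' = \<bar>M\<bar>"
  have iw: "integrable lborel (\<lambda>x::real^2. M' * (2 * B) * indicator (cball 0 R) x)"
    using emeasure_lborel_cball_finite[of "0::real^2" R] by (intro integrable_mult_right) (auto simp: integrable_indicator_iff)
  have me: "(\<lambda>x. indicator S x *\<^sub>R (H x \<bullet> grad v x)) \<in> borel_measurable lborel"
    if "(\<lambda>x. indicator S x *\<^sub>R H x) \<in> borel_measurable borel" for H :: "real^2 \<Rightarrow> real^2"
  proof -
    have "(\<lambda>x. (indicator S x *\<^sub>R H x) \<bullet> grad v x) \<in> borel_measurable borel" using that gm by measurable
    then show ?thesis by simp
  qed
  have bd: "AE x in lborel. norm (indicator S x *\<^sub>R (F n x \<bullet> grad v x)) \<le> M' * (2 * B) * indicator (cball 0 R) x" for n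
  proof (rule AE_I2)
    fix x :: "real^2"
    show "norm (indicator S x *\<^sub>R (F n x \<bullet> grad v x)) \<le> M' * (2 * B) * indicator (cball 0 R) x"
    proof (cases "x \<in> S \<and> norm x \<le> R")
      case True
      have "\<bar>F n x \<bullet> grad v x\<bar> \<le> norm (F n x) * norm (grad v x)" by (rule Cauchy_Schwarz_ineq2)
      also have "\<dots> \<le> M' * (2 * B)" using bound[of x n] True gb[of x] by (intro mult_mono) (auto simp: M'_def)
      finally show ?thesis using True by simp
    next
      case False
      then show ?thesis using g0[of x] B0 by (auto simp: indicator_def M'_def)
    qed
  qed
  have cv: "AE x in lborel. (\<lambda>n. indicator S x *\<^sub>R (F n x \<bullet> grad v x)) \<longlonglongrightarrow> indicator S x *\<^sub>R (G x \<bullet> grad v x)"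
    using conv
  proof eventually_elim
    case (elim x)
    then show ?case by (cases "x \<in> S") (auto intro!: tendsto_intros)
  qed
  show "set_integrable lborel S (\<lambda>x. G x \<bullet> grad v x)"
    unfolding set_integrable_def by (rule integrable_dominated_convergence[OF me[OF meas(2)] me[OF meas(1)] iw cv bd])
  show "(\<lambda>n. LINT x:S|lborel. F n x \<bullet> grad v x) \<longlonglongrightarrow> (LINT x:S|lborel. G x \<bullet> grad v x)"
    unfolding set_lebesgue_integral_def by (rule integral_dominated_convergence[OF me[OF meas(2)] me[OF meas(1)] iw cv bd])
qed

context
  fixes \<gamma> k :: real and S :: "(real^2) set" and w :: "real^2 \<Rightarrow> real" and u :: "real^2 \<Rightarrow> real^2"
  assumes \<gamma>: "\<gamma> > 1" and S: "open S" "0 \<notin> S" and fl: "stream_flow \<gamma> S k w u"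
begin

lemma flow_C: "C_k 1 S (\<lambda>x. u x $ i)"
  using fl exhaust_2[of i] unfolding stream_flow_def by auto

lemma flow_norm: "x \<in> S \<Longrightarrow> (norm (u x))\<^sup>2 < 1"
  using fl unfolding stream_flow_def by (auto simp: abs_square_less_1)

lemma flow_norm_sq_C: "C_k 1 S (\<lambda>x. (norm (u x))\<^sup>2)"
  unfolding norm_real2_sq unfolding power2_eq_square by (intro C_k_add C_k_mult S(1) flow_C)

lemma flow_density_C: "C_k 1 S (\<lambda>x. gas_density \<gamma> ((norm (u x))\<^sup>2))"
  by (rule C_k_compose[OF S(1) _ _ gas_density_C_k[OF \<gamma>] flow_norm_sq_C])
    (use flow_norm sonic_less_max_speed[OF \<gamma>] in \<open>auto simp: less_imp_le\<close>)

lemma flow_pressure_C: "C_k 1 S (\<lambda>x. gas_density \<gamma> ((norm (u x))\<^sup>2) powr \<gamma> / \<gamma>)"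
proof -
  have "C_k 1 S (\<lambda>x. gas_density \<gamma> ((norm (u x))\<^sup>2) powr \<gamma> * (1 / \<gamma>))"
    by (intro C_k_mult C_k_powr C_k_const flow_density_C S(1))
      (use gas_density_ge_1[OF \<gamma>] flow_norm in \<open>force simp: less_imp_le intro: less_le_trans[OF zero_less_one]\<close>)
  then show ?thesis by simp
qed

lemma flow_momentum_field:
  "C_k 1 S (\<lambda>x. gas_density \<gamma> ((norm (u x))\<^sup>2) * u x $ i)"
  by (intro C_k_mult flow_density_C flow_C S(1))

text \<open>The mass flux is the sum of a rotated gradient, divergence-free since mixed derivatives commute, and
of a multiple of the point source field.\<close>

lemma flow_mass:
  assumes x: "x \<in> S"
  shows "pd 1 (\<lambda>x. gas_density \<gamma> ((norm (u x))\<^sup>2) * u x $ 1) x + pd 2 (\<lambda>x. gas_density \<gamma> ((norm (u x))\<^sup>2) * u x $ 2) x = 0"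
proof -
  have Cw: "C_k 2 S w" using fl unfolding stream_flow_def by blast
  have C1: "C_k 1 S (pd i w)" for i using C_k_pd[of 1 S w] Cw by (simp add: numeral_2_eq_2)
  have d: "pd i w differentiable (at x)" for i using C1 x by auto
  have x0: "x \<noteq> 0" using S x by blast
  note r = radial_field_pd(2)[OF x0]
  have k: "(\<lambda>x. k * (x $ i / (norm x)\<^sup>2)) differentiable (at x)" for i by (rule differentiable_mult[OF differentiable_const r])
  have pk: "pd i (\<lambda>x. k * (x $ i / (norm x)\<^sup>2)) x = k * pd i (\<lambda>x. x $ i / (norm x)\<^sup>2) x" for i
  proof -
    have "pd i (\<lambda>x. k) x = 0" using pd_eqI[OF has_derivative_const] by simp
    then show ?thesis using pd_mult[OF differentiable_const r, of i k] by simp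
  qed
  have dm: "(\<lambda>x. - pd 1 w x) differentiable (at x)" by (rule differentiable_minus[OF d])
  have "pd 1 (\<lambda>x. pd 2 w x + k * (x $ 1 / (norm x)\<^sup>2)) x = pd 1 (\<lambda>x. gas_density \<gamma> ((norm (u x))\<^sup>2) * u x $ 1) x"
    by (rule pd_cong(1)[OF S(1) x]) (use fl differentiable_add[OF d k] in \<open>auto simp: stream_flow_def\<close>)
  moreover have "pd 2 (\<lambda>x. - pd 1 w x + k * (x $ 2 / (norm x)\<^sup>2)) x = pd 2 (\<lambda>x. gas_density \<gamma> ((norm (u x))\<^sup>2) * u x $ 2) x"
    by (rule pd_cong(1)[OF S(1) x]) (use fl differentiable_add[OF dm k] in \<open>auto simp: stream_flow_def\<close>)
  moreover have "pd 1 (\<lambda>x. pd 2 w x + k * (x $ 1 / (norm x)\<^sup>2)) x = pd 1 (pd 2 w) x + k * pd 1 (\<lambda>x. x $ 1 / (norm x)\<^sup>2) x"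
    using pd_add[OF d k] pk by simp
  moreover have "pd 2 (\<lambda>x. - pd 1 w x + k * (x $ 2 / (norm x)\<^sup>2)) x = - pd 2 (pd 1 w) x + k * pd 2 (\<lambda>x. x $ 2 / (norm x)\<^sup>2) x"
    using pd_add[OF dm k] pd_minus[OF d] pk by simp
  moreover have "pd 1 (pd 2 w) x = pd 2 (pd 1 w) x" by (rule mixed_partials_commute[OF S(1) Cw x])
  moreover have "k * pd 1 (\<lambda>x. x $ 1 / (norm x)\<^sup>2) x + k * pd 2 (\<lambda>x. x $ 2 / (norm x)\<^sup>2) x = 0"
    using radial_field_pd(1)[OF x0] by (simp add: distrib_left[symmetric])
  ultimately show ?thesis by linarith
qed

text \<open>By conservation of mass, \<open>div (\<rho> u u\<^sub>i) = \<rho> u \<bullet> \<nabla>u\<^sub>i\<close>. As \<open>u\<close> is irrotational, this is \<open>\<rho> \<partial>\<^sub>i |u|\<^sup>2 / 2\<close>,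
which is \<open>- \<partial>\<^sub>i p\<close> by Bernoulli's law.\<close>

lemma flow_momentum:
  assumes x: "x \<in> S"
  shows "pd 1 (\<lambda>x. gas_density \<gamma> ((norm (u x))\<^sup>2) * (u x $ 1)\<^sup>2 + gas_density \<gamma> ((norm (u x))\<^sup>2) powr \<gamma> / \<gamma>) x
     + pd 2 (\<lambda>x. gas_density \<gamma> ((norm (u x))\<^sup>2) * u x $ 1 * u x $ 2) x = 0"
    and "pd 1 (\<lambda>x. gas_density \<gamma> ((norm (u x))\<^sup>2) * u x $ 1 * u x $ 2) x
     + pd 2 (\<lambda>x. gas_density \<gamma> ((norm (u x))\<^sup>2) * (u x $ 2)\<^sup>2 + gas_density \<gamma> ((norm (u x))\<^sup>2) powr \<gamma> / \<gamma>) x = 0"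
proof -
  define \<rho> where "\<rho> x = gas_density \<gamma> ((norm (u x))\<^sup>2)" for x
  define P where "P x = \<rho> x powr \<gamma> / \<gamma>" for x
  define m where "m i x = \<rho> x * u x $ i" for i x
  have du: "(\<lambda>x. u x $ i) differentiable (at x)" for i using flow_C x by auto
  have dm: "m i differentiable (at x)" for i using flow_momentum_field x by (auto simp: m_def[abs_def] \<rho>_def)
  have dP: "P differentiable (at x)" using flow_pressure_C x by (auto simp: P_def[abs_def] \<rho>_def)
  have dq: "(\<lambda>x. (norm (u x))\<^sup>2) differentiable (at x)" using flow_norm_sq_C x by auto
  have mass: "pd 1 (m 1) x + pd 2 (m 2) x = 0" using flow_mass[OF x] by (simp add: m_def[abs_def] \<rho>_def)
  have curl: "pd 2 (\<lambda>x. u x $ 1) x = pd 1 (\<lambda>x. u x $ 2) x" using fl x unfolding stream_flow_def by blast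
  have q: "pd i (\<lambda>x. (norm (u x))\<^sup>2) x = 2 * u x $ 1 * pd i (\<lambda>x. u x $ 1) x + 2 * u x $ 2 * pd i (\<lambda>x. u x $ 2) x" for i
    unfolding norm_real2_sq unfolding power2_eq_square
    by (subst pd_add[OF differentiable_mult[OF du du] differentiable_mult[OF du du]]) (simp add: pd_mult[OF du du])
  have PP: "pd i P x = - \<rho> x / 2 * pd i (\<lambda>x. (norm (u x))\<^sup>2) x" for i
    unfolding P_def[abs_def] \<rho>_def
    by (rule pd_compose[OF dq pressure_has_derivative[OF \<gamma>]]) (use flow_norm[OF x] in simp)
  have Pi: "pd i P x = - (m 1 x * pd i (\<lambda>x. u x $ 1) x + m 2 x * pd i (\<lambda>x. u x $ 2) x)" for i
    unfolding PP q m_def by (simp add: algebra_simps)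
  have mu: "pd j (\<lambda>x. m i x * u x $ l) x = m i x * pd j (\<lambda>x. u x $ l) x + pd j (m i) x * u x $ l" for i j l
    by (rule pd_mult[OF dm du])
  have muP: "pd j (\<lambda>x. m i x * u x $ l + P x) x = pd j (\<lambda>x. m i x * u x $ l) x + pd j P x" for i j l
    by (rule pd_add[OF differentiable_mult[OF dm du] dP])
  have mass': "pd 2 (m 2) x = - pd 1 (m 1) x" using mass by simp
  have 1: "pd 1 (\<lambda>x. m 1 x * u x $ 1 + P x) x + pd 2 (\<lambda>x. m 2 x * u x $ 1) x = 0"
    unfolding muP mu Pi curl mass' by (simp add: algebra_simps)
  have 2: "pd 1 (\<lambda>x. m 1 x * u x $ 2) x + pd 2 (\<lambda>x. m 2 x * u x $ 2 + P x) x = 0"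
    unfolding muP mu Pi curl mass' by (simp add: algebra_simps)
  show "pd 1 (\<lambda>x. gas_density \<gamma> ((norm (u x))\<^sup>2) * (u x $ 1)\<^sup>2 + gas_density \<gamma> ((norm (u x))\<^sup>2) powr \<gamma> / \<gamma>) x
     + pd 2 (\<lambda>x. gas_density \<gamma> ((norm (u x))\<^sup>2) * u x $ 1 * u x $ 2) x = 0"
    using 1 unfolding m_def P_def \<rho>_def by (simp add: power2_eq_square mult_ac)
  show "pd 1 (\<lambda>x. gas_density \<gamma> ((norm (u x))\<^sup>2) * u x $ 1 * u x $ 2) x
     + pd 2 (\<lambda>x. gas_density \<gamma> ((norm (u x))\<^sup>2) * (u x $ 2)\<^sup>2 + gas_density \<gamma> ((norm (u x))\<^sup>2) powr \<gamma> / \<gamma>) x = 0"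
    using 2 unfolding m_def P_def \<rho>_def by (simp add: power2_eq_square mult_ac)
qed

lemma flow_weak_euler: "weak_euler \<gamma> S (\<lambda>x. gas_density \<gamma> ((norm (u x))\<^sup>2)) u"
  unfolding weak_euler_def Let_def
proof (intro conjI)
  have sq: "C_k 1 S (\<lambda>x. (u x $ i)\<^sup>2)" for i
    unfolding power2_eq_square by (intro C_k_mult flow_C S(1))
  have uu: "C_k 1 S (\<lambda>x. gas_density \<gamma> ((norm (u x))\<^sup>2) * u x $ 1 * u x $ 2)"
    by (intro C_k_mult flow_C flow_density_C S(1))
  have up: "C_k 1 S (\<lambda>x. gas_density \<gamma> ((norm (u x))\<^sup>2) * (u x $ i)\<^sup>2 + gas_density \<gamma> ((norm (u x))\<^sup>2) powr \<gamma> / \<gamma>)" for i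
    by (rule C_k_add[OF S(1) C_k_mult[OF S(1) flow_density_C sq] flow_pressure_C])
  show "weakly_div_free S (\<lambda>x. vector [gas_density \<gamma> ((norm (u x))\<^sup>2) * u x $ 1, gas_density \<gamma> ((norm (u x))\<^sup>2) * u x $ 2])"
    by (rule weakly_div_freeI[OF S(1) flow_momentum_field flow_momentum_field flow_mass])
  show "weakly_div_free S (\<lambda>x. vector [gas_density \<gamma> ((norm (u x))\<^sup>2) * (u x $ 1)\<^sup>2 + gas_density \<gamma> ((norm (u x))\<^sup>2) powr \<gamma> / \<gamma>,
      gas_density \<gamma> ((norm (u x))\<^sup>2) * u x $ 1 * u x $ 2])"
    by (rule weakly_div_freeI[OF S(1) up uu flow_momentum(1)])
  show "weakly_div_free S (\<lambda>x. vector [gas_density \<gamma> ((norm (u x))\<^sup>2) * u x $ 1 * u x $ 2,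
      gas_density \<gamma> ((norm (u x))\<^sup>2) * (u x $ 2)\<^sup>2 + gas_density \<gamma> ((norm (u x))\<^sup>2) powr \<gamma> / \<gamma>])"
    by (rule weakly_div_freeI[OF S(1) uu up flow_momentum(2)])
  show "weakly_div_free S (\<lambda>x. vector [- (u x $ 2), u x $ 1])"
  proof (rule weakly_div_freeI[OF S(1) C_k_minus[OF S(1) flow_C] flow_C])
    fix x assume x: "x \<in> S"
    have du: "(\<lambda>x. u x $ 2) differentiable (at x)" using flow_C[of 2] x by auto
    show "pd 1 (\<lambda>x. - u x $ 2) x + pd 2 (\<lambda>x. u x $ 1) x = 0"
      using pd_minus[OF du] fl x unfolding stream_flow_def by simp
  qed
qed

end

section \<open>The normal trace of the mass flux\<close>

text \<open>The squared positive part is the simplest \<open>C\<^sup>1\<close> function that is constant on a half-line; it serves to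
build cutoffs.\<close>

lemma DERIV_max_square: "((\<lambda>t::real. (max 0 t)\<^sup>2) has_real_derivative 2 * max 0 t) (at t)"
proof -
  consider "t > 0" | "t < 0" | "t = 0" by linarith
  then show ?thesis
  proof cases
    case 1
    have "((\<lambda>t. t\<^sup>2) has_real_derivative 2 * max 0 t) (at t)" using 1 by (auto intro!: derivative_eq_intros)
    then show ?thesis
      by (rule has_field_derivative_transform_within_open[where S="{0<..}"]) (use 1 in auto)
  next
    case 2
    have "((\<lambda>t. 0) has_real_derivative 2 * max 0 t) (at t)" using 2 by simp
    then show ?thesis
      by (rule has_field_derivative_transform_within_open[where S="{..<0}"]) (use 2 in auto)
  next
    case 3
    have "((\<lambda>h. ((max 0 (0 + h))\<^sup>2 - (max 0 0)\<^sup>2) / h) \<longlongrightarrow> (0::real)) (at 0)"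
    proof (rule Lim_null_comparison)
      show "\<forall>\<^sub>F h::real in at 0. norm (((max 0 (0 + h))\<^sup>2 - (max 0 0)\<^sup>2) / h) \<le> \<bar>h\<bar>"
        by (rule always_eventually) (auto simp: max_def power2_eq_square)
      show "((\<lambda>h::real. \<bar>h\<bar>) \<longlongrightarrow> 0) (at 0)" by (intro tendsto_rabs_zero tendsto_ident_at)
    qed
    then show ?thesis unfolding 3 by (simp add: DERIV_def)
  qed
qed

lemma C_1_max_square: "C_k 1 UNIV (\<lambda>t::real. (max 0 t)\<^sup>2)"
proof -
  have "C_k 0 UNIV (\<lambda>t::real. 2 * max 0 t)" by (auto intro!: continuous_intros)
  then show ?thesis using C_k_real_SucI[OF open_UNIV DERIV_max_square, of 0] by simp
qed

lemma C_k_pd_swap: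
  assumes "C_k 2 UNIV v" shows "pd i (pd j v) x = pd j (pd i v) x"
  by (rule mixed_partials_commute[OF open_UNIV assms]) simp

text \<open>The product of the Lipschitz function \<open>zero_extension S w\<close> with \<open>q\<close> is Lipschitz with bounded support, and it is
differentiable off the frontier, a null set. So the integral of its derivative over the plane is 0,
without any boundary term and without regularity of \<open>w\<close> at the boundary.\<close>

lemma zero_extension_parts:
  fixes w q :: "real^2 \<Rightarrow> real"
  assumes S: "open S" "0 \<notin> S" and null: "frontier S \<in> null_sets lborel"
    and Cw: "C_k 1 S w" and L: "0 \<le> L"
    and lip: "\<And>x y. \<bar>zero_extension S w x - zero_extension S w y\<bar> \<le> L * norm (x - y)"
    and q: "C_k 1 UNIV q" and supp: "\<And>x. norm x > R \<Longrightarrow> q x = 0" and R: "0 \<le> R"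
  shows "integrable lborel (\<lambda>x. indicator S x * (pd i w x * q x + w x * pd i q x))"
    "(\<integral>x. indicator S x * (pd i w x * q x + w x * pd i q x) \<partial>lborel) = 0"
proof -
  define W where "W = zero_extension S w"
  have dq: "(q has_derivative frechet_derivative q (at x)) (at x)" for x
    by (rule C_k_has_derivative[of 0 UNIV]) (use q in auto)
  have cq: "continuous_on UNIV (\<lambda>x. frechet_derivative q (at x) b)" if "b \<in> Basis" for b using q that by simp
  obtain Lq where Lq: "\<And>x y. \<bar>q x - q y\<bar> \<le> Lq * norm (x - y)"
    using Lipschitz_of_C1_bounded_support[OF dq cq supp] by blast
  obtain B where B: "\<And>x. \<bar>q x\<bar> \<le> B"
  proof -
    have "\<bar>q x\<bar> \<le> \<bar>Lq\<bar> * (2 * R + 1)" for x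
    proof (cases "norm x > R")
      case False
      \<comment> \<open>A point outside the support, from which the bound for \<open>q\<close> is measured.\<close>
      define z :: "real^2" where "z = (R + 1) *\<^sub>R axis 1 1"
      have nz: "norm z = R + 1" using R by (simp add: z_def norm_axis_1)
      have "\<bar>q x - q z\<bar> \<le> Lq * norm (x - z)" by (rule Lq)
      also have "\<dots> \<le> \<bar>Lq\<bar> * (2 * R + 1)"
        using norm_triangle_ineq4[of x z] nz False by (intro mult_mono) auto
      finally show ?thesis using supp[of z] nz by simp
    qed (use supp R in simp)
    then show thesis by (rule that)
  qed
  have B0: "0 \<le> B" using B[of 0] by linarith
  have W0: "W 0 = 0" using S by (simp add: W_def zero_extension_def)
  have WR: "\<bar>W x\<bar> \<le> L * R" if "norm x \<le> R" for x
    using lip[of x 0] W0 mult_left_mono[OF that L] by (simp add: W_def)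
  have lipf: "\<bar>W x * q x - W y * q y\<bar> \<le> (L * R * \<bar>Lq\<bar> + B * L) * norm (x - y)" for x y
  proof -
    have main: "\<bar>W x * q x - W y * q y\<bar> \<le> (L * R * \<bar>Lq\<bar> + B * L) * norm (x - y)" if x: "norm x \<le> R" for x y
    proof -
      have "W x * q x - W y * q y = W x * (q x - q y) + q y * (W x - W y)" by (simp add: algebra_simps)
      then have "\<bar>W x * q x - W y * q y\<bar> \<le> \<bar>W x\<bar> * \<bar>q x - q y\<bar> + \<bar>q y\<bar> * \<bar>W x - W y\<bar>"
        by (metis abs_mult abs_triangle_ineq)
      also have "\<dots> \<le> (L * R) * (\<bar>Lq\<bar> * norm (x - y)) + B * (L * norm (x - y))"
      proof (intro add_mono mult_mono)
        show "\<bar>q x - q y\<bar> \<le> \<bar>Lq\<bar> * norm (x - y)" using Lq[of x y] mult_right_mono[OF abs_ge_self, of "norm (x - y)" Lq] by simp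
        show "\<bar>W x - W y\<bar> \<le> L * norm (x - y)" using lip by (simp add: W_def)
      qed (use WR[OF x] B B0 L R in auto)
      finally show ?thesis by (simp add: algebra_simps)
    qed
    show ?thesis
    proof (cases "norm x \<le> R")
      case True then show ?thesis by (rule main)
    next
      case x: False
      show ?thesis
      proof (cases "norm y \<le> R")
        case True then show ?thesis using main[OF True, of x] by (simp add: abs_minus_commute norm_minus_commute)
      next
        case False then show ?thesis using x supp L R B0 by simp
      qed
    qed
  qed
  have z: "W x * q x = 0" if "norm x > R" for x using supp that by simp
  define g where "g x = indicator S x * (pd i w x * q x + w x * pd i q x)" for x
  have "C_k 0 S (pd i w)" "C_k 0 UNIV (pd i q)" using C_k_pd[of 0 S w] C_k_pd[of 0 UNIV q] Cw q by auto
  then have gm: "g \<in> borel_measurable borel" unfolding g_def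
    by (intro borel_measurable_indicator_times S(1) continuous_intros)
      (use C_k_imp_continuous_on[OF Cw] C_k_imp_continuous_on[OF q] in \<open>auto intro: continuous_on_subset\<close>)
  have ae: "AE x in lborel. ((\<lambda>t. W (x + t *\<^sub>R axis i 1) * q (x + t *\<^sub>R axis i 1)) has_real_derivative g x) (at 0)"
    using AE_not_in[OF null]
  proof eventually_elim
    case (elim x)
    show ?case
    proof (cases "x \<in> S")
      case True
      have d: "w differentiable (at x)" "q differentiable (at x)" using Cw q True by auto
      then have dm: "(\<lambda>x. w x * q x) differentiable (at x)" by (rule differentiable_mult)
      have "((\<lambda>x. w x * q x) has_derivative frechet_derivative (\<lambda>x. w x * q x) (at x)) (at x)"
        using dm frechet_derivative_works by blast
      then have "((\<lambda>x. W x * q x) has_derivative frechet_derivative (\<lambda>x. w x * q x) (at x)) (at x)"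
        by (rule has_derivative_transform_within_open[OF _ S(1) True]) (simp add: W_def zero_extension_def)
      from has_derivative_directional[OF this, of "axis i 1"]
      show ?thesis using pd_mult[OF d, of i] True unfolding pd_def[of i "\<lambda>x. w x * q x"]
        by (simp add: g_def add.commute)
    next
      case False
      then have x: "x \<in> - closure S" using elim S(1) by (auto simp: frontier_def interior_open)
      have "((\<lambda>x. W x * q x) has_derivative (\<lambda>h. 0)) (at x)"
        by (rule has_derivative_transform_within_open[OF has_derivative_const[of 0] _ x])
          (use closure_subset in \<open>auto simp: W_def zero_extension_def\<close>)
      from has_derivative_directional[OF this, of "axis i 1"]
      show ?thesis using False by (simp add: g_def)
    qed
  qed
  show "integrable lborel (\<lambda>x. indicator S x * (pd i w x * q x + w x * pd i q x))"
    "(\<integral>x. indicator S x * (pd i w x * q x + w x * pd i q x) \<partial>lborel) = 0"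
    using integral_directional_derivative_Lipschitz[OF lipf z ae gm] unfolding g_def by auto
qed

text \<open>Move the derivatives from \<open>w\<close> to \<open>v\<close>; the mixed derivatives of \<open>v\<close> cancel.\<close>

lemma rotated_gradient_orthogonal:
  fixes w v :: "real^2 \<Rightarrow> real"
  assumes S: "open S" "0 \<notin> S" and null: "frontier S \<in> null_sets lborel"
    and Cw: "C_k 1 S w" and L: "0 \<le> L"
    and lip: "\<And>x y. \<bar>zero_extension S w x - zero_extension S w y\<bar> \<le> L * norm (x - y)"
    and v: "test_function T v"
  shows "integrable lborel (\<lambda>x. indicator S x * (pd 2 w x * pd 1 v x - pd 1 w x * pd 2 v x))"
    "(\<integral>x. indicator S x * (pd 2 w x * pd 1 v x - pd 1 w x * pd 2 v x) \<partial>lborel) = 0"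
proof -
  obtain R B K where T: "\<And>k. C_k k UNIV v" "0 \<le> R" "\<And>x. norm x > R \<Longrightarrow> v x = 0" "\<And>x i. norm x > R \<Longrightarrow> pd i v x = 0"
    "\<And>i x. \<bar>pd i v x\<bar> \<le> B" "compact K" "K \<subseteq> T" "\<And>x. x \<notin> K \<Longrightarrow> v x = 0" "\<And>x. grad v x = vector [pd 1 v x, pd 2 v x]"
    by (rule test_function_facts[OF v], rule that)
  have C: "C_k 1 UNIV (pd i v)" for i by (rule C_k_pd[OF T(1)])
  note z = zero_extension_parts[OF S null Cw L lip C T(4) T(2)]
  have sw: "pd 1 (pd 2 v) x = pd 2 (pd 1 v) x" for x by (rule C_k_pd_swap[OF T(1)])
  have e: "indicator S x * (pd 2 w x * pd 1 v x - pd 1 w x * pd 2 v x)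
    = indicator S x * (pd 2 w x * pd 1 v x + w x * pd 2 (pd 1 v) x) - indicator S x * (pd 1 w x * pd 2 v x + w x * pd 1 (pd 2 v) x)" for x
    unfolding sw by (simp add: algebra_simps)
  show "integrable lborel (\<lambda>x. indicator S x * (pd 2 w x * pd 1 v x - pd 1 w x * pd 2 v x))"
    "(\<integral>x. indicator S x * (pd 2 w x * pd 1 v x - pd 1 w x * pd 2 v x) \<partial>lborel) = 0"
    unfolding e using z[of 2 1] z[of 1 2] by simp_all
qed

text \<open>The total integral over the plane of the divergence of a \<open>C\<^sup>1\<close> field with bounded support is 0, so the
integral over the exterior is minus the one over \<open>D\<close>, which the divergence theorem evaluates. The
point source field is singular inside \<open>D\<close> and is modified in the unit disc first.\<close>

lemma radial_field_trace:
  assumes adm: "admissible_domain D c" and n: "inner_unit_normal D c n" and v: "test_function T v"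
  shows "integrable lborel (\<lambda>x. indicator (exterior D) x * (x $ 1 / (norm x)\<^sup>2 * pd 1 v x + x $ 2 / (norm x)\<^sup>2 * pd 2 v x))"
    "(\<integral>x. indicator (exterior D) x * (x $ 1 / (norm x)\<^sup>2 * pd 1 v x + x $ 2 / (norm x)\<^sup>2 * pd 2 v x) \<partial>lborel)
      = arclength_integral c (\<lambda>x. 1 / norm x * (sgn x \<bullet> n x) * v x)"
proof -
  define \<Omega> where "\<Omega> = exterior D"
  note E = exterior_facts[OF adm, folded \<Omega>_def]
  obtain R B K where T: "\<And>k. C_k k UNIV v" "0 \<le> R" "\<And>x. norm x > R \<Longrightarrow> v x = 0" "\<And>x i. norm x > R \<Longrightarrow> pd i v x = 0"
    "\<And>i x. \<bar>pd i v x\<bar> \<le> B" "compact K" "K \<subseteq> T" "\<And>x. x \<notin> K \<Longrightarrow> v x = 0" "\<And>x. grad v x = vector [pd 1 v x, pd 2 v x]"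
    by (rule test_function_facts[OF v], rule that)
  \<comment> \<open>A positive \<open>C\<^sup>1\<close> function that equals \<open>|x|\<^sup>2\<close> for \<open>|x| \<ge> 1\<close>, in particular on the curve and outside.\<close>
  define h where "h x = (norm x)\<^sup>2 + (max 0 (1 - (norm x)\<^sup>2))\<^sup>2" for x :: "real^2"
  have hpos: "h x > 0" for x
  proof (cases "x = 0")
    case True then show ?thesis by (simp add: h_def)
  next
    case False then show ?thesis unfolding h_def by (intro add_pos_nonneg) auto
  qed
  have h1: "h x = (norm x)\<^sup>2" if "norm x \<ge> 1" for x using that one_le_power[of "norm x" 2] by (simp add: h_def)
  have Ch: "C_k 1 UNIV h" unfolding h_def[abs_def]
    by (intro C_k_add open_UNIV C_k_norm_sq C_k_compose[OF _ _ _ C_1_max_square] C_k_diff C_k_const) auto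
  define G where "G i x = v x * (x $ i / h x)" for i x
  have CG: "C_k 1 UNIV (G i)" for i unfolding G_def[abs_def]
    by (intro C_k_mult open_UNIV T(1) C_k_divide C_k_nth Ch hpos)
  have G0: "G i x = 0" if "norm x > R" for i x using T(3)[OF that] by (simp add: G_def)
  define dG where "dG x = pd 1 (G 1) x + pd 2 (G 2) x" for x
  have idG: "integrable lborel dG" "(\<integral>x. dG x \<partial>lborel) = 0"
    unfolding dG_def[abs_def] using integral_pd_C1[where R=R, OF CG G0, of 1 1] integral_pd_C1[where R=R, OF CG G0, of 2 2] by simp_all
  have dGO: "dG x = x $ 1 / (norm x)\<^sup>2 * pd 1 v x + x $ 2 / (norm x)\<^sup>2 * pd 2 v x" if x: "x \<in> \<Omega>" for x
  proof -
    have x0: "x \<noteq> 0" using E(2)[OF x] by auto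
    note r = radial_field_pd(2)[OF x0]
    have dv: "v differentiable (at x)" using T(1)[of 1] by simp
    have "pd i (\<lambda>x. v x * (x $ j / (norm x)\<^sup>2)) x = pd i (G j) x" for i j
      by (rule pd_cong(1)[OF E(1) x _ differentiable_mult[OF dv r]]) (use E(2) h1 in \<open>simp add: G_def less_imp_le\<close>)
    then have GG: "pd i (G j) x = v x * pd i (\<lambda>x. x $ j / (norm x)\<^sup>2) x + pd i v x * (x $ j / (norm x)\<^sup>2)" for i j
      using pd_mult[OF dv r] by metis
    have "dG x = v x * (pd 1 (\<lambda>x. x $ 1 / (norm x)\<^sup>2) x + pd 2 (\<lambda>x. x $ 2 / (norm x)\<^sup>2) x)
       + (pd 1 v x * (x $ 1 / (norm x)\<^sup>2) + pd 2 v x * (x $ 2 / (norm x)\<^sup>2))"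
      unfolding dG_def GG distrib_left by linarith
    then show ?thesis unfolding radial_field_pd(1)[OF x0] by (simp add: mult.commute)
  qed
  have c: "smooth_closed_curve c" "open D" "frontier D = c ` {0..1}" using adm unfolding admissible_domain_def by auto
  have nullF: "frontier D \<in> null_sets lborel" unfolding c(3) by (rule curve_null_set[OF c(1)])
  have dist: "AE x in lborel. indicator \<Omega> x * dG x = dG x - dG x * indicator D x"
    using AE_not_in[OF nullF]
  proof eventually_elim
    case (elim x)
    then have "x \<in> \<Omega> \<longleftrightarrow> x \<notin> D" using c(2) closure_subset[of D] by (auto simp: \<Omega>_def exterior_def frontier_def interior_open)
    then show ?case by (auto simp: indicator_def)
  qed
  have mD: "D \<in> sets lborel" "\<Omega> \<in> sets lborel" using c(2) E(1) by auto
  have iD: "integrable lborel (\<lambda>x. dG x * indicator D x)" using integrable_real_mult_indicator[OF mD(1) idG(1)] by simp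
  have iO: "integrable lborel (\<lambda>x. indicator \<Omega> x * dG x)" using integrable_real_mult_indicator[OF mD(2) idG(1)] by (simp add: mult.commute)
  have eq: "indicator \<Omega> x * dG x = indicator \<Omega> x * (x $ 1 / (norm x)\<^sup>2 * pd 1 v x + x $ 2 / (norm x)\<^sup>2 * pd 2 v x)" for x
    using dGO by (cases "x \<in> \<Omega>") auto
  show "integrable lborel (\<lambda>x. indicator (exterior D) x * (x $ 1 / (norm x)\<^sup>2 * pd 1 v x + x $ 2 / (norm x)\<^sup>2 * pd 2 v x))"
    using iO unfolding eq unfolding \<Omega>_def .
  have d: "(G i has_derivative frechet_derivative (G i) (at x)) (at x)" for i x
    by (rule C_k_has_derivative[of 0 UNIV]) (use CG in auto)
  have cd: "continuous_on UNIV (\<lambda>x. frechet_derivative (G i) (at x) b)" if "b \<in> Basis" for b i using CG[of i] that by simp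
  have "(\<integral>x. indicator \<Omega> x * dG x \<partial>lborel) = (\<integral>x. dG x - dG x * indicator D x \<partial>lborel)"
    by (rule integral_cong_AE[OF _ _ dist]) (use iO iD idG(1) in \<open>auto intro: borel_measurable_integrable\<close>)
  also have "\<dots> = - (\<integral>x. dG x * indicator D x \<partial>lborel)" using idG iD by simp
  also have "\<dots> = integral {0..1} (\<lambda>t. (G 1 (c t) * n (c t) $ 1 + G 2 (c t) * n (c t) $ 2) * norm (vector_derivative c (at t)))"
    using divergence_theorem_domain[where R=R, OF adm n d cd d cd G0 G0, of 1 2] unfolding dG_def pd_def by simp
  also have "\<dots> = arclength_integral c (\<lambda>x. 1 / norm x * (sgn x \<bullet> n x) * v x)"
    unfolding arclength_integral_def
  proof (rule integral_cong)
    fix t :: real assume "t \<in> {0..1}"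
    then have "norm (c t) \<ge> 1" using E(5) c(3) by blast
    then have "G i (c t) = v (c t) * (c t $ i / (norm (c t))\<^sup>2)" for i by (simp add: G_def h1)
    then show "(G 1 (c t) * n (c t) $ 1 + G 2 (c t) * n (c t) $ 2) * norm (vector_derivative c (at t))
      = 1 / norm (c t) * (sgn (c t) \<bullet> n (c t)) * v (c t) * norm (vector_derivative c (at t))"
      by (simp add: inner_real2 sgn_div_norm power2_eq_square divide_inverse algebra_simps)
  qed
  finally show "(\<integral>x. indicator (exterior D) x * (x $ 1 / (norm x)\<^sup>2 * pd 1 v x + x $ 2 / (norm x)\<^sup>2 * pd 2 v x) \<partial>lborel)
      = arclength_integral c (\<lambda>x. 1 / norm x * (sgn x \<bullet> n x) * v x)" unfolding eq unfolding \<Omega>_def .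
qed

lemma arclength_integral_cmult:
  "arclength_integral c (\<lambda>x. k * f x) = k * arclength_integral c f"
  unfolding arclength_integral_def by (simp add: mult.assoc)

text \<open>The rotated gradient of \<open>w\<close> does not contribute to the normal trace, because \<open>w\<close> vanishes on the curve.\<close>

lemma flow_trace:
  assumes adm: "admissible_domain D c" and n: "inner_unit_normal D c n" and k: "k \<ge> 0"
    and fl: "stream_flow \<gamma> (exterior D) k w u" and v: "test_function T v"
  shows "(LINT x:exterior D|lborel. (gas_density \<gamma> ((norm (u x))\<^sup>2) *\<^sub>R u x) \<bullet> grad v x)
    = k * arclength_integral c (\<lambda>x. 1 / norm x * (sgn x \<bullet> n x) * v x)"
proof -
  define \<Omega> where "\<Omega> = exterior D"
  note E = exterior_facts[OF adm, folded \<Omega>_def]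
  obtain R B K where T: "\<And>k. C_k k UNIV v" "0 \<le> R" "\<And>x. norm x > R \<Longrightarrow> v x = 0" "\<And>x i. norm x > R \<Longrightarrow> pd i v x = 0"
    "\<And>i x. \<bar>pd i v x\<bar> \<le> B" "compact K" "K \<subseteq> T" "\<And>x. x \<notin> K \<Longrightarrow> v x = 0" "\<And>x. grad v x = vector [pd 1 v x, pd 2 v x]"
    by (rule test_function_facts[OF v], rule that)
  have O0: "0 \<notin> \<Omega>" using E(2) by force
  have null: "frontier \<Omega> \<in> null_sets lborel"
  proof (rule null_sets_subset)
    show "frontier D \<in> null_sets lborel"
      using adm curve_null_set[of c] unfolding admissible_domain_def by simp
    show "frontier \<Omega> \<in> sets lborel" using frontier_closed by simp
  qed (rule E(4))
  have fl': "C_k 2 \<Omega> w" "\<And>x y. \<bar>zero_extension \<Omega> w x - zero_extension \<Omega> w y\<bar> \<le> (1 + k) * norm (x - y)"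
    "\<And>x. x \<in> \<Omega> \<Longrightarrow> gas_density \<gamma> ((norm (u x))\<^sup>2) * u x $ 1 = pd 2 w x + k * (x $ 1 / (norm x)\<^sup>2)"
    "\<And>x. x \<in> \<Omega> \<Longrightarrow> gas_density \<gamma> ((norm (u x))\<^sup>2) * u x $ 2 = - pd 1 w x + k * (x $ 2 / (norm x)\<^sup>2)"
    using fl unfolding stream_flow_def \<Omega>_def by auto
  have Cw: "C_k 1 \<Omega> w" by (rule C_k_le[OF fl'(1)]) simp
  note A = rotated_gradient_orthogonal[OF E(1) O0 null Cw _ fl'(2) v]
  note Bt = radial_field_trace[OF adm n v, folded \<Omega>_def]
  have "indicator \<Omega> x *\<^sub>R ((gas_density \<gamma> ((norm (u x))\<^sup>2) *\<^sub>R u x) \<bullet> grad v x)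
    = indicator \<Omega> x * (pd 2 w x * pd 1 v x - pd 1 w x * pd 2 v x)
      + k * (indicator \<Omega> x * (x $ 1 / (norm x)\<^sup>2 * pd 1 v x + x $ 2 / (norm x)\<^sup>2 * pd 2 v x))" for x
  proof (cases "x \<in> \<Omega>")
    case True
    have "(gas_density \<gamma> ((norm (u x))\<^sup>2) *\<^sub>R u x) \<bullet> grad v x
      = (gas_density \<gamma> ((norm (u x))\<^sup>2) * u x $ 1) * pd 1 v x + (gas_density \<gamma> ((norm (u x))\<^sup>2) * u x $ 2) * pd 2 v x"
      unfolding T(9) inner_real2 by simp
    then show ?thesis unfolding fl'(3)[OF True] fl'(4)[OF True] using True by (simp add: algebra_simps)
  qed simp
  then show ?thesis
    unfolding \<Omega>_def[symmetric] set_lebesgue_integral_def using A Bt k by simp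
qed

section \<open>Compactness of families of subsonic flows\<close>

text \<open>A diagonal sequence converges on a countable dense set, and equicontinuity extends the convergence to
every point. Dividing by \<open>1 + |x|\<close> makes the values bounded uniformly in \<open>x\<close>, as the selection of the diagonal sequence requires.\<close>

lemma Lipschitz_pointwise_convergent_subsequence:
  fixes W :: "nat \<Rightarrow> 'a::euclidean_space \<Rightarrow> real"
  assumes L: "0 \<le> L" and lip: "\<And>n x y. \<bar>W n x - W n y\<bar> \<le> L * norm (x - y)" and W0: "\<And>n. W n 0 = 0"
  obtains r where "strict_mono r" "\<And>x. convergent (\<lambda>n. W (r n) x)"
proof -
  obtain Q :: "'a set" where Q: "countable Q" "\<And>X. open X \<Longrightarrow> X \<noteq> {} \<Longrightarrow> \<exists>d\<in>Q. d \<in> X"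
    using countable_dense_exists by metis
  define f where "f n x = W n x / (1 + norm x)" for n x
  have pos: "1 + norm x > 0" for x :: 'a by (simp add: add_pos_nonneg)
  have "norm (f n x) \<le> L" for n x
  proof -
    have "\<bar>W n x\<bar> \<le> L * norm x" using lip[of n x 0] W0 by simp
    also have "\<dots> \<le> L * (1 + norm x)" using L by (intro mult_left_mono) auto
    finally show ?thesis using pos[of x] unfolding f_def by (simp add: pos_divide_le_eq)
  qed
  then obtain r where r: "strict_mono r" "\<And>x. x \<in> Q \<Longrightarrow> \<exists>l. (\<lambda>n. f (r n) x) \<longlonglongrightarrow> l"
    using function_convergent_subsequence[OF Q(1), of f L] by blast
  have convQ: "Cauchy (\<lambda>n. W (r n) x)" if x: "x \<in> Q" for x
  proof -
    obtain l where "(\<lambda>n. f (r n) x) \<longlonglongrightarrow> l" using r(2)[OF x] by blast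
    then have "(\<lambda>n. f (r n) x * (1 + norm x)) \<longlonglongrightarrow> l * (1 + norm x)" by (intro tendsto_intros)
    moreover have "f (r n) x * (1 + norm x) = W (r n) x" for n using pos[of x] unfolding f_def by simp
    ultimately show ?thesis using LIMSEQ_imp_Cauchy by simp
  qed
  have "Cauchy (\<lambda>n. W (r n) x)" for x
  proof (rule metric_CauchyI)
    fix e :: real assume e: "e > 0"
    define d where "d = e / (3 * (L + 1))"
    have d: "d > 0" "L * d \<le> e / 3"
    proof -
      show "d > 0" using e L by (simp add: d_def)
      have "L * d \<le> (L + 1) * d" using \<open>d > 0\<close> by (intro mult_right_mono) auto
      also have "\<dots> = e / 3"
      proof -
        have "M * (e / (3 * M)) = e / 3" if "M \<noteq> 0" for M :: real using that by simp
        from this[of "L + 1"] show ?thesis using L by (simp add: d_def)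
      qed
      finally show "L * d \<le> e / 3" .
    qed
    obtain y where y: "y \<in> Q" "y \<in> ball x d" using Q(2)[of "ball x d"] d by auto
    obtain M where M: "\<And>m n. m \<ge> M \<Longrightarrow> n \<ge> M \<Longrightarrow> dist (W (r m) y) (W (r n) y) < e / 3"
      using metric_CauchyD[OF convQ[OF y(1)], of "e / 3"] e by auto
    have near: "\<bar>W (r n) x - W (r n) y\<bar> \<le> e / 3" for n
    proof -
      have "norm (x - y) \<le> d" using y(2) by (simp add: dist_norm)
      then have "L * norm (x - y) \<le> L * d" using L by (rule mult_left_mono)
      then show ?thesis using lip[of "r n" x y] d(2) by linarith
    qed
    show "\<exists>M. \<forall>m\<ge>M. \<forall>n\<ge>M. dist (W (r m) x) (W (r n) x) < e"
    proof (intro exI[of _ M] allI impI)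
      fix m n assume "m \<ge> M" "n \<ge> M"
      then have "\<bar>W (r m) y - W (r n) y\<bar> < e / 3" using M by (simp add: dist_real_def)
      then show "dist (W (r m) x) (W (r n) x) < e" using near[of m] near[of n] unfolding dist_real_def by linarith
    qed
  qed
  then show thesis using that r(1) by (simp add: Cauchy_convergent_iff)
qed

text \<open>Along a fast subsequence the consecutive differences \<open>d j\<close> satisfy \<open>\<integral> d j\<^sup>4 \<le> 2 / 32\<^sup>j\<close> on \<open>B m\<close> for all
\<open>j \<ge> m\<close>. Since 16 is smaller than 32, the series of the \<open>16\<^sup>j d j\<^sup>4\<close> has finite integral and is finite almost
everywhere; since \<open>16 = 2\<^sup>4\<close>, there \<open>d j\<close> is bounded by a multiple of \<open>2\<^sup>-\<^sup>j\<close>, and the sequence converges as a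
telescoping series. Asking for \<open>j \<ge> m\<close> only lets one subsequence serve all sets \<open>B m\<close>.\<close>

lemma AE_convergent_subsequence_of_L4_Cauchy:
  fixes f :: "nat \<Rightarrow> 'a::euclidean_space \<Rightarrow> 'b::{banach, second_countable_topology}"
    and B :: "nat \<Rightarrow> 'a set" and \<eta> :: "nat \<Rightarrow> nat \<Rightarrow> real"
  assumes meas: "\<And>n. f n \<in> borel_measurable borel" and B: "\<And>m. B m \<in> sets borel"
    and Cauchy: "\<And>m i j. (\<integral>\<^sup>+x. ennreal (indicator (B m) x * norm (f i x - f j x) ^ 4) \<partial>lborel) \<le> ennreal (\<eta> m i + \<eta> m j)"
    and \<eta>: "\<And>m. \<eta> m \<longlonglongrightarrow> (0::real)"
  obtains s :: "nat \<Rightarrow> nat" where "strict_mono s" "AE x in lborel. \<forall>m. x \<in> B m \<longrightarrow> convergent (\<lambda>j. f (s j) x)"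
proof -
  have "\<exists>N. \<forall>m\<le>j. \<forall>i\<ge>N. \<eta> m i \<le> 1 / 32 ^ j" for j :: nat
  proof -
    have "\<forall>\<^sub>F i in sequentially. \<eta> m i < 1 / 32 ^ j" for m
      using order_tendstoD(2)[OF \<eta>, of "1 / 32 ^ j"] by simp
    then have "\<forall>\<^sub>F i in sequentially. \<forall>m\<in>{..j}. \<eta> m i < 1 / 32 ^ j"
      by (intro eventually_ball_finite) auto
    then show ?thesis unfolding eventually_sequentially by (meson atMost_iff less_imp_le)
  qed
  then obtain N where N: "\<And>j m i. m \<le> j \<Longrightarrow> i \<ge> N j \<Longrightarrow> \<eta> m i \<le> 1 / 32 ^ j" by metis
  \<comment> \<open>The sum makes \<open>s\<close> strictly increasing and at least \<open>N\<close>.\<close>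
  define s where "s j = j + (\<Sum>i\<le>j. N i)" for j
  have smono: "strict_mono s" unfolding strict_mono_Suc_iff by (simp add: s_def)
  have sN: "s j \<ge> N j" "s (Suc j) \<ge> N j" for j
  proof -
    have "N j \<le> (\<Sum>i\<le>j. N i)" by (rule member_le_sum) auto
    then show 1: "s j \<ge> N j" by (simp add: s_def)
    have "s j < s (Suc j)" using smono by (simp add: strict_mono_Suc_iff)
    then show "s (Suc j) \<ge> N j" using 1 by linarith
  qed
  define d where "d j x = norm (f (s (Suc j)) x - f (s j) x)" for j x
  have dm [measurable]: "d j \<in> borel_measurable borel" for j unfolding d_def using meas by measurable
  have conv: "AE x in lborel. x \<in> B m \<longrightarrow> convergent (\<lambda>j. f (s j) x)" for m
  proof -
    define h where "h j x = ennreal (16 ^ (j + m) * (indicator (B m) x * d (j + m) x ^ 4))" for j x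
    have hm [measurable]: "h j \<in> borel_measurable lborel" for j unfolding h_def using B by measurable
    have "(\<integral>\<^sup>+x. (\<Sum>j. h j x) \<partial>lborel) = (\<Sum>j. \<integral>\<^sup>+x. h j x \<partial>lborel)"
      by (rule nn_integral_suminf) simp
    also have "\<dots> \<le> (\<Sum>j. ennreal (2 * (1 / 2) ^ j))"
    proof (rule suminf_le)
      fix j
      have "(\<integral>\<^sup>+x. h j x \<partial>lborel) = (\<integral>\<^sup>+x. ennreal (16 ^ (j + m)) * ennreal (indicator (B m) x * d (j + m) x ^ 4) \<partial>lborel)"
        unfolding h_def by (intro nn_integral_cong ennreal_mult) (auto simp: d_def)
      also have "\<dots> = ennreal (16 ^ (j + m)) * (\<integral>\<^sup>+x. ennreal (indicator (B m) x * d (j + m) x ^ 4) \<partial>lborel)"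
        by (rule nn_integral_cmult) (use B in measurable)
      also have "\<dots> \<le> ennreal (16 ^ (j + m)) * ennreal (\<eta> m (s (Suc (j + m))) + \<eta> m (s (j + m)))"
        unfolding d_def by (intro mult_left_mono Cauchy) simp
      also have "\<dots> \<le> ennreal (16 ^ (j + m)) * ennreal (1 / 32 ^ (j + m) + 1 / 32 ^ (j + m))"
        using N[of m "j + m" "s (Suc (j + m))"] N[of m "j + m" "s (j + m)"] sN[of "j + m"]
        by (intro mult_left_mono ennreal_leI add_mono) auto
      also have "\<dots> = ennreal (16 ^ (j + m) * (1 / 32 ^ (j + m) + 1 / 32 ^ (j + m)))"
        by (rule ennreal_mult[symmetric]) auto
      also have "\<dots> \<le> ennreal (2 * (1 / 2) ^ j)"
      proof (rule ennreal_leI)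
        have "(32::real) ^ (j + m) = 16 ^ (j + m) * 2 ^ (j + m)" by (simp add: power_mult_distrib[symmetric])
        then have "(16::real) ^ (j + m) * (1 / 32 ^ (j + m) + 1 / 32 ^ (j + m)) = 2 * (1 / 2 ^ (j + m))" by simp
        also have "\<dots> \<le> 2 * (1 / 2 ^ j)" by (intro mult_left_mono divide_left_mono) (auto intro: power_increasing)
        also have "\<dots> = 2 * (1 / 2) ^ j" by (simp add: power_divide)
        finally show "(16::real) ^ (j + m) * (1 / 32 ^ (j + m) + 1 / 32 ^ (j + m)) \<le> 2 * (1 / 2) ^ j" .
      qed
      finally show "(\<integral>\<^sup>+x. h j x \<partial>lborel) \<le> ennreal (2 * (1 / 2) ^ j)" .
    qed auto
    also have "\<dots> < \<infinity>"
      by (subst suminf_ennreal2) (auto intro!: summable_mult summable_geometric)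
    finally have fin: "(\<integral>\<^sup>+x. (\<Sum>j. h j x) \<partial>lborel) < \<infinity>" .
    have "AE x in lborel. (\<Sum>j. h j x) \<noteq> \<infinity>"
      by (rule nn_integral_noteq_infinite) (use fin in auto)
    then show ?thesis
    proof eventually_elim
      case (elim x)
      show ?case
      proof
        assume x: "x \<in> B m"
        define C where "C = enn2real (\<Sum>j. h j x)"
        have hC: "16 ^ (j + m) * d (j + m) x ^ 4 \<le> C" for j
        proof -
          have "h j x \<le> (\<Sum>j. h j x)" using sum_le_suminf[of "\<lambda>j. h j x" "{j}"] by simp
          also have "\<dots> = ennreal C" unfolding C_def using elim by (simp add: less_top)
          finally have "ennreal (16 ^ (j + m) * d (j + m) x ^ 4) \<le> ennreal C" using x by (simp add: h_def)
          then show ?thesis by (subst (asm) ennreal_le_iff) (auto simp: C_def)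
        qed
        have dC: "d (j + m) x \<le> max 1 C * (1 / 2) ^ (j + m)" for j
        proof -
          define y where "y = 2 ^ (j + m) * d (j + m) x"
          have y0: "y \<ge> 0" by (simp add: y_def d_def)
          have "((2::real) ^ (j + m)) ^ 4 = (2 ^ 4) ^ (j + m)" by (metis power_mult mult.commute)
          then have "((2::real) ^ (j + m)) ^ 4 = 16 ^ (j + m)" by simp
          then have y4: "y ^ 4 \<le> C" using hC[of j] unfolding y_def power_mult_distrib by simp
          have "y \<le> max 1 C"
          proof (cases "y \<le> 1")
            case False
            then have "y ^ 1 \<le> y ^ 4" by (intro power_increasing) auto
            then show ?thesis using y4 by simp
          qed simp
          then show ?thesis unfolding y_def by (simp add: power_divide field_simps)
        qed
        have sm: "summable (\<lambda>j. f (s (Suc (j + m))) x - f (s (j + m)) x)"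
        proof (rule summable_norm_cancel, rule summable_comparison_test')
          show "summable (\<lambda>j. max 1 C * (1 / 2) ^ (j + m))"
            unfolding power_add by (intro summable_mult summable_mult2 summable_geometric) auto
          show "norm (norm (f (s (Suc (j + m))) x - f (s (j + m)) x)) \<le> max 1 C * (1 / 2) ^ (j + m)" if "j \<ge> 0" for j
            using dC[of j] by (simp add: d_def)
        qed
        define F where "F j = f (s (j + m)) x" for j
        have "summable (\<lambda>j. F (Suc j) - F j)" using sm by (simp add: F_def)
        then have "convergent (\<lambda>n. \<Sum>j<n. F (Suc j) - F j)" by (simp add: summable_iff_convergent)
        then have "convergent (\<lambda>n. F n - F 0)" by (simp add: sum_lessThan_telescope)
        then have "convergent (\<lambda>n. (F n - F 0) + F 0)" by (intro convergent_add convergent_const)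
        then have "convergent (\<lambda>n. f (s (n + m)) x)" by (simp add: F_def)
        then show "convergent (\<lambda>j. f (s j) x)" using convergent_ignore_initial_segment[of "\<lambda>j. f (s j) x" m] by simp
      qed
    qed
  qed
  show thesis
  proof (rule that[OF smono])
    show "AE x in lborel. \<forall>m. x \<in> B m \<longrightarrow> convergent (\<lambda>j. f (s j) x)"
      unfolding AE_all_countable using conv by blast
  qed
qed

lemma gas_density_derivative:
  assumes "\<gamma> > 1" "s \<le> 1"
  shows "(gas_density \<gamma> has_real_derivative - gas_density \<gamma> s / (\<gamma> + 1 - (\<gamma> - 1) * s)) (at s)"
proof -
  define b where "b s = (\<gamma> + 1 - (\<gamma> - 1) * s) / 2" for s
  have b: "b s > 0" using gas_density_base[OF assms] unfolding b_def by linarith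
  have db: "(b has_real_derivative - (\<gamma> - 1) / 2) (at s)"
    unfolding b_def[abs_def] by (auto intro!: derivative_eq_intros)
  have "((\<lambda>s. b s powr (1 / (\<gamma> - 1))) has_real_derivative
     (1 / (\<gamma> - 1)) * b s powr (1 / (\<gamma> - 1) - 1) * (- (\<gamma> - 1) / 2)) (at s)"
    by (rule DERIV_chain2[OF _ db, of "\<lambda>x. x powr (1 / (\<gamma> - 1))"]) (auto intro!: derivative_eq_intros simp: b)
  moreover have "(1 / (\<gamma> - 1)) * b s powr (1 / (\<gamma> - 1) - 1) * (- (\<gamma> - 1) / 2) = - (b s powr (1 / (\<gamma> - 1))) / (2 * b s)"
  proof -
    have A: "b s powr (1 / (\<gamma> - 1) - 1) = b s powr (1 / (\<gamma> - 1)) / b s" using b by (simp add: powr_diff)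
    have K: "(1 / a) * (y / z) * (- a / 2) = - y / (2 * z)" if "a \<noteq> 0" for a y z :: real
      using that by simp
    show ?thesis unfolding A by (rule K) (use assms in simp)
  qed
  ultimately have "((\<lambda>s. b s powr (1 / (\<gamma> - 1))) has_real_derivative - (b s powr (1 / (\<gamma> - 1))) / (2 * b s)) (at s)"
    by (simp only:)
  moreover have "gas_density \<gamma> = (\<lambda>s. b s powr (1 / (\<gamma> - 1)))" by (simp add: fun_eq_iff gas_density_def b_def)
  moreover have "\<gamma> + 1 - (\<gamma> - 1) * s = 2 * b s" by (simp add: b_def)
  ultimately show ?thesis by (simp only:)
qed

text \<open>The derivative of \<open>g(q\<^sup>2) q\<close> is at least \<open>1 - q\<^sup>2 \<ge> 1 - q\<close>, which degenerates at the sonic speed only to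
first order. Integrated over \<open>[q', q]\<close>, the bound \<open>1 - q\<close> leaves at least half the square of the
length of the interval.\<close>

lemma scalar_flux_growth:
  assumes \<gamma>: "\<gamma> > 1" and q: "0 \<le> q'" "q' \<le> q" "q \<le> 1"
  shows "gas_density \<gamma> (q\<^sup>2) * q - gas_density \<gamma> (q'\<^sup>2) * q' \<ge> (q - q')\<^sup>2 / 2"
proof -
  \<comment> \<open>The flux minus an antiderivative of \<open>1 - q\<close>.\<close>
  define F where "F q = gas_density \<gamma> (q\<^sup>2) * q - q + q\<^sup>2 / 2" for q
  have "F q' \<le> F q"
  proof (rule DERIV_nonneg_imp_nondecreasing[OF q(2)])
    fix x assume x: "q' \<le> x" "x \<le> q"
    have x1: "0 \<le> x" "x \<le> 1" "x\<^sup>2 \<le> 1" using x q by (auto simp: power_le_one)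
    define B where "B = \<gamma> + 1 - (\<gamma> - 1) * x\<^sup>2"
    define g where "g = gas_density \<gamma> (x\<^sup>2)"
    have B: "B \<ge> 2" using gas_density_base[OF \<gamma> x1(3)] by (simp add: B_def)
    have g: "g \<ge> 1" unfolding g_def by (rule gas_density_ge_1[OF \<gamma> x1(3)])
    have "((\<lambda>x. gas_density \<gamma> (x\<^sup>2)) has_real_derivative - g / B * (2 * x)) (at x)"
      unfolding g_def B_def
      by (rule DERIV_chain2[where f="gas_density \<gamma>" and g="\<lambda>x. x\<^sup>2", OF gas_density_derivative[OF \<gamma> x1(3)]])
        (auto intro!: derivative_eq_intros)
    then have "(F has_real_derivative g * 1 + (- g / B * (2 * x)) * x - 1 + x) (at x)"
      unfolding F_def[abs_def] g_def
      by (auto intro!: derivative_eq_intros)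
    moreover have "g * 1 + (- g / B * (2 * x)) * x - 1 + x \<ge> 0"
    proof -
      have "2 * x\<^sup>2 / B \<le> 2 * x\<^sup>2 / 2" using B by (intro divide_left_mono) auto
      then have 1: "1 - 2 * x\<^sup>2 / B \<ge> 1 - x\<^sup>2" by simp
      then have "g * (1 - 2 * x\<^sup>2 / B) \<ge> 1 * (1 - x\<^sup>2)" using g x1 by (intro mult_mono) auto
      moreover have "g * (1 - 2 * x\<^sup>2 / B) = g * 1 + (- g / B * (2 * x)) * x" by (simp add: algebra_simps power2_eq_square)
      moreover have "x\<^sup>2 \<le> x" using x1 by (simp add: power2_eq_square mult_left_le)
      moreover have "0 \<le> b - 1 + x" if "1 * (1 - c) \<le> a" "a = b" "c \<le> x" for a b c :: real using that by simp
      ultimately show ?thesis by blast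
    qed
    ultimately show "\<exists>y. (F has_real_derivative y) (at x) \<and> 0 \<le> y" by blast
  qed
  moreover have "(q - q') * (1 - q) \<ge> 0" using q by (intro mult_nonneg_nonneg) auto
  moreover have "(q - q')\<^sup>2 / 2 = q\<^sup>2 / 2 + q'\<^sup>2 / 2 - q * q'"
    by (simp add: power2_eq_square algebra_simps add_divide_distrib diff_divide_distrib)
  moreover have "(q - q') * (1 - q) = q - q' - q\<^sup>2 + q * q'" by (simp add: power2_eq_square algebra_simps)
  ultimately show ?thesis unfolding F_def by (simp add: field_simps)
qed

text \<open>Split \<open>|u - v|\<^sup>2\<close> into the radial part \<open>X\<^sup>2\<close> with \<open>X = | |u| - |v| |\<close> and the angular part
\<open>Y = 2 (|u| |v| - u \<bullet> v)\<close>. The inner product on the right splits in the same way. Its angular part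
is at least \<open>Y\<close> since densities are at least 1. Its radial part is degenerate at the
sonic speed and only bounds \<open>X\<^sup>3 / 2\<close>. This is why the exponent 4 appears instead of 2.\<close>

lemma momentum_monotonicity:
  fixes u v :: "'a::real_inner"
  assumes \<gamma>: "\<gamma> > 1" and uv: "norm u \<le> 1" "norm v \<le> 1"
  shows "norm (u - v) ^ 4 \<le> 8 * ((gas_density \<gamma> ((norm u)\<^sup>2) *\<^sub>R u - gas_density \<gamma> ((norm v)\<^sup>2) *\<^sub>R v) \<bullet> (u - v))"
proof -
  define q where "q = norm u"
  define q' where "q' = norm v"
  define \<rho> where "\<rho> = gas_density \<gamma> (q\<^sup>2)"
  define \<rho>' where "\<rho>' = gas_density \<gamma> (q'\<^sup>2)"
  define X where "X = \<bar>q - q'\<bar>"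
  define Y where "Y = 2 * (q * q' - u \<bullet> v)"
  have q: "0 \<le> q" "q \<le> 1" "0 \<le> q'" "q' \<le> 1" using uv by (auto simp: q_def q'_def)
  have \<rho>: "\<rho> \<ge> 1" "\<rho>' \<ge> 1" unfolding \<rho>_def \<rho>'_def using q by (auto intro!: gas_density_ge_1[OF \<gamma>] power_le_one)
  have Y: "0 \<le> Y" "Y \<le> 4"
  proof -
    have cs: "\<bar>u \<bullet> v\<bar> \<le> q * q'" unfolding q_def q'_def by (rule Cauchy_Schwarz_ineq2)
    have "u \<bullet> v \<le> q * q'" "- (u \<bullet> v) \<le> q * q'"
      using order_trans[OF abs_ge_self cs] order_trans[OF abs_ge_minus_self cs] by auto
    then show "0 \<le> Y" unfolding Y_def by simp
    have "q * q' \<le> 1 * 1" using q by (intro mult_mono) auto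
    then show "Y \<le> 4" unfolding Y_def using \<open>- (u \<bullet> v) \<le> q * q'\<close> by simp
  qed
  have X: "0 \<le> X" "X \<le> 1" unfolding X_def using q by auto
  have uu: "u \<bullet> u = q\<^sup>2" "v \<bullet> v = q'\<^sup>2" by (simp_all add: q_def q'_def power2_norm_eq_inner)
  have n2: "(norm (u - v))\<^sup>2 = X\<^sup>2 + Y"
    unfolding power2_norm_eq_inner X_def Y_def power2_abs
    using uu by (simp add: inner_diff_left inner_diff_right inner_commute power2_eq_square algebra_simps)
  have E: "(\<rho> *\<^sub>R u - \<rho>' *\<^sub>R v) \<bullet> (u - v) = (\<rho> * q - \<rho>' * q') * (q - q') + (\<rho> + \<rho>') * (Y / 2)"
  proof -
    have Y2: "Y / 2 = q * q' - u \<bullet> v" by (simp add: Y_def)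
    show ?thesis unfolding Y2
      using uu by (simp add: inner_diff_left inner_diff_right inner_commute power2_eq_square algebra_simps)
  qed
  have E1: "(\<rho> * q - \<rho>' * q') * (q - q') \<ge> X ^ 3 / 2"
  proof (cases "q' \<le> q")
    case True
    have "(q - q')\<^sup>2 / 2 * (q - q') \<le> (\<rho> * q - \<rho>' * q') * (q - q')"
      using scalar_flux_growth[OF \<gamma> q(3) True q(2)] True unfolding \<rho>_def \<rho>'_def by (intro mult_right_mono) auto
    then show ?thesis using True by (simp add: X_def power2_eq_square power3_eq_cube)
  next
    case False
    then have le: "q \<le> q'" by simp
    have "(q' - q)\<^sup>2 / 2 * (q' - q) \<le> (\<rho>' * q' - \<rho> * q) * (q' - q)"
      using scalar_flux_growth[OF \<gamma> q(1) le q(4)] le unfolding \<rho>_def \<rho>'_def by (intro mult_right_mono) auto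
    moreover have "(\<rho>' * q' - \<rho> * q) * (q' - q) = (\<rho> * q - \<rho>' * q') * (q - q')" by (simp add: algebra_simps)
    moreover have "X = q' - q" using le by (simp add: X_def)
    ultimately show ?thesis by (simp add: power2_eq_square power3_eq_cube)
  qed
  have E2: "(\<rho> + \<rho>') * (Y / 2) \<ge> 2 * (Y / 2)" using \<rho> Y by (intro mult_right_mono) auto
  have E8: "8 * ((\<rho> *\<^sub>R u - \<rho>' *\<^sub>R v) \<bullet> (u - v)) \<ge> 4 * X ^ 3 + 8 * Y"
  proof -
    have K: "4 * a + 8 * y \<le> 8 * (A + B)" if "a / 2 \<le> A" "2 * (y / 2) \<le> B" for a y A B :: real
      using that by simp
    show ?thesis unfolding E
      by (rule K[OF E1 E2])
  qed
  have "norm (u - v) ^ 4 = (X\<^sup>2 + Y)\<^sup>2" unfolding n2[symmetric] by (simp add: power_mult[symmetric])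
  also have "\<dots> \<le> 2 * (X\<^sup>2)\<^sup>2 + 2 * Y\<^sup>2"
    using zero_le_power2[of "X\<^sup>2 - Y"] by (simp add: power2_eq_square algebra_simps)
  also have "\<dots> \<le> 2 * X ^ 3 + 8 * Y"
  proof -
    have "X ^ 4 \<le> X ^ 3" using X by (intro power_decreasing) auto
    then have "(X\<^sup>2)\<^sup>2 \<le> X ^ 3" by (simp add: power_mult[symmetric])
    moreover have "Y * Y \<le> 4 * Y" using Y by (intro mult_right_mono) auto
    ultimately show ?thesis by (simp add: power2_eq_square)
  qed
  also have "\<dots> \<le> 4 * X ^ 3 + 8 * Y" using X by simp
  finally show ?thesis using E8 unfolding \<rho>_def \<rho>'_def q_def q'_def by linarith
qed

text \<open>For two flows of the sequence, \<open>u\<^sub>i - u\<^sub>j\<close> is irrotational, so its rotation \<open>(F1, F2)\<close> is divergence-free and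
orthogonal to \<open>\<nabla>(\<phi> (w\<^sub>i - w\<^sub>j))\<close>. The part of this with \<open>\<phi> \<nabla>(w\<^sub>i - w\<^sub>j)\<close> is \<open>\<phi> (m\<^sub>i - m\<^sub>j) \<bullet> (u\<^sub>i - u\<^sub>j)\<close> up to a
multiple of \<open>k\<^sub>i - k\<^sub>j\<close>, and the part with \<open>(w\<^sub>i - w\<^sub>j) \<nabla>\<phi>\<close> is small with \<open>w\<^sub>i - w\<^sub>j\<close> because velocities are
bounded. Monotonicity of the momentum turns the first part into the fourth power of \<open>|u\<^sub>i - u\<^sub>j|\<close>.\<close>

lemma local_energy_estimate:
  fixes u :: "nat \<Rightarrow> real^2 \<Rightarrow> real^2" and w :: "nat \<Rightarrow> real^2 \<Rightarrow> real" and k :: "nat \<Rightarrow> real"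
  assumes \<gamma>: "\<gamma> > 1" and S: "open S" "\<And>x. x \<in> S \<Longrightarrow> norm x \<ge> 1"
    and flow: "\<And>n. stream_flow \<gamma> S (k n) (w n) (u n)"
    and k: "\<And>n. 0 \<le> k n" "\<And>n. k n \<le> Kb" "k \<longlonglongrightarrow> kh"
    and conv: "\<And>x. (\<lambda>n. zero_extension S (w n) x) \<longlonglongrightarrow> Wl x"
    and ball: "cball a r \<subseteq> S" "r > 0"
  obtains \<eta> where "\<eta> \<longlonglongrightarrow> 0"
    "\<And>i j. (\<integral>\<^sup>+x. ennreal (indicator (ball a (r/2)) x * norm (u i x - u j x) ^ 4) \<partial>lborel) \<le> ennreal (\<eta> i + \<eta> j)"
proof -
  have S0: "0 \<notin> S" using S(2)[of 0] by auto
  \<comment> \<open>A \<open>C\<^sup>1\<close> cutoff: positive in the open ball, at least \<open>c0\<close> on the half ball, zero outside.\<close>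
  define \<phi> where "\<phi> x = (max 0 (r\<^sup>2 - ((x $ 1 - a $ 1)\<^sup>2 + (x $ 2 - a $ 2)\<^sup>2)))\<^sup>2" for x :: "real^2"
  have \<phi>n: "\<phi> x = (max 0 (r\<^sup>2 - (norm (x - a))\<^sup>2))\<^sup>2" for x unfolding \<phi>_def norm_real2_sq by simp
  have C\<phi>: "C_k 1 UNIV \<phi>" unfolding \<phi>_def[abs_def]
    by (rule C_k_compose[OF _ _ _ C_1_max_square])
      (unfold power2_eq_square, auto intro!: C_k_diff C_k_add C_k_mult C_k_const C_k_nth simp del: C_k.simps)
  have \<phi>0: "\<phi> x = 0" if "x \<notin> cball a r" for x
  proof -
    have "r < norm (x - a)" using that by (simp add: dist_norm norm_minus_commute)
    then have "r\<^sup>2 \<le> (norm (x - a))\<^sup>2" using ball(2) by (intro power_mono) auto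
    then show ?thesis by (simp add: \<phi>n)
  qed
  have \<phi>pos: "0 \<le> \<phi> x" for x by (simp add: \<phi>_def)
  have \<phi>le: "\<phi> x \<le> (r\<^sup>2)\<^sup>2" for x unfolding \<phi>n by (intro power_mono) auto
  define c0 where "c0 = (3 * r\<^sup>2 / 4)\<^sup>2"
  have c0: "c0 > 0" using ball(2) by (simp add: c0_def)
  have \<phi>c0: "c0 \<le> \<phi> x" if "x \<in> ball a (r/2)" for x
  proof -
    have "norm (x - a) \<le> r / 2" using that by (simp add: dist_norm norm_minus_commute)
    then have "(norm (x - a))\<^sup>2 \<le> (r/2)\<^sup>2" by (intro power_mono) auto
    then have N: "(norm (x - a))\<^sup>2 \<le> r\<^sup>2 / 4" by (simp only: power_divide) simp
    have "3 * R / 4 \<le> R - y" if "y \<le> R / 4" for y R :: real using that by simp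
    from this[OF N] have "3 * r\<^sup>2 / 4 \<le> r\<^sup>2 - (norm (x - a))\<^sup>2" .
    then have "3 * r\<^sup>2 / 4 \<le> max 0 (r\<^sup>2 - (norm (x - a))\<^sup>2)" by (rule order_trans[OF _ max.cobounded2])
    then show ?thesis unfolding c0_def \<phi>n by (intro power_mono) auto
  qed
  have d\<phi>: "(\<phi> has_derivative frechet_derivative \<phi> (at x)) (at x)" for x
    by (rule C_k_has_derivative[of 0 UNIV]) (use C\<phi> in auto)
  have c\<phi>: "continuous_on UNIV (\<lambda>x. frechet_derivative \<phi> (at x) b)" if "b \<in> Basis" for b using C\<phi> that by simp
  have \<phi>R: "\<phi> x = 0" if "norm x > norm a + r" for x
  proof (rule \<phi>0)
    have "norm (x - a) > r" using that norm_triangle_ineq2[of x a] by linarith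
    then show "x \<notin> cball a r" by (simp add: dist_norm norm_minus_commute)
  qed
  obtain Bc where Bc: "\<And>x b. b \<in> Basis \<Longrightarrow> \<bar>frechet_derivative \<phi> (at x) b\<bar> \<le> Bc"
  proof (rule C1_bounded_support_derivative[of \<phi> "\<lambda>x. frechet_derivative \<phi> (at x)" "norm a + r"])
    show "(\<phi> has_derivative frechet_derivative \<phi> (at x)) (at x)" for x by (rule d\<phi>)
    show "continuous_on UNIV (\<lambda>x. frechet_derivative \<phi> (at x) b)" if "b \<in> Basis" for b by (rule c\<phi>[OF that])
    show "\<phi> x = 0" if "norm x > norm a + r" for x by (rule \<phi>R[OF that])
  qed (rule that)
  have Bp: "\<bar>pd i \<phi> x\<bar> \<le> Bc" for i x unfolding pd_def by (rule Bc[OF axis_in_Basis_real2])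
  have Bc0: "0 \<le> Bc" using Bp[of 1 0] by linarith
  have pd0: "pd i \<phi> x = 0" if x: "x \<notin> cball a r" for i x
  proof -
    have "open (- cball a r)" by (simp add: open_Compl)
    then have "pd i (\<lambda>x. 0) x = pd i \<phi> x" by (rule pd_cong(1)) (use x \<phi>0 in auto)
    then show ?thesis using pd_eqI[OF has_derivative_const] by simp
  qed
  define W where "W n = zero_extension S (w n)" for n
  have lipW: "\<bar>W n x - W n y\<bar> \<le> (1 + Kb) * norm (x - y)" for n x y
  proof -
    have "\<bar>W n x - W n y\<bar> \<le> (1 + k n) * norm (x - y)" using flow unfolding stream_flow_def W_def by blast
    also have "\<dots> \<le> (1 + Kb) * norm (x - y)" using k by (intro mult_right_mono) auto
    finally show ?thesis .
  qed
  have Kb: "0 \<le> Kb" using k(1)[of 0] k(2)[of 0] by linarith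
  have Wm: "W n \<in> borel_measurable borel" for n
    by (intro borel_measurable_continuous_onI lipschitz_on_continuous_on[of "1 + Kb"] lipschitz_onI)
      (use lipW Kb in \<open>auto simp: dist_norm\<close>)
  have convW: "(\<lambda>n. W n x) \<longlonglongrightarrow> Wl x" for x using conv by (simp add: W_def)
  have Wlm: "Wl \<in> borel_measurable borel" by (rule borel_measurable_LIMSEQ_real[OF convW Wm])
  define M where "M = (1 + Kb) * (norm a + r)"
  have WM: "\<bar>W n x\<bar> \<le> M" if "x \<in> cball a r" for n x
  proof -
    have "norm x \<le> norm a + r" using that norm_triangle_ineq2[of x a] by (simp add: dist_norm norm_minus_commute)
    then have "(1 + Kb) * norm x \<le> M" unfolding M_def using Kb by (intro mult_left_mono) auto
    moreover have "W n 0 = 0" using S0 by (simp add: W_def zero_extension_def)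
    ultimately show ?thesis using lipW[of n x 0] by simp
  qed
  have WlM: "\<bar>Wl x\<bar> \<le> M" if "x \<in> cball a r" for x
    by (rule LIMSEQ_le_const2[OF tendsto_rabs[OF convW]]) (use WM[OF that] in auto)
  define Bd :: "real^2 \<Rightarrow> real" where "Bd x = indicator (cball a r) x" for x
  have iBd: "integrable lborel (\<lambda>x. c * Bd x)" for c :: real unfolding Bd_def
    using emeasure_lborel_cball_finite[of a r] by (intro integrable_mult_right) (auto simp: integrable_indicator_iff)
  have Bdm [measurable]: "Bd \<in> borel_measurable borel" unfolding Bd_def
    by (intro borel_measurable_indicator) simp
  define e where "e n = (\<integral>x. Bd x * \<bar>W n x - Wl x\<bar> \<partial>lborel)" for n
  have bde: "norm (Bd x * \<bar>W n x - Wl x\<bar>) \<le> 2 * M * Bd x" for n x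
  proof (cases "x \<in> cball a r")
    case True
    have "\<bar>W n x - Wl x\<bar> \<le> \<bar>W n x\<bar> + \<bar>Wl x\<bar>" by (rule abs_triangle_ineq4)
    then show ?thesis using WM[OF True, of n] WlM[OF True] True by (simp add: Bd_def)
  qed (simp add: Bd_def)
  have em: "(\<lambda>x. Bd x * \<bar>W n x - Wl x\<bar>) \<in> borel_measurable lborel" for n using Wm Wlm by measurable
  have ie: "integrable lborel (\<lambda>x. Bd x * \<bar>W n x - Wl x\<bar>)" for n
    by (rule Bochner_Integration.integrable_bound[OF iBd[of "2 * M"] em]) (use bde in \<open>auto intro: order_trans[OF _ abs_ge_self]\<close>)
  have elim: "e \<longlonglongrightarrow> 0"
  proof -
    have "(\<lambda>n. \<integral>x. Bd x * \<bar>W n x - Wl x\<bar> \<partial>lborel) \<longlonglongrightarrow> integral\<^sup>L lborel (\<lambda>x::real^2. 0 :: real)"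
    proof (rule integral_dominated_convergence[OF _ em iBd[of "2 * M"]])
      show "AE x in lborel. (\<lambda>n. Bd x * \<bar>W n x - Wl x\<bar>) \<longlonglongrightarrow> 0"
      proof (rule AE_I2)
        fix x :: "real^2"
        have "(\<lambda>n. Bd x * \<bar>W n x - Wl x\<bar>) \<longlonglongrightarrow> Bd x * \<bar>Wl x - Wl x\<bar>" by (intro tendsto_intros convW)
        then show "(\<lambda>n. Bd x * \<bar>W n x - Wl x\<bar>) \<longlonglongrightarrow> 0" by simp
      qed
      show "AE x in lborel. norm (Bd x * \<bar>W n x - Wl x\<bar>) \<le> 2 * M * Bd x" for n using bde by simp
    qed simp
    then show ?thesis unfolding e_def by simp
  qed
  define V where "V = (\<integral>x. Bd x \<partial>lborel)"
  have V0: "0 \<le> V" unfolding V_def by (rule integral_nonneg_AE) (simp add: Bd_def)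
  \<comment> \<open>The factor 8 is that of the monotonicity estimate and \<open>1 / c0\<close> removes the cutoff; \<open>4 Bc\<close> and \<open>2 (r\<^sup>2)\<^sup>2\<close> bound the coefficients of \<open>w\<^sub>i - w\<^sub>j\<close> and \<open>k\<^sub>i - k\<^sub>j\<close>.\<close>
  define \<eta> where "\<eta> n = 8 / c0 * (4 * Bc * e n + 2 * (r\<^sup>2)\<^sup>2 * V * \<bar>k n - kh\<bar>)" for n
  have \<eta>lim: "\<eta> \<longlonglongrightarrow> 0"
  proof -
    have "\<eta> \<longlonglongrightarrow> 8 / c0 * (4 * Bc * 0 + 2 * (r\<^sup>2)\<^sup>2 * V * \<bar>kh - kh\<bar>)"
      unfolding \<eta>_def[abs_def] by (intro tendsto_intros elim k(3))
    then show ?thesis by simp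
  qed
  show thesis
  proof (rule that[OF \<eta>lim])
    fix i j
    define \<omega> where "\<omega> x = w i x - w j x" for x
    define F1 where "F1 x = u j x $ 2 - u i x $ 2" for x
    define F2 where "F2 x = u i x $ 1 - u j x $ 1" for x
    define m where "m n x = gas_density \<gamma> ((norm (u n x))\<^sup>2) *\<^sub>R u n x" for n x
    define E where "E x = (m i x - m j x) \<bullet> (u i x - u j x)" for x
    have Cu: "C_k 1 S (\<lambda>x. u n x $ l)" for n l using flow[of n] exhaust_2[of l] unfolding stream_flow_def by auto
    have Cw: "C_k 1 S (w n)" for n using flow[of n] C_k_le[of 2 S "w n" 1] unfolding stream_flow_def by simp
    have F: "C_k 1 S F1" "C_k 1 S F2" unfolding F1_def[abs_def] F2_def[abs_def] by (intro C_k_diff S(1) Cu)+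
    have C\<omega>: "C_k 1 S \<omega>" unfolding \<omega>_def[abs_def] by (intro C_k_diff S(1) Cw)
    have C\<phi>S: "C_k 1 S \<phi>" by (rule C_k_subset[OF C\<phi>]) simp
    have du: "(\<lambda>x. u n x $ l) differentiable (at x)" if "x \<in> S" for n l x using Cu that by auto
    have dw: "w n differentiable (at x)" if "x \<in> S" for n x using Cw that by auto
    have div: "pd 1 F1 x + pd 2 F2 x = 0" if x: "x \<in> S" for x
    proof -
      have "pd 2 (\<lambda>x. u n x $ 1) x = pd 1 (\<lambda>x. u n x $ 2) x" for n using flow[of n] x unfolding stream_flow_def by blast
      then show ?thesis unfolding F1_def[abs_def] F2_def[abs_def] using pd_diff[OF du[OF x] du[OF x]] by simp
    qed
    \<comment> \<open>The exact term, with integral 0.\<close>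
    define T where "T x = indicator S x * (F1 x * pd 1 (\<lambda>x. \<phi> x * \<omega> x) x + F2 x * pd 2 (\<lambda>x. \<phi> x * \<omega> x) x)" for x
    have T: "integrable lborel T" "(\<integral>x. T x \<partial>lborel) = 0"
      unfolding T_def using weak_divergence_C1[OF S(1) F C_k_mult[OF S(1) C\<phi>S C\<omega>] compact_cball ball(1) _ div] \<phi>0 by auto
    \<comment> \<open>The error terms.\<close>
    define Z where "Z x = 4 * Bc * (Bd x * \<bar>W i x - W j x\<bar>) + 2 * (r\<^sup>2)\<^sup>2 * \<bar>k i - k j\<bar> * Bd x" for x
    have un: "norm (u n x) < 1" if "x \<in> S" for n x using flow[of n] that unfolding stream_flow_def by blast
    have comp: "\<bar>(u i x - u j x) $ l\<bar> \<le> 2" if "x \<in> S" for x l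
      using component_le_norm_cart[of "u i x - u j x" l] norm_triangle_ineq4[of "u i x" "u j x"] un[OF that, of i] un[OF that, of j] by linarith
    have key: "\<phi> x * E x \<le> T x + Z x" if x: "x \<in> S" for x
    proof (cases "x \<in> cball a r")
      case False
      then have "T x = 0"
      proof -
        have "pd l (\<lambda>x. \<phi> x * \<omega> x) x = 0" for l
        proof -
          have d: "\<phi> differentiable (at x)" "\<omega> differentiable (at x)" using C\<phi> C\<omega> x by auto
          show ?thesis using pd_mult[OF d] \<phi>0[OF False] pd0[OF False] by simp
        qed
        then show ?thesis by (simp add: T_def)
      qed
      then show ?thesis using \<phi>0[OF False] False by (simp add: Z_def Bd_def)
    next
      case True
      have d: "\<phi> differentiable (at x)" "\<omega> differentiable (at x)" using C\<phi> C\<omega> x by auto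
      have p\<omega>: "pd l \<omega> x = pd l (w i) x - pd l (w j) x" for l
        unfolding \<omega>_def[abs_def] by (rule pd_diff[OF dw[OF x] dw[OF x]])
      have mm: "m n x $ 1 = pd 2 (w n) x + k n * (x $ 1 / (norm x)\<^sup>2)" "m n x $ 2 = - pd 1 (w n) x + k n * (x $ 2 / (norm x)\<^sup>2)" for n
        using flow[of n] x unfolding stream_flow_def m_def by auto
      \<comment> \<open>The contribution of the point source field to \<open>E x\<close>, per unit of \<open>k i - k j\<close>.\<close>
      define R where "R = F2 x * (x $ 1 / (norm x)\<^sup>2) - F1 x * (x $ 2 / (norm x)\<^sup>2)"
      have E1: "E x = F1 x * pd 1 \<omega> x + F2 x * pd 2 \<omega> x + (k i - k j) * R"
        unfolding E_def inner_real2 p\<omega> R_def F1_def F2_def vector_minus_component mm by algebra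
      define Q where "Q = F1 x * pd 1 \<phi> x + F2 x * pd 2 \<phi> x"
      have T1: "T x = \<phi> x * (F1 x * pd 1 \<omega> x + F2 x * pd 2 \<omega> x) + \<omega> x * Q"
        unfolding T_def Q_def pd_mult[OF d] using x by (simp add: algebra_simps)
      have "\<phi> x * E x = T x - \<omega> x * Q + (k i - k j) * (\<phi> x * R)" unfolding E1 T1 by (simp add: algebra_simps)
      moreover have "- (\<omega> x * Q) \<le> 4 * Bc * \<bar>W i x - W j x\<bar>"
      proof -
        have f: "\<bar>F1 x\<bar> \<le> 2" "\<bar>F2 x\<bar> \<le> 2" using comp[OF x, of 1] comp[OF x, of 2] by (auto simp: F1_def F2_def abs_minus_commute)
        have "\<bar>F1 x * pd 1 \<phi> x\<bar> \<le> 2 * Bc" "\<bar>F2 x * pd 2 \<phi> x\<bar> \<le> 2 * Bc"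
          unfolding abs_mult using f Bp by (intro mult_mono; simp)+
        then have "\<bar>Q\<bar> \<le> 4 * Bc" unfolding Q_def using abs_triangle_ineq[of "F1 x * pd 1 \<phi> x" "F2 x * pd 2 \<phi> x"] by linarith
        then have "\<bar>\<omega> x\<bar> * \<bar>Q\<bar> \<le> \<bar>\<omega> x\<bar> * (4 * Bc)" by (intro mult_left_mono) auto
        moreover have "\<omega> x = W i x - W j x" using x by (simp add: \<omega>_def W_def zero_extension_def)
        moreover have "- (\<omega> x * Q) \<le> \<bar>\<omega> x\<bar> * \<bar>Q\<bar>" unfolding abs_mult[symmetric] by (rule abs_ge_minus_self)
        ultimately show ?thesis by (simp add: mult_ac)
      qed
      moreover have "(k i - k j) * (\<phi> x * R) \<le> 2 * (r\<^sup>2)\<^sup>2 * \<bar>k i - k j\<bar>"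
      proof -
        define y where "y = (1 / (norm x)\<^sup>2) *\<^sub>R x"
        have nx: "norm x \<ge> 1" by (rule S(2)[OF x])
        have ny: "norm y \<le> 1" unfolding y_def using nx by (auto simp: power2_eq_square divide_le_eq_1)
        have "R = (u i x - u j x) \<bullet> y" unfolding R_def inner_real2 y_def F1_def F2_def by (simp add: algebra_simps diff_divide_distrib)
        then have "\<bar>R\<bar> \<le> norm (u i x - u j x) * norm y" by (simp add: Cauchy_Schwarz_ineq2)
        also have "\<dots> \<le> 2 * 1"
          using norm_triangle_ineq4[of "u i x" "u j x"] un[OF x, of i] un[OF x, of j] ny by (intro mult_mono) auto
        finally have "\<bar>\<phi> x\<bar> * \<bar>R\<bar> \<le> (r\<^sup>2)\<^sup>2 * 2" using \<phi>le[of x] \<phi>pos[of x] by (intro mult_mono) auto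
        then have "\<bar>k i - k j\<bar> * (\<bar>\<phi> x\<bar> * \<bar>R\<bar>) \<le> \<bar>k i - k j\<bar> * ((r\<^sup>2)\<^sup>2 * 2)" by (intro mult_left_mono) auto
        moreover have "(k i - k j) * (\<phi> x * R) \<le> \<bar>k i - k j\<bar> * (\<bar>\<phi> x\<bar> * \<bar>R\<bar>)" unfolding abs_mult[symmetric] by (rule abs_ge_self)
        ultimately show ?thesis by (simp add: mult_ac)
      qed
      moreover have "Z x = 4 * Bc * \<bar>W i x - W j x\<bar> + 2 * (r\<^sup>2)\<^sup>2 * \<bar>k i - k j\<bar>" using True by (simp add: Z_def Bd_def)
      ultimately show ?thesis by simp
    qed
    have mono: "norm (u i x - u j x) ^ 4 \<le> 8 * E x" if x: "x \<in> S" for x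
      unfolding E_def m_def by (rule momentum_monotonicity[OF \<gamma>]) (use un[OF x] less_imp_le in auto)
    have E0: "0 \<le> E x" if x: "x \<in> S" for x
      using order_trans[OF zero_le_power[OF norm_ge_zero] mono[OF x]] by simp
    have TZ0: "0 \<le> T x + Z x" for x
    proof (cases "x \<in> S")
      case True
      have "0 \<le> \<phi> x * E x" using \<phi>pos E0[OF True] by (intro mult_nonneg_nonneg)
      then show ?thesis using key[OF True] by linarith
    next
      case False
      then show ?thesis using Bc0 by (simp add: T_def Z_def Bd_def)
    qed
    have ptw: "indicator (ball a (r/2)) x * norm (u i x - u j x) ^ 4 \<le> 8 / c0 * (T x + Z x)" for x
    proof (cases "x \<in> ball a (r/2)")
      case True
      have "x \<in> cball a r" using True ball(2) by auto
      then have x: "x \<in> S" using ball(1) by blast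
      have "c0 * norm (u i x - u j x) ^ 4 \<le> \<phi> x * (8 * E x)"
        using \<phi>c0[OF True] mono[OF x] c0 by (intro mult_mono) (auto simp: \<phi>pos)
      also have "\<dots> \<le> 8 * (T x + Z x)" using key[OF x] by simp
      finally have "norm (u i x - u j x) ^ 4 \<le> 8 * (T x + Z x) / c0" using c0 by (simp add: pos_le_divide_eq mult.commute)
      then show ?thesis using True by simp
    next
      case False
      then show ?thesis using TZ0[of x] c0 by simp
    qed
    have iW: "integrable lborel (\<lambda>x. Bd x * \<bar>W i x - W j x\<bar>)" "(\<integral>x. Bd x * \<bar>W i x - W j x\<bar> \<partial>lborel) \<le> e i + e j"
    proof -
      have le: "Bd x * \<bar>W i x - W j x\<bar> \<le> Bd x * \<bar>W i x - Wl x\<bar> + Bd x * \<bar>W j x - Wl x\<bar>" for x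
      proof -
        have "\<bar>W i x - W j x\<bar> \<le> \<bar>W i x - Wl x\<bar> + \<bar>W j x - Wl x\<bar>" by linarith
        then have "Bd x * \<bar>W i x - W j x\<bar> \<le> Bd x * (\<bar>W i x - Wl x\<bar> + \<bar>W j x - Wl x\<bar>)" by (intro mult_left_mono) (simp_all add: Bd_def)
        then show ?thesis by (simp add: distrib_left)
      qed
      show 1: "integrable lborel (\<lambda>x. Bd x * \<bar>W i x - W j x\<bar>)"
      proof (rule Bochner_Integration.integrable_bound[OF Bochner_Integration.integrable_add[OF ie[of i] ie[of j]]])
        show "(\<lambda>x. Bd x * \<bar>W i x - W j x\<bar>) \<in> borel_measurable lborel" using Wm by measurable
        show "AE x in lborel. norm (Bd x * \<bar>W i x - W j x\<bar>) \<le> norm (Bd x * \<bar>W i x - Wl x\<bar> + Bd x * \<bar>W j x - Wl x\<bar>)"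
        proof (rule AE_I2)
          fix x
          have "0 \<le> Bd x * \<bar>W i x - W j x\<bar>" by (simp add: Bd_def)
          then show "norm (Bd x * \<bar>W i x - W j x\<bar>) \<le> norm (Bd x * \<bar>W i x - Wl x\<bar> + Bd x * \<bar>W j x - Wl x\<bar>)"
            using le[of x] unfolding real_norm_def by linarith
        qed
      qed
      have "(\<integral>x. Bd x * \<bar>W i x - W j x\<bar> \<partial>lborel) \<le> (\<integral>x. Bd x * \<bar>W i x - Wl x\<bar> + Bd x * \<bar>W j x - Wl x\<bar> \<partial>lborel)"
        by (rule integral_mono[OF 1 Bochner_Integration.integrable_add[OF ie ie] le])
      then show "(\<integral>x. Bd x * \<bar>W i x - W j x\<bar> \<partial>lborel) \<le> e i + e j"
        unfolding e_def by (simp add: Bochner_Integration.integral_add[OF ie ie])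
    qed
    have iZ: "integrable lborel Z" unfolding Z_def
      by (intro Bochner_Integration.integrable_add integrable_mult_right iW(1) iBd)
    have Zle: "(\<integral>x. Z x \<partial>lborel) \<le> 4 * Bc * (e i + e j) + 2 * (r\<^sup>2)\<^sup>2 * V * (\<bar>k i - kh\<bar> + \<bar>k j - kh\<bar>)"
    proof -
      have "(\<integral>x. Z x \<partial>lborel) = 4 * Bc * (\<integral>x. Bd x * \<bar>W i x - W j x\<bar> \<partial>lborel) + 2 * (r\<^sup>2)\<^sup>2 * \<bar>k i - k j\<bar> * V"
        unfolding Z_def V_def using iW(1) iBd by (subst Bochner_Integration.integral_add) auto
      also have "\<dots> \<le> 4 * Bc * (e i + e j) + 2 * (r\<^sup>2)\<^sup>2 * (\<bar>k i - kh\<bar> + \<bar>k j - kh\<bar>) * V"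
        using iW(2) Bc0 V0 by (intro add_mono mult_left_mono mult_right_mono) auto
      finally show ?thesis by (simp add: mult_ac)
    qed
    have "(\<integral>\<^sup>+x. ennreal (indicator (ball a (r/2)) x * norm (u i x - u j x) ^ 4) \<partial>lborel)
      \<le> (\<integral>\<^sup>+x. ennreal (8 / c0 * (T x + Z x)) \<partial>lborel)"
      by (intro nn_integral_mono ennreal_leI ptw)
    also have "\<dots> = ennreal (\<integral>x. 8 / c0 * (T x + Z x) \<partial>lborel)"
    proof (rule nn_integral_eq_integral)
      show "integrable lborel (\<lambda>x. 8 / c0 * (T x + Z x))" using T(1) iZ by simp
      show "AE x in lborel. 0 \<le> 8 / c0 * (T x + Z x)"
        using c0 by (intro AE_I2 mult_nonneg_nonneg TZ0) simp
    qed
    also have "(\<integral>x. 8 / c0 * (T x + Z x) \<partial>lborel) = 8 / c0 * (\<integral>x. Z x \<partial>lborel)"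
      using T iZ by simp
    also have "ennreal \<dots> \<le> ennreal (\<eta> i + \<eta> j)"
    proof (rule ennreal_leI)
      have "8 / c0 * (\<integral>x. Z x \<partial>lborel) \<le> 8 / c0 * (4 * Bc * (e i + e j) + 2 * (r\<^sup>2)\<^sup>2 * V * (\<bar>k i - kh\<bar> + \<bar>k j - kh\<bar>))"
        using Zle c0 by (intro mult_left_mono) auto
      also have "\<dots> = \<eta> i + \<eta> j" unfolding \<eta>_def by (simp only: distrib_left distrib_right add_ac)
      finally show "8 / c0 * (\<integral>x. Z x \<partial>lborel) \<le> \<eta> i + \<eta> j" .
    qed
    finally show "(\<integral>\<^sup>+x. ennreal (indicator (ball a (r/2)) x * norm (u i x - u j x) ^ 4) \<partial>lborel) \<le> ennreal (\<eta> i + \<eta> j)" .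
  qed
qed

lemma stream_flow_measurable:
  assumes S: "open S" and flow: "stream_flow \<gamma> S k w u"
  shows "(\<lambda>x. indicator S x *\<^sub>R u x) \<in> borel_measurable borel"
proof -
  have C: "C_k 1 S (\<lambda>x. u x $ 1)" "C_k 1 S (\<lambda>x. u x $ 2)"
    using flow unfolding stream_flow_def by blast+
  note c = C_k_imp_continuous_on[OF C(1)] C_k_imp_continuous_on[OF C(2)]
  have "continuous_on S (\<lambda>x. u x $ 1 *\<^sub>R axis 1 1 + u x $ 2 *\<^sub>R (axis 2 1 :: real^2))"
    by (intro continuous_intros c)
  then have "continuous_on S u" unfolding real2_expand[symmetric] .
  then show ?thesis by (intro borel_measurable_continuous_on_indicator) (use S in auto)
qed

text \<open>First a subsequence along which the zero extensions of the \<open>w\<^sub>n\<close> converge at every point; then the energy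
estimate on countably many half balls that cover \<open>S\<close> makes the velocities Cauchy in \<open>L\<^sup>4\<close> of each
of them.\<close>

lemma stream_flow_compactness:
  fixes u :: "nat \<Rightarrow> real^2 \<Rightarrow> real^2" and w :: "nat \<Rightarrow> real^2 \<Rightarrow> real" and k :: "nat \<Rightarrow> real"
  assumes \<gamma>: "\<gamma> > 1" and S: "open S" "\<And>x. x \<in> S \<Longrightarrow> norm x \<ge> 1"
    and flow: "\<And>n. stream_flow \<gamma> S (k n) (w n) (u n)"
    and k: "\<And>n. 0 \<le> k n" "\<And>n. k n \<le> Kb" "k \<longlonglongrightarrow> kh"
  obtains s :: "nat \<Rightarrow> nat" where "strict_mono s" "AE x in lborel. x \<in> S \<longrightarrow> convergent (\<lambda>j. u (s j) x)"
proof (cases "S = {}")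
  case True
  then show thesis using that[of id] by (simp add: strict_mono_id)
next
  case False
  have S0: "0 \<notin> S" using S(2)[of 0] by auto
  define W where "W n = zero_extension S (w n)" for n
  have Kb: "0 \<le> Kb" using k(1)[of 0] k(2)[of 0] by linarith
  have lipW: "\<bar>W n x - W n y\<bar> \<le> (1 + Kb) * norm (x - y)" for n x y
  proof -
    have "\<bar>W n x - W n y\<bar> \<le> (1 + k n) * norm (x - y)" using flow unfolding stream_flow_def W_def by blast
    also have "\<dots> \<le> (1 + Kb) * norm (x - y)" using k by (intro mult_right_mono) auto
    finally show ?thesis .
  qed
  have W0: "W n 0 = 0" for n using S0 by (simp add: W_def zero_extension_def)
  have Kb1: "0 \<le> 1 + Kb" using Kb by simp
  obtain r where r: "strict_mono r" "\<And>x. convergent (\<lambda>n. W (r n) x)"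
    by (rule Lipschitz_pointwise_convergent_subsequence[OF Kb1 lipW W0], rule that)
  have conv: "(\<lambda>n. zero_extension S (w (r n)) x) \<longlonglongrightarrow> lim (\<lambda>n. W (r n) x)" for x
    using r(2)[of x] unfolding convergent_LIMSEQ_iff W_def .
  have kr: "(\<lambda>n. k (r n)) \<longlonglongrightarrow> kh" using LIMSEQ_subseq_LIMSEQ[OF k(3) r(1)] by (simp add: o_def)
  have "\<exists>\<rho>. \<rho> > 0 \<and> cball a \<rho> \<subseteq> S" if "a \<in> S" for a using S(1) that open_contains_cball by blast
  then obtain \<rho> where \<rho>: "\<And>a. a \<in> S \<Longrightarrow> \<rho> a > 0 \<and> cball a (\<rho> a) \<subseteq> S" by metis
  obtain \<F> where \<F>: "\<F> \<subseteq> (\<lambda>a. ball a (\<rho> a / 2)) ` S" "countable \<F>" "\<Union>\<F> = (\<Union>a\<in>S. ball a (\<rho> a / 2))"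
  proof (rule Lindelof)
    show "\<And>X. X \<in> (\<lambda>a. ball a (\<rho> a / 2)) ` S \<Longrightarrow> open X" by auto
  qed (rule that)
  have cover: "S \<subseteq> \<Union>\<F>" unfolding \<F>(3)
  proof
    fix x assume x: "x \<in> S"
    have "x \<in> ball x (\<rho> x / 2)" using \<rho>[OF x] by simp
    with x show "x \<in> (\<Union>a\<in>S. ball a (\<rho> a / 2))" by blast
  qed
  have \<F>ne: "\<F> \<noteq> {}" using cover False by auto
  define B where "B m = from_nat_into \<F> m" for m
  have rB: "range B = \<F>" unfolding B_def[abs_def] by (rule range_from_nat_into[OF \<F>ne \<F>(2)])
  define f where "f n x = indicator S x *\<^sub>R u (r n) x" for n x
  have fm: "f n \<in> borel_measurable borel" for n
    unfolding f_def[abs_def] by (rule stream_flow_measurable[OF S(1) flow])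
  have Bm: "B m \<in> sets borel" for m
  proof -
    have "B m \<in> (\<lambda>a. ball a (\<rho> a / 2)) ` S" using \<F>(1) rB by blast
    then show ?thesis by auto
  qed
  define P where "P m \<eta> \<longleftrightarrow> \<eta> \<longlonglongrightarrow> 0 \<and>
    (\<forall>i j. (\<integral>\<^sup>+x. ennreal (indicator (B m) x * norm (f i x - f j x) ^ 4) \<partial>lborel) \<le> ennreal (\<eta> i + \<eta> j))" for m and \<eta> :: "nat \<Rightarrow> real"
  have "\<exists>\<eta>. P m \<eta>" for m
  proof -
    obtain a where a: "a \<in> S" "B m = ball a (\<rho> a / 2)" using \<F>(1) rB by blast
    have ca: "cball a (\<rho> a) \<subseteq> S" "\<rho> a > 0" using \<rho>[OF a(1)] by auto
    obtain \<eta> where \<eta>: "\<eta> \<longlonglongrightarrow> 0"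
      "\<And>i j. (\<integral>\<^sup>+x. ennreal (indicator (ball a (\<rho> a / 2)) x * norm (u (r i) x - u (r j) x) ^ 4) \<partial>lborel) \<le> ennreal (\<eta> i + \<eta> j)"
    proof (rule local_energy_estimate[where u="\<lambda>n. u (r n)" and w="\<lambda>n. w (r n)" and k="\<lambda>n. k (r n)", OF \<gamma> S _ _ _ kr conv ca])
      show "stream_flow \<gamma> S (k (r n)) (w (r n)) (u (r n))" for n by (rule flow)
      show "0 \<le> k (r n)" "k (r n) \<le> Kb" for n by (rule k)+
    qed ((assumption | rule that)+)
    have "indicator (B m) x * norm (f i x - f j x) ^ 4 = indicator (ball a (\<rho> a / 2)) x * norm (u (r i) x - u (r j) x) ^ 4" for i j x
    proof (cases "x \<in> ball a (\<rho> a / 2)")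
      case True
      then have "x \<in> cball a (\<rho> a)" using ca(2) by auto
      then have "x \<in> S" using ca(1) by blast
      then show ?thesis by (simp add: a(2) f_def)
    qed (simp add: a(2))
    then show ?thesis unfolding P_def using \<eta> by (intro exI[of _ \<eta>]) simp
  qed
  then obtain \<eta> where "\<And>m. P m (\<eta> m)" by metis
  then have \<eta>: "\<And>m. \<eta> m \<longlonglongrightarrow> 0"
    "\<And>m i j. (\<integral>\<^sup>+x. ennreal (indicator (B m) x * norm (f i x - f j x) ^ 4) \<partial>lborel) \<le> ennreal (\<eta> m i + \<eta> m j)"
    unfolding P_def by blast+
  obtain s where s: "strict_mono s" "AE x in lborel. \<forall>m. x \<in> B m \<longrightarrow> convergent (\<lambda>j. f (s j) x)"
    by (rule AE_convergent_subsequence_of_L4_Cauchy[OF fm Bm \<eta>(2) \<eta>(1)], rule that)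
  show thesis
  proof (rule that[of "r \<circ> s"])
    show "strict_mono (r \<circ> s)" using strict_mono_o[OF r(1) s(1)] .
    show "AE x in lborel. x \<in> S \<longrightarrow> convergent (\<lambda>j. u ((r \<circ> s) j) x)"
      using s(2)
    proof eventually_elim
      case (elim x)
      show ?case
      proof
        assume x: "x \<in> S"
        then obtain m where "x \<in> B m" using cover rB by blast
        with elim have "convergent (\<lambda>j. f (s j) x)" by blast
        then show "convergent (\<lambda>j. u ((r \<circ> s) j) x)" using x by (simp add: f_def)
      qed
    qed
  qed
qed

section \<open>The subsonic-sonic limit\<close>

lemma vector_real2: "(vector [a, b] :: real^2) = a *\<^sub>R axis 1 1 + b *\<^sub>R axis 2 1"
  by (simp add: vec_eq_iff forall_2)

text \<open>A flux \<open>\<Psi>\<close> that is continuous on the closed unit ball is bounded there, so the fluxes of velocities that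
converge almost everywhere are dominated by a constant.\<close>

lemma nonlinear_weak_limit:
  fixes U :: "nat \<Rightarrow> real^2 \<Rightarrow> real^2" and uh :: "real^2 \<Rightarrow> real^2" and \<Psi> :: "real^2 \<Rightarrow> real^2"
  assumes S: "open S"
    and Um: "\<And>n. (\<lambda>x. indicator S x *\<^sub>R U n x) \<in> borel_measurable borel" and um: "uh \<in> borel_measurable borel"
    and un: "\<forall>n. \<forall>x\<in>S. norm (U n x) \<le> 1" and uhn: "AE x in lborel. x \<in> S \<longrightarrow> norm (uh x) \<le> 1"
    and conv: "AE x in lborel. x \<in> S \<longrightarrow> (\<lambda>n. U n x) \<longlonglongrightarrow> uh x"
    and \<Psi>m: "\<Psi> \<in> borel_measurable borel" and \<Psi>c: "\<forall>q. norm q \<le> 1 \<longrightarrow> isCont \<Psi> q"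
  shows "\<exists>M. \<forall>q. norm q \<le> 1 \<longrightarrow> norm (\<Psi> q) \<le> M"
    "\<And>T v. test_function T v \<Longrightarrow> set_integrable lborel S (\<lambda>x. \<Psi> (uh x) \<bullet> grad v x)"
    "\<And>T v. test_function T v \<Longrightarrow>
      (\<lambda>n. LINT x:S|lborel. \<Psi> (U n x) \<bullet> grad v x) \<longlonglongrightarrow> (LINT x:S|lborel. \<Psi> (uh x) \<bullet> grad v x)"
proof -
  have "compact (\<Psi> ` cball 0 1)"
    using \<Psi>c by (intro compact_continuous_image continuous_at_imp_continuous_on) auto
  then have "bounded (\<Psi> ` cball 0 1)" by (rule compact_imp_bounded)
  then obtain M where "\<forall>y\<in>\<Psi> ` cball 0 1. norm y \<le> M" unfolding bounded_iff by blast
  then have M: "norm (\<Psi> q) \<le> M" if "norm q \<le> 1" for q using that by simp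
  then show "\<exists>M. \<forall>q. norm q \<le> 1 \<longrightarrow> norm (\<Psi> q) \<le> M" by blast
  have mS: "(indicator S :: real^2 \<Rightarrow> real) \<in> borel_measurable borel" using S by simp
  have 1: "(\<lambda>x. indicator S x *\<^sub>R \<Psi> (U n x)) \<in> borel_measurable borel" for n
  proof -
    have "(\<lambda>x. indicator S x *\<^sub>R \<Psi> (indicator S x *\<^sub>R U n x)) \<in> borel_measurable borel"
      using measurable_compose[OF Um \<Psi>m] mS by (intro borel_measurable_scaleR)
    moreover have "(\<lambda>x. indicator S x *\<^sub>R \<Psi> (indicator S x *\<^sub>R U n x)) = (\<lambda>x. indicator S x *\<^sub>R \<Psi> (U n x))"
      by (auto simp: fun_eq_iff indicator_def)
    ultimately show ?thesis by metis
  qed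
  have 2: "(\<lambda>x. indicator S x *\<^sub>R \<Psi> (uh x)) \<in> borel_measurable borel"
    using measurable_compose[OF um \<Psi>m] mS by (intro borel_measurable_scaleR)
  have 3: "norm (\<Psi> (U n x)) \<le> M" if "x \<in> S" for n x using M un that by blast
  have 4: "AE x in lborel. x \<in> S \<longrightarrow> (\<lambda>n. \<Psi> (U n x)) \<longlonglongrightarrow> \<Psi> (uh x)"
    using conv uhn
  proof eventually_elim
    case (elim x)
    then show ?case using \<Psi>c isCont_tendsto_compose[of "uh x" \<Psi>] by blast
  qed
  show "set_integrable lborel S (\<lambda>x. \<Psi> (uh x) \<bullet> grad v x)"
    "(\<lambda>n. LINT x:S|lborel. \<Psi> (U n x) \<bullet> grad v x) \<longlonglongrightarrow> (LINT x:S|lborel. \<Psi> (uh x) \<bullet> grad v x)"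
    if "test_function T v" for T v
    using weak_pairing_limit[OF 1 2 3 4 that] by auto
qed

lemma weakly_div_free_limit:
  fixes U :: "nat \<Rightarrow> real^2 \<Rightarrow> real^2" and uh :: "real^2 \<Rightarrow> real^2" and \<Psi> :: "real^2 \<Rightarrow> real^2"
  assumes S: "open S"
    and Um: "\<And>n. (\<lambda>x. indicator S x *\<^sub>R U n x) \<in> borel_measurable borel" and um: "uh \<in> borel_measurable borel"
    and un: "\<forall>n. \<forall>x\<in>S. norm (U n x) \<le> 1" and uhn: "AE x in lborel. x \<in> S \<longrightarrow> norm (uh x) \<le> 1"
    and conv: "AE x in lborel. x \<in> S \<longrightarrow> (\<lambda>n. U n x) \<longlonglongrightarrow> uh x"
    and \<Psi>m: "\<Psi> \<in> borel_measurable borel" and \<Psi>c: "\<forall>q. norm q \<le> 1 \<longrightarrow> isCont \<Psi> q"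
    and weak: "\<And>n. weakly_div_free S (\<lambda>x. \<Psi> (U n x))"
  shows "weakly_div_free S (\<lambda>x. \<Psi> (uh x))"
  unfolding weakly_div_free_def
proof (intro allI impI conjI)
  fix v assume v: "test_function S v"
  note L = nonlinear_weak_limit[OF S Um um un uhn conv \<Psi>m \<Psi>c]
  show "set_integrable lborel S (\<lambda>x. \<Psi> (uh x) \<bullet> grad v x)" by (rule L(2)[OF v])
  have "(LINT x:S|lborel. \<Psi> (U n x) \<bullet> grad v x) = 0" for n using weak[of n] v unfolding weakly_div_free_def by blast
  then show "(LINT x:S|lborel. \<Psi> (uh x) \<bullet> grad v x) = 0" using L(3)[OF v] by (simp add: LIMSEQ_const_iff)
qed

lemma isCont_density_speed:
  fixes q :: "'a::real_inner"
  assumes "\<gamma> > 1" "norm q \<le> 1"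
  shows "isCont (\<lambda>q. gas_density \<gamma> ((norm q)\<^sup>2)) q"
proof (rule isCont_o2[where g="gas_density \<gamma>"])
  show "isCont (\<lambda>q. (norm q)\<^sup>2) q" by (intro continuous_intros)
  show "isCont (gas_density \<gamma>) ((norm q)\<^sup>2)" by (rule isCont_gas_density[OF assms(1)]) (use assms(2) in \<open>simp add: power_le_one\<close>)
qed

lemma gas_density_measurable: "gas_density \<gamma> \<in> borel_measurable borel"
  unfolding gas_density_def[abs_def] by measurable

theorem theorem1p2:
  fixes \<gamma> \<kappa>1 \<kappa>2hat :: real
    and D :: "(real^2) set" and c :: "real \<Rightarrow> real^2" and n :: "real^2 \<Rightarrow> real^2"
    and \<epsilon>s :: "nat \<Rightarrow> real" and Ht :: "nat \<Rightarrow> real \<Rightarrow> real"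
    and \<kappa>2 :: "real \<Rightarrow> real" and u :: "real \<Rightarrow> real^2 \<Rightarrow> real^2"
  assumes "\<gamma> > 1"
    and "admissible_domain D c" and "inner_unit_normal D c n"
    and "0 < \<kappa>1" and "\<kappa>1 < 1"
    and "is_threshold \<gamma> D \<kappa>1 \<epsilon>s Ht \<kappa>2hat" and "\<kappa>2hat > 0"
    and "(\<kappa>2 \<longlongrightarrow> \<kappa>2hat) (at_right 0)"
    and "\<forall>\<^sub>F \<epsilon> in at_right 0. \<kappa>2 \<epsilon> < \<kappa>2hat"
    and "\<forall>\<^sub>F \<epsilon> in at_right 0. uniformly_subsonic_flow \<gamma> D \<kappa>1 (\<kappa>2 \<epsilon>) (u \<epsilon>)"
  shows "\<exists>(e :: nat \<Rightarrow> real) (uh :: real^2 \<Rightarrow> real^2).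
    (\<forall>k. 0 < e k \<and> e (Suc k) < e k) \<and> e \<longlonglongrightarrow> 0 \<and>
    uh \<in> borel_measurable borel \<and>
    (AE x in lborel. x \<in> exterior D \<longrightarrow>
      (\<lambda>k. u (e k) x $ 1) \<longlonglongrightarrow> uh x $ 1 \<and>
      (\<lambda>k. u (e k) x $ 2) \<longlonglongrightarrow> uh x $ 2 \<and>
      (\<lambda>k. gas_density \<gamma> ((norm (u (e k) x))\<^sup>2) * u (e k) x $ 1)
        \<longlonglongrightarrow> gas_density \<gamma> ((norm (uh x))\<^sup>2) * uh x $ 1 \<and>
      (\<lambda>k. gas_density \<gamma> ((norm (u (e k) x))\<^sup>2) * u (e k) x $ 2)
        \<longlonglongrightarrow> gas_density \<gamma> ((norm (uh x))\<^sup>2) * uh x $ 2) \<and>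
    (AE x in lborel. x \<in> exterior D \<longrightarrow> norm (uh x) \<le> 1) \<and>
    weak_euler \<gamma> (exterior D) (\<lambda>x. gas_density \<gamma> ((norm (uh x))\<^sup>2)) uh \<and>
    normal_trace (exterior D) c (\<lambda>x. gas_density \<gamma> ((norm (uh x))\<^sup>2) *\<^sub>R uh x)
      (\<lambda>x. radial_flux \<gamma> \<kappa>1 \<kappa>2hat (norm x) * (sgn x \<bullet> n x))"
proof -
  note \<gamma> = assms(1) and adm = assms(2) and n = assms(3) and \<kappa>1 = assms(4)
  define \<Omega> where "\<Omega> = exterior D"
  note E = exterior_facts[OF adm, folded \<Omega>_def]
  have O0: "0 \<notin> \<Omega>" using E(2) by force
  obtain b where b: "b > 0" "\<And>\<epsilon>. 0 < \<epsilon> \<Longrightarrow> \<epsilon> < b \<Longrightarrow> uniformly_subsonic_flow \<gamma> D \<kappa>1 (\<kappa>2 \<epsilon>) (u \<epsilon>)"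
    using assms(10) unfolding eventually_at_right_field by auto
  \<comment> \<open>The shift by 2 keeps every \<open>e0 i\<close> below \<open>b\<close>.\<close>
  define e0 where "e0 i = b / (real i + 2)" for i
  have e0: "0 < e0 i" "e0 i < b" "e0 (Suc i) < e0 i" for i
  proof -
    show "0 < e0 i" unfolding e0_def using b(1) by simp
    have "b * 1 < b * (real i + 2)" using b(1) by (intro mult_strict_left_mono) auto
    then show "e0 i < b" unfolding e0_def by (simp add: pos_divide_less_eq)
    show "e0 (Suc i) < e0 i" unfolding e0_def using b(1) by (intro divide_strict_left_mono) auto
  qed
  have e0lim: "e0 \<longlonglongrightarrow> 0" unfolding e0_def using b(1) by real_asymp
  have e0right: "filterlim e0 (at_right 0) sequentially"
    by (rule filterlim_at_withinI[OF e0lim]) (use e0(1) in \<open>auto intro!: always_eventually simp: less_imp_neq[symmetric]\<close>)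
  have \<kappa>lim: "(\<lambda>i. \<kappa>2 (e0 i)) \<longlonglongrightarrow> \<kappa>2hat" by (rule filterlim_compose[OF assms(8) e0right])
  note flow = uniformly_subsonic_stream_flow[OF adm \<gamma> \<kappa>1 b(2)[OF e0(1,2)], folded \<Omega>_def]
  define k where "k i = rho0 \<gamma> \<kappa>1 (\<kappa>2 (e0 i)) * \<kappa>1" for i
  define kh where "kh = rho0 \<gamma> \<kappa>1 \<kappa>2hat * \<kappa>1"
  have "\<forall>i. \<exists>w. stream_flow \<gamma> \<Omega> (k i) w (u (e0 i))" using flow(2) unfolding k_def by blast
  then obtain w where w: "\<And>i. stream_flow \<gamma> \<Omega> (k i) (w i) (u (e0 i))" by metis
  have sqlim: "(\<lambda>i. \<kappa>1\<^sup>2 + (\<kappa>2 (e0 i))\<^sup>2) \<longlonglongrightarrow> \<kappa>1\<^sup>2 + \<kappa>2hat\<^sup>2" by (intro tendsto_intros \<kappa>lim)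
  have sub: "\<kappa>1\<^sup>2 + \<kappa>2hat\<^sup>2 \<le> 1"
    by (rule LIMSEQ_le_const2[OF sqlim]) (use flow(1) less_imp_le in blast)
  have k0: "0 \<le> k i" for i
    unfolding k_def using rho0_facts(1)[OF \<gamma> \<kappa>1 flow(1), of i] \<kappa>1 by (intro mult_nonneg_nonneg) linarith+
  \<comment> \<open>The density \<open>\<rho>\<^sub>0\<close> is continuous up to the limiting parameters \<open>\<kappa>\<^sub>1\<^sup>2 + \<kappa>\<^sub>2\<^sup>2 = 1\<close>.\<close>
  have klim: "k \<longlonglongrightarrow> kh"
  proof -
    have "(\<lambda>i. gas_density \<gamma> (\<kappa>1\<^sup>2 + (\<kappa>2 (e0 i))\<^sup>2)) \<longlonglongrightarrow> gas_density \<gamma> (\<kappa>1\<^sup>2 + \<kappa>2hat\<^sup>2)"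
      by (rule isCont_tendsto_compose[OF isCont_gas_density[OF \<gamma> sub] sqlim])
    then have "(\<lambda>i. rho0 \<gamma> \<kappa>1 (\<kappa>2 (e0 i))) \<longlonglongrightarrow> rho0 \<gamma> \<kappa>1 \<kappa>2hat"
      using rho0_eq_gas_density[OF \<gamma> sub] rho0_eq_gas_density[OF \<gamma> less_imp_le[OF flow(1)]] by simp
    then show ?thesis unfolding k_def[abs_def] kh_def by (intro tendsto_intros)
  qed
  obtain Kb where Kb: "\<And>i. k i \<le> Kb"
  proof -
    have "Bseq k" using klim convergent_imp_Bseq convergentI by blast
    then obtain K where "\<forall>i. norm (k i) \<le> K" by (rule BseqE)
    then have "k i \<le> K" for i using abs_le_D1[of "k i" K] by simp
    then show thesis by (rule that)
  qed
  have nO: "norm x \<ge> 1" if "x \<in> \<Omega>" for x using E(2)[OF that] by simp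
  obtain s where s: "strict_mono s" "AE x in lborel. x \<in> \<Omega> \<longrightarrow> convergent (\<lambda>j. u (e0 (s j)) x)"
    by (rule stream_flow_compactness[where S=\<Omega> and u="\<lambda>i. u (e0 i)", OF \<gamma> E(1) _ w k0 Kb klim]; (rule nO | rule that); assumption?)
  define e where "e j = e0 (s j)" for j
  define U where "U j = u (e j)" for j
  have fl: "stream_flow \<gamma> \<Omega> (k (s j)) (w (s j)) (U j)" for j using w[of "s j"] by (simp add: U_def e_def)
  have Um: "(\<lambda>x. indicator \<Omega> x *\<^sub>R U j x) \<in> borel_measurable borel" for j by (rule stream_flow_measurable[OF E(1) fl])
  have Un: "norm (U j x) \<le> 1" if "x \<in> \<Omega>" for j x using fl[of j] that unfolding stream_flow_def by (auto intro: less_imp_le)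
  \<comment> \<open>The factor \<open>indicator \<Omega>\<close> makes the limit Borel measurable on the whole plane.\<close>
  define uh where "uh x = lim (\<lambda>j. indicator \<Omega> x *\<^sub>R U j x)" for x
  have uhm: "uh \<in> borel_measurable borel" unfolding uh_def[abs_def] by (rule borel_measurable_lim_metric[OF Um])
  have conv: "AE x in lborel. x \<in> \<Omega> \<longrightarrow> (\<lambda>j. U j x) \<longlonglongrightarrow> uh x"
    using s(2)
  proof eventually_elim
    case (elim x)
    show ?case
    proof
      assume x: "x \<in> \<Omega>"
      then have "convergent (\<lambda>j. U j x)" using elim by (simp add: U_def e_def)
      then show "(\<lambda>j. U j x) \<longlonglongrightarrow> uh x" using x by (simp add: uh_def convergent_LIMSEQ_iff)
    qed
  qed
  have uhn: "AE x in lborel. x \<in> \<Omega> \<longrightarrow> norm (uh x) \<le> 1"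
    using conv
  proof eventually_elim
    case (elim x)
    show ?case
    proof
      assume x: "x \<in> \<Omega>"
      then have "(\<lambda>j. norm (U j x)) \<longlonglongrightarrow> norm (uh x)" using elim by (intro tendsto_norm) blast
      then show "norm (uh x) \<le> 1" by (rule LIMSEQ_le_const2) (use Un[OF x] in blast)
    qed
  qed
  note [measurable] = gas_density_measurable
  have gc: "isCont (\<lambda>q. gas_density \<gamma> ((norm q)\<^sup>2)) q" if "norm q \<le> 1" for q :: "real^2"
    by (rule isCont_density_speed[OF \<gamma> that])
  have pc: "isCont (\<lambda>q. gas_density \<gamma> ((norm q)\<^sup>2) powr \<gamma> / \<gamma>) q" if "norm q \<le> 1" for q :: "real^2"
  proof -
    have "gas_density \<gamma> ((norm q)\<^sup>2) \<noteq> 0"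
      using gas_density_ge_1[OF \<gamma>, of "(norm q)\<^sup>2"] that by (auto simp: power_le_one)
    then show ?thesis using \<gamma> gc[OF that] unfolding isCont_def by (intro tendsto_divide tendsto_powr tendsto_const) auto
  qed
  have cc: "isCont (\<lambda>q. q $ l) q" for q :: "real^2" and l
    by (rule bounded_linear.isCont[OF bounded_linear_vec_nth]) (rule continuous_ident)
  have vc: "isCont (\<lambda>q :: real^2. vector [f q, h q] :: real^2) q" if "isCont f q" "isCont h q" for f h :: "real^2 \<Rightarrow> real" and q
    unfolding vector_real2 by (intro continuous_add continuous_scaleR continuous_const that)
  have fl2: "isCont (\<lambda>q. gas_density \<gamma> ((norm q)\<^sup>2) * (q $ l)\<^sup>2 + gas_density \<gamma> ((norm q)\<^sup>2) powr \<gamma> / \<gamma>) q"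
    "isCont (\<lambda>q. gas_density \<gamma> ((norm q)\<^sup>2) * q $ l * q $ l') q" if "norm q \<le> 1" for q :: "real^2" and l l'
    by (intro continuous_add continuous_mult continuous_power cc gc[OF that] pc[OF that])+
  have Un': "\<forall>j. \<forall>x\<in>\<Omega>. norm (U j x) \<le> 1" using Un by blast
  note L = weakly_div_free_limit[OF E(1) Um uhm Un' uhn conv]
  define \<Psi> where "\<Psi> q = gas_density \<gamma> ((norm q)\<^sup>2) *\<^sub>R q" for q :: "real^2"
  have \<Psi>m: "\<Psi> \<in> borel_measurable borel" unfolding \<Psi>_def[abs_def] by measurable
  have \<Psi>c: "isCont \<Psi> q" if "norm q \<le> 1" for q unfolding \<Psi>_def[abs_def] by (intro continuous_intros gc[OF that])
  have \<Psi>v: "\<Psi> q = vector [gas_density \<gamma> ((norm q)\<^sup>2) * q $ 1, gas_density \<gamma> ((norm q)\<^sup>2) * q $ 2]" for q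
    by (simp add: \<Psi>_def vec_eq_iff forall_2)
  have euler: "weak_euler \<gamma> \<Omega> (\<lambda>x. gas_density \<gamma> ((norm (U j x))\<^sup>2)) (U j)" for j
    by (rule flow_weak_euler[OF \<gamma> E(1) O0 fl])
  have mass: "weakly_div_free \<Omega> (\<lambda>x. \<Psi> (uh x))"
    by (rule L[OF \<Psi>m]) (use \<Psi>c euler in \<open>auto simp: weak_euler_def Let_def \<Psi>v\<close>)
  have weak: "weak_euler \<gamma> \<Omega> (\<lambda>x. gas_density \<gamma> ((norm (uh x))\<^sup>2)) uh"
    unfolding weak_euler_def Let_def
  proof (intro conjI)
    show "weakly_div_free \<Omega> (\<lambda>x. vector [gas_density \<gamma> ((norm (uh x))\<^sup>2) * uh x $ 1, gas_density \<gamma> ((norm (uh x))\<^sup>2) * uh x $ 2])"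
      using mass unfolding \<Psi>v .
    show "weakly_div_free \<Omega> (\<lambda>x. vector [gas_density \<gamma> ((norm (uh x))\<^sup>2) * (uh x $ 1)\<^sup>2 + gas_density \<gamma> ((norm (uh x))\<^sup>2) powr \<gamma> / \<gamma>,
      gas_density \<gamma> ((norm (uh x))\<^sup>2) * uh x $ 1 * uh x $ 2])"
    proof (rule L[where \<Psi>="\<lambda>q. vector [gas_density \<gamma> ((norm q)\<^sup>2) * (q $ 1)\<^sup>2 + gas_density \<gamma> ((norm q)\<^sup>2) powr \<gamma> / \<gamma>,
        gas_density \<gamma> ((norm q)\<^sup>2) * q $ 1 * q $ 2]"])
      show "\<forall>q. norm q \<le> 1 \<longrightarrow> isCont (\<lambda>q :: real^2. vector [gas_density \<gamma> ((norm q)\<^sup>2) * (q $ 1)\<^sup>2 + gas_density \<gamma> ((norm q)\<^sup>2) powr \<gamma> / \<gamma>,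
        gas_density \<gamma> ((norm q)\<^sup>2) * q $ 1 * q $ 2] :: real^2) q"
        using fl2 by (intro allI impI vc) blast+
    qed (use euler in \<open>auto simp: weak_euler_def Let_def vector_real2\<close>)
    show "weakly_div_free \<Omega> (\<lambda>x. vector [gas_density \<gamma> ((norm (uh x))\<^sup>2) * uh x $ 1 * uh x $ 2,
      gas_density \<gamma> ((norm (uh x))\<^sup>2) * (uh x $ 2)\<^sup>2 + gas_density \<gamma> ((norm (uh x))\<^sup>2) powr \<gamma> / \<gamma>])"
    proof (rule L[where \<Psi>="\<lambda>q. vector [gas_density \<gamma> ((norm q)\<^sup>2) * q $ 1 * q $ 2,
        gas_density \<gamma> ((norm q)\<^sup>2) * (q $ 2)\<^sup>2 + gas_density \<gamma> ((norm q)\<^sup>2) powr \<gamma> / \<gamma>]"])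
      show "\<forall>q. norm q \<le> 1 \<longrightarrow> isCont (\<lambda>q :: real^2. vector [gas_density \<gamma> ((norm q)\<^sup>2) * q $ 1 * q $ 2,
        gas_density \<gamma> ((norm q)\<^sup>2) * (q $ 2)\<^sup>2 + gas_density \<gamma> ((norm q)\<^sup>2) powr \<gamma> / \<gamma>] :: real^2) q"
        using fl2 by (intro allI impI vc) blast+
    qed (use euler in \<open>auto simp: weak_euler_def Let_def vector_real2\<close>)
    show "weakly_div_free \<Omega> (\<lambda>x. vector [- (uh x $ 2), uh x $ 1])"
    proof (rule L[where \<Psi>="\<lambda>q. vector [- (q $ 2), q $ 1]"])
      show "\<forall>q. norm q \<le> 1 \<longrightarrow> isCont (\<lambda>q :: real^2. vector [- (q $ 2), q $ 1] :: real^2) q"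
        by (intro allI impI vc continuous_minus cc)
    qed (use euler in \<open>auto simp: weak_euler_def Let_def vector_real2\<close>)
  qed
  have \<Psi>c': "\<forall>q. norm q \<le> 1 \<longrightarrow> isCont \<Psi> q" using \<Psi>c by blast
  note N = nonlinear_weak_limit[OF E(1) Um uhm Un' uhn conv \<Psi>m \<Psi>c']
  have c: "frontier D = c ` {0..1}" using adm unfolding admissible_domain_def by blast
  have trace: "normal_trace \<Omega> c (\<lambda>x. \<Psi> (uh x)) (\<lambda>x. radial_flux \<gamma> \<kappa>1 \<kappa>2hat (norm x) * (sgn x \<bullet> n x))"
    unfolding normal_trace_def
  proof (intro conjI mass allI impI)
    obtain M where M: "\<forall>q. norm q \<le> 1 \<longrightarrow> norm (\<Psi> q) \<le> M" using N(1) by blast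
    have "AE x in lborel. x \<in> \<Omega> \<longrightarrow> norm (\<Psi> (uh x)) \<le> M" using uhn by eventually_elim (use M in blast)
    then show "\<exists>M. AE x in lborel. x \<in> \<Omega> \<longrightarrow> norm (\<Psi> (uh x)) \<le> M" by blast
    fix v assume v: "test_function UNIV v"
    show "set_integrable lborel \<Omega> (\<lambda>x. \<Psi> (uh x) \<bullet> grad v x)" by (rule N(2)[OF v])
    define A where "A = arclength_integral c (\<lambda>x. 1 / norm x * (sgn x \<bullet> n x) * v x)"
    have "(LINT x:\<Omega>|lborel. \<Psi> (U j x) \<bullet> grad v x) = k (s j) * A" for j
      unfolding \<Psi>_def A_def \<Omega>_def by (rule flow_trace[OF adm n k0 fl[unfolded \<Omega>_def] v])
    then have "(\<lambda>j. k (s j) * A) \<longlonglongrightarrow> (LINT x:\<Omega>|lborel. \<Psi> (uh x) \<bullet> grad v x)" using N(3)[OF v] by simp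
    moreover have "(\<lambda>j. k (s j) * A) \<longlonglongrightarrow> kh * A"
      using LIMSEQ_subseq_LIMSEQ[OF klim s(1)] by (intro tendsto_intros) (simp add: o_def)
    ultimately have "(LINT x:\<Omega>|lborel. \<Psi> (uh x) \<bullet> grad v x) = kh * A" by (rule LIMSEQ_unique)
    also have "\<dots> = arclength_integral c (\<lambda>x. radial_flux \<gamma> \<kappa>1 \<kappa>2hat (norm x) * (sgn x \<bullet> n x) * v x)"
      unfolding A_def arclength_integral_cmult[symmetric] unfolding arclength_integral_def
    proof (rule integral_cong)
      fix t :: real assume "t \<in> {0..1}"
      then have "norm (c t) \<ge> 1" using E(5) c by blast
      then have "radial_flux \<gamma> \<kappa>1 \<kappa>2hat (norm (c t)) = kh / norm (c t)"
        unfolding radial_flux_def kh_def using radial_flux_subsonic[OF \<gamma> \<kappa>1] by auto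
      then show "kh * (1 / norm (c t) * (sgn (c t) \<bullet> n (c t)) * v (c t)) * norm (vector_derivative c (at t))
        = radial_flux \<gamma> \<kappa>1 \<kappa>2hat (norm (c t)) * (sgn (c t) \<bullet> n (c t)) * v (c t) * norm (vector_derivative c (at t))"
        by simp
    qed
    finally show "(LINT x:\<Omega>|lborel. \<Psi> (uh x) \<bullet> grad v x)
      = arclength_integral c (\<lambda>x. radial_flux \<gamma> \<kappa>1 \<kappa>2hat (norm x) * (sgn x \<bullet> n x) * v x)" .
  qed
  have pointwise: "AE x in lborel. x \<in> \<Omega> \<longrightarrow>
      (\<lambda>k. u (e k) x $ 1) \<longlonglongrightarrow> uh x $ 1 \<and>
      (\<lambda>k. u (e k) x $ 2) \<longlonglongrightarrow> uh x $ 2 \<and>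
      (\<lambda>k. gas_density \<gamma> ((norm (u (e k) x))\<^sup>2) * u (e k) x $ 1)
        \<longlonglongrightarrow> gas_density \<gamma> ((norm (uh x))\<^sup>2) * uh x $ 1 \<and>
      (\<lambda>k. gas_density \<gamma> ((norm (u (e k) x))\<^sup>2) * u (e k) x $ 2)
        \<longlonglongrightarrow> gas_density \<gamma> ((norm (uh x))\<^sup>2) * uh x $ 2"
    using conv uhn
  proof eventually_elim
    case (elim x)
    show ?case
    proof
      assume x: "x \<in> \<Omega>"
      then have c: "(\<lambda>j. u (e j) x) \<longlonglongrightarrow> uh x" and n: "norm (uh x) \<le> 1" using elim by (auto simp: U_def)
      have g: "(\<lambda>j. gas_density \<gamma> ((norm (u (e j) x))\<^sup>2)) \<longlonglongrightarrow> gas_density \<gamma> ((norm (uh x))\<^sup>2)"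
        by (rule isCont_tendsto_compose[OF gc[OF n] c])
      show "(\<lambda>k. u (e k) x $ 1) \<longlonglongrightarrow> uh x $ 1 \<and>
        (\<lambda>k. u (e k) x $ 2) \<longlonglongrightarrow> uh x $ 2 \<and>
        (\<lambda>k. gas_density \<gamma> ((norm (u (e k) x))\<^sup>2) * u (e k) x $ 1)
          \<longlonglongrightarrow> gas_density \<gamma> ((norm (uh x))\<^sup>2) * uh x $ 1 \<and>
        (\<lambda>k. gas_density \<gamma> ((norm (u (e k) x))\<^sup>2) * u (e k) x $ 2)
          \<longlonglongrightarrow> gas_density \<gamma> ((norm (uh x))\<^sup>2) * uh x $ 2"
        by (intro conjI tendsto_intros c g)
    qed
  qed
  have e_dec: "0 < e j \<and> e (Suc j) < e j" for j
  proof -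
    have "antimono e0" "s j < s (Suc j)" using e0(3) s(1) by (auto simp: decseq_Suc_iff less_imp_le strict_mono_Suc_iff)
    then have "e0 (s (Suc j)) \<le> e0 (Suc (s j))" by (simp add: antimonoD Suc_leI)
    then show ?thesis using e0 unfolding e_def by (meson le_less_trans)
  qed
  have e_lim: "e \<longlonglongrightarrow> 0" unfolding e_def[abs_def] using LIMSEQ_subseq_LIMSEQ[OF e0lim s(1)] by (simp add: o_def)
  show ?thesis
    unfolding \<Omega>_def[symmetric]
    using e_dec e_lim uhm pointwise uhn weak trace unfolding \<Psi>_def
    by (intro exI[of _ e] exI[of _ uh]) blast
qed

end
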